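(* Let $\mathcal{A}$ be a complete and cocomplete abelian category and let $(\mathcal{X},\mathcal{Y})$ be an admissible balanced pair in $\mathcal{A}$. Let $\mathcal{E}$ be the class of right $\mathcal{X}$-acyclic (equivalently, left $\mathcal{Y}$-acyclic) short exact sequences in $\mathcal{A}$. Let $\mathcal{E}\text{-}\mathrm{dw}\widetilde{\mathcal{X}}$ (resp. $\mathcal{E}\text{-}\mathrm{dw}\widetilde{\mathcal{Y}}$) be the class of complexes all of whose terms lie in $\mathcal{X}$ (resp. $\mathcal{Y}$). Assume that $(\mathcal{E}\text{-}\mathrm{dw}\widetilde{\mathcal{X}})^{\perp} = {}^{\perp}(\mathcal{E}\text{-}\mathrm{dw}\widetilde{\mathcal{Y}})$, the orthogonals being taken with respect to $\mathrm{Ext}^1_{\mathrm{Ch}(\mathcal{E})}(-,-)$. Then there is a triangle-equivalence $\mathbf{K}(\mathcal{X}) \simeq \mathbf{K}(\mathcal{Y})$.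
   Context: All subcategories are full, additive, and closed under isomorphisms and direct summands. Complexes are written homologically: $\cdots\to C_{n+1}\to C_n\to C_{n-1}\to\cdots$. A right $\mathcal{X}$-approximation of $M\in\mathcal{A}$ is a morphism $X\to M$ with $X\in\mathcal{X}$ through which every morphism from an object of $\mathcal{X}$ to $M$ factors; $\mathcal{X}$ is contravariantly finite if every object has one. Left $\mathcal{Y}$-approximations and covariantly finite subcategories are defined dually. A complex is right $\mathcal{X}$-acyclic if it becomes acyclic under $\mathrm{Hom}_{\mathcal{A}}(X,-)$ for all $X\in\mathcal{X}$, and left $\mathcal{Y}$-acyclic if it becomes acyclic under $\mathrm{Hom}_{\mathcal{A}}(-,Y)$ for all $Y\in\mathcal{Y}$. An $\mathcal{X}$-resolution of $M$ is a right $\mathcal{X}$-acyclic complex $\cdots\to X_1\to X_0\to M\to 0$ with all $X_i\in\mathcal{X}$; a $\mathcal{Y}$-coresolution is a left $\mathcal{Y}$-acyclic complex $0\to M\to Y^0\to Y^1\to\cdots$ with all $Y^i\in\mathcal{Y}$. The pair $(\mathcal{X},\mathcal{Y})$ is balanced if $\mathcal{X}$ is contravariantly finite, $\mathcal{Y}$ is covariantly finite, and every object $M$ has an $\mathcal{X}$-resolution that is left $\mathcal{Y}$-acyclic and a $\mathcal{Y}$-coresolution that is right $\mathcal{X}$-acyclic. It is admissible if every right $\mathcal{X}$-approximation is epic and every left $\mathcal{Y}$-approximation is monic. $(\mathcal{A},\mathcal{E})$ is an exact category, and $\mathrm{Ch}(\mathcal{A},\mathcal{E})$ denotes the category of complexes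 over $\mathcal{A}$ with the exact structure $\mathrm{Ch}(\mathcal{E})$ consisting of short exact sequences of complexes lying in $\mathcal{E}$ in each degree. $\mathrm{Ext}^1_{\mathrm{Ch}(\mathcal{E})}$ is the Yoneda Ext of this exact category. For a class $\mathcal{S}$ of complexes, $\mathcal{S}^{\perp}=\{C : \mathrm{Ext}^1_{\mathrm{Ch}(\mathcal{E})}(S,C)=0\ \forall S\in\mathcal{S}\}$ and ${}^{\perp}\mathcal{S}=\{C : \mathrm{Ext}^1_{\mathrm{Ch}(\mathcal{E})}(C,S)=0\ \forall S\in\mathcal{S}\}$. $\mathbf{K}(\mathcal{X})$ (resp. $\mathbf{K}(\mathcal{Y})$) is the chain homotopy category of complexes with all terms in $\mathcal{X}$ (resp. $\mathcal{Y}$). *)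

theory Defs
  imports "HOL-Algebra.Group"
begin

section \<open>Categories and functors\<close>

record ('o, 'm) category =
  Obj  :: "'o set"
  Arr  :: "'m set"
  Dom  :: "'m \<Rightarrow> 'o"
  Cod  :: "'m \<Rightarrow> 'o"
  Ide  :: "'o \<Rightarrow> 'm"
  Comp :: "'m \<Rightarrow> 'm \<Rightarrow> 'm" (infixl "\<cdot>\<index>" 70)

definition Hom :: "('o, 'm, 'z) category_scheme \<Rightarrow> 'o \<Rightarrow> 'o \<Rightarrow> 'm set" where
  "Hom C a b = {f \<in> Arr C. Dom C f = a \<and> Cod C f = b}"

locale category =
  fixes C :: "('o, 'm, 'z) category_scheme" (structure)
  assumes Dom_in_Obj: "f \<in> Arr C \<Longrightarrow> Dom C f \<in> Obj C"
    and Cod_in_Obj: "f \<in> Arr C \<Longrightarrow> Cod C f \<in> Obj C"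
    and Ide_in_Hom: "a \<in> Obj C \<Longrightarrow> Ide C a \<in> Hom C a a"
    and Comp_in_Hom: "\<lbrakk>f \<in> Hom C a b; g \<in> Hom C b c\<rbrakk> \<Longrightarrow> g \<cdot> f \<in> Hom C a c"
    and Ide_left: "f \<in> Hom C a b \<Longrightarrow> Ide C b \<cdot> f = f"
    and Ide_right: "f \<in> Hom C a b \<Longrightarrow> f \<cdot> Ide C a = f"
    and Comp_assoc: "\<lbrakk>f \<in> Hom C a b; g \<in> Hom C b c; h \<in> Hom C c d\<rbrakk>
                       \<Longrightarrow> (h \<cdot> g) \<cdot> f = h \<cdot> (g \<cdot> f)"

definition opposite :: "('o, 'm, 'z) category_scheme \<Rightarrow> ('o, 'm) category" where
  "opposite C = \<lparr>Obj = Obj C, Arr = Arr C, Dom = Cod C, Cod = Dom C, Ide = Ide C,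
                 Comp = (\<lambda>g f. f \<cdot>\<^bsub>C\<^esub> g)\<rparr>"

definition is_iso :: "('o, 'm, 'z) category_scheme \<Rightarrow> 'm \<Rightarrow> bool" where
  "is_iso C f \<longleftrightarrow> f \<in> Arr C \<and>
     (\<exists>g \<in> Hom C (Cod C f) (Dom C f).
        g \<cdot>\<^bsub>C\<^esub> f = Ide C (Dom C f) \<and> f \<cdot>\<^bsub>C\<^esub> g = Ide C (Cod C f))"

definition is_monic :: "('o, 'm, 'z) category_scheme \<Rightarrow> 'm \<Rightarrow> bool" where
  "is_monic C f \<longleftrightarrow> f \<in> Arr C \<and>
     (\<forall>t. \<forall>g \<in> Hom C t (Dom C f). \<forall>h \<in> Hom C t (Dom C f).
        f \<cdot>\<^bsub>C\<^esub> g = f \<cdot>\<^bsub>C\<^esub> h \<longrightarrow> g = h)"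

definition is_epic :: "('o, 'm, 'z) category_scheme \<Rightarrow> 'm \<Rightarrow> bool" where
  "is_epic C f \<longleftrightarrow> f \<in> Arr C \<and>
     (\<forall>t. \<forall>g \<in> Hom C (Cod C f) t. \<forall>h \<in> Hom C (Cod C f) t.
        g \<cdot>\<^bsub>C\<^esub> f = h \<cdot>\<^bsub>C\<^esub> f \<longrightarrow> g = h)"

definition is_functor ::
  "('o, 'm, 'z) category_scheme \<Rightarrow> ('p, 'n, 'y) category_scheme
     \<Rightarrow> ('o \<Rightarrow> 'p) \<Rightarrow> ('m \<Rightarrow> 'n) \<Rightarrow> bool" where
  "is_functor C D Fo Fm \<longleftrightarrow>
     (\<forall>a \<in> Obj C. Fo a \<in> Obj D) \<and>
     (\<forall>a b. \<forall>f \<in> Hom C a b. Fm f \<in> Hom D (Fo a) (Fo b)) \<and>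
     (\<forall>a \<in> Obj C. Fm (Ide C a) = Ide D (Fo a)) \<and>
     (\<forall>a b c. \<forall>f \<in> Hom C a b. \<forall>g \<in> Hom C b c. Fm (g \<cdot>\<^bsub>C\<^esub> f) = Fm g \<cdot>\<^bsub>D\<^esub> Fm f)"

definition is_natural_iso ::
  "('o, 'm, 'z) category_scheme \<Rightarrow> ('p, 'n, 'y) category_scheme
     \<Rightarrow> ('o \<Rightarrow> 'p) \<Rightarrow> ('m \<Rightarrow> 'n) \<Rightarrow> ('o \<Rightarrow> 'p) \<Rightarrow> ('m \<Rightarrow> 'n) \<Rightarrow> ('o \<Rightarrow> 'n) \<Rightarrow> bool" where
  "is_natural_iso C D Fo Fm Go Gm \<eta> \<longleftrightarrow>
     (\<forall>a \<in> Obj C. \<eta> a \<in> Hom D (Fo a) (Go a) \<and> is_iso D (\<eta> a)) \<and>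
     (\<forall>a b. \<forall>f \<in> Hom C a b. \<eta> b \<cdot>\<^bsub>D\<^esub> Fm f = Gm f \<cdot>\<^bsub>D\<^esub> \<eta> a)"

definition is_equivalence ::
  "('o, 'm, 'z) category_scheme \<Rightarrow> ('p, 'n, 'y) category_scheme
     \<Rightarrow> ('o \<Rightarrow> 'p) \<Rightarrow> ('m \<Rightarrow> 'n) \<Rightarrow> bool" where
  "is_equivalence C D Fo Fm \<longleftrightarrow> is_functor C D Fo Fm \<and>
     (\<exists>Go Gm \<eta> \<epsilon>. is_functor D C Go Gm \<and>
        is_natural_iso C C (\<lambda>a. a) (\<lambda>f. f) (Go \<circ> Fo) (Gm \<circ> Fm) \<eta> \<and>
        is_natural_iso D D (Fo \<circ> Go) (Fm \<circ> Gm) (\<lambda>b. b) (\<lambda>g. g) \<epsilon>)"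


section \<open>Limits and completeness\<close>

definition is_cone ::
  "('i, 'j) category \<Rightarrow> ('o, 'm, 'z) category_scheme
     \<Rightarrow> ('i \<Rightarrow> 'o) \<Rightarrow> ('j \<Rightarrow> 'm) \<Rightarrow> 'o \<Rightarrow> ('i \<Rightarrow> 'm) \<Rightarrow> bool" where
  "is_cone J C Fo Fm v \<pi> \<longleftrightarrow> v \<in> Obj C \<and>
     (\<forall>i \<in> Obj J. \<pi> i \<in> Hom C v (Fo i)) \<and>
     (\<forall>i k. \<forall>f \<in> Hom J i k. Fm f \<cdot>\<^bsub>C\<^esub> \<pi> i = \<pi> k)"

definition is_limit ::
  "('i, 'j) category \<Rightarrow> ('o, 'm, 'z) category_scheme
     \<Rightarrow> ('i \<Rightarrow> 'o) \<Rightarrow> ('j \<Rightarrow> 'm) \<Rightarrow> 'o \<Rightarrow> ('i \<Rightarrow> 'm) \<Rightarrow> bool" where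
  "is_limit J C Fo Fm v \<pi> \<longleftrightarrow> is_cone J C Fo Fm v \<pi> \<and>
     (\<forall>w \<rho>. is_cone J C Fo Fm w \<rho> \<longrightarrow>
        (\<exists>!u. u \<in> Hom C w v \<and> (\<forall>i \<in> Obj J. \<pi> i \<cdot>\<^bsub>C\<^esub> u = \<rho> i)))"

text \<open>
  HOL has no built-in class of small sets, so smallness is relative to a type \<open>'u\<close>: the small
  index categories are those whose objects and arrows are elements of \<open>'u\<close>. (Limits
  over categories of arbitrary size exist only in degenerate cases, by Freyd's theorem.)
\<close>

definition complete_category :: "'u itself \<Rightarrow> ('o, 'm, 'z) category_scheme \<Rightarrow> bool" where
  "complete_category (_ :: 'u itself) C \<longleftrightarrow>
     (\<forall>(J :: ('u, 'u) category) Fo Fm. category J \<and> is_functor J C Fo Fm \<longrightarrow>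
        (\<exists>v \<pi>. is_limit J C Fo Fm v \<pi>))"

definition cocomplete_category :: "'u itself \<Rightarrow> ('o, 'm, 'z) category_scheme \<Rightarrow> bool" where
  "cocomplete_category U C \<longleftrightarrow> complete_category U (opposite C)"


section \<open>Abelian categories\<close>

text \<open>\<open>Zero A a b\<close> is the zero morphism from \<open>a\<close> to \<open>b\<close>; \<open>Add\<close> is used on parallel arrows only.\<close>

record ('o, 'm) preadd_category = "('o, 'm) category" +
  Add  :: "'m \<Rightarrow> 'm \<Rightarrow> 'm" (infixl "\<uplus>\<index>" 65)
  Zero :: "'o \<Rightarrow> 'o \<Rightarrow> 'm"

definition hom_group :: "('o, 'm, 'z) preadd_category_scheme \<Rightarrow> 'o \<Rightarrow> 'o \<Rightarrow> 'm monoid" where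
  "hom_group A a b = \<lparr>carrier = Hom A a b, mult = Add A, one = Zero A a b\<rparr>"

definition Neg :: "('o, 'm, 'z) preadd_category_scheme \<Rightarrow> 'm \<Rightarrow> 'm" where
  "Neg A f = inv\<^bsub>hom_group A (Dom A f) (Cod A f)\<^esub> f"

locale preadditive_category = category A
  for A :: "('o, 'm, 'z) preadd_category_scheme" (structure) +
  assumes comm_group_hom: "\<lbrakk>a \<in> Obj A; b \<in> Obj A\<rbrakk> \<Longrightarrow> comm_group (hom_group A a b)"
    and Comp_Add: "\<lbrakk>f \<in> Hom A a b; f' \<in> Hom A a b; g \<in> Hom A b c\<rbrakk>
                     \<Longrightarrow> g \<cdot> (f \<uplus> f') = (g \<cdot> f) \<uplus> (g \<cdot> f')"
    and Add_Comp: "\<lbrakk>f \<in> Hom A a b; g \<in> Hom A b c; g' \<in> Hom A b c\<rbrakk>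
                     \<Longrightarrow> (g \<uplus> g') \<cdot> f = (g \<cdot> f) \<uplus> (g' \<cdot> f)"

definition is_zero_object :: "('o, 'm, 'z) category_scheme \<Rightarrow> 'o \<Rightarrow> bool" where
  "is_zero_object C z \<longleftrightarrow> z \<in> Obj C \<and>
     (\<forall>a \<in> Obj C. (\<exists>!f. f \<in> Hom C a z) \<and> (\<exists>!f. f \<in> Hom C z a))"

definition is_biproduct ::
  "('o, 'm, 'z) preadd_category_scheme \<Rightarrow> 'o \<Rightarrow> 'o \<Rightarrow> 'o
     \<Rightarrow> 'm \<Rightarrow> 'm \<Rightarrow> 'm \<Rightarrow> 'm \<Rightarrow> bool" where
  "is_biproduct A a b s \<iota>\<^sub>1 \<iota>\<^sub>2 \<pi>\<^sub>1 \<pi>\<^sub>2 \<longleftrightarrow> a \<in> Obj A \<and> b \<in> Obj A \<and> s \<in> Obj A \<and>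
     \<iota>\<^sub>1 \<in> Hom A a s \<and> \<iota>\<^sub>2 \<in> Hom A b s \<and> \<pi>\<^sub>1 \<in> Hom A s a \<and> \<pi>\<^sub>2 \<in> Hom A s b \<and>
     \<pi>\<^sub>1 \<cdot>\<^bsub>A\<^esub> \<iota>\<^sub>1 = Ide A a \<and> \<pi>\<^sub>2 \<cdot>\<^bsub>A\<^esub> \<iota>\<^sub>2 = Ide A b \<and>
     \<pi>\<^sub>2 \<cdot>\<^bsub>A\<^esub> \<iota>\<^sub>1 = Zero A a b \<and> \<pi>\<^sub>1 \<cdot>\<^bsub>A\<^esub> \<iota>\<^sub>2 = Zero A b a \<and>
     (\<iota>\<^sub>1 \<cdot>\<^bsub>A\<^esub> \<pi>\<^sub>1) \<uplus>\<^bsub>A\<^esub> (\<iota>\<^sub>2 \<cdot>\<^bsub>A\<^esub> \<pi>\<^sub>2) = Ide A s"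

definition is_direct_sum :: "('o, 'm, 'z) preadd_category_scheme \<Rightarrow> 'o \<Rightarrow> 'o \<Rightarrow> 'o \<Rightarrow> bool" where
  "is_direct_sum A a b s \<longleftrightarrow> (\<exists>\<iota>\<^sub>1 \<iota>\<^sub>2 \<pi>\<^sub>1 \<pi>\<^sub>2. is_biproduct A a b s \<iota>\<^sub>1 \<iota>\<^sub>2 \<pi>\<^sub>1 \<pi>\<^sub>2)"

definition is_kernel :: "('o, 'm, 'z) preadd_category_scheme \<Rightarrow> 'm \<Rightarrow> 'm \<Rightarrow> bool" where
  "is_kernel A k f \<longleftrightarrow> k \<in> Arr A \<and> f \<in> Arr A \<and> Cod A k = Dom A f \<and>
     f \<cdot>\<^bsub>A\<^esub> k = Zero A (Dom A k) (Cod A f) \<and>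
     (\<forall>t. \<forall>g \<in> Hom A t (Dom A f). f \<cdot>\<^bsub>A\<^esub> g = Zero A t (Cod A f) \<longrightarrow>
        (\<exists>!u. u \<in> Hom A t (Dom A k) \<and> k \<cdot>\<^bsub>A\<^esub> u = g))"

definition is_cokernel :: "('o, 'm, 'z) preadd_category_scheme \<Rightarrow> 'm \<Rightarrow> 'm \<Rightarrow> bool" where
  "is_cokernel A c f \<longleftrightarrow> c \<in> Arr A \<and> f \<in> Arr A \<and> Dom A c = Cod A f \<and>
     c \<cdot>\<^bsub>A\<^esub> f = Zero A (Dom A f) (Cod A c) \<and>
     (\<forall>t. \<forall>g \<in> Hom A (Cod A f) t. g \<cdot>\<^bsub>A\<^esub> f = Zero A (Dom A f) t \<longrightarrow>
        (\<exists>!u. u \<in> Hom A (Cod A c) t \<and> u \<cdot>\<^bsub>A\<^esub> c = g))"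

locale abelian_category = preadditive_category +
  assumes ex_zero_object: "\<exists>z. is_zero_object A z"
    and ex_direct_sum: "\<lbrakk>a \<in> Obj A; b \<in> Obj A\<rbrakk> \<Longrightarrow> \<exists>s. is_direct_sum A a b s"
    and ex_kernel: "f \<in> Arr A \<Longrightarrow> \<exists>k. is_kernel A k f"
    and ex_cokernel: "f \<in> Arr A \<Longrightarrow> \<exists>c. is_cokernel A c f"
    and monic_normal: "is_monic A f \<Longrightarrow> \<exists>g. is_kernel A f g"
    and epic_normal: "is_epic A f \<Longrightarrow> \<exists>g. is_cokernel A f g"

text \<open>A full subcategory is given by its set of objects.\<close>

definition is_subcategory :: "('o, 'm, 'z) preadd_category_scheme \<Rightarrow> 'o set \<Rightarrow> bool" where
  "is_subcategory A X \<longleftrightarrow> X \<subseteq> Obj A \<and>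
     (\<forall>z. is_zero_object A z \<longrightarrow> z \<in> X) \<and>
     (\<forall>a \<in> X. \<forall>b \<in> X. \<forall>s. is_direct_sum A a b s \<longrightarrow> s \<in> X) \<and>
     (\<forall>f. is_iso A f \<and> Dom A f \<in> X \<longrightarrow> Cod A f \<in> X) \<and>
     (\<forall>a b s. is_direct_sum A a b s \<and> s \<in> X \<longrightarrow> a \<in> X \<and> b \<in> X)"


section \<open>Complexes\<close>

text \<open>Homological grading: \<open>Diff C n\<close> goes from \<open>Term C n\<close> to \<open>Term C (n - 1)\<close>.\<close>

record ('o, 'm) chain_complex =
  Term :: "int \<Rightarrow> 'o"
  Diff :: "int \<Rightarrow> 'm"

definition is_complex ::
  "('o, 'm, 'z) preadd_category_scheme \<Rightarrow> ('o, 'm) chain_complex \<Rightarrow> bool" where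
  "is_complex A C \<longleftrightarrow>
     (\<forall>n. Term C n \<in> Obj A) \<and>
     (\<forall>n. Diff C n \<in> Hom A (Term C n) (Term C (n - 1))) \<and>
     (\<forall>n. Diff C n \<cdot>\<^bsub>A\<^esub> Diff C (n + 1) = Zero A (Term C (n + 1)) (Term C (n - 1)))"

record ('o, 'm) chain_map =
  Source :: "('o, 'm) chain_complex"
  Target :: "('o, 'm) chain_complex"
  At     :: "int \<Rightarrow> 'm"

definition is_chain_map ::
  "('o, 'm, 'z) preadd_category_scheme \<Rightarrow> ('o, 'm) chain_map \<Rightarrow> bool" where
  "is_chain_map A f \<longleftrightarrow> is_complex A (Source f) \<and> is_complex A (Target f) \<and>
     (\<forall>n. At f n \<in> Hom A (Term (Source f) n) (Term (Target f) n)) \<and>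
     (\<forall>n. At f (n - 1) \<cdot>\<^bsub>A\<^esub> Diff (Source f) n = Diff (Target f) n \<cdot>\<^bsub>A\<^esub> At f n)"

definition Ch ::
  "('o, 'm, 'z) preadd_category_scheme
     \<Rightarrow> (('o, 'm) chain_complex, ('o, 'm) chain_map) preadd_category" where
  "Ch A = \<lparr>
     Obj = {C. is_complex A C},
     Arr = {f. is_chain_map A f},
     Dom = Source,
     Cod = Target,
     Ide = (\<lambda>C. \<lparr>Source = C, Target = C, At = (\<lambda>n. Ide A (Term C n))\<rparr>),
     Comp = (\<lambda>g f. \<lparr>Source = Source f, Target = Target g, At = (\<lambda>n. At g n \<cdot>\<^bsub>A\<^esub> At f n)\<rparr>),
     Add = (\<lambda>f g. \<lparr>Source = Source f, Target = Target f, At = (\<lambda>n. At f n \<uplus>\<^bsub>A\<^esub> At g n)\<rparr>),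
     Zero = (\<lambda>C D. \<lparr>Source = C, Target = D, At = (\<lambda>n. Zero A (Term C n) (Term D n))\<rparr>)\<rparr>"

definition dw ::
  "('o, 'm, 'z) preadd_category_scheme \<Rightarrow> 'o set \<Rightarrow> ('o, 'm) chain_complex set" where
  "dw A X = {C. is_complex A C \<and> (\<forall>n. Term C n \<in> X)}"


section \<open>Balanced pairs\<close>

definition is_right_approximation ::
  "('o, 'm, 'z) category_scheme \<Rightarrow> 'o set \<Rightarrow> 'm \<Rightarrow> bool" where
  "is_right_approximation A X f \<longleftrightarrow> f \<in> Arr A \<and> Dom A f \<in> X \<and>
     (\<forall>x \<in> X. \<forall>g \<in> Hom A x (Cod A f). \<exists>h \<in> Hom A x (Dom A f). f \<cdot>\<^bsub>A\<^esub> h = g)"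

definition is_left_approximation ::
  "('o, 'm, 'z) category_scheme \<Rightarrow> 'o set \<Rightarrow> 'm \<Rightarrow> bool" where
  "is_left_approximation A Y f \<longleftrightarrow> f \<in> Arr A \<and> Cod A f \<in> Y \<and>
     (\<forall>y \<in> Y. \<forall>g \<in> Hom A (Dom A f) y. \<exists>h \<in> Hom A (Cod A f) y. h \<cdot>\<^bsub>A\<^esub> f = g)"

definition contravariantly_finite :: "('o, 'm, 'z) category_scheme \<Rightarrow> 'o set \<Rightarrow> bool" where
  "contravariantly_finite A X \<longleftrightarrow>
     (\<forall>M \<in> Obj A. \<exists>f. is_right_approximation A X f \<and> Cod A f = M)"

definition covariantly_finite :: "('o, 'm, 'z) category_scheme \<Rightarrow> 'o set \<Rightarrow> bool" where
  "covariantly_finite A Y \<longleftrightarrow>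
     (\<forall>M \<in> Obj A. \<exists>f. is_left_approximation A Y f \<and> Dom A f = M)"

definition right_acyclic ::
  "('o, 'm, 'z) preadd_category_scheme \<Rightarrow> 'o set \<Rightarrow> ('o, 'm) chain_complex \<Rightarrow> bool" where
  "right_acyclic A X C \<longleftrightarrow> (\<forall>x \<in> X. \<forall>n.
     {f \<in> Hom A x (Term C n). Diff C n \<cdot>\<^bsub>A\<^esub> f = Zero A x (Term C (n - 1))} =
     (\<lambda>g. Diff C (n + 1) \<cdot>\<^bsub>A\<^esub> g) ` Hom A x (Term C (n + 1)))"

definition left_acyclic ::
  "('o, 'm, 'z) preadd_category_scheme \<Rightarrow> 'o set \<Rightarrow> ('o, 'm) chain_complex \<Rightarrow> bool" where
  "left_acyclic A Y C \<longleftrightarrow> (\<forall>y \<in> Y. \<forall>n.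
     {f \<in> Hom A (Term C n) y. f \<cdot>\<^bsub>A\<^esub> Diff C (n + 1) = Zero A (Term C (n + 1)) y} =
     (\<lambda>g. g \<cdot>\<^bsub>A\<^esub> Diff C n) ` Hom A (Term C (n - 1)) y)"

text \<open>
  In a resolution the object \<open>M\<close> sits in degree \<open>-1\<close> and \<open>X\<^sub>n\<close> in degree \<open>n\<close>; in a coresolution
  \<open>M\<close> sits in degree \<open>1\<close> and \<open>Y\<^sup>n\<close> in degree \<open>-n\<close>. Acyclicity refers to the augmented complex.
\<close>

definition is_resolution ::
  "('o, 'm, 'z) preadd_category_scheme \<Rightarrow> 'o set \<Rightarrow> 'o \<Rightarrow> ('o, 'm) chain_complex \<Rightarrow> bool" where
  "is_resolution A X M C \<longleftrightarrow> is_complex A C \<and> Term C (-1) = M \<and>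
     (\<forall>n \<ge> 0. Term C n \<in> X) \<and> (\<forall>n < -1. is_zero_object A (Term C n)) \<and> right_acyclic A X C"

definition is_coresolution ::
  "('o, 'm, 'z) preadd_category_scheme \<Rightarrow> 'o set \<Rightarrow> 'o \<Rightarrow> ('o, 'm) chain_complex \<Rightarrow> bool" where
  "is_coresolution A Y M C \<longleftrightarrow> is_complex A C \<and> Term C 1 = M \<and>
     (\<forall>n \<le> 0. Term C n \<in> Y) \<and> (\<forall>n > 1. is_zero_object A (Term C n)) \<and> left_acyclic A Y C"

definition balanced_pair ::
  "('o, 'm, 'z) preadd_category_scheme \<Rightarrow> 'o set \<Rightarrow> 'o set \<Rightarrow> bool" where
  "balanced_pair A X Y \<longleftrightarrow> is_subcategory A X \<and> is_subcategory A Y \<and>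
     contravariantly_finite A X \<and> covariantly_finite A Y \<and>
     (\<forall>M \<in> Obj A. \<exists>C. is_resolution A X M C \<and> left_acyclic A Y C) \<and>
     (\<forall>M \<in> Obj A. \<exists>C. is_coresolution A Y M C \<and> right_acyclic A X C)"

definition admissible_balanced_pair ::
  "('o, 'm, 'z) preadd_category_scheme \<Rightarrow> 'o set \<Rightarrow> 'o set \<Rightarrow> bool" where
  "admissible_balanced_pair A X Y \<longleftrightarrow> balanced_pair A X Y \<and>
     (\<forall>f. is_right_approximation A X f \<longrightarrow> is_epic A f) \<and>
     (\<forall>f. is_left_approximation A Y f \<longrightarrow> is_monic A f)"


section \<open>Exact structures and Yoneda Ext\<close>

definition short_exact :: "('o, 'm, 'z) preadd_category_scheme \<Rightarrow> 'm \<Rightarrow> 'm \<Rightarrow> bool" where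
  "short_exact A i p \<longleftrightarrow> is_kernel A i p \<and> is_cokernel A p i"

text \<open>
  A short exact sequence is represented by its two arrows. Right \<open>X\<close>-acyclicity of
  \<open>0 \<rightarrow> L \<rightarrow> M \<rightarrow> N \<rightarrow> 0\<close> is exactness of \<open>0 \<rightarrow> Hom(x,L) \<rightarrow> Hom(x,M) \<rightarrow> Hom(x,N) \<rightarrow> 0\<close> at all
  three places, for every \<open>x\<close> in \<open>X\<close>.
\<close>

definition right_acyclic_sequences ::
  "('o, 'm, 'z) preadd_category_scheme \<Rightarrow> 'o set \<Rightarrow> ('m \<times> 'm) set" where
  "right_acyclic_sequences A X = {(i, p). short_exact A i p \<and> (\<forall>x \<in> X.
     inj_on (\<lambda>f. i \<cdot>\<^bsub>A\<^esub> f) (Hom A x (Dom A i)) \<and>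
     {f \<in> Hom A x (Cod A i). p \<cdot>\<^bsub>A\<^esub> f = Zero A x (Cod A p)} =
       (\<lambda>f. i \<cdot>\<^bsub>A\<^esub> f) ` Hom A x (Dom A i) \<and>
     (\<lambda>f. p \<cdot>\<^bsub>A\<^esub> f) ` Hom A x (Dom A p) = Hom A x (Cod A p))}"

definition Ch_exact ::
  "('o, 'm, 'z) preadd_category_scheme \<Rightarrow> ('m \<times> 'm) set
     \<Rightarrow> (('o, 'm) chain_map \<times> ('o, 'm) chain_map) set" where
  "Ch_exact A E = {(i, p). i \<in> Arr (Ch A) \<and> p \<in> Arr (Ch A) \<and> Target i = Source p \<and>
     (\<forall>n. (At i n, At p n) \<in> E)}"

text \<open>
  For a category \<open>B\<close> with a class \<open>E\<close> of short exact sequences: extensions \<open>c \<rightarrow> e \<rightarrow> s\<close> and the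
  underlying set of the Yoneda group Ext\<open>\<^sup>1(s, c)\<close>. The Baer sum plays no role, since a group
  is zero iff it has exactly one element.
\<close>

definition extensions ::
  "('o, 'm, 'z) category_scheme \<Rightarrow> ('m \<times> 'm) set \<Rightarrow> 'o \<Rightarrow> 'o \<Rightarrow> ('m \<times> 'm) set" where
  "extensions B E s c = {(i, p) \<in> E. Dom B i = c \<and> Cod B p = s}"

definition extension_equiv ::
  "('o, 'm, 'z) category_scheme \<Rightarrow> ('m \<times> 'm) set \<Rightarrow> 'o \<Rightarrow> 'o \<Rightarrow> (('m \<times> 'm) \<times> ('m \<times> 'm)) set" where
  "extension_equiv B E s c = {((i, p), (i', p')).
     (i, p) \<in> extensions B E s c \<and> (i', p') \<in> extensions B E s c \<and>
     (\<exists>h \<in> Hom B (Cod B i) (Cod B i'). is_iso B h \<and> h \<cdot>\<^bsub>B\<^esub> i = i' \<and> p' \<cdot>\<^bsub>B\<^esub> h = p)}"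

definition Ext1 ::
  "('o, 'm, 'z) category_scheme \<Rightarrow> ('m \<times> 'm) set \<Rightarrow> 'o \<Rightarrow> 'o \<Rightarrow> ('m \<times> 'm) set set" where
  "Ext1 B E s c = extensions B E s c // extension_equiv B E s c"

definition Ext1_zero ::
  "('o, 'm, 'z) category_scheme \<Rightarrow> ('m \<times> 'm) set \<Rightarrow> 'o \<Rightarrow> 'o \<Rightarrow> bool" where
  "Ext1_zero B E s c \<longleftrightarrow> is_singleton (Ext1 B E s c)"

definition right_orth ::
  "('o, 'm, 'z) category_scheme \<Rightarrow> ('m \<times> 'm) set \<Rightarrow> 'o set \<Rightarrow> 'o set" where
  "right_orth B E S = {c \<in> Obj B. \<forall>s \<in> S. Ext1_zero B E s c}"

definition left_orth ::
  "('o, 'm, 'z) category_scheme \<Rightarrow> ('m \<times> 'm) set \<Rightarrow> 'o set \<Rightarrow> 'o set" where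
  "left_orth B E S = {c \<in> Obj B. \<forall>s \<in> S. Ext1_zero B E c s}"


section \<open>Homotopy categories and triangle equivalences\<close>

definition homotopic ::
  "('o, 'm, 'z) preadd_category_scheme \<Rightarrow> (('o, 'm) chain_map \<times> ('o, 'm) chain_map) set" where
  "homotopic A = {(f, g). f \<in> Arr (Ch A) \<and> g \<in> Arr (Ch A) \<and>
     Source f = Source g \<and> Target f = Target g \<and>
     (\<exists>h. (\<forall>n. h n \<in> Hom A (Term (Source f) n) (Term (Target f) (n + 1))) \<and>
          (\<forall>n. At f n = At g n \<uplus>\<^bsub>A\<^esub>
             ((Diff (Target f) (n + 1) \<cdot>\<^bsub>A\<^esub> h n) \<uplus>\<^bsub>A\<^esub> (h (n - 1) \<cdot>\<^bsub>A\<^esub> Diff (Source f) n))))}"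

definition htpy_class ::
  "('o, 'm, 'z) preadd_category_scheme \<Rightarrow> ('o, 'm) chain_map \<Rightarrow> ('o, 'm) chain_map set" where
  "htpy_class A f = homotopic A `` {f}"

text \<open>
  The homotopy category of complexes with terms in \<open>X\<close>, as a preadditive category. Its arrows
  are homotopy classes; source and target are the same for all representatives, and the
  operations are those induced from \<open>Ch A\<close>.
\<close>

definition K_preadd ::
  "('o, 'm, 'z) preadd_category_scheme \<Rightarrow> 'o set
     \<Rightarrow> (('o, 'm) chain_complex, ('o, 'm) chain_map set) preadd_category" where
  "K_preadd A X = \<lparr>
     Obj = dw A X,
     Arr = (\<Union>C \<in> dw A X. \<Union>D \<in> dw A X. htpy_class A ` Hom (Ch A) C D),
     Dom = (\<lambda>F. Source (SOME f. f \<in> F)),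
     Cod = (\<lambda>F. Target (SOME f. f \<in> F)),
     Ide = (\<lambda>C. htpy_class A (Ide (Ch A) C)),
     Comp = (\<lambda>G F. \<Union>g \<in> G. \<Union>f \<in> F. htpy_class A (g \<cdot>\<^bsub>Ch A\<^esub> f)),
     Add = (\<lambda>F G. \<Union>f \<in> F. \<Union>g \<in> G. htpy_class A (f \<uplus>\<^bsub>Ch A\<^esub> g)),
     Zero = (\<lambda>C D. htpy_class A (Zero (Ch A) C D))\<rparr>"

definition shift_complex ::
  "('o, 'm, 'z) preadd_category_scheme \<Rightarrow> ('o, 'm) chain_complex \<Rightarrow> ('o, 'm) chain_complex" where
  "shift_complex A C = \<lparr>Term = (\<lambda>n. Term C (n - 1)), Diff = (\<lambda>n. Neg A (Diff C (n - 1)))\<rparr>"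

definition shift_map ::
  "('o, 'm, 'z) preadd_category_scheme \<Rightarrow> ('o, 'm) chain_map \<Rightarrow> ('o, 'm) chain_map" where
  "shift_map A f = \<lparr>Source = shift_complex A (Source f), Target = shift_complex A (Target f),
                    At = (\<lambda>n. At f (n - 1))\<rparr>"

text \<open>
  \<open>C \<rightarrow> D \<rightarrow> cone f \<rightarrow> \<Sigma>C\<close> for a chain map \<open>f : C \<rightarrow> D\<close>. In degree \<open>n\<close> the cone is a biproduct of
  \<open>C\<^sub>n\<^sub>-\<^sub>1\<close> and \<open>D\<^sub>n\<close>, with differential \<open>(c, d) \<mapsto> (- \<partial>c, f c + \<partial>d)\<close>. No biproducts are
  chosen in \<open>A\<close>, so the cone is any complex \<open>Target i\<close> of this form.
\<close>

definition is_cone_triangle ::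
  "('o, 'm, 'z) preadd_category_scheme
     \<Rightarrow> ('o, 'm) chain_map \<Rightarrow> ('o, 'm) chain_map \<Rightarrow> ('o, 'm) chain_map \<Rightarrow> bool" where
  "is_cone_triangle A f i p \<longleftrightarrow>
     (let C = Source f; D = Target f; E = Target i in
        f \<in> Arr (Ch A) \<and> i \<in> Hom (Ch A) D E \<and> p \<in> Hom (Ch A) E (shift_complex A C) \<and>
        (\<exists>\<sigma> \<rho>. \<forall>n.
           is_biproduct A (Term C (n - 1)) (Term D n) (Term E n) (\<sigma> n) (At i n) (At p n) (\<rho> n) \<and>
           Diff E n =
             (\<sigma> (n - 1) \<cdot>\<^bsub>A\<^esub> Neg A (Diff C (n - 1)) \<cdot>\<^bsub>A\<^esub> At p n) \<uplus>\<^bsub>A\<^esub>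
             ((At i (n - 1) \<cdot>\<^bsub>A\<^esub> At f (n - 1) \<cdot>\<^bsub>A\<^esub> At p n) \<uplus>\<^bsub>A\<^esub>
              (At i (n - 1) \<cdot>\<^bsub>A\<^esub> Diff D n \<cdot>\<^bsub>A\<^esub> \<rho> n))))"

record ('o, 'm) triang_category = "('o, 'm) preadd_category" +
  ShiftO :: "'o \<Rightarrow> 'o"
  ShiftM :: "'m \<Rightarrow> 'm"
  Triangles :: "('m \<times> 'm \<times> 'm) set"

definition K_shift ::
  "('o, 'm, 'z) preadd_category_scheme \<Rightarrow> ('o, 'm) chain_map set \<Rightarrow> ('o, 'm) chain_map set" where
  "K_shift A F = (\<Union>f \<in> F. htpy_class A (shift_map A f))"

definition K_triangles ::
  "('o, 'm, 'z) preadd_category_scheme \<Rightarrow> 'o set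
     \<Rightarrow> (('o, 'm) chain_map set \<times> ('o, 'm) chain_map set \<times> ('o, 'm) chain_map set) set" where
  "K_triangles A X = (let K = K_preadd A X in
     {(u, v, w). \<exists>P \<in> dw A X. \<exists>Q \<in> dw A X. \<exists>R \<in> dw A X.
        u \<in> Hom K P Q \<and> v \<in> Hom K Q R \<and> w \<in> Hom K R (shift_complex A P) \<and>
        (\<exists>f i p a b c.
           is_cone_triangle A f i p \<and>
           Source f \<in> dw A X \<and> Target f \<in> dw A X \<and> Target i \<in> dw A X \<and>
           a \<in> Hom K P (Source f) \<and> is_iso K a \<and>
           b \<in> Hom K Q (Target f) \<and> is_iso K b \<and>
           c \<in> Hom K R (Target i) \<and> is_iso K c \<and>
           b \<cdot>\<^bsub>K\<^esub> u = htpy_class A f \<cdot>\<^bsub>K\<^esub> a \<and>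
           c \<cdot>\<^bsub>K\<^esub> v = htpy_class A i \<cdot>\<^bsub>K\<^esub> b \<and>
           K_shift A a \<cdot>\<^bsub>K\<^esub> w = htpy_class A p \<cdot>\<^bsub>K\<^esub> c)})"

definition K ::
  "('o, 'm, 'z) preadd_category_scheme \<Rightarrow> 'o set
     \<Rightarrow> (('o, 'm) chain_complex, ('o, 'm) chain_map set) triang_category" where
  "K A X = preadd_category.extend (K_preadd A X)
     (triang_category.fields (shift_complex A) (K_shift A) (K_triangles A X))"

definition is_triangle_functor ::
  "('o, 'm, 'z) triang_category_scheme \<Rightarrow> ('p, 'n, 'y) triang_category_scheme
     \<Rightarrow> ('o \<Rightarrow> 'p) \<Rightarrow> ('m \<Rightarrow> 'n) \<Rightarrow> ('o \<Rightarrow> 'n) \<Rightarrow> bool" where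
  "is_triangle_functor S T Fo Fm \<phi> \<longleftrightarrow> is_functor S T Fo Fm \<and>
     (\<forall>a b. \<forall>f \<in> Hom S a b. \<forall>g \<in> Hom S a b. Fm (f \<uplus>\<^bsub>S\<^esub> g) = Fm f \<uplus>\<^bsub>T\<^esub> Fm g) \<and>
     is_natural_iso S T (Fo \<circ> ShiftO S) (Fm \<circ> ShiftM S) (ShiftO T \<circ> Fo) (ShiftM T \<circ> Fm) \<phi> \<and>
     (\<forall>(u, v, w) \<in> Triangles S. (Fm u, Fm v, \<phi> (Dom S u) \<cdot>\<^bsub>T\<^esub> Fm w) \<in> Triangles T)"

definition triangle_equivalent ::
  "('o, 'm, 'z) triang_category_scheme \<Rightarrow> ('p, 'n, 'y) triang_category_scheme \<Rightarrow> bool" where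
  "triangle_equivalent S T \<longleftrightarrow>
     (\<exists>Fo Fm \<phi>. is_triangle_functor S T Fo Fm \<phi> \<and> is_equivalence S T Fo Fm)"

end

theory Submission
  imports Defs "HOL-Algebra.Free_Abelian_Groups"
begin

context category
begin

lemma HomI: "\<lbrakk>f \<in> Arr C; Dom C f = a; Cod C f = b\<rbrakk> \<Longrightarrow> f \<in> Hom C a b"
  by (simp add: Hom_def)

lemma Dom_Obj [simp]: "f \<in> Arr C \<Longrightarrow> Dom C f \<in> Obj C"
  by (rule Dom_in_Obj)

lemma Cod_Obj [simp]: "f \<in> Arr C \<Longrightarrow> Cod C f \<in> Obj C"
  by (rule Cod_in_Obj)

lemma Ide_Arr [simp]: "a \<in> Obj C \<Longrightarrow> Ide C a \<in> Arr C"
  and Dom_Ide [simp]: "a \<in> Obj C \<Longrightarrow> Dom C (Ide C a) = a"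
  and Cod_Ide [simp]: "a \<in> Obj C \<Longrightarrow> Cod C (Ide C a) = a"
  using Ide_in_Hom[of a] by (simp_all add: Hom_def)

lemma Comp_Hom:
  assumes "f \<in> Arr C" "g \<in> Arr C" "Dom C g = Cod C f"
  shows "g \<cdot> f \<in> Hom C (Dom C f) (Cod C g)"
  using Comp_in_Hom[of f "Dom C f" "Cod C f" g "Cod C g"] assms by (simp add: Hom_def)

lemma Comp_Arr [simp]: "\<lbrakk>f \<in> Arr C; g \<in> Arr C; Dom C g = Cod C f\<rbrakk> \<Longrightarrow> g \<cdot> f \<in> Arr C"
  and Dom_Comp [simp]: "\<lbrakk>f \<in> Arr C; g \<in> Arr C; Dom C g = Cod C f\<rbrakk> \<Longrightarrow> Dom C (g \<cdot> f) = Dom C f"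
  and Cod_Comp [simp]: "\<lbrakk>f \<in> Arr C; g \<in> Arr C; Dom C g = Cod C f\<rbrakk> \<Longrightarrow> Cod C (g \<cdot> f) = Cod C g"
  using Comp_Hom[of f g] by (simp_all add: Hom_def)

lemma Ide_Comp [simp]: "\<lbrakk>f \<in> Arr C; Cod C f = b\<rbrakk> \<Longrightarrow> Ide C b \<cdot> f = f"
  using Ide_left[of f "Dom C f" b] by (simp add: Hom_def)

lemma Comp_Ide [simp]: "\<lbrakk>f \<in> Arr C; Dom C f = a\<rbrakk> \<Longrightarrow> f \<cdot> Ide C a = f"
  using Ide_right[of f a "Cod C f"] by (simp add: Hom_def)

lemma assoc [simp]:
  "\<lbrakk>f \<in> Arr C; g \<in> Arr C; h \<in> Arr C; Dom C g = Cod C f; Dom C h = Cod C g\<rbrakk>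
    \<Longrightarrow> (h \<cdot> g) \<cdot> f = h \<cdot> (g \<cdot> f)"
  using Comp_assoc[of f "Dom C f" "Cod C f" g "Cod C g" h "Cod C h"] by (simp add: Hom_def)

text \<open>Composites are normalised to the right; a rule for \<open>g \<cdot> f\<close> then has to act inside \<open>g \<cdot> (f \<cdot> x)\<close>.\<close>

lemma Comp_reassoc:
  assumes "g \<cdot> f = k" "f \<in> Arr C" "g \<in> Arr C" "Dom C g = Cod C f" "x \<in> Arr C" "Dom C f = Cod C x"
  shows "g \<cdot> (f \<cdot> x) = k \<cdot> x"
  using assoc[of x f g] assms by simp

end

context preadditive_category
begin

lemma Zero_Arr [simp]: "\<lbrakk>a \<in> Obj A; b \<in> Obj A\<rbrakk> \<Longrightarrow> Zero A a b \<in> Arr A"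
  and Dom_Zero [simp]: "\<lbrakk>a \<in> Obj A; b \<in> Obj A\<rbrakk> \<Longrightarrow> Dom A (Zero A a b) = a"
  and Cod_Zero [simp]: "\<lbrakk>a \<in> Obj A; b \<in> Obj A\<rbrakk> \<Longrightarrow> Cod A (Zero A a b) = b"
  using group.is_monoid[OF comm_group.axioms(2)[OF comm_group_hom[of a b]], THEN monoid.one_closed]
  by (simp_all add: hom_group_def Hom_def)

lemma Add_Hom:
  assumes "f \<in> Arr A" "g \<in> Arr A" "Dom A g = Dom A f" "Cod A g = Cod A f"
  shows "f \<uplus> g \<in> Hom A (Dom A f) (Cod A f)"
  using monoid.m_closed[OF group.is_monoid[OF comm_group.axioms(2)[OF comm_group_hom[of "Dom A f" "Cod A f"]]], of f g] assms
  by (simp add: hom_group_def Hom_def)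

lemma Add_Arr [simp]: "\<lbrakk>f \<in> Arr A; g \<in> Arr A; Dom A g = Dom A f; Cod A g = Cod A f\<rbrakk> \<Longrightarrow> f \<uplus> g \<in> Arr A"
  and Dom_Add [simp]: "\<lbrakk>f \<in> Arr A; g \<in> Arr A; Dom A g = Dom A f; Cod A g = Cod A f\<rbrakk> \<Longrightarrow> Dom A (f \<uplus> g) = Dom A f"
  and Cod_Add [simp]: "\<lbrakk>f \<in> Arr A; g \<in> Arr A; Dom A g = Dom A f; Cod A g = Cod A f\<rbrakk> \<Longrightarrow> Cod A (f \<uplus> g) = Cod A f"
  using Add_Hom[of f g] by (simp_all add: Hom_def)

lemma Neg_Hom: "f \<in> Arr A \<Longrightarrow> Neg A f \<in> Hom A (Dom A f) (Cod A f)"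
  using group.inv_closed[OF comm_group.axioms(2)[OF comm_group_hom[of "Dom A f" "Cod A f"]], of f]
  by (simp add: hom_group_def Hom_def Neg_def)

lemma Neg_Arr [simp]: "f \<in> Arr A \<Longrightarrow> Neg A f \<in> Arr A"
  and Dom_Neg [simp]: "f \<in> Arr A \<Longrightarrow> Dom A (Neg A f) = Dom A f"
  and Cod_Neg [simp]: "f \<in> Arr A \<Longrightarrow> Cod A (Neg A f) = Cod A f"
  using Neg_Hom[of f] by (simp_all add: Hom_def)

text \<open>
  Identities between sums of parallel arrows are decided in the free abelian group on \<open>Hom A a b\<close>:
  \<open>ev a b\<close> evaluates a formal integral combination of arrows, and \<open>lin a b f x\<close> records that the
  formal combination \<open>x\<close> evaluates to \<open>f\<close>. The rules for \<open>lin\<close> read off \<open>x\<close> from \<open>f\<close>, after which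
  the simplifier compares two elements of an honest \<open>ab_group_add\<close> type.
\<close>

definition ev :: "'o \<Rightarrow> 'o \<Rightarrow> ('m \<Rightarrow>\<^sub>0 int) \<Rightarrow> 'm" where
  "ev a b = (SOME h. h \<in> hom (free_Abelian_group (Hom A a b)) (hom_group A a b) \<and>
                (\<forall>f \<in> Hom A a b. h (frag_of f) = f))"

definition lin :: "'o \<Rightarrow> 'o \<Rightarrow> 'm \<Rightarrow> ('m \<Rightarrow>\<^sub>0 int) \<Rightarrow> bool" where
  "lin a b f x \<longleftrightarrow> a \<in> Obj A \<and> b \<in> Obj A \<and> Poly_Mapping.keys x \<subseteq> Hom A a b \<and> ev a b x = f"

lemma ev_spec:
  assumes "a \<in> Obj A" "b \<in> Obj A"
  shows "ev a b \<in> hom (free_Abelian_group (Hom A a b)) (hom_group A a b)"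
    and "f \<in> Hom A a b \<Longrightarrow> ev a b (frag_of f) = f"
proof -
  interpret G: comm_group "hom_group A a b" using assms by (rule comm_group_hom)
  have "(\<lambda>f. f) ` Hom A a b \<subseteq> carrier (hom_group A a b)" by (simp add: hom_group_def)
  then obtain h where "h \<in> hom (free_Abelian_group (Hom A a b)) (hom_group A a b)"
      "\<And>f. f \<in> Hom A a b \<Longrightarrow> h (frag_of f) = f"
    using G.free_Abelian_group_universal[of "\<lambda>f. f"] by blast
  then have "\<exists>h. h \<in> hom (free_Abelian_group (Hom A a b)) (hom_group A a b) \<and>
                (\<forall>f \<in> Hom A a b. h (frag_of f) = f)" by blast
  from someI_ex[OF this]
  show "ev a b \<in> hom (free_Abelian_group (Hom A a b)) (hom_group A a b)"
    and "f \<in> Hom A a b \<Longrightarrow> ev a b (frag_of f) = f"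
    by (auto simp: ev_def)
qed

lemma lin_atom: "\<lbrakk>f \<in> Arr A; Dom A f = a; Cod A f = b\<rbrakk> \<Longrightarrow> lin a b f (frag_of f)"
  using ev_spec(2)[of a b f] by (auto simp: lin_def Hom_def)

lemma lin_zero: "\<lbrakk>a = a'; b = b'; a \<in> Obj A; b \<in> Obj A\<rbrakk> \<Longrightarrow> lin a b (Zero A a' b') 0"
proof -
  assume *: "a = a'" "b = b'" "a \<in> Obj A" "b \<in> Obj A"
  interpret G: comm_group "hom_group A a b" using * by (intro comm_group_hom)
  show ?thesis
    using hom_one[OF ev_spec(1)[of a b]] * G.is_group by (simp add: lin_def hom_group_def)
qed

lemma lin_add: "\<lbrakk>lin a b f x; lin a b g y\<rbrakk> \<Longrightarrow> lin a b (f \<uplus> g) (x + y)"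
proof -
  assume *: "lin a b f x" "lin a b g y"
  have "ev a b (x + y) = ev a b x \<uplus> ev a b y"
    using hom_mult[OF ev_spec(1)[of a b], of x y] * by (simp add: lin_def hom_group_def)
  with * show ?thesis using keys_add[of x y] by (auto simp: lin_def)
qed

lemma lin_neg: "lin a b f x \<Longrightarrow> lin a b (Neg A f) (- x)"
proof -
  assume *: "lin a b f x"
  then have ab: "a \<in> Obj A" "b \<in> Obj A" and k: "Poly_Mapping.keys x \<subseteq> Hom A a b" by (auto simp: lin_def)
  interpret G: comm_group "hom_group A a b" using ab by (intro comm_group_hom)
  interpret h: group_hom "free_Abelian_group (Hom A a b)" "hom_group A a b" "ev a b"
    using ev_spec(1)[OF ab] by (simp add: group_hom_def group_hom_axioms_def G.is_group)
  have "f \<in> Hom A a b" using h.hom_closed[of x] * k by (simp add: lin_def hom_group_def)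
  then have "Neg A f = inv\<^bsub>hom_group A a b\<^esub> f" by (simp add: Neg_def Hom_def)
  also have "\<dots> = ev a b (- x)" using h.hom_inv[of x] * k by (simp add: lin_def)
  finally show ?thesis using * by (simp add: lin_def)
qed

lemma lin_eqI: "\<lbrakk>lin (Dom A f) (Cod A f) f x; lin (Dom A f) (Cod A f) g y; x = y\<rbrakk> \<Longrightarrow> f = g"
  by (auto simp: lin_def)

lemmas lin_intros = lin_add lin_neg lin_zero lin_atom

lemma lin_iff: "lin a b f x \<Longrightarrow> f \<in> Hom A a b"
proof -
  assume *: "lin a b f x"
  then show ?thesis using hom_in_carrier[OF ev_spec(1)[of a b], of x] by (auto simp: lin_def hom_group_def)
qed

text \<open>Moving an equation \<open>l' = r'\<close> across: it suffices that \<open>l = r\<close> follows by adding it.\<close>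

lemma Add_cancel:
  assumes "f \<uplus> h = g \<uplus> h" "f \<in> Arr A" "g \<in> Arr A" "h \<in> Arr A"
    "Dom A g = Dom A f" "Cod A g = Cod A f" "Dom A h = Dom A f" "Cod A h = Cod A f"
  shows "f = g"
proof -
  have "f = (f \<uplus> h) \<uplus> Neg A h"
    by (insert assms, rule lin_eqI, (rule lin_intros | simp)+)
  also have "\<dots> = g"
    unfolding assms(1)
    by (insert assms, rule lin_eqI, (rule lin_intros | simp)+)
  finally show ?thesis .
qed

lemma Add_zero_left [simp]: "\<lbrakk>f \<in> Arr A; a = Dom A f; b = Cod A f\<rbrakk> \<Longrightarrow> Zero A a b \<uplus> f = f"
  by (rule lin_eqI, (rule lin_intros | simp)+)

lemma Add_zero_right [simp]: "\<lbrakk>f \<in> Arr A; a = Dom A f; b = Cod A f\<rbrakk> \<Longrightarrow> f \<uplus> Zero A a b = f"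
  by (rule lin_eqI, (rule lin_intros | simp)+)

lemma Add_Neg [simp]: "f \<in> Arr A \<Longrightarrow> f \<uplus> Neg A f = Zero A (Dom A f) (Cod A f)"
  by (rule lin_eqI, (rule lin_intros | simp)+)

lemma Neg_Neg [simp]: "f \<in> Arr A \<Longrightarrow> Neg A (Neg A f) = f"
  by (rule lin_eqI, (rule lin_intros | simp)+)

lemma Neg_Zero [simp]: "\<lbrakk>a \<in> Obj A; b \<in> Obj A\<rbrakk> \<Longrightarrow> Neg A (Zero A a b) = Zero A a b"
  by (rule lin_eqI, (rule lin_intros | simp)+)

lemma Comp_distrib [simp]:
  "\<lbrakk>f \<in> Arr A; f' \<in> Arr A; g \<in> Arr A; Dom A f' = Dom A f; Cod A f' = Cod A f; Dom A g = Cod A f\<rbrakk>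
    \<Longrightarrow> g \<cdot> (f \<uplus> f') = (g \<cdot> f) \<uplus> (g \<cdot> f')"
  using Comp_Add[of f "Dom A f" "Cod A f" f' g "Cod A g"] by (simp add: Hom_def)

lemma distrib_Comp [simp]:
  "\<lbrakk>f \<in> Arr A; g \<in> Arr A; g' \<in> Arr A; Dom A g' = Dom A g; Cod A g' = Cod A g; Dom A g = Cod A f\<rbrakk>
    \<Longrightarrow> (g \<uplus> g') \<cdot> f = (g \<cdot> f) \<uplus> (g' \<cdot> f)"
  using Add_Comp[of f "Dom A f" "Cod A f" g "Cod A g" g'] by (simp add: Hom_def)

lemma Comp_Zero [simp]:
  assumes "g \<in> Arr A" "a \<in> Obj A" "b = Dom A g"
  shows "g \<cdot> Zero A a b = Zero A a (Cod A g)"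
proof -
  let ?z = "g \<cdot> Zero A a b"
  have "?z \<uplus> ?z = g \<cdot> (Zero A a b \<uplus> Zero A a b)" using assms by (subst Comp_distrib) simp_all
  also have "\<dots> = Zero A a (Cod A g) \<uplus> ?z" using assms by simp
  finally show ?thesis by (rule Add_cancel) (use assms in simp_all)
qed

lemma Zero_Comp [simp]:
  assumes "f \<in> Arr A" "c \<in> Obj A" "b = Cod A f"
  shows "Zero A b c \<cdot> f = Zero A (Dom A f) c"
proof -
  let ?z = "Zero A b c \<cdot> f"
  have "?z \<uplus> ?z = (Zero A b c \<uplus> Zero A b c) \<cdot> f" using assms by (subst distrib_Comp) simp_all
  also have "\<dots> = Zero A (Dom A f) c \<uplus> ?z" using assms by simp
  finally show ?thesis by (rule Add_cancel) (use assms in simp_all)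
qed

lemma Comp_Neg [simp]:
  assumes "f \<in> Arr A" "g \<in> Arr A" "Dom A g = Cod A f"
  shows "g \<cdot> Neg A f = Neg A (g \<cdot> f)"
proof -
  have "(g \<cdot> Neg A f) \<uplus> (g \<cdot> f) = g \<cdot> (Neg A f \<uplus> f)" using assms by simp
  also have "Neg A f \<uplus> f = Zero A (Dom A f) (Cod A f)"
    by (insert assms, rule lin_eqI, (rule lin_intros | simp)+)
  also have "g \<cdot> \<dots> = Zero A (Dom A f) (Cod A g)" using assms by simp
  also have "\<dots> = Neg A (g \<cdot> f) \<uplus> (g \<cdot> f)"
    by (insert assms, rule lin_eqI, (rule lin_intros | simp)+)
  finally show ?thesis by (rule Add_cancel) (use assms in simp_all)
qed

lemma Neg_Comp [simp]:
  assumes "f \<in> Arr A" "g \<in> Arr A" "Dom A g = Cod A f"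
  shows "Neg A g \<cdot> f = Neg A (g \<cdot> f)"
proof -
  have "(Neg A g \<cdot> f) \<uplus> (g \<cdot> f) = (Neg A g \<uplus> g) \<cdot> f" using assms by simp
  also have "Neg A g \<uplus> g = Zero A (Dom A g) (Cod A g)"
    by (insert assms, rule lin_eqI, (rule lin_intros | simp)+)
  also have "\<dots> \<cdot> f = Zero A (Dom A f) (Cod A g)" using assms by simp
  also have "\<dots> = Neg A (g \<cdot> f) \<uplus> (g \<cdot> f)"
    by (insert assms, rule lin_eqI, (rule lin_intros | simp)+)
  finally show ?thesis by (rule Add_cancel) (use assms in simp_all)
qed

text \<open>A linear consequence of one resp. two equations between parallel arrows.\<close>

lemma Add_cross:
  assumes "l' = r'" "l \<uplus> r' = r \<uplus> l'"
    "l \<in> Arr A" "r \<in> Arr A" "l' \<in> Arr A"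
    "Dom A r = Dom A l" "Cod A r = Cod A l" "Dom A l' = Dom A l" "Cod A l' = Cod A l"
  shows "l = r"
  using assms Add_cancel[of l l' r] by simp


lemma famD:
  assumes "\<And>n. h n \<in> Hom A (S n) (T n)"
  shows "h n \<in> Arr A" "Dom A (h n) = S n" "Cod A (h n) = T n"
  using assms by (simp_all add: Hom_def)

lemma cplxD:
  assumes "is_complex A C"
  shows "Term C n \<in> Obj A" "Diff C n \<in> Arr A" "Dom A (Diff C n) = Term C n"
    "Cod A (Diff C n) = Term C (n - 1)"
    "m = n - 1 \<Longrightarrow> Diff C m \<cdot> Diff C n = Zero A (Term C n) (Term C (n - 2))"
    "\<lbrakk>m = n - 1; x \<in> Arr A; Cod A x = Term C n\<rbrakk>
      \<Longrightarrow> Diff C m \<cdot> (Diff C n \<cdot> x) = Zero A (Dom A x) (Term C (n - 2))"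
proof -
  show 1: "\<And>n. Term C n \<in> Obj A" "\<And>n. Diff C n \<in> Arr A" "\<And>n. Dom A (Diff C n) = Term C n"
    "\<And>n. Cod A (Diff C n) = Term C (n - 1)"
    using assms by (simp_all add: is_complex_def Hom_def)
  have dd: "Diff C (n - 1) \<cdot> Diff C n = Zero A (Term C n) (Term C (n - 2))" for n
  proof -
    have "Diff C (n - 1) \<cdot> Diff C (n - 1 + 1) = Zero A (Term C (n - 1 + 1)) (Term C (n - 1 - 1))"
      using assms unfolding is_complex_def by blast
    then show ?thesis by simp
  qed
  then show "m = n - 1 \<Longrightarrow> Diff C m \<cdot> Diff C n = Zero A (Term C n) (Term C (n - 2))" by simp
  show "\<lbrakk>m = n - 1; x \<in> Arr A; Cod A x = Term C n\<rbrakk>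
      \<Longrightarrow> Diff C m \<cdot> (Diff C n \<cdot> x) = Zero A (Dom A x) (Term C (n - 2))"
    using Comp_reassoc[OF dd[of n], of x] 1 by simp
qed

definition cm :: "('o, 'm) chain_complex \<Rightarrow> ('o, 'm) chain_complex \<Rightarrow> (int \<Rightarrow> 'm) \<Rightarrow> bool" where
  "cm C D f \<longleftrightarrow> (\<forall>n. f n \<in> Hom A (Term C n) (Term D n)) \<and>
     (\<forall>n. f (n - 1) \<cdot> Diff C n = Diff D n \<cdot> f n)"

lemma cmD:
  assumes "cm C D f"
  shows "f n \<in> Arr A" "Dom A (f n) = Term C n" "Cod A (f n) = Term D n"
    "m = n - 1 \<Longrightarrow> f m \<cdot> Diff C n = Diff D n \<cdot> f n"
  using assms by (simp_all add: cm_def Hom_def)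

lemma cm_reassoc:
  assumes "cm C D f" "is_complex A C" "is_complex A D"
  shows "\<lbrakk>m = n - 1; x \<in> Arr A; Cod A x = Term C n\<rbrakk>
    \<Longrightarrow> f m \<cdot> (Diff C n \<cdot> x) = Diff D n \<cdot> (f n \<cdot> x)"
  using Comp_reassoc[OF cmD(4)[OF assms(1), of m n], of x] cmD[OF assms(1)] cplxD[OF assms(2)] cplxD[OF assms(3)]
  by simp

lemma cmI:
  assumes "\<And>n. f n \<in> Arr A" "\<And>n. Dom A (f n) = Term C n" "\<And>n. Cod A (f n) = Term D n"
    "\<And>n. f (n - 1) \<cdot> Diff C n = Diff D n \<cdot> f n"
  shows "cm C D f"
  using assms by (simp add: cm_def Hom_def)

definition htp where
  "htp C D f g \<longleftrightarrow> (\<exists>h. (\<forall>n. h n \<in> Hom A (Term C n) (Term D (n + 1))) \<and>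
     (\<forall>n. f n = g n \<uplus> ((Diff D (n + 1) \<cdot> h n) \<uplus> (h (n - 1) \<cdot> Diff C n))))"

lemma htpI:
  assumes "\<And>n. h n \<in> Arr A" "\<And>n. Dom A (h n) = Term C n" "\<And>n. Cod A (h n) = Term D (n + 1)"
    "\<And>n. f n = g n \<uplus> ((Diff D (n + 1) \<cdot> h n) \<uplus> (h (n - 1) \<cdot> Diff C n))"
  shows "htp C D f g"
  unfolding htp_def by (rule exI[of _ h]) (use assms in \<open>simp add: Hom_def\<close>)

lemma htpE:
  assumes "htp C D f g"
  obtains h where "\<And>n. h n \<in> Arr A" "\<And>n. Dom A (h n) = Term C n" "\<And>n. Cod A (h n) = Term D (n + 1)"
    "\<And>n. f n = g n \<uplus> ((Diff D (n + 1) \<cdot> h n) \<uplus> (h (n - 1) \<cdot> Diff C n))"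
  using assms unfolding htp_def by (auto simp: Hom_def)

lemma cm_ide: "is_complex A C \<Longrightarrow> cm C C (\<lambda>n. Ide A (Term C n))"
  by (rule cmI) (simp_all add: cplxD)

lemma cm_comp:
  assumes "cm C D f" "cm D E g" "is_complex A C" "is_complex A D" "is_complex A E"
  shows "cm C E (\<lambda>n. g n \<cdot> f n)"
proof -
  note [simp] = cmD[OF assms(1)] cmD[OF assms(2)] cplxD[OF assms(3)] cplxD[OF assms(4)] cplxD[OF assms(5)]
    cm_reassoc[OF assms(2,4,5)]
  show ?thesis by (rule cmI) simp_all
qed

lemma cm_add:
  assumes "cm C D f" "cm C D g" "is_complex A C" "is_complex A D"
  shows "cm C D (\<lambda>n. f n \<uplus> g n)"
proof -
  note [simp] = cmD[OF assms(1)] cmD[OF assms(2)] cplxD[OF assms(3)] cplxD[OF assms(4)]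
  show ?thesis by (rule cmI) simp_all
qed

lemma cm_neg:
  assumes "cm C D f" "is_complex A C" "is_complex A D"
  shows "cm C D (\<lambda>n. Neg A (f n))"
proof -
  note [simp] = cmD[OF assms(1)] cplxD[OF assms(2)] cplxD[OF assms(3)]
  show ?thesis by (rule cmI) simp_all
qed

lemma cm_zero: "\<lbrakk>is_complex A C; is_complex A D\<rbrakk> \<Longrightarrow> cm C D (\<lambda>n. Zero A (Term C n) (Term D n))"
  by (rule cmI) (simp_all add: cplxD)

lemma htp_refl:
  assumes "cm C D f" "is_complex A C" "is_complex A D"
  shows "htp C D f f"
proof -
  note [simp] = cmD[OF assms(1)] cplxD[OF assms(2)] cplxD[OF assms(3)]
  show ?thesis by (rule htpI[where h = "\<lambda>n. Zero A (Term C n) (Term D (n + 1))"]) simp_all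
qed

lemma htp_sym:
  assumes "htp C D f g" "cm C D f" "cm C D g" "is_complex A C" "is_complex A D"
  shows "htp C D g f"
proof -
  note [simp] = cmD[OF assms(2)] cmD[OF assms(3)] cplxD[OF assms(4)] cplxD[OF assms(5)]
  obtain h where [simp]: "\<And>n. h n \<in> Arr A" "\<And>n. Dom A (h n) = Term C n" "\<And>n. Cod A (h n) = Term D (n + 1)"
    and h: "\<And>n. f n = g n \<uplus> ((Diff D (n + 1) \<cdot> h n) \<uplus> (h (n - 1) \<cdot> Diff C n))"
    using assms(1) by (rule htpE) blast
  show ?thesis
    by (rule htpI[where h = "\<lambda>n. Neg A (h n)"])
      (simp_all, simp add: h, rule lin_eqI, (rule lin_intros | simp)+)
qed

lemma htp_trans:
  assumes "htp C D f g" "htp C D g k" "cm C D f" "cm C D g" "cm C D k" "is_complex A C" "is_complex A D"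
  shows "htp C D f k"
proof -
  note [simp] = cmD[OF assms(3)] cmD[OF assms(4)] cmD[OF assms(5)] cplxD[OF assms(6)] cplxD[OF assms(7)]
  obtain h where [simp]: "\<And>n. h n \<in> Arr A" "\<And>n. Dom A (h n) = Term C n" "\<And>n. Cod A (h n) = Term D (n + 1)"
    and h: "\<And>n. f n = g n \<uplus> ((Diff D (n + 1) \<cdot> h n) \<uplus> (h (n - 1) \<cdot> Diff C n))"
    using assms(1) by (rule htpE) blast
  obtain h' where [simp]: "\<And>n. h' n \<in> Arr A" "\<And>n. Dom A (h' n) = Term C n" "\<And>n. Cod A (h' n) = Term D (n + 1)"
    and h': "\<And>n. g n = k n \<uplus> ((Diff D (n + 1) \<cdot> h' n) \<uplus> (h' (n - 1) \<cdot> Diff C n))"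
    using assms(2) by (rule htpE) blast
  show ?thesis
    by (rule htpI[where h = "\<lambda>n. h n \<uplus> h' n"])
      (simp_all, simp add: h h', rule lin_eqI, (rule lin_intros | simp)+)
qed

lemma htp_add:
  assumes "htp C D f g" "htp C D f' g'" "cm C D f" "cm C D g" "cm C D f'" "cm C D g'"
    "is_complex A C" "is_complex A D"
  shows "htp C D (\<lambda>n. f n \<uplus> f' n) (\<lambda>n. g n \<uplus> g' n)"
proof -
  note [simp] = cmD[OF assms(3)] cmD[OF assms(4)] cmD[OF assms(5)] cmD[OF assms(6)] cplxD[OF assms(7)] cplxD[OF assms(8)]
  obtain h where [simp]: "\<And>n. h n \<in> Arr A" "\<And>n. Dom A (h n) = Term C n" "\<And>n. Cod A (h n) = Term D (n + 1)"
    and h: "\<And>n. f n = g n \<uplus> ((Diff D (n + 1) \<cdot> h n) \<uplus> (h (n - 1) \<cdot> Diff C n))"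
    using assms(1) by (rule htpE) blast
  obtain h' where [simp]: "\<And>n. h' n \<in> Arr A" "\<And>n. Dom A (h' n) = Term C n" "\<And>n. Cod A (h' n) = Term D (n + 1)"
    and h': "\<And>n. f' n = g' n \<uplus> ((Diff D (n + 1) \<cdot> h' n) \<uplus> (h' (n - 1) \<cdot> Diff C n))"
    using assms(2) by (rule htpE) blast
  show ?thesis
    by (rule htpI[where h = "\<lambda>n. h n \<uplus> h' n"])
      (simp_all, simp add: h h', rule lin_eqI, (rule lin_intros | simp)+)
qed

lemma htp_comp_left:
  assumes "htp C D f g" "cm C D f" "cm C D g" "cm D E k" "is_complex A C" "is_complex A D" "is_complex A E"
  shows "htp C E (\<lambda>n. k n \<cdot> f n) (\<lambda>n. k n \<cdot> g n)"
proof -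
  note [simp] = cmD[OF assms(2)] cmD[OF assms(3)] cmD[OF assms(4)] cplxD[OF assms(5)] cplxD[OF assms(6)] cplxD[OF assms(7)]
    cm_reassoc[OF assms(4,6,7)]
  obtain h where [simp]: "\<And>n. h n \<in> Arr A" "\<And>n. Dom A (h n) = Term C n" "\<And>n. Cod A (h n) = Term D (n + 1)"
    and h: "\<And>n. f n = g n \<uplus> ((Diff D (n + 1) \<cdot> h n) \<uplus> (h (n - 1) \<cdot> Diff C n))"
    using assms(1) by (rule htpE) blast
  show ?thesis
    by (rule htpI[where h = "\<lambda>n. k (n + 1) \<cdot> h n"]) (simp_all add: h)
qed

lemma htp_comp_right:
  assumes "htp D E f g" "cm D E f" "cm D E g" "cm C D k" "is_complex A C" "is_complex A D" "is_complex A E"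
  shows "htp C E (\<lambda>n. f n \<cdot> k n) (\<lambda>n. g n \<cdot> k n)"
proof -
  note [simp] = cmD[OF assms(2)] cmD[OF assms(3)] cmD[OF assms(4)] cplxD[OF assms(5)] cplxD[OF assms(6)] cplxD[OF assms(7)]
    cm_reassoc[OF assms(4,5,6)]
  obtain h where [simp]: "\<And>n. h n \<in> Arr A" "\<And>n. Dom A (h n) = Term D n" "\<And>n. Cod A (h n) = Term E (n + 1)"
    and h: "\<And>n. f n = g n \<uplus> ((Diff E (n + 1) \<cdot> h n) \<uplus> (h (n - 1) \<cdot> Diff D n))"
    using assms(1) by (rule htpE) blast
  show ?thesis
    by (rule htpI[where h = "\<lambda>n. h n \<cdot> k n"]) (simp_all add: h)
qed

abbreviation nul where "nul C D f \<equiv> htp C D f (\<lambda>n. Zero A (Term C n) (Term D n))"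

lemma nulE:
  assumes "nul C D f" "is_complex A C" "is_complex A D"
  obtains h where "\<And>n. h n \<in> Arr A" "\<And>n. Dom A (h n) = Term C n" "\<And>n. Cod A (h n) = Term D (n + 1)"
    "\<And>n. f n = (Diff D (n + 1) \<cdot> h n) \<uplus> (h (n - 1) \<cdot> Diff C n)"
proof -
  note [simp] = cplxD[OF assms(2)] cplxD[OF assms(3)]
  obtain h where [simp]: "\<And>n. h n \<in> Arr A" "\<And>n. Dom A (h n) = Term C n" "\<And>n. Cod A (h n) = Term D (n + 1)"
    and h: "\<And>n. f n = Zero A (Term C n) (Term D n) \<uplus> ((Diff D (n + 1) \<cdot> h n) \<uplus> (h (n - 1) \<cdot> Diff C n))"
    using assms(1) by (rule htpE) blast
  show thesis by (rule that[of h]) (use h in simp_all)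
qed

lemma nulI:
  assumes "\<And>n. h n \<in> Arr A" "\<And>n. Dom A (h n) = Term C n" "\<And>n. Cod A (h n) = Term D (n + 1)"
    "\<And>n. f n = (Diff D (n + 1) \<cdot> h n) \<uplus> (h (n - 1) \<cdot> Diff C n)" "is_complex A C" "is_complex A D"
  shows "nul C D f"
proof -
  note [simp] = cplxD[OF assms(5)] cplxD[OF assms(6)] assms(1-3)
  show ?thesis by (rule htpI[of h]) (simp_all add: assms(4))
qed

definition nullmaps where
  "nullmaps C D \<longleftrightarrow> (\<forall>f. cm C D f \<longrightarrow> nul C D f)"


abbreviation mk :: "('o, 'm) chain_complex \<Rightarrow> ('o, 'm) chain_complex \<Rightarrow> (int \<Rightarrow> 'm) \<Rightarrow> ('o, 'm) chain_map" where
  "mk C D f \<equiv> \<lparr>Source = C, Target = D, At = f\<rparr>"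

definition cls where "cls C D f = htpy_class A (mk C D f)"

lemma chain_map_iff:
  "is_chain_map A m \<longleftrightarrow> is_complex A (Source m) \<and> is_complex A (Target m) \<and> cm (Source m) (Target m) (At m)"
  by (auto simp: is_chain_map_def cm_def)

lemma Hom_Ch_iff:
  "m \<in> Hom (Ch A) C D \<longleftrightarrow> is_complex A C \<and> is_complex A D \<and> cm C D (At m) \<and> m = mk C D (At m)"
  by (cases m) (auto simp: Hom_def Ch_def chain_map_iff)

lemma homotopic_iff:
  "(m, m') \<in> homotopic A \<longleftrightarrow> is_chain_map A m \<and> is_chain_map A m' \<and> Source m = Source m' \<and>
    Target m = Target m' \<and> htp (Source m) (Target m) (At m) (At m')"
  by (auto simp: homotopic_def htp_def Ch_def)

lemma cls_eq:
  "cls C D f = (if is_complex A C \<and> is_complex A D \<and> cm C D f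
     then mk C D ` {g. cm C D g \<and> htp C D f g} else {})"
proof -
  have "m \<in> cls C D f \<longleftrightarrow> is_complex A C \<and> is_complex A D \<and> cm C D f \<and>
      m \<in> mk C D ` {g. cm C D g \<and> htp C D f g}" for m
    by (cases m) (auto simp: cls_def htpy_class_def homotopic_iff chain_map_iff)
  then show ?thesis by auto
qed

lemma cls_mem:
  "\<lbrakk>cm C D f; is_complex A C; is_complex A D\<rbrakk> \<Longrightarrow> m \<in> cls C D f \<longleftrightarrow> (\<exists>g. m = mk C D g \<and> cm C D g \<and> htp C D f g)"
  by (auto simp: cls_eq)

lemma cls_eq_iff:
  assumes "cm C D f" "cm C D g" "is_complex A C" "is_complex A D"
  shows "cls C D f = cls C D g \<longleftrightarrow> htp C D f g"
proof
  assume "cls C D f = cls C D g"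
  moreover have "mk C D g \<in> cls C D g" using cls_mem[OF assms(2-4)] htp_refl[OF assms(2-4)] assms by blast
  ultimately have "mk C D g \<in> cls C D f" by simp
  then show "htp C D f g" unfolding cls_mem[OF assms(1,3,4)] by auto
next
  assume h: "htp C D f g"
  then have h': "htp C D g f" by (rule htp_sym) (use assms in simp_all)
  have "htp C D f k \<longleftrightarrow> htp C D g k" if "cm C D k" for k
    using htp_trans[OF h', of k] htp_trans[OF h, of k] assms that by blast
  then show "cls C D f = cls C D g" using assms by (auto simp: cls_eq)
qed

lemma source_cls:
  assumes "cm C D f" "is_complex A C" "is_complex A D"
  shows "Source (SOME m. m \<in> cls C D f) = C" "Target (SOME m. m \<in> cls C D f) = D"
proof -
  have "mk C D f \<in> cls C D f" using cls_mem[OF assms] htp_refl[OF assms] assms by blast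
  then have "(SOME m. m \<in> cls C D f) \<in> cls C D f" by (rule someI)
  then show "Source (SOME m. m \<in> cls C D f) = C" "Target (SOME m. m \<in> cls C D f) = D"
    unfolding cls_mem[OF assms] by auto
qed

lemma dwD: "C \<in> dw A X \<Longrightarrow> is_complex A C" by (simp add: dw_def)

lemma K_Arr_iff:
  "F \<in> Arr (K_preadd A X) \<longleftrightarrow> (\<exists>C D f. C \<in> dw A X \<and> D \<in> dw A X \<and> cm C D f \<and> F = cls C D f)"
proof
  assume "F \<in> Arr (K_preadd A X)"
  then obtain C D m where *: "C \<in> dw A X" "D \<in> dw A X" "m \<in> Hom (Ch A) C D" "F = htpy_class A m"
    by (auto simp: K_preadd_def)
  moreover obtain f where "m = mk C D f" "cm C D f" using *(3) Hom_Ch_iff by blast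
  ultimately show "\<exists>C D f. C \<in> dw A X \<and> D \<in> dw A X \<and> cm C D f \<and> F = cls C D f"
    by (auto simp: cls_def)
next
  assume "\<exists>C D f. C \<in> dw A X \<and> D \<in> dw A X \<and> cm C D f \<and> F = cls C D f"
  then obtain C D f where *: "C \<in> dw A X" "D \<in> dw A X" "cm C D f" "F = cls C D f" by blast
  then have "mk C D f \<in> Hom (Ch A) C D" by (auto simp: Hom_Ch_iff dwD)
  with * show "F \<in> Arr (K_preadd A X)" by (auto simp: K_preadd_def cls_def)
qed

lemma K_Hom_iff:
  "F \<in> Hom (K_preadd A X) C D \<longleftrightarrow> C \<in> dw A X \<and> D \<in> dw A X \<and> (\<exists>f. cm C D f \<and> F = cls C D f)"
proof -
  have "Dom (K_preadd A X) (cls C D f) = C" "Cod (K_preadd A X) (cls C D f) = D"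
    if "C \<in> dw A X" "D \<in> dw A X" "cm C D f" for C D f
    using that source_cls[of C D f] by (simp_all add: K_preadd_def dwD)
  then show ?thesis by (auto simp: Hom_def K_Arr_iff)
qed

lemma K_HomI: "\<lbrakk>C \<in> dw A X; D \<in> dw A X; cm C D f\<rbrakk> \<Longrightarrow> cls C D f \<in> Hom (K_preadd A X) C D"
  by (auto simp: K_Hom_iff)

lemma K_simps:
  assumes "C \<in> dw A X" "D \<in> dw A X" "cm C D f"
  shows "cls C D f \<in> Arr (K_preadd A X)" "Dom (K_preadd A X) (cls C D f) = C"
    "Cod (K_preadd A X) (cls C D f) = D"
proof -
  have "cls C D f \<in> Hom (K_preadd A X) C D" using assms by (auto simp: K_Hom_iff)
  then show "cls C D f \<in> Arr (K_preadd A X)" "Dom (K_preadd A X) (cls C D f) = C"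
    "Cod (K_preadd A X) (cls C D f) = D" by (simp_all add: Hom_def)
qed

lemma K_Obj [simp]: "Obj (K_preadd A X) = dw A X"
  by (simp add: K_preadd_def)

lemma K_Ide: "Ide (K_preadd A X) C = cls C C (\<lambda>n. Ide A (Term C n))"
  by (simp add: K_preadd_def cls_def Ch_def)

lemma K_Zero: "Zero (K_preadd A X) C D = cls C D (\<lambda>n. Zero A (Term C n) (Term D n))"
  by (simp add: K_preadd_def cls_def Ch_def)

lemma K_Comp:
  assumes "cm C D f" "cm D E g" "is_complex A C" "is_complex A D" "is_complex A E"
  shows "cls D E g \<cdot>\<^bsub>K_preadd A X\<^esub> cls C D f = cls C E (\<lambda>n. g n \<cdot> f n)"
proof -
  have eq: "cls C E (\<lambda>n. g' n \<cdot> f' n) = cls C E (\<lambda>n. g n \<cdot> f n)"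
    if "cm C D f'" "htp C D f f'" "cm D E g'" "htp D E g g'" for f' g'
  proof -
    note c = cm_comp[OF _ _ assms(3-5)]
    have "htp C E (\<lambda>n. g n \<cdot> f n) (\<lambda>n. g n \<cdot> f' n)"
      by (rule htp_comp_left[where D = D]) (use assms that in simp_all)
    moreover have "htp C E (\<lambda>n. g n \<cdot> f' n) (\<lambda>n. g' n \<cdot> f' n)"
      by (rule htp_comp_right[where D = D]) (use assms that in simp_all)
    ultimately have "htp C E (\<lambda>n. g n \<cdot> f n) (\<lambda>n. g' n \<cdot> f' n)"
      by (rule htp_trans) (use c assms that in simp_all)
    then show ?thesis using c assms that by (subst eq_commute, subst cls_eq_iff) auto
  qed
  have "cls D E g \<cdot>\<^bsub>K_preadd A X\<^esub> cls C D f
      = (\<Union>m \<in> cls D E g. \<Union>m' \<in> cls C D f. cls C E (\<lambda>n. At m n \<cdot> At m' n))"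
    unfolding K_preadd_def
    by (simp, intro SUP_cong refl)
      (auto simp: cls_mem[OF assms(1,3,4)] cls_mem[OF assms(2,4,5)] Ch_def simp flip: cls_def)
  also have "\<dots> = (\<Union>m \<in> cls D E g. \<Union>m' \<in> cls C D f. cls C E (\<lambda>n. g n \<cdot> f n))"
  proof (intro SUP_cong refl)
    fix m m' assume "m \<in> cls D E g" "m' \<in> cls C D f"
    then show "cls C E (\<lambda>n. At m n \<cdot> At m' n) = cls C E (\<lambda>n. g n \<cdot> f n)"
      unfolding cls_mem[OF assms(1,3,4)] cls_mem[OF assms(2,4,5)] using eq by auto
  qed
  also have "\<dots> = cls C E (\<lambda>n. g n \<cdot> f n)"
  proof -
    have "mk C D f \<in> cls C D f" using cls_mem[OF assms(1,3,4)] htp_refl[OF assms(1,3,4)] assms by blast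
    moreover have "mk D E g \<in> cls D E g" using cls_mem[OF assms(2,4,5)] htp_refl[OF assms(2,4,5)] assms by blast
    ultimately show ?thesis by auto
  qed
  finally show ?thesis .
qed

lemma K_Add:
  assumes "cm C D f" "cm C D g" "is_complex A C" "is_complex A D"
  shows "cls C D f \<uplus>\<^bsub>K_preadd A X\<^esub> cls C D g = cls C D (\<lambda>n. f n \<uplus> g n)"
proof -
  have eq: "cls C D (\<lambda>n. f' n \<uplus> g' n) = cls C D (\<lambda>n. f n \<uplus> g n)"
    if "cm C D f'" "htp C D f f'" "cm C D g'" "htp C D g g'" for f' g'
  proof -
    have "htp C D (\<lambda>n. f n \<uplus> g n) (\<lambda>n. f' n \<uplus> g' n)"
      by (rule htp_add) (use assms that in simp_all)
    then show ?thesis using cm_add[OF _ _ assms(3,4)] assms that by (subst eq_commute, subst cls_eq_iff) auto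
  qed
  have "cls C D f \<uplus>\<^bsub>K_preadd A X\<^esub> cls C D g
      = (\<Union>m \<in> cls C D f. \<Union>m' \<in> cls C D g. cls C D (\<lambda>n. At m n \<uplus> At m' n))"
    unfolding K_preadd_def
    by (simp, intro SUP_cong refl)
      (auto simp: cls_mem[OF assms(1,3,4)] cls_mem[OF assms(2,3,4)] Ch_def simp flip: cls_def)
  also have "\<dots> = (\<Union>m \<in> cls C D f. \<Union>m' \<in> cls C D g. cls C D (\<lambda>n. f n \<uplus> g n))"
  proof (intro SUP_cong refl)
    fix m m' assume "m \<in> cls C D f" "m' \<in> cls C D g"
    then show "cls C D (\<lambda>n. At m n \<uplus> At m' n) = cls C D (\<lambda>n. f n \<uplus> g n)"
      unfolding cls_mem[OF assms(1,3,4)] cls_mem[OF assms(2,3,4)] using eq by auto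
  qed
  also have "\<dots> = cls C D (\<lambda>n. f n \<uplus> g n)"
  proof -
    have "mk C D f \<in> cls C D f" using cls_mem[OF assms(1,3,4)] htp_refl[OF assms(1,3,4)] assms by blast
    moreover have "mk C D g \<in> cls C D g" using cls_mem[OF assms(2,3,4)] htp_refl[OF assms(2,3,4)] assms by blast
    ultimately show ?thesis by auto
  qed
  finally show ?thesis .
qed

lemma K_cls_cong:
  "(\<And>n. f n = g n) \<Longrightarrow> cls C D f = cls C D g"
  by (metis ext)

lemma K_category: "category (K_preadd A X)"
proof
  let ?K = "K_preadd A X"
  fix F assume "F \<in> Arr ?K"
  then obtain C D f where *: "C \<in> dw A X" "D \<in> dw A X" "cm C D f" "F = cls C D f" by (auto simp: K_Arr_iff)
  then show "Dom ?K F \<in> Obj ?K" "Cod ?K F \<in> Obj ?K" by (simp_all add: K_simps)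
next
  let ?K = "K_preadd A X"
  fix C assume "C \<in> Obj ?K"
  then show "Ide ?K C \<in> Hom ?K C C" using cm_ide[of C] by (simp add: K_HomI K_Ide dwD)
next
  let ?K = "K_preadd A X"
  fix F G C D E assume "F \<in> Hom ?K C D" "G \<in> Hom ?K D E"
  then obtain f g where *: "C \<in> dw A X" "D \<in> dw A X" "E \<in> dw A X" "cm C D f" "F = cls C D f"
    "cm D E g" "G = cls D E g" by (auto simp: K_Hom_iff)
  have "cm C E (\<lambda>n. g n \<cdot> f n)" by (rule cm_comp[of C D]) (use * in \<open>simp_all add: dwD\<close>)
  then show "G \<cdot>\<^bsub>?K\<^esub> F \<in> Hom ?K C E" using * by (simp add: K_HomI K_Comp dwD)
next
  let ?K = "K_preadd A X"
  fix F C D assume "F \<in> Hom ?K C D"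
  then obtain f where *: "C \<in> dw A X" "D \<in> dw A X" "cm C D f" "F = cls C D f" by (auto simp: K_Hom_iff)
  note [simp] = cplxD[OF dwD[OF *(1)]] cplxD[OF dwD[OF *(2)]] cmD[OF *(3)] dwD[OF *(1)] dwD[OF *(2)]
  show "Ide ?K D \<cdot>\<^bsub>?K\<^esub> F = F"
    using *(3) cm_ide[of D] by (simp add: *(4) K_Ide K_Comp)
  show "F \<cdot>\<^bsub>?K\<^esub> Ide ?K C = F"
    using *(3) cm_ide[of C] by (simp add: *(4) K_Ide K_Comp)
next
  let ?K = "K_preadd A X"
  fix F G H C D E B assume "F \<in> Hom ?K C D" "G \<in> Hom ?K D E" "H \<in> Hom ?K E B"
  then obtain f g h where *: "C \<in> dw A X" "D \<in> dw A X" "E \<in> dw A X" "B \<in> dw A X" "cm C D f" "F = cls C D f"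
    "cm D E g" "G = cls D E g" "cm E B h" "H = cls E B h" by (auto simp: K_Hom_iff)
  note [simp] = cmD[OF *(5)] cmD[OF *(7)] cmD[OF *(9)] dwD[OF *(1)] dwD[OF *(2)] dwD[OF *(3)] dwD[OF *(4)]
    cm_comp[OF *(5,7)] cm_comp[OF *(7,9)]
  show "H \<cdot>\<^bsub>?K\<^esub> G \<cdot>\<^bsub>?K\<^esub> F = H \<cdot>\<^bsub>?K\<^esub> (G \<cdot>\<^bsub>?K\<^esub> F)"
    using *(5,7,9) by (simp add: *(6,8,10) K_Comp)
qed

lemma K_preadditive: "preadditive_category (K_preadd A X)"
proof -
  let ?K = "K_preadd A X"
  interpret K: category ?K by (rule K_category)
  show ?thesis
  proof (intro preadditive_category.intro preadditive_category_axioms.intro K_category)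
    fix C D assume "C \<in> Obj ?K" "D \<in> Obj ?K"
    then have [simp]: "C \<in> dw A X" "D \<in> dw A X" "is_complex A C" "is_complex A D" by (auto simp: dwD)
    note [simp] = cm_zero[of C D] cm_add[of C D] cm_neg[of C D] cplxD[of C] cplxD[of D] K_Add K_Zero
    show "comm_group (hom_group ?K C D)"
    proof (rule comm_groupI)
      fix F G assume "F \<in> carrier (hom_group ?K C D)" "G \<in> carrier (hom_group ?K C D)"
      then obtain f g where *: "cm C D f" "F = cls C D f" "cm C D g" "G = cls C D g"
        by (auto simp: hom_group_def K_Hom_iff)
      note [simp] = cmD[OF *(1)] cmD[OF *(3)]
      show "F \<otimes>\<^bsub>hom_group ?K C D\<^esub> G \<in> carrier (hom_group ?K C D)"
        using * by (simp add: hom_group_def K_HomI)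
      show "F \<otimes>\<^bsub>hom_group ?K C D\<^esub> G = G \<otimes>\<^bsub>hom_group ?K C D\<^esub> F"
        using * by (simp add: hom_group_def, intro K_cls_cong)
          (rule lin_eqI, (rule lin_intros | simp)+)
    next
      show "\<one>\<^bsub>hom_group ?K C D\<^esub> \<in> carrier (hom_group ?K C D)"
        by (simp add: hom_group_def K_HomI)
    next
      fix F G H assume "F \<in> carrier (hom_group ?K C D)" "G \<in> carrier (hom_group ?K C D)" "H \<in> carrier (hom_group ?K C D)"
      then obtain f g h where *: "cm C D f" "F = cls C D f" "cm C D g" "G = cls C D g" "cm C D h" "H = cls C D h"
        by (auto simp: hom_group_def K_Hom_iff)
      note [simp] = cmD[OF *(1)] cmD[OF *(3)] cmD[OF *(5)]
      show "F \<otimes>\<^bsub>hom_group ?K C D\<^esub> G \<otimes>\<^bsub>hom_group ?K C D\<^esub> H = F \<otimes>\<^bsub>hom_group ?K C D\<^esub> (G \<otimes>\<^bsub>hom_group ?K C D\<^esub> H)"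
        using * by (simp add: hom_group_def, intro K_cls_cong)
          (rule lin_eqI, (rule lin_intros | simp)+)
    next
      fix F assume "F \<in> carrier (hom_group ?K C D)"
      then obtain f where *: "cm C D f" "F = cls C D f" by (auto simp: hom_group_def K_Hom_iff)
      note [simp] = cmD[OF *(1)]
      show "\<one>\<^bsub>hom_group ?K C D\<^esub> \<otimes>\<^bsub>hom_group ?K C D\<^esub> F = F"
        using * by (simp add: hom_group_def)
      have "cls C D (\<lambda>n. Neg A (f n)) \<in> carrier (hom_group ?K C D)"
        using * by (simp add: hom_group_def K_HomI)
      moreover have "cls C D (\<lambda>n. Neg A (f n)) \<otimes>\<^bsub>hom_group ?K C D\<^esub> F = \<one>\<^bsub>hom_group ?K C D\<^esub>"
        using * by (simp add: hom_group_def, intro K_cls_cong)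
          (rule lin_eqI, (rule lin_intros | simp)+)
      ultimately show "\<exists>G \<in> carrier (hom_group ?K C D). G \<otimes>\<^bsub>hom_group ?K C D\<^esub> F = \<one>\<^bsub>hom_group ?K C D\<^esub>"
        by blast
    qed
  next
    fix F F' G C D E assume "F \<in> Hom ?K C D" "F' \<in> Hom ?K C D" "G \<in> Hom ?K D E"
    then obtain f f' g where *: "C \<in> dw A X" "D \<in> dw A X" "E \<in> dw A X" "cm C D f" "F = cls C D f"
      "cm C D f'" "F' = cls C D f'" "cm D E g" "G = cls D E g" by (auto simp: K_Hom_iff)
    note [simp] = cmD[OF *(4)] cmD[OF *(6)] cmD[OF *(8)] dwD[OF *(1)] dwD[OF *(2)] dwD[OF *(3)]
      cm_comp[OF *(4,8)] cm_comp[OF *(6,8)] cm_add[OF *(4,6)]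
    show "G \<cdot>\<^bsub>?K\<^esub> (F \<uplus>\<^bsub>?K\<^esub> F') = (G \<cdot>\<^bsub>?K\<^esub> F) \<uplus>\<^bsub>?K\<^esub> (G \<cdot>\<^bsub>?K\<^esub> F')"
      using *(4,6,8) by (simp add: *(5,7,9) K_Comp K_Add)
  next
    fix F G G' C D E assume "F \<in> Hom ?K C D" "G \<in> Hom ?K D E" "G' \<in> Hom ?K D E"
    then obtain f g g' where *: "C \<in> dw A X" "D \<in> dw A X" "E \<in> dw A X" "cm C D f" "F = cls C D f"
      "cm D E g" "G = cls D E g" "cm D E g'" "G' = cls D E g'" by (auto simp: K_Hom_iff)
    note [simp] = cmD[OF *(4)] cmD[OF *(6)] cmD[OF *(8)] dwD[OF *(1)] dwD[OF *(2)] dwD[OF *(3)]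
      cm_comp[OF *(4,6)] cm_comp[OF *(4,8)] cm_add[OF *(6,8)]
    show "(G \<uplus>\<^bsub>?K\<^esub> G') \<cdot>\<^bsub>?K\<^esub> F = (G \<cdot>\<^bsub>?K\<^esub> F) \<uplus>\<^bsub>?K\<^esub> (G' \<cdot>\<^bsub>?K\<^esub> F)"
      using *(4,6,8) by (simp add: *(5,7,9) K_Comp K_Add)
  qed
qed

lemma shift_complex: "is_complex A C \<Longrightarrow> is_complex A (shift_complex A C)"
proof -
  assume C: "is_complex A C"
  note [simp] = cplxD[OF C]
  show ?thesis by (simp add: is_complex_def shift_complex_def Hom_def)
qed

lemma shift_Term [simp]: "Term (shift_complex A C) n = Term C (n - 1)"
  and shift_Diff [simp]: "Diff (shift_complex A C) n = Neg A (Diff C (n - 1))"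
  by (simp_all add: shift_complex_def)

lemma shift_dw: "C \<in> dw A X \<Longrightarrow> shift_complex A C \<in> dw A X"
  using shift_complex[of C] by (simp add: dw_def)

definition unshift :: "('o, 'm) chain_complex \<Rightarrow> ('o, 'm) chain_complex" where
  "unshift C = \<lparr>Term = (\<lambda>n. Term C (n + 1)), Diff = (\<lambda>n. Neg A (Diff C (n + 1)))\<rparr>"

lemma unshift_Term [simp]: "Term (unshift C) n = Term C (n + 1)"
  and unshift_Diff [simp]: "Diff (unshift C) n = Neg A (Diff C (n + 1))"
  by (simp_all add: unshift_def)

lemma unshift_complex: "is_complex A C \<Longrightarrow> is_complex A (unshift C)"
proof -
  assume C: "is_complex A C"
  note [simp] = cplxD[OF C]
  show ?thesis by (simp add: is_complex_def Hom_def algebra_simps)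
qed

lemma unshift_dw: "C \<in> dw A X \<Longrightarrow> unshift C \<in> dw A X"
  using unshift_complex[of C] by (simp add: dw_def)

lemma shift_unshift: "is_complex A C \<Longrightarrow> shift_complex A (unshift C) = C"
  by (simp add: shift_complex_def cplxD)

lemma cm_shift_iff: 
  assumes "is_complex A C" "is_complex A D"
  shows "cm (shift_complex A C) (shift_complex A D) (\<lambda>n. f (n - 1)) \<longleftrightarrow> cm C D f" (is "?L = ?R")
proof
  note [simp] = cplxD[OF assms(1)] cplxD[OF assms(2)]
  assume ?R
  note [simp] = cmD[OF \<open>?R\<close>]
  show ?L by (rule cmI) simp_all
next
  note [simp] = cplxD[OF assms(1)] cplxD[OF assms(2)]
  assume L: ?L
  have a: "f n \<in> Arr A" "Dom A (f n) = Term C n" "Cod A (f n) = Term D n" for n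
    using cmD(1-3)[OF L, of "n + 1"] by simp_all
  note [simp] = a
  have "Neg A (f (n - 1) \<cdot> Diff C n) = Neg A (Diff D n \<cdot> f n)" for n
    using cmD(4)[OF L, of n "n + 1"] by simp
  then have "Neg A (Neg A (f (n - 1) \<cdot> Diff C n)) = Neg A (Neg A (Diff D n \<cdot> f n))" for n by simp
  then show ?R by (intro cmI) simp_all
qed

lemma htp_shift_iff: 
  assumes "is_complex A C" "is_complex A D" "cm C D f" "cm C D g"
  shows "htp (shift_complex A C) (shift_complex A D) (\<lambda>n. f (n - 1)) (\<lambda>n. g (n - 1)) \<longleftrightarrow> htp C D f g" (is "?L = ?R")
proof
  note [simp] = cplxD[OF assms(1)] cplxD[OF assms(2)] cmD[OF assms(3)] cmD[OF assms(4)]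
  assume ?R
  then obtain h where [simp]: "\<And>n. h n \<in> Arr A" "\<And>n. Dom A (h n) = Term C n" "\<And>n. Cod A (h n) = Term D (n + 1)"
    and h: "\<And>n. f n = g n \<uplus> ((Diff D (n + 1) \<cdot> h n) \<uplus> (h (n - 1) \<cdot> Diff C n))"
    by (rule htpE) blast
  show ?L by (rule htpI[where h = "\<lambda>n. Neg A (h (n - 1))"]) (simp_all, simp add: h)
next
  note [simp] = cplxD[OF assms(1)] cplxD[OF assms(2)] cmD[OF assms(3)] cmD[OF assms(4)]
  assume ?L
  then obtain h where h': "\<And>n. h n \<in> Arr A" "\<And>n. Dom A (h n) = Term (shift_complex A C) n"
      "\<And>n. Cod A (h n) = Term (shift_complex A D) (n + 1)"
    and h: "\<And>n. f (n - 1) = g (n - 1) \<uplus> ((Diff (shift_complex A D) (n + 1) \<cdot> h n) \<uplus> (h (n - 1) \<cdot> Diff (shift_complex A C) n))"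
    by (rule htpE) blast
  note [simp] = h'
  have h: "f n = g n \<uplus> (Neg A (Diff D (n + 1) \<cdot> h (n + 1)) \<uplus> Neg A (h n \<cdot> Diff C n))" for n
    using h[of "n + 1"] by (simp add: add.commute)
  show ?R by (rule htpI[where h = "\<lambda>n. Neg A (h (n + 1))"]) (simp_all add: h add.commute)
qed

lemma K_shift_cls:
  assumes "cm C D f" "is_complex A C" "is_complex A D"
  shows "K_shift A (cls C D f) = cls (shift_complex A C) (shift_complex A D) (\<lambda>n. f (n - 1))"
proof -
  have "K_shift A (cls C D f) = (\<Union>m \<in> cls C D f. cls (shift_complex A C) (shift_complex A D) (\<lambda>n. At m (n - 1)))"
    unfolding K_shift_def
    by (intro SUP_cong refl) (auto simp: cls_mem[OF assms] shift_map_def simp flip: cls_def)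
  also have "\<dots> = (\<Union>m \<in> cls C D f. cls (shift_complex A C) (shift_complex A D) (\<lambda>n. f (n - 1)))"
  proof (intro SUP_cong refl)
    fix m assume "m \<in> cls C D f"
    then obtain g where g: "m = mk C D g" "cm C D g" "htp C D f g" using cls_mem[OF assms] by auto
    have "htp (shift_complex A C) (shift_complex A D) (\<lambda>n. f (n - 1)) (\<lambda>n. g (n - 1))"
      using htp_shift_iff[OF assms(2,3,1) g(2)] g by blast
    then have "cls (shift_complex A C) (shift_complex A D) (\<lambda>n. f (n - 1)) =
        cls (shift_complex A C) (shift_complex A D) (\<lambda>n. g (n - 1))"
      using cm_shift_iff[OF assms(2,3)] g(2) assms shift_complex by (subst cls_eq_iff) auto
    then show "cls (shift_complex A C) (shift_complex A D) (\<lambda>n. At m (n - 1))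
        = cls (shift_complex A C) (shift_complex A D) (\<lambda>n. f (n - 1))" by (simp add: g)
  qed
  also have "\<dots> = cls (shift_complex A C) (shift_complex A D) (\<lambda>n. f (n - 1))"
  proof -
    have "mk C D f \<in> cls C D f" using cls_mem[OF assms] htp_refl[OF assms] assms by blast
    then show ?thesis by auto
  qed
  finally show ?thesis .
qed


lemma biD:
  assumes "is_biproduct A a b s i j p q"
  shows "a \<in> Obj A" "b \<in> Obj A" "s \<in> Obj A"
    "i \<in> Arr A" "Dom A i = a" "Cod A i = s" "j \<in> Arr A" "Dom A j = b" "Cod A j = s"
    "p \<in> Arr A" "Dom A p = s" "Cod A p = a" "q \<in> Arr A" "Dom A q = s" "Cod A q = b"
    "p \<cdot> i = Ide A a" "q \<cdot> j = Ide A b" "q \<cdot> i = Zero A a b" "p \<cdot> j = Zero A b a"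
  using assms by (simp_all add: is_biproduct_def Hom_def)

lemma bi_reassoc:
  assumes "is_biproduct A a b s i j p q" "x \<in> Arr A"
  shows "Cod A x = a \<Longrightarrow> p \<cdot> (i \<cdot> x) = x" "Cod A x = b \<Longrightarrow> q \<cdot> (j \<cdot> x) = x"
    "Cod A x = a \<Longrightarrow> q \<cdot> (i \<cdot> x) = Zero A (Dom A x) b" "Cod A x = b \<Longrightarrow> p \<cdot> (j \<cdot> x) = Zero A (Dom A x) a"
  using biD[OF assms(1)] assms(2) Comp_reassoc[of p i _ x] Comp_reassoc[of q j _ x]
    Comp_reassoc[of q i _ x] Comp_reassoc[of p j _ x] by simp_all

lemma bi_sum: "is_biproduct A a b s i j p q \<Longrightarrow> (i \<cdot> p) \<uplus> (j \<cdot> q) = Ide A s"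
  by (simp add: is_biproduct_def)

lemma bi_from:
  assumes "is_biproduct A a b s i j p q" "f \<in> Arr A" "Dom A f = s"
  shows "f = ((f \<cdot> i) \<cdot> p) \<uplus> ((f \<cdot> j) \<cdot> q)"
proof -
  have "f = f \<cdot> ((i \<cdot> p) \<uplus> (j \<cdot> q))" using assms by (simp add: bi_sum[OF assms(1)])
  then show ?thesis using biD[OF assms(1)] assms(2,3) by simp
qed

lemma bi_into:
  assumes "is_biproduct A a b s i j p q" "f \<in> Arr A" "Cod A f = s"
  shows "f = (i \<cdot> (p \<cdot> f)) \<uplus> (j \<cdot> (q \<cdot> f))"
proof -
  have "f = ((i \<cdot> p) \<uplus> (j \<cdot> q)) \<cdot> f" using assms by (simp add: bi_sum[OF assms(1)])
  then show ?thesis using biD[OF assms(1)] assms(2,3) by simp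
qed

lemma bi_eq_from:
  assumes "is_biproduct A a b s i j p q" "f \<in> Arr A" "Dom A f = s" "g \<in> Arr A" "Dom A g = s"
    "f \<cdot> i = g \<cdot> i" "f \<cdot> j = g \<cdot> j"
  shows "f = g"
  using bi_from[OF assms(1-3)] bi_from[OF assms(1,4,5)] assms(6,7) by simp

lemma bi_eq_into:
  assumes "is_biproduct A a b s i j p q" "f \<in> Arr A" "Cod A f = s" "g \<in> Arr A" "Cod A g = s"
    "p \<cdot> f = p \<cdot> g" "q \<cdot> f = q \<cdot> g"
  shows "f = g"
  using bi_into[OF assms(1-3)] bi_into[OF assms(1,4,5)] assms(6,7) by simp

definition cone where
  "cone C D f E i p \<sigma> \<rho> \<longleftrightarrow> is_complex A C \<and> is_complex A D \<and> is_complex A E \<and>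
     cm C D f \<and> cm D E i \<and> cm E (shift_complex A C) p \<and>
     (\<forall>n. is_biproduct A (Term C (n - 1)) (Term D n) (Term E n) (\<sigma> n) (i n) (p n) (\<rho> n) \<and>
       Diff E n = (\<sigma> (n - 1) \<cdot> Neg A (Diff C (n - 1)) \<cdot> p n) \<uplus>
             ((i (n - 1) \<cdot> f (n - 1) \<cdot> p n) \<uplus> (i (n - 1) \<cdot> Diff D n \<cdot> \<rho> n)))"

lemma cone_triangle_mk:
  "is_cone_triangle A (mk C D f) (mk D' E i) (mk E' S p) \<longleftrightarrow> D' = D \<and> E' = E \<and> S = shift_complex A C \<and>
     (\<exists>\<sigma> \<rho>. cone C D f E i p \<sigma> \<rho>)"
  by (auto simp: is_cone_triangle_def Let_def Hom_def Ch_def chain_map_iff cone_def shift_complex)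

lemma cone_triangleE:
  assumes "is_cone_triangle A F I P"
  obtains C D E f i p \<sigma> \<rho> where "F = mk C D f" "I = mk D E i" "P = mk E (shift_complex A C) p"
    "cone C D f E i p \<sigma> \<rho>"
proof -
  obtain C D f D' E i E' S p where *: "F = mk C D f" "I = mk D' E i" "P = mk E' S p"
    by (cases F, cases I, cases P)
  show thesis using assms that unfolding * cone_triangle_mk by auto
qed

lemma coneD:
  assumes "cone C D f E i p \<sigma> \<rho>"
  shows "is_complex A C" "is_complex A D" "is_complex A E" "is_complex A (shift_complex A C)" "is_complex A (shift_complex A D)"
    "cm C D f" "cm D E i" "cm E (shift_complex A C) p"
    "is_biproduct A (Term C (n - 1)) (Term D n) (Term E n) (\<sigma> n) (i n) (p n) (\<rho> n)"
  using assms by (simp_all add: cone_def shift_complex)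

lemma cone_diff:
  assumes c: "cone C D f E i p \<sigma> \<rho>"
  shows "Diff E n \<cdot> \<sigma> n = Neg A (\<sigma> (n - 1) \<cdot> Diff C (n - 1)) \<uplus> (i (n - 1) \<cdot> f (n - 1))"
    "m = n - 1 \<Longrightarrow> \<rho> m \<cdot> Diff E n = (f (n - 1) \<cdot> p n) \<uplus> (Diff D n \<cdot> \<rho> n)"
proof -
  note [simp] = coneD(1-5)[OF c] cplxD[OF coneD(1)[OF c]] cplxD[OF coneD(2)[OF c]] cplxD[OF coneD(3)[OF c]]
    cmD[OF coneD(6)[OF c]] biD(4-)[OF coneD(9)[OF c]] bi_reassoc[OF coneD(9)[OF c]]
  have "Diff E n = (\<sigma> (n - 1) \<cdot> Neg A (Diff C (n - 1)) \<cdot> p n) \<uplus>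
             ((i (n - 1) \<cdot> f (n - 1) \<cdot> p n) \<uplus> (i (n - 1) \<cdot> Diff D n \<cdot> \<rho> n))" for n
    using c by (simp only: cone_def)
  then have d: "Diff E n = Neg A (\<sigma> (n - 1) \<cdot> (Diff C (n - 1) \<cdot> p n)) \<uplus>
             ((i (n - 1) \<cdot> (f (n - 1) \<cdot> p n)) \<uplus> (i (n - 1) \<cdot> (Diff D n \<cdot> \<rho> n)))" for n
    by (simp del: cmD(4)[OF coneD(6)[OF c]])
  show "Diff E n \<cdot> \<sigma> n = Neg A (\<sigma> (n - 1) \<cdot> Diff C (n - 1)) \<uplus> (i (n - 1) \<cdot> f (n - 1))"
    by (subst d) simp
  show "m = n - 1 \<Longrightarrow> \<rho> m \<cdot> Diff E n = (f (n - 1) \<cdot> p n) \<uplus> (Diff D n \<cdot> \<rho> n)"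
    by (subst d) simp
qed

lemma cone_diff_reassoc:
  assumes c: "cone C D f E i p \<sigma> \<rho>" and x: "x \<in> Arr A"
  shows "Cod A x = Term C (n - 1) \<Longrightarrow>
      Diff E n \<cdot> (\<sigma> n \<cdot> x) = Neg A (\<sigma> (n - 1) \<cdot> (Diff C (n - 1) \<cdot> x)) \<uplus> (i (n - 1) \<cdot> (f (n - 1) \<cdot> x))"
    "\<lbrakk>m = n - 1; Cod A x = Term E n\<rbrakk> \<Longrightarrow> \<rho> m \<cdot> (Diff E n \<cdot> x) = (f (n - 1) \<cdot> (p n \<cdot> x)) \<uplus> (Diff D n \<cdot> (\<rho> n \<cdot> x))"
proof -
  note [simp] = coneD(1-5)[OF c] cplxD[OF coneD(1)[OF c]] cplxD[OF coneD(2)[OF c]] cplxD[OF coneD(3)[OF c]]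
    cmD(1-3)[OF coneD(6)[OF c]] biD(4-)[OF coneD(9)[OF c]] bi_reassoc[OF coneD(9)[OF c]] x
  show "Cod A x = Term C (n - 1) \<Longrightarrow>
      Diff E n \<cdot> (\<sigma> n \<cdot> x) = Neg A (\<sigma> (n - 1) \<cdot> (Diff C (n - 1) \<cdot> x)) \<uplus> (i (n - 1) \<cdot> (f (n - 1) \<cdot> x))"
    using Comp_reassoc[OF cone_diff(1)[OF c, of n], of x] by simp
  show "\<lbrakk>m = n - 1; Cod A x = Term E n\<rbrakk> \<Longrightarrow> \<rho> m \<cdot> (Diff E n \<cdot> x) = (f (n - 1) \<cdot> (p n \<cdot> x)) \<uplus> (Diff D n \<cdot> (\<rho> n \<cdot> x))"
    using Comp_reassoc[OF cone_diff(2)[OF c, of m n], of x] by simp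
qed

lemma cone_null_left:
  assumes c: "cone C D f E i p \<sigma> \<rho>"
  shows "nul C E (\<lambda>n. i n \<cdot> f n)"
proof -
  note [simp] = coneD(1-5)[OF c] cplxD[OF coneD(1)[OF c]] cplxD[OF coneD(2)[OF c]] cplxD[OF coneD(3)[OF c]]
    cmD[OF coneD(6)[OF c]] biD(4-)[OF coneD(9)[OF c]] cone_diff[OF c]
  show ?thesis
    by (rule nulI[where h = "\<lambda>n. \<sigma> (n + 1)"]) (simp_all, rule lin_eqI, (rule lin_intros | simp)+)
qed

lemma cone_null_right:
  assumes c: "cone C D f E i p \<sigma> \<rho>"
  shows "nul E (shift_complex A D) (\<lambda>n. f (n - 1) \<cdot> p n)"
proof -
  note [simp] = coneD(1-5)[OF c] cplxD[OF coneD(1)[OF c]] cplxD[OF coneD(2)[OF c]] cplxD[OF coneD(3)[OF c]]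
    cmD[OF coneD(6)[OF c]] biD(4-)[OF coneD(9)[OF c]] cone_diff[OF c]
  show ?thesis
    by (rule nulI[where h = "\<rho>"]) (simp_all, rule lin_eqI, (rule lin_intros | simp)+)
qed

lemma cone_extend:
  assumes c: "cone C D f E i p \<sigma> \<rho>" and b: "cm D J b" "nul C J (\<lambda>n. b n \<cdot> f n)" and J: "is_complex A J"
  shows "\<exists>c. cm E J c \<and> (\<forall>n. c n \<cdot> i n = b n)"
proof -
  note [simp] = coneD(1-5)[OF c] cplxD[OF coneD(1)[OF c]] cplxD[OF coneD(2)[OF c]] cplxD[OF coneD(3)[OF c]]
    cmD[OF coneD(6)[OF c]] cmD[OF coneD(8)[OF c], simplified] biD(4-)[OF coneD(9)[OF c]] cone_diff[OF c] J cplxD[OF J] cmD[OF b(1)]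
    cm_reassoc[OF b(1)] bi_reassoc[OF coneD(9)[OF c]] cone_diff_reassoc[OF c]
  obtain h where [simp]: "\<And>n. h n \<in> Arr A" "\<And>n. Dom A (h n) = Term C n" "\<And>n. Cod A (h n) = Term J (n + 1)"
    and h: "\<And>n. b n \<cdot> f n = (Diff J (n + 1) \<cdot> h n) \<uplus> (h (n - 1) \<cdot> Diff C n)"
    by (rule nulE[OF b(2)]) (simp_all, blast)
  have h': "b (n - 1) \<cdot> (f (n - 1) \<cdot> p n) = (Diff J n \<cdot> (h (n - 1) \<cdot> p n)) \<uplus> (h (n - 2) \<cdot> (Diff C (n - 1) \<cdot> p n))" for n
    using Comp_reassoc[OF h[of "n - 1"], of "p n"] by simp
  show ?thesis
    by (intro exI[of _ "\<lambda>n. (b n \<cdot> \<rho> n) \<uplus> (h (n - 1) \<cdot> p n)"] conjI cmI allI)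
      (simp_all add: h', rule lin_eqI, (rule lin_intros | simp)+)
qed


lemma cone_factor:
  assumes c: "cone C D f E i p \<sigma> \<rho>" and b: "cm E J b" "nul D J (\<lambda>n. b n \<cdot> i n)" and J: "is_complex A J"
  shows "\<exists>e. cm (shift_complex A C) J e \<and> htp E J b (\<lambda>n. e n \<cdot> p n)"
proof -
  note [simp] = coneD(1-5)[OF c] cplxD[OF coneD(1)[OF c]] cplxD[OF coneD(2)[OF c]] cplxD[OF coneD(3)[OF c]]
    cmD[OF coneD(6)[OF c]] cmD[OF coneD(8)[OF c], simplified] biD(4-)[OF coneD(9)[OF c]] cone_diff[OF c] J cplxD[OF J]
    cmD(1-3)[OF b(1)] bi_reassoc[OF coneD(9)[OF c]] cone_diff_reassoc[OF c]
  obtain h where [simp]: "\<And>n. h n \<in> Arr A" "\<And>n. Dom A (h n) = Term D n" "\<And>n. Cod A (h n) = Term J (n + 1)"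
    and h: "\<And>n. b n \<cdot> i n = (Diff J (n + 1) \<cdot> h n) \<uplus> (h (n - 1) \<cdot> Diff D n)"
    by (rule nulE[OF b(2)]) (simp_all, blast)
  have bs: "Diff J n \<cdot> (b n \<cdot> \<sigma> n) = Neg A (b (n - 1) \<cdot> (\<sigma> (n - 1) \<cdot> Diff C (n - 1))) \<uplus> (b (n - 1) \<cdot> (i (n - 1) \<cdot> f (n - 1)))" for n
    using Comp_reassoc[OF cmD(4)[OF b(1), of "n - 1" n, symmetric], of "\<sigma> n"] by simp
  have hf: "b (n - 1) \<cdot> (i (n - 1) \<cdot> f (n - 1)) = (Diff J n \<cdot> (h (n - 1) \<cdot> f (n - 1))) \<uplus> (h (n - 2) \<cdot> (Diff D (n - 1) \<cdot> f (n - 1)))" for n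
    using Comp_reassoc[OF h[of "n - 1"], of "f (n - 1)"] by simp
  have hr: "b n \<cdot> (i n \<cdot> \<rho> n) = (Diff J (n + 1) \<cdot> (h n \<cdot> \<rho> n)) \<uplus> (h (n - 1) \<cdot> (Diff D n \<cdot> \<rho> n))" for n
    using Comp_reassoc[OF h[of n], of "\<rho> n"] by simp
  have bb: "b n = (b n \<cdot> (\<sigma> n \<cdot> p n)) \<uplus> (b n \<cdot> (i n \<cdot> \<rho> n))" for n
    using bi_from[OF coneD(9)[OF c, of n], of "b n"] by simp
  show ?thesis
    apply (intro exI[of _ "\<lambda>n. (b n \<cdot> \<sigma> n) \<uplus> Neg A (h (n - 1) \<cdot> f (n - 1))"] conjI cmI)
         apply simp_all
     apply (simp add: bs hf)
     apply (rule lin_eqI, (rule lin_intros | simp)+)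
    apply (rule htpI[where h = "\<lambda>n. h n \<cdot> \<rho> n"])
       apply simp_all
    apply (subst bb, subst hr)
    apply (rule lin_eqI, (rule lin_intros | simp)+)
    done
qed

lemma cone_shift_factor:
  assumes c: "cone C D f E i p \<sigma> \<rho>" and e: "cm (shift_complex A C) J e" "nul E J (\<lambda>n. e n \<cdot> p n)" and J: "is_complex A J"
  shows "\<exists>m. cm (shift_complex A D) J m \<and> htp (shift_complex A C) J e (\<lambda>n. m n \<cdot> f (n - 1))"
proof -
  note [simp] = coneD(1-5)[OF c] cplxD[OF coneD(1)[OF c]] cplxD[OF coneD(2)[OF c]] cplxD[OF coneD(3)[OF c]]
    cmD[OF coneD(6)[OF c]] cmD[OF coneD(7)[OF c]] biD(4-)[OF coneD(9)[OF c]] cone_diff[OF c] J cplxD[OF J]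
    cmD(1-3)[OF e(1), simplified] bi_reassoc[OF coneD(9)[OF c]] cone_diff_reassoc[OF c]
  obtain h where [simp]: "\<And>n. h n \<in> Arr A" "\<And>n. Dom A (h n) = Term E n" "\<And>n. Cod A (h n) = Term J (n + 1)"
    and h: "\<And>n. e n \<cdot> p n = (Diff J (n + 1) \<cdot> h n) \<uplus> (h (n - 1) \<cdot> Diff E n)"
    by (rule nulE[OF e(2)]) (simp_all, blast)
  have "Zero A (Term D n) (Term J n) = (Diff J (n + 1) \<cdot> (h n \<cdot> i n)) \<uplus> (h (n - 1) \<cdot> (Diff E n \<cdot> i n))" for n
    using Comp_reassoc[OF h[of n], of "i n"] by simp
  then have hi: "Zero A (Term D (n - 1)) (Term J (n - 1)) = (Diff J n \<cdot> (h (n - 1) \<cdot> i (n - 1))) \<uplus> (h (n - 2) \<cdot> (Diff E (n - 1) \<cdot> i (n - 1)))" for n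
    by (metis (no_types) add.commute add_diff_cancel_left' diff_add_cancel diff_diff_eq one_add_one)
  have e1: "Neg A (h (n - 2) \<cdot> (Diff E (n - 1) \<cdot> i (n - 1))) = Diff J n \<cdot> (h (n - 1) \<cdot> i (n - 1))" for n
    by (rule Add_cross[OF hi[of n]]) (simp_all, rule lin_eqI, (rule lin_intros | simp)+)
  have e2: "e n = (Diff J (n + 1) \<cdot> (h n \<cdot> \<sigma> n)) \<uplus> (h (n - 1) \<cdot> (Diff E n \<cdot> \<sigma> n))" for n
    using Comp_reassoc[OF h[of n], of "\<sigma> n"] by simp
  show ?thesis
    apply (intro exI[of _ "\<lambda>n. h (n - 1) \<cdot> i (n - 1)"] conjI cmI)
        apply simp_all
     apply (simp add: e1)
    apply (rule htpI[where h = "\<lambda>n. h n \<cdot> \<sigma> n"])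
       apply simp_all
    apply (subst e2, simp)
    apply (rule lin_eqI, (rule lin_intros | simp)+)
    done
qed

lemma cone_lift:
  assumes c: "cone C D f E i p \<sigma> \<rho>" and a: "cm Q D a" "nul Q E (\<lambda>n. i n \<cdot> a n)" and Q: "is_complex A Q"
  shows "\<exists>b. cm Q C b \<and> htp Q D a (\<lambda>n. f n \<cdot> b n)"
proof -
  note [simp] = coneD(1-5)[OF c] cplxD[OF coneD(1)[OF c]] cplxD[OF coneD(2)[OF c]] cplxD[OF coneD(3)[OF c]]
    cmD[OF coneD(6)[OF c]] cmD[OF coneD(7)[OF c]] biD(4-)[OF coneD(9)[OF c]] cone_diff[OF c] Q cplxD[OF Q]
    cmD[OF a(1)] bi_reassoc[OF coneD(9)[OF c]] cone_diff_reassoc[OF c]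
  obtain h where [simp]: "\<And>n. h n \<in> Arr A" "\<And>n. Dom A (h n) = Term Q n" "\<And>n. Cod A (h n) = Term E (n + 1)"
    and h: "\<And>n. i n \<cdot> a n = (Diff E (n + 1) \<cdot> h n) \<uplus> (h (n - 1) \<cdot> Diff Q n)"
    by (rule nulE[OF a(2)]) (simp_all, blast)
  have pd: "p n \<cdot> (Diff E (n + 1) \<cdot> x) = Neg A (Diff C n \<cdot> (p (n + 1) \<cdot> x))" if "x \<in> Arr A" "Cod A x = Term E (n + 1)" for n x
    using cm_reassoc[OF coneD(8)[OF c], of n "n + 1" x] that by simp
  have "p n \<cdot> (i n \<cdot> a n) = p n \<cdot> ((Diff E (n + 1) \<cdot> h n) \<uplus> (h (n - 1) \<cdot> Diff Q n))" for n
    by (subst h) simp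
  then have e0: "Zero A (Term Q n) (Term C (n - 1)) = Neg A (Diff C n \<cdot> (p (n + 1) \<cdot> h n)) \<uplus> (p n \<cdot> (h (n - 1) \<cdot> Diff Q n))" for n
    by (simp add: pd)
  have e1: "p n \<cdot> (h (n - 1) \<cdot> Diff Q n) = Diff C n \<cdot> (p (n + 1) \<cdot> h n)" for n
    by (rule Add_cross[OF e0[of n, symmetric]]) (simp_all, rule lin_eqI, (rule lin_intros | simp)+)
  have "\<rho> n \<cdot> (i n \<cdot> a n) = \<rho> n \<cdot> ((Diff E (n + 1) \<cdot> h n) \<uplus> (h (n - 1) \<cdot> Diff Q n))" for n
    by (subst h) simp
  then have e2: "a n = ((f n \<cdot> (p (n + 1) \<cdot> h n)) \<uplus> (Diff D (n + 1) \<cdot> (\<rho> (n + 1) \<cdot> h n))) \<uplus> (\<rho> n \<cdot> (h (n - 1) \<cdot> Diff Q n))" for n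
    by simp
  show ?thesis
    apply (intro exI[of _ "\<lambda>n. p (n + 1) \<cdot> h n"] conjI cmI)
        apply simp_all
     apply (simp add: e1)
    apply (rule htpI[where h = "\<lambda>n. \<rho> (n + 1) \<cdot> h n"])
       apply simp_all
    apply (subst e2)
    apply (rule lin_eqI, (rule lin_intros | simp)+)
    done
qed

lemma cone_shift_lift:
  assumes c: "cone C D f E i p \<sigma> \<rho>" and b: "cm Q (shift_complex A C) b" 
    "nul Q (shift_complex A D) (\<lambda>n. f (n - 1) \<cdot> b n)" and Q: "is_complex A Q"
  shows "\<exists>c. cm Q E c \<and> (\<forall>n. p n \<cdot> c n = b n)"
proof -
  note [simp] = coneD(1-5)[OF c] cplxD[OF coneD(1)[OF c]] cplxD[OF coneD(2)[OF c]] cplxD[OF coneD(3)[OF c]]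
    cmD[OF coneD(6)[OF c]] cmD[OF coneD(7)[OF c]] biD(4-)[OF coneD(9)[OF c]] cone_diff[OF c] Q cplxD[OF Q]
    cmD[OF b(1), simplified] bi_reassoc[OF coneD(9)[OF c]] cone_diff_reassoc[OF c]
  obtain h where hh [simp]: "\<And>n. h n \<in> Arr A" "\<And>n. Dom A (h n) = Term Q n" "\<And>n. Cod A (h n) = Term D n"
    and h: "\<And>n. f (n - 1) \<cdot> b n = Neg A (Diff D n \<cdot> h n) \<uplus> (h (n - 1) \<cdot> Diff Q n)"
  proof (rule nulE[OF b(2)], simp_all, goal_cases)
    case (1 h)
    then show ?case by (intro 1(1)[of h]) simp_all
  qed
  have ih: "i (n - 1) \<cdot> (f (n - 1) \<cdot> b n) = Neg A (i (n - 1) \<cdot> (Diff D n \<cdot> h n)) \<uplus> (i (n - 1) \<cdot> (h (n - 1) \<cdot> Diff Q n))" for n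
    by (subst h) (simp del: cmD(4)[OF coneD(7)[OF c]])
  have di: "Diff E n \<cdot> (i n \<cdot> h n) = i (n - 1) \<cdot> (Diff D n \<cdot> h n)" for n
    using cm_reassoc[OF coneD(7)[OF c], of "n - 1" n "h n"] by simp
  show ?thesis
    apply (intro exI[of _ "\<lambda>n. (\<sigma> n \<cdot> b n) \<uplus> (i n \<cdot> h n)"] conjI cmI allI)
        apply simp_all
    apply (simp add: ih di)
    apply (rule lin_eqI, (rule lin_intros | simp)+)
    done
qed


lemma cone_exists:
  assumes ds: "\<And>a b. \<lbrakk>a \<in> Obj A; b \<in> Obj A\<rbrakk> \<Longrightarrow> \<exists>s. is_direct_sum A a b s"
    and f: "cm C D f" and C: "is_complex A C" and D: "is_complex A D"
  shows "\<exists>E i p \<sigma> \<rho>. cone C D f E i p \<sigma> \<rho>"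
proof -
  note [simp] = C D cplxD[OF C] cplxD[OF D] cmD[OF f] shift_complex
  have "\<forall>n. \<exists>e i p \<sigma> \<rho>. is_biproduct A (Term C (n - 1)) (Term D n) e \<sigma> i p \<rho>"
    using ds[of "Term C (n - 1)" "Term D n" for n] by (simp add: is_direct_sum_def) blast
  then obtain T i p \<sigma> \<rho> where bi: "\<And>n. is_biproduct A (Term C (n - 1)) (Term D n) (T n) (\<sigma> n) (i n) (p n) (\<rho> n)"
    by metis
  note [simp] = biD(3-)[OF bi] bi_reassoc[OF bi]
  define E where "E = \<lparr>Term = T, Diff = (\<lambda>n. (\<sigma> (n - 1) \<cdot> Neg A (Diff C (n - 1)) \<cdot> p n) \<uplus>
             ((i (n - 1) \<cdot> f (n - 1) \<cdot> p n) \<uplus> (i (n - 1) \<cdot> Diff D n \<cdot> \<rho> n)))\<rparr>"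
  have [simp]: "Term E = T" and E: "\<And>n. Diff E n = Neg A (\<sigma> (n - 1) \<cdot> (Diff C (n - 1) \<cdot> p n)) \<uplus>
             ((i (n - 1) \<cdot> (f (n - 1) \<cdot> p n)) \<uplus> (i (n - 1) \<cdot> (Diff D n \<cdot> \<rho> n)))"
    by (simp_all add: E_def)
  have fd: "f (n - 2) \<cdot> (Diff C (n - 1) \<cdot> x) = Diff D (n - 1) \<cdot> (f (n - 1) \<cdot> x)" if "x \<in> Arr A" "Cod A x = Term C (n - 1)" for n x
    using cm_reassoc[OF f C D, of "n - 2" "n - 1"] that by simp
  have cE: "is_complex A E"
    unfolding is_complex_def
    apply (intro conjI allI)
      apply simp
     apply (simp add: E Hom_def)
    apply (simp add: E)
    subgoal for n
      using fd[of "p (n + 1)" "n + 1"] 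
      apply simp
      apply (rule lin_eqI, (rule lin_intros | simp)+)
      done
    done
  moreover have "cm D E i" by (rule cmI) (simp_all add: E)
  moreover have "cm E (shift_complex A C) p" by (rule cmI) (simp_all add: E)
  moreover have "Diff E n = (\<sigma> (n - 1) \<cdot> Neg A (Diff C (n - 1)) \<cdot> p n) \<uplus>
             ((i (n - 1) \<cdot> f (n - 1) \<cdot> p n) \<uplus> (i (n - 1) \<cdot> Diff D n \<cdot> \<rho> n))" for n
    by (simp add: E_def)
  ultimately have "cone C D f E i p \<sigma> \<rho>"
    using bi f by (simp add: cone_def)
  then show ?thesis by blast
qed

lemma cone_into:
  assumes c: "cone C D f E i p \<sigma> \<rho>" and Q: "is_complex A Q" and q: "cm Q (shift_complex A C) q"
    and r: "\<And>n. r n \<in> Arr A" "\<And>n. Dom A (r n) = Term Q n" "\<And>n. Cod A (r n) = Term D n"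
    and rd: "\<And>n. r (n - 1) \<cdot> Diff Q n = (Diff D n \<cdot> r n) \<uplus> (f (n - 1) \<cdot> q n)"
  shows "cm Q E (\<lambda>n. (\<sigma> n \<cdot> q n) \<uplus> (i n \<cdot> r n))"
proof -
  note [simp] = coneD(1-5)[OF c] cplxD[OF coneD(1)[OF c]] cplxD[OF coneD(2)[OF c]] cplxD[OF coneD(3)[OF c]]
    cmD(1-3)[OF coneD(6)[OF c]] cmD(1-3)[OF coneD(7)[OF c]] biD(4-)[OF coneD(9)[OF c]]
    Q cplxD[OF Q] cmD[OF q, simplified] r
  have i: "Diff E n \<cdot> (i n \<cdot> r n) = i (n - 1) \<cdot> (Diff D n \<cdot> r n)" for n
    using cm_reassoc[OF coneD(7)[OF c], of "n - 1" n "r n"] by simp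
  show ?thesis
    by (rule cmI) (simp_all add: i rd cone_diff_reassoc[OF c], rule lin_eqI, (rule lin_intros | simp)+)
qed

lemma cone_map:
  assumes c: "cone C D f E i p \<sigma> \<rho>" and c': "cone C' D' f' E' i' p' \<sigma>' \<rho>'"
    and a: "cm C C' a" and b: "cm D D' b" and H: "htp C D' (\<lambda>n. b n \<cdot> f n) (\<lambda>n. f' n \<cdot> a n)"
  shows "\<exists>k. cm E E' k \<and> (\<forall>n. k n \<cdot> i n = i' n \<cdot> b n) \<and> (\<forall>n. p' n \<cdot> k n = a (n - 1) \<cdot> p n)"
proof -
  note [simp] = coneD(1-5)[OF c] cplxD[OF coneD(1)[OF c]] cplxD[OF coneD(2)[OF c]] cplxD[OF coneD(3)[OF c]]
    cmD(1-3)[OF coneD(6)[OF c]] biD(4-)[OF coneD(9)[OF c]]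
    coneD(1-5)[OF c'] cplxD[OF coneD(1)[OF c']] cplxD[OF coneD(2)[OF c']] cplxD[OF coneD(3)[OF c']]
    cmD(1-3)[OF coneD(6)[OF c']] biD(4-)[OF coneD(9)[OF c']] cmD(1-3)[OF a] cmD(1-3)[OF b]
  obtain h where [simp]: "\<And>n. h n \<in> Arr A" "\<And>n. Dom A (h n) = Term C n" "\<And>n. Cod A (h n) = Term D' (n + 1)"
    and h: "\<And>n. b n \<cdot> f n = (f' n \<cdot> a n) \<uplus> ((Diff D' (n + 1) \<cdot> h n) \<uplus> (h (n - 1) \<cdot> Diff C n))"
    by (rule htpE[OF H]) blast
  define q where "q n = a (n - 1) \<cdot> p n" for n
  define r where "r n = (b n \<cdot> \<rho> n) \<uplus> (h (n - 1) \<cdot> p n)" for n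
  have s: "cm (shift_complex A C) (shift_complex A C') (\<lambda>n. a (n - 1))" using a by (simp add: cm_shift_iff)
  have q: "cm E (shift_complex A C') q"
    unfolding q_def by (rule cm_comp[OF coneD(8)[OF c] s]) simp_all
  have bf: "b (n - 1) \<cdot> (f (n - 1) \<cdot> p n) = (f' (n - 1) \<cdot> (a (n - 1) \<cdot> p n)) \<uplus> ((Diff D' n \<cdot> (h (n - 1) \<cdot> p n)) \<uplus> (h (n - 2) \<cdot> (Diff C (n - 1) \<cdot> p n)))" for n
    using Comp_reassoc[OF h[of "n - 1"], of "p n"] by simp
  have rd: "r (n - 1) \<cdot> Diff E n = (Diff D' n \<cdot> r n) \<uplus> (f' (n - 1) \<cdot> q n)" for n
  proof -
    have bd: "b (n - 1) \<cdot> (Diff D n \<cdot> \<rho> n) = Diff D' n \<cdot> (b n \<cdot> \<rho> n)"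
      using cm_reassoc[OF b, of "n - 1" n "\<rho> n"] by simp
    have pd: "p (n - 1) \<cdot> Diff E n = Neg A (Diff C (n - 1) \<cdot> p n)"
      using cmD(4)[OF coneD(8)[OF c], of "n - 1" n] by simp
    show ?thesis unfolding r_def q_def
      by (simp add: cone_diff(2)[OF c] bd pd bf, rule lin_eqI, (rule lin_intros | simp)+)
  qed
  have r: "r n \<in> Arr A" "Dom A (r n) = Term E n" "Cod A (r n) = Term D' n" for n
    by (simp_all add: r_def)
  note [simp] = r cmD(1-3)[OF q, simplified] bi_reassoc[OF coneD(9)[OF c']]
  have "cm E E' (\<lambda>n. (\<sigma>' n \<cdot> q n) \<uplus> (i' n \<cdot> r n))"
    by (rule cone_into[OF c' _ q r rd]) simp
  moreover have "((\<sigma>' n \<cdot> q n) \<uplus> (i' n \<cdot> r n)) \<cdot> i n = i' n \<cdot> b n" for n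
  proof -
    have "q n \<cdot> i n = Zero A (Term D n) (Term C' (n - 1))" "r n \<cdot> i n = b n"
      by (simp_all add: r_def q_def)
    then show ?thesis by simp
  qed
  moreover have "p' n \<cdot> ((\<sigma>' n \<cdot> q n) \<uplus> (i' n \<cdot> r n)) = a (n - 1) \<cdot> p n" for n
    by (simp add: q_def[symmetric])
  ultimately show ?thesis by blast
qed

abbreviation KK where "KK \<equiv> K_preadd A (Obj A)"

lemma dw_all [simp]: "C \<in> dw A (Obj A) \<longleftrightarrow> is_complex A C"
  by (auto simp: dw_def is_complex_def)

lemma KK_Hom_iff: "F \<in> Hom KK C D \<longleftrightarrow> is_complex A C \<and> is_complex A D \<and> (\<exists>f. cm C D f \<and> F = cls C D f)"
  by (simp add: K_Hom_iff)

lemma KK_zero_iff: "\<lbrakk>cm C D f; is_complex A C; is_complex A D\<rbrakk> \<Longrightarrow> cls C D f = Zero KK C D \<longleftrightarrow> nul C D f"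
  using cls_eq_iff[of C D f "\<lambda>n. Zero A (Term C n) (Term D n)"] cm_zero by (simp add: K_Zero)

lemma KK_comp_zero_iff:
  assumes "cm C D f" "cm D E g" "is_complex A C" "is_complex A D" "is_complex A E"
  shows "cls D E g \<cdot>\<^bsub>KK\<^esub> cls C D f = Zero KK C E \<longleftrightarrow> nul C E (\<lambda>n. g n \<cdot> f n)"
  using KK_zero_iff[OF cm_comp[OF assms]] assms K_Comp[OF assms] by simp

lemma K_shift_Hom: "F \<in> Hom KK C D \<Longrightarrow> K_shift A F \<in> Hom KK (shift_complex A C) (shift_complex A D)"
proof -
  assume "F \<in> Hom KK C D"
  then obtain f where *: "cm C D f" "F = cls C D f" "is_complex A C" "is_complex A D" by (auto simp: KK_Hom_iff)
  then have "cm (shift_complex A C) (shift_complex A D) (\<lambda>n. f (n - 1))" by (simp add: cm_shift_iff)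
  then show ?thesis using * by (simp add: K_HomI K_shift_cls shift_complex)
qed

lemma K_shift_Comp:
  assumes "F \<in> Hom KK C D" "G \<in> Hom KK D E"
  shows "K_shift A (G \<cdot>\<^bsub>KK\<^esub> F) = K_shift A G \<cdot>\<^bsub>KK\<^esub> K_shift A F"
proof -
  obtain f g where *: "cm C D f" "F = cls C D f" "cm D E g" "G = cls D E g"
    "is_complex A C" "is_complex A D" "is_complex A E" using assms by (auto simp: KK_Hom_iff)
  note [simp] = shift_complex *(5-7)
  have s: "cm (shift_complex A C) (shift_complex A D) (\<lambda>n. f (n - 1))" "cm (shift_complex A D) (shift_complex A E) (\<lambda>n. g (n - 1))"
    using * by (simp_all add: cm_shift_iff)
  show ?thesis
    using *(1,3) K_Comp[OF s] by (simp add: *(2,4) K_Comp K_shift_cls cm_comp[OF *(1,3)])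
qed

lemma K_shift_inj:
  assumes "F \<in> Hom KK C D" "G \<in> Hom KK C D" "K_shift A F = K_shift A G"
  shows "F = G"
proof -
  obtain f g where *: "cm C D f" "F = cls C D f" "cm C D g" "G = cls C D g"
    "is_complex A C" "is_complex A D" using assms by (auto simp: KK_Hom_iff)
  note [simp] = shift_complex *(5-6)
  have s: "cm (shift_complex A C) (shift_complex A D) (\<lambda>n. f (n - 1))" "cm (shift_complex A C) (shift_complex A D) (\<lambda>n. g (n - 1))"
    using * by (simp_all add: cm_shift_iff)
  have "htp (shift_complex A C) (shift_complex A D) (\<lambda>n. f (n - 1)) (\<lambda>n. g (n - 1))"
    using assms(3) cls_eq_iff[OF s] *(1,3) by (simp add: *(2,4) K_shift_cls)
  then show ?thesis using * cls_eq_iff[OF *(1,3)] by (simp add: htp_shift_iff)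
qed

lemma K_shift_surj:
  assumes "G \<in> Hom KK (shift_complex A C) (shift_complex A D)" "is_complex A C" "is_complex A D"
  shows "\<exists>F \<in> Hom KK C D. K_shift A F = G"
proof -
  obtain g where g: "cm (shift_complex A C) (shift_complex A D) g" "G = cls (shift_complex A C) (shift_complex A D) g"
    using assms by (auto simp: KK_Hom_iff)
  have "cm C D (\<lambda>n. g (n + 1))" using cm_shift_iff[OF assms(2,3), of "\<lambda>n. g (n + 1)"] g by simp
  then show ?thesis using g assms by (intro bexI[of _ "cls C D (\<lambda>n. g (n + 1))"]) (auto simp: KK_Hom_iff K_shift_cls)
qed

lemma K_shift_Zero: "\<lbrakk>is_complex A C; is_complex A D\<rbrakk> \<Longrightarrow> K_shift A (Zero KK C D) = Zero KK (shift_complex A C) (shift_complex A D)"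
  by (simp add: K_Zero K_shift_cls cm_zero)

lemma K_shift_Ide: "is_complex A C \<Longrightarrow> K_shift A (Ide KK C) = Ide KK (shift_complex A C)"
  by (simp add: K_Ide K_shift_cls cm_ide)

text \<open>The exact Hom sequences of the triangle \<open>C \<rightarrow> D \<rightarrow> E \<rightarrow> \<Sigma>C\<close> of a mapping cone.\<close>

context
  fixes C D E f i p \<sigma> \<rho> u v w
  assumes c: "cone C D f E i p \<sigma> \<rho>"
  defines "u \<equiv> cls C D f" and "v \<equiv> cls D E i" and "w \<equiv> cls E (shift_complex A C) p"
begin

lemma cone_arrows: "u \<in> Hom KK C D" "v \<in> Hom KK D E" "w \<in> Hom KK E (shift_complex A C)"
  using coneD(1-8)[OF c] by (auto simp: KK_Hom_iff u_def v_def w_def)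

lemma KK_cone_null: "v \<cdot>\<^bsub>KK\<^esub> u = Zero KK C E" "K_shift A u \<cdot>\<^bsub>KK\<^esub> w = Zero KK E (shift_complex A D)"
proof -
  note * = coneD(1-8)[OF c]
  show "v \<cdot>\<^bsub>KK\<^esub> u = Zero KK C E"
    using KK_comp_zero_iff[OF *(6,7,1,2,3)] cone_null_left[OF c] by (simp add: u_def v_def)
  have s: "cm (shift_complex A C) (shift_complex A D) (\<lambda>n. f (n - 1))" using * by (simp add: cm_shift_iff)
  show "K_shift A u \<cdot>\<^bsub>KK\<^esub> w = Zero KK E (shift_complex A D)"
    using KK_comp_zero_iff[OF *(8) s *(3,4,5)] cone_null_right[OF c] * by (simp add: u_def w_def K_shift_cls)
qed

lemma KK_cone_extend:
  assumes "b \<in> Hom KK D J" "b \<cdot>\<^bsub>KK\<^esub> u = Zero KK C J"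
  shows "\<exists>e \<in> Hom KK E J. e \<cdot>\<^bsub>KK\<^esub> v = b"
proof -
  note * = coneD(1-8)[OF c]
  obtain b' where b: "cm D J b'" "b = cls D J b'" and J: "is_complex A J" using assms by (auto simp: KK_Hom_iff)
  have "nul C J (\<lambda>n. b' n \<cdot> f n)" using assms(2) KK_comp_zero_iff[OF *(6) b(1) *(1,2) J] by (simp add: b u_def)
  from cone_extend[OF c b(1) this J] obtain e where e: "cm E J e" "\<And>n. e n \<cdot> i n = b' n" by blast
  then show ?thesis
    using * J by (intro bexI[of _ "cls E J e"]) (auto simp: KK_Hom_iff v_def K_Comp b)
qed

lemma KK_cone_factor:
  assumes "b \<in> Hom KK E J" "b \<cdot>\<^bsub>KK\<^esub> v = Zero KK D J"
  shows "\<exists>e \<in> Hom KK (shift_complex A C) J. e \<cdot>\<^bsub>KK\<^esub> w = b"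
proof -
  note * = coneD(1-8)[OF c]
  obtain b' where b: "cm E J b'" "b = cls E J b'" and J: "is_complex A J" using assms by (auto simp: KK_Hom_iff)
  have "nul D J (\<lambda>n. b' n \<cdot> i n)" using assms(2) KK_comp_zero_iff[OF *(7) b(1) *(2,3) J] by (simp add: b v_def)
  from cone_factor[OF c b(1) this J] obtain e where e: "cm (shift_complex A C) J e" "htp E J b' (\<lambda>n. e n \<cdot> p n)" by blast
  have "cls E J (\<lambda>n. e n \<cdot> p n) = b"
    using e cls_eq_iff[OF b(1) cm_comp[OF *(8) e(1) *(3,4) J] *(3) J] b by simp
  then show ?thesis
    using * J e by (intro bexI[of _ "cls (shift_complex A C) J e"]) (auto simp: KK_Hom_iff w_def K_Comp)
qed

lemma KK_cone_shift_factor: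
  assumes "e \<in> Hom KK (shift_complex A C) J" "e \<cdot>\<^bsub>KK\<^esub> w = Zero KK E J"
  shows "\<exists>m \<in> Hom KK (shift_complex A D) J. e = m \<cdot>\<^bsub>KK\<^esub> K_shift A u"
proof -
  note * = coneD(1-8)[OF c]
  obtain e' where e: "cm (shift_complex A C) J e'" "e = cls (shift_complex A C) J e'" and J: "is_complex A J"
    using assms by (auto simp: KK_Hom_iff)
  have s: "cm (shift_complex A C) (shift_complex A D) (\<lambda>n. f (n - 1))" using * by (simp add: cm_shift_iff)
  have "nul E J (\<lambda>n. e' n \<cdot> p n)" using assms(2) KK_comp_zero_iff[OF *(8) e(1) *(3,4) J] by (simp add: e w_def)
  from cone_shift_factor[OF c e(1) this J] obtain m where m: "cm (shift_complex A D) J m"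
    "htp (shift_complex A C) J e' (\<lambda>n. m n \<cdot> f (n - 1))" by blast
  have "e = cls (shift_complex A C) J (\<lambda>n. m n \<cdot> f (n - 1))"
    using m cls_eq_iff[OF e(1) cm_comp[OF s m(1) *(4,5) J] *(4) J] e by simp
  then show ?thesis
    using * J m s by (intro bexI[of _ "cls (shift_complex A D) J m"]) (auto simp: KK_Hom_iff u_def K_shift_cls K_Comp)
qed

lemma KK_cone_lift:
  assumes "a \<in> Hom KK Q D" "v \<cdot>\<^bsub>KK\<^esub> a = Zero KK Q E"
  shows "\<exists>b \<in> Hom KK Q C. a = u \<cdot>\<^bsub>KK\<^esub> b"
proof -
  note * = coneD(1-8)[OF c]
  obtain a' where a: "cm Q D a'" "a = cls Q D a'" and Q: "is_complex A Q" using assms by (auto simp: KK_Hom_iff)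
  have "nul Q E (\<lambda>n. i n \<cdot> a' n)" using assms(2) KK_comp_zero_iff[OF a(1) *(7) Q *(2,3)] by (simp add: a v_def)
  from cone_lift[OF c a(1) this Q] obtain b where b: "cm Q C b" "htp Q D a' (\<lambda>n. f n \<cdot> b n)" by blast
  have "a = cls Q D (\<lambda>n. f n \<cdot> b n)"
    using b cls_eq_iff[OF a(1) cm_comp[OF b(1) *(6) Q *(1,2)] Q *(2)] a by simp
  then show ?thesis
    using * Q b by (intro bexI[of _ "cls Q C b"]) (auto simp: KK_Hom_iff u_def K_Comp)
qed

lemma KK_cone_shift_lift:
  assumes "b \<in> Hom KK Q (shift_complex A C)" "K_shift A u \<cdot>\<^bsub>KK\<^esub> b = Zero KK Q (shift_complex A D)"
  shows "\<exists>e \<in> Hom KK Q E. w \<cdot>\<^bsub>KK\<^esub> e = b"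
proof -
  note * = coneD(1-8)[OF c]
  obtain b' where b: "cm Q (shift_complex A C) b'" "b = cls Q (shift_complex A C) b'" and Q: "is_complex A Q"
    using assms by (auto simp: KK_Hom_iff)
  have s: "cm (shift_complex A C) (shift_complex A D) (\<lambda>n. f (n - 1))" using * by (simp add: cm_shift_iff)
  have "nul Q (shift_complex A D) (\<lambda>n. f (n - 1) \<cdot> b' n)"
    using assms(2) KK_comp_zero_iff[OF b(1) s Q *(4,5)] * by (simp add: b u_def K_shift_cls)
  from cone_shift_lift[OF c b(1) this Q] obtain e where e: "cm Q E e" "\<And>n. p n \<cdot> e n = b' n" by blast
  then show ?thesis
    using * Q by (intro bexI[of _ "cls Q E e"]) (auto simp: KK_Hom_iff w_def K_Comp b)
qed

end


definition pre_iso where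
  "pre_iso Ys C D u \<longleftrightarrow> u \<in> Hom KK C D \<and> (\<forall>J \<in> Ys.
     (\<forall>b \<in> Hom KK C J. \<exists>a \<in> Hom KK D J. a \<cdot>\<^bsub>KK\<^esub> u = b) \<and>
     (\<forall>a \<in> Hom KK D J. \<forall>a' \<in> Hom KK D J. a \<cdot>\<^bsub>KK\<^esub> u = a' \<cdot>\<^bsub>KK\<^esub> u \<longrightarrow> a = a'))"

definition post_iso where
  "post_iso Xs C D u \<longleftrightarrow> u \<in> Hom KK C D \<and> (\<forall>Q \<in> Xs.
     (\<forall>b \<in> Hom KK Q D. \<exists>a \<in> Hom KK Q C. u \<cdot>\<^bsub>KK\<^esub> a = b) \<and>
     (\<forall>a \<in> Hom KK Q C. \<forall>a' \<in> Hom KK Q C. u \<cdot>\<^bsub>KK\<^esub> a = u \<cdot>\<^bsub>KK\<^esub> a' \<longrightarrow> a = a'))"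

lemma pre_isoI:
  assumes u: "u \<in> Hom KK C D"
    and s: "\<And>J b. \<lbrakk>J \<in> Ys; b \<in> Hom KK C J\<rbrakk> \<Longrightarrow> \<exists>a \<in> Hom KK D J. a \<cdot>\<^bsub>KK\<^esub> u = b"
    and i: "\<And>J a. \<lbrakk>J \<in> Ys; a \<in> Hom KK D J; a \<cdot>\<^bsub>KK\<^esub> u = Zero KK C J\<rbrakk> \<Longrightarrow> a = Zero KK D J"
  shows "pre_iso Ys C D u"
proof -
  interpret K: preadditive_category KK by (rule K_preadditive)
  have "a = a'" if J: "J \<in> Ys" and a: "a \<in> Hom KK D J" "a' \<in> Hom KK D J" "a \<cdot>\<^bsub>KK\<^esub> u = a' \<cdot>\<^bsub>KK\<^esub> u" for J a a'
  proof -
    note [simp] = u[unfolded Hom_def, simplified] a(1,2)[unfolded Hom_def, simplified]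
    have DJ: "is_complex A C" "is_complex A D" "is_complex A J"
      using a(1) u by (auto simp: KK_Hom_iff)
    have "(a \<uplus>\<^bsub>KK\<^esub> Neg KK a') \<cdot>\<^bsub>KK\<^esub> u = Zero KK C J" using a(3) DJ by simp
    then have z: "a \<uplus>\<^bsub>KK\<^esub> Neg KK a' = Zero KK D J"
      by (intro i[OF J]) (simp_all add: Hom_def)
    show ?thesis
      by (rule K.Add_cross[OF z]) (simp_all add: DJ, rule K.lin_eqI, (rule K.lin_intros | simp)+)
  qed
  then show ?thesis
    unfolding pre_iso_def using u s by (intro conjI ballI impI) simp_all
qed

lemma post_isoI:
  assumes u: "u \<in> Hom KK C D"
    and s: "\<And>Q b. \<lbrakk>Q \<in> Xs; b \<in> Hom KK Q D\<rbrakk> \<Longrightarrow> \<exists>a \<in> Hom KK Q C. u \<cdot>\<^bsub>KK\<^esub> a = b"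
    and i: "\<And>Q a. \<lbrakk>Q \<in> Xs; a \<in> Hom KK Q C; u \<cdot>\<^bsub>KK\<^esub> a = Zero KK Q D\<rbrakk> \<Longrightarrow> a = Zero KK Q C"
  shows "post_iso Xs C D u"
proof -
  interpret K: preadditive_category KK by (rule K_preadditive)
  have "a = a'" if J: "Q \<in> Xs" and a: "a \<in> Hom KK Q C" "a' \<in> Hom KK Q C" "u \<cdot>\<^bsub>KK\<^esub> a = u \<cdot>\<^bsub>KK\<^esub> a'" for Q a a'
  proof -
    note [simp] = u[unfolded Hom_def, simplified] a(1,2)[unfolded Hom_def, simplified]
    have DJ: "is_complex A C" "is_complex A Q" "is_complex A D"
      using a(1) u by (auto simp: KK_Hom_iff)
    have "u \<cdot>\<^bsub>KK\<^esub> (a \<uplus>\<^bsub>KK\<^esub> Neg KK a') = Zero KK Q D" using a(3) DJ by simp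
    then have z: "a \<uplus>\<^bsub>KK\<^esub> Neg KK a' = Zero KK Q C"
      by (intro i[OF J]) (simp_all add: Hom_def)
    show ?thesis
      by (rule K.Add_cross[OF z]) (simp_all add: DJ, rule K.lin_eqI, (rule K.lin_intros | simp)+)
  qed
  then show ?thesis
    unfolding post_iso_def using u s by (intro conjI ballI impI) simp_all
qed

lemma nullmaps_KK:
  assumes "nullmaps C D" "F \<in> Hom KK C D"
  shows "F = Zero KK C D"
proof -
  obtain f where f: "cm C D f" "F = cls C D f" "is_complex A C" "is_complex A D"
    using assms by (auto simp: KK_Hom_iff)
  then show ?thesis using assms(1) KK_zero_iff[OF f(1,3,4)] by (simp add: nullmaps_def)
qed

lemma KK_Obj: "F \<in> Hom KK C D \<Longrightarrow> is_complex A C" "F \<in> Hom KK C D \<Longrightarrow> is_complex A D"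
  by (auto simp: KK_Hom_iff)

lemma KK_HomI: "\<lbrakk>F \<in> Hom KK C D; G \<in> Hom KK D E\<rbrakk> \<Longrightarrow> G \<cdot>\<^bsub>KK\<^esub> F \<in> Hom KK C E"
  by (rule category.Comp_in_Hom[OF K_category])

lemma cone_pre_iso:
  assumes c: "cone C D f E i p \<sigma> \<rho>"
    and Ys: "\<And>J. J \<in> Ys \<Longrightarrow> nullmaps E J" "\<And>J. J \<in> Ys \<Longrightarrow> shift_complex A J \<in> Ys"
  shows "pre_iso Ys C D (cls C D f)"
proof (rule pre_isoI)
  interpret K: preadditive_category KK by (rule K_preadditive)
  note ar = cone_arrows[OF c]
  let ?u = "cls C D f" and ?v = "cls D E i" and ?w = "cls E (shift_complex A C) p"
  show "?u \<in> Hom KK C D" by (rule ar)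
  fix J assume J: "J \<in> Ys"
  show "\<exists>a \<in> Hom KK D J. a \<cdot>\<^bsub>KK\<^esub> ?u = b" if b: "b \<in> Hom KK C J" for b
  proof -
    have "K_shift A b \<cdot>\<^bsub>KK\<^esub> ?w \<in> Hom KK E (shift_complex A J)"
      by (rule KK_HomI[OF ar(3) K_shift_Hom[OF b]])
    then have "K_shift A b \<cdot>\<^bsub>KK\<^esub> ?w = Zero KK E (shift_complex A J)"
      using Ys J by (intro nullmaps_KK) auto
    from KK_cone_shift_factor[OF c K_shift_Hom[OF b] this] obtain m where
      m: "m \<in> Hom KK (shift_complex A D) (shift_complex A J)" "K_shift A b = m \<cdot>\<^bsub>KK\<^esub> K_shift A ?u" by blast
    obtain a where a: "a \<in> Hom KK D J" "K_shift A a = m"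
      using K_shift_surj[OF m(1)] KK_Obj[OF ar(1)] KK_Obj[OF b] by blast
    have "K_shift A (a \<cdot>\<^bsub>KK\<^esub> ?u) = K_shift A b" using K_shift_Comp[OF ar(1) a(1)] a m by simp
    then have "a \<cdot>\<^bsub>KK\<^esub> ?u = b" by (rule K_shift_inj[OF KK_HomI[OF ar(1) a(1)] b])
    then show ?thesis using a by blast
  qed
  show "a = Zero KK D J" if a: "a \<in> Hom KK D J" "a \<cdot>\<^bsub>KK\<^esub> ?u = Zero KK C J" for a
  proof -
    from KK_cone_extend[OF c a] obtain e where e: "e \<in> Hom KK E J" "e \<cdot>\<^bsub>KK\<^esub> ?v = a" by blast
    have "e = Zero KK E J" using nullmaps_KK[OF Ys(1)[OF J] e(1)] .
    then show ?thesis using e(2) ar(2) KK_Obj[OF e(1)] by (auto simp: Hom_def)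
  qed
qed

lemma cone_post_iso:
  assumes c: "cone C D f E i p \<sigma> \<rho>"
    and Xs: "\<And>Q. Q \<in> Xs \<Longrightarrow> nullmaps Q E" "\<And>Q. Q \<in> Xs \<Longrightarrow> shift_complex A Q \<in> Xs"
  shows "post_iso Xs C D (cls C D f)"
proof (rule post_isoI)
  interpret K: preadditive_category KK by (rule K_preadditive)
  note ar = cone_arrows[OF c]
  let ?u = "cls C D f" and ?v = "cls D E i" and ?w = "cls E (shift_complex A C) p"
  show "?u \<in> Hom KK C D" by (rule ar)
  fix Q assume Q: "Q \<in> Xs"
  show "\<exists>a \<in> Hom KK Q C. ?u \<cdot>\<^bsub>KK\<^esub> a = b" if b: "b \<in> Hom KK Q D" for b
  proof -
    have "?v \<cdot>\<^bsub>KK\<^esub> b = Zero KK Q E"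
      using Xs(1)[OF Q] KK_HomI[OF b ar(2)] by (rule nullmaps_KK)
    then show ?thesis using KK_cone_lift[OF c b] by metis
  qed
  show "a = Zero KK Q C" if a: "a \<in> Hom KK Q C" "?u \<cdot>\<^bsub>KK\<^esub> a = Zero KK Q D" for a
  proof -
    have QD: "is_complex A Q" "is_complex A D" "is_complex A C" using KK_Obj[OF a(1)] KK_Obj[OF ar(1)] by auto
    have "K_shift A ?u \<cdot>\<^bsub>KK\<^esub> K_shift A a = Zero KK (shift_complex A Q) (shift_complex A D)"
      using K_shift_Comp[OF a(1) ar(1)] a(2) K_shift_Zero[OF QD(1,2)] by simp
    from KK_cone_shift_lift[OF c K_shift_Hom[OF a(1)] this] obtain e where
      e: "e \<in> Hom KK (shift_complex A Q) E" "?w \<cdot>\<^bsub>KK\<^esub> e = K_shift A a" by blast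
    have "e = Zero KK (shift_complex A Q) E" using nullmaps_KK[OF Xs(1)[OF Xs(2)[OF Q]] e(1)] .
    then have "K_shift A a = K_shift A (Zero KK Q C)"
      using e(2)[symmetric] ar(3) KK_Obj[OF e(1)] K_shift_Zero[OF QD(1,3)] by (auto simp: Hom_def)
    then show ?thesis
      by (rule K_shift_inj[OF a(1), rotated]) (simp add: K_Zero K_HomI cm_zero QD)
  qed
qed

lemma pre_iso_shift:
  assumes "pre_iso Ys C D u" and Ys: "\<And>J. J \<in> Ys \<Longrightarrow> unshift J \<in> Ys"
  shows "pre_iso Ys (shift_complex A C) (shift_complex A D) (K_shift A u)"
proof -
  note pi = assms(1)[unfolded pre_iso_def]
  have u: "u \<in> Hom KK C D" using pi by blast
  have CD: "is_complex A C" "is_complex A D" using KK_Obj[OF u] by auto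
  have 1: "\<exists>a \<in> Hom KK (shift_complex A D) J. a \<cdot>\<^bsub>KK\<^esub> K_shift A u = b"
    if J: "J \<in> Ys" and b: "b \<in> Hom KK (shift_complex A C) J" for J b
  proof -
    have J': "is_complex A J" "shift_complex A (unshift J) = J" "is_complex A (unshift J)"
      using KK_Obj[OF b] shift_unshift unshift_complex by auto
    obtain b' where b': "b' \<in> Hom KK C (unshift J)" "K_shift A b' = b"
      using K_shift_surj[of b C "unshift J"] b J' CD by auto
    obtain a where a: "a \<in> Hom KK D (unshift J)" "a \<cdot>\<^bsub>KK\<^esub> u = b'" using pi Ys[OF J] b' by blast
    show ?thesis
      by (rule bexI[of _ "K_shift A a"]) (use K_shift_Comp[OF u a(1)] K_shift_Hom[OF a(1)] a b' J' in simp_all)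
  qed
  have 2: "a = a'" if J: "J \<in> Ys" and a: "a \<in> Hom KK (shift_complex A D) J" "a' \<in> Hom KK (shift_complex A D) J"
      "a \<cdot>\<^bsub>KK\<^esub> K_shift A u = a' \<cdot>\<^bsub>KK\<^esub> K_shift A u" for J a a'
  proof -
    have J': "is_complex A J" "shift_complex A (unshift J) = J" "is_complex A (unshift J)"
      using KK_Obj[OF a(1)] shift_unshift unshift_complex by auto
    obtain b where b: "b \<in> Hom KK D (unshift J)" "K_shift A b = a"
      using K_shift_surj[of a D "unshift J"] a J' CD by auto
    obtain b' where b': "b' \<in> Hom KK D (unshift J)" "K_shift A b' = a'"
      using K_shift_surj[of a' D "unshift J"] a J' CD by auto
    have "K_shift A (b \<cdot>\<^bsub>KK\<^esub> u) = K_shift A (b' \<cdot>\<^bsub>KK\<^esub> u)"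
      using K_shift_Comp[OF u b(1)] K_shift_Comp[OF u b'(1)] b b' a by simp
    then have "b \<cdot>\<^bsub>KK\<^esub> u = b' \<cdot>\<^bsub>KK\<^esub> u" by (rule K_shift_inj[OF KK_HomI[OF u b(1)] KK_HomI[OF u b'(1)]])
    then have "b = b'" using pi Ys[OF J] b b' by blast
    then show ?thesis using b b' by simp
  qed
  show ?thesis
    unfolding pre_iso_def by (intro conjI ballI impI K_shift_Hom[OF u] 1, assumption+, rule 2, assumption+)
qed

lemma five_pre_iso:
  assumes c: "cone C D f E i p \<sigma> \<rho>" and c': "cone C' D' f' E' i' p' \<sigma>' \<rho>'"
    and a: "pre_iso Ys C C' a" and b: "pre_iso Ys D D' b" and k: "k \<in> Hom KK E E'"
    and 1: "b \<cdot>\<^bsub>KK\<^esub> cls C D f = cls C' D' f' \<cdot>\<^bsub>KK\<^esub> a"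
    and 2: "k \<cdot>\<^bsub>KK\<^esub> cls D E i = cls D' E' i' \<cdot>\<^bsub>KK\<^esub> b"
    and 3: "cls E' (shift_complex A C') p' \<cdot>\<^bsub>KK\<^esub> k = K_shift A a \<cdot>\<^bsub>KK\<^esub> cls E (shift_complex A C) p"
    and Ys: "\<And>J. J \<in> Ys \<Longrightarrow> unshift J \<in> Ys"
  shows "pre_iso Ys E E' k"
proof (rule pre_isoI[OF k])
  interpret K: preadditive_category KK by (rule K_preadditive)
  define u v w where "u = cls C D f" and "v = cls D E i" and "w = cls E (shift_complex A C) p"
  define u' v' w' where "u' = cls C' D' f'" and "v' = cls D' E' i'" and "w' = cls E' (shift_complex A C') p'"
  note sa = pre_iso_shift[OF a Ys] and sb = pre_iso_shift[OF b Ys]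
  have Hom: "u \<in> Hom KK C D" "v \<in> Hom KK D E" "w \<in> Hom KK E (shift_complex A C)"
    "u' \<in> Hom KK C' D'" "v' \<in> Hom KK D' E'" "w' \<in> Hom KK E' (shift_complex A C')"
    "a \<in> Hom KK C C'" "b \<in> Hom KK D D'"
    using cone_arrows[OF c] cone_arrows[OF c'] a b
    by (simp_all add: u_def v_def w_def u'_def v'_def w'_def pre_iso_def)
  have sHom: "K_shift A a \<in> Hom KK (shift_complex A C) (shift_complex A C')"
    "K_shift A b \<in> Hom KK (shift_complex A D) (shift_complex A D')"
    "K_shift A u \<in> Hom KK (shift_complex A C) (shift_complex A D)"
    "K_shift A u' \<in> Hom KK (shift_complex A C') (shift_complex A D')"
    using Hom K_shift_Hom by blast+
  note eqs = 1[folded u_def u'_def] 2[folded v_def v'_def] 3[folded w_def w'_def]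
  have s1: "K_shift A b \<cdot>\<^bsub>KK\<^esub> K_shift A u = K_shift A u' \<cdot>\<^bsub>KK\<^esub> K_shift A a"
    using K_shift_Comp[OF Hom(1,8)] K_shift_Comp[OF Hom(7,4)] eqs(1) by simp
  note cx = coneD(1-5)[OF c] coneD(1-5)[OF c']
  note [simp] = Hom[unfolded Hom_def, simplified] sHom[unfolded Hom_def, simplified] k[unfolded Hom_def, simplified] cx
  fix J assume J: "J \<in> Ys"
  show "\<exists>y \<in> Hom KK E' J. y \<cdot>\<^bsub>KK\<^esub> k = e" if e: "e \<in> Hom KK E J" for e
  proof -
    note [simp] = e[unfolded Hom_def, simplified] KK_Obj[OF e]
    have "e \<cdot>\<^bsub>KK\<^esub> v \<in> Hom KK D J" by (simp add: Hom_def)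
    then obtain d where d: "d \<in> Hom KK D' J" "d \<cdot>\<^bsub>KK\<^esub> b = e \<cdot>\<^bsub>KK\<^esub> v"
      using b J unfolding pre_iso_def by blast
    note [simp] = d(1)[unfolded Hom_def, simplified]
    have "(d \<cdot>\<^bsub>KK\<^esub> u') \<cdot>\<^bsub>KK\<^esub> a = (d \<cdot>\<^bsub>KK\<^esub> b) \<cdot>\<^bsub>KK\<^esub> u" using eqs(1) by simp
    also have "\<dots> = Zero KK C J" using KK_cone_null(1)[OF c, folded u_def v_def] unfolding d(2) by simp
    also have "\<dots> = Zero KK C' J \<cdot>\<^bsub>KK\<^esub> a" by simp
    finally have "d \<cdot>\<^bsub>KK\<^esub> u' = Zero KK C' J"
      using a J unfolding pre_iso_def by (auto simp: Hom_def)
    from KK_cone_extend[OF c' d(1) this[unfolded u'_def], folded v'_def] obtain e' where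
      e': "e' \<in> Hom KK E' J" "e' \<cdot>\<^bsub>KK\<^esub> v' = d" by (rule bexE) (rule that)
    note [simp] = e'(1)[unfolded Hom_def, simplified]
    have ekv: "e' \<cdot>\<^bsub>KK\<^esub> (k \<cdot>\<^bsub>KK\<^esub> v) = e \<cdot>\<^bsub>KK\<^esub> v"
      using K.Comp_reassoc[OF e'(2), of b] d(2) by (simp add: eqs(2))
    define g where "g = e \<uplus>\<^bsub>KK\<^esub> Neg KK (e' \<cdot>\<^bsub>KK\<^esub> k)"
    have g: "g \<in> Hom KK E J" "g \<cdot>\<^bsub>KK\<^esub> v = Zero KK D J"
      using ekv by (simp_all add: g_def Hom_def)
    note [simp] = g(1)[unfolded Hom_def, simplified]
    obtain z where z: "z \<in> Hom KK (shift_complex A C) J" "z \<cdot>\<^bsub>KK\<^esub> w = g"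
      using KK_cone_factor[OF c g[unfolded v_def], folded w_def] by (rule bexE) (rule that)
    note [simp] = z(1)[unfolded Hom_def, simplified]
    obtain z' where z': "z' \<in> Hom KK (shift_complex A C') J" "z' \<cdot>\<^bsub>KK\<^esub> K_shift A a = z"
      using sa z(1) J unfolding pre_iso_def by blast
    note [simp] = z'(1)[unfolded Hom_def, simplified]
    have "z' \<cdot>\<^bsub>KK\<^esub> (w' \<cdot>\<^bsub>KK\<^esub> k) = g"
      using K.Comp_reassoc[OF z'(2), of w] z(2) by (simp add: eqs(3))
    then have "(e' \<uplus>\<^bsub>KK\<^esub> (z' \<cdot>\<^bsub>KK\<^esub> w')) \<cdot>\<^bsub>KK\<^esub> k = (e' \<cdot>\<^bsub>KK\<^esub> k) \<uplus>\<^bsub>KK\<^esub> g" by simp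
    also have "\<dots> = e" unfolding g_def
      by (rule K.lin_eqI, (rule K.lin_intros | simp)+)
    finally show ?thesis by (intro bexI[of _ "e' \<uplus>\<^bsub>KK\<^esub> (z' \<cdot>\<^bsub>KK\<^esub> w')"]) (simp_all add: Hom_def)
  qed
  show "y = Zero KK E' J" if y: "y \<in> Hom KK E' J" "y \<cdot>\<^bsub>KK\<^esub> k = Zero KK E J" for y
  proof -
    note [simp] = y(1)[unfolded Hom_def, simplified] KK_Obj[OF y(1)]
    have "(y \<cdot>\<^bsub>KK\<^esub> v') \<cdot>\<^bsub>KK\<^esub> b = (y \<cdot>\<^bsub>KK\<^esub> k) \<cdot>\<^bsub>KK\<^esub> v" using eqs(2) by simp
    also have "\<dots> = Zero KK D' J \<cdot>\<^bsub>KK\<^esub> b" unfolding y(2) by simp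
    finally have "y \<cdot>\<^bsub>KK\<^esub> v' = Zero KK D' J"
      using b J unfolding pre_iso_def by (auto simp: Hom_def)
    from KK_cone_factor[OF c' y(1) this[unfolded v'_def], folded w'_def]
    obtain z where z: "z \<in> Hom KK (shift_complex A C') J" "z \<cdot>\<^bsub>KK\<^esub> w' = y" by (rule bexE) (rule that)
    note [simp] = z(1)[unfolded Hom_def, simplified]
    have "(z \<cdot>\<^bsub>KK\<^esub> K_shift A a) \<cdot>\<^bsub>KK\<^esub> w = (z \<cdot>\<^bsub>KK\<^esub> w') \<cdot>\<^bsub>KK\<^esub> k" using eqs(3) by simp
    also have "\<dots> = Zero KK E J" unfolding z(2) y(2) ..
    finally have "(z \<cdot>\<^bsub>KK\<^esub> K_shift A a) \<cdot>\<^bsub>KK\<^esub> w = Zero KK E J" .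
    moreover have "z \<cdot>\<^bsub>KK\<^esub> K_shift A a \<in> Hom KK (shift_complex A C) J" by (simp add: Hom_def)
    ultimately have "\<exists>m \<in> Hom KK (shift_complex A D) J. z \<cdot>\<^bsub>KK\<^esub> K_shift A a = m \<cdot>\<^bsub>KK\<^esub> K_shift A u"
      using KK_cone_shift_factor[OF c, folded u_def w_def] by simp
    then obtain m where m: "m \<in> Hom KK (shift_complex A D) J" "z \<cdot>\<^bsub>KK\<^esub> K_shift A a = m \<cdot>\<^bsub>KK\<^esub> K_shift A u"
      by (rule bexE) (rule that)
    obtain m' where m': "m' \<in> Hom KK (shift_complex A D') J" "m' \<cdot>\<^bsub>KK\<^esub> K_shift A b = m"
      using sb m(1) J unfolding pre_iso_def by blast
    note [simp] = m'(1)[unfolded Hom_def, simplified]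
    have "(m' \<cdot>\<^bsub>KK\<^esub> K_shift A u') \<cdot>\<^bsub>KK\<^esub> K_shift A a = (m' \<cdot>\<^bsub>KK\<^esub> K_shift A b) \<cdot>\<^bsub>KK\<^esub> K_shift A u"
      using s1 by simp
    also have "\<dots> = z \<cdot>\<^bsub>KK\<^esub> K_shift A a" unfolding m'(2) m(2) ..
    finally have "(m' \<cdot>\<^bsub>KK\<^esub> K_shift A u') \<cdot>\<^bsub>KK\<^esub> K_shift A a = z \<cdot>\<^bsub>KK\<^esub> K_shift A a" .
    moreover have "m' \<cdot>\<^bsub>KK\<^esub> K_shift A u' \<in> Hom KK (shift_complex A C') J" by (simp add: Hom_def)
    ultimately have "m' \<cdot>\<^bsub>KK\<^esub> K_shift A u' = z"
      using sa J z(1) unfolding pre_iso_def by blast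
    then have "y = (m' \<cdot>\<^bsub>KK\<^esub> K_shift A u') \<cdot>\<^bsub>KK\<^esub> w'" by (simp only: z(2))
    also have "\<dots> = m' \<cdot>\<^bsub>KK\<^esub> (K_shift A u' \<cdot>\<^bsub>KK\<^esub> w')" by simp
    also have "K_shift A u' \<cdot>\<^bsub>KK\<^esub> w' = Zero KK E' (shift_complex A D')"
      unfolding u'_def w'_def by (rule KK_cone_null(2)[OF c'])
    finally show ?thesis by simp
  qed
qed


lemma K_sel [simp]:
  "Obj (K A X) = dw A X" "Arr (K A X) = Arr (K_preadd A X)" "Dom (K A X) = Dom KK" "Cod (K A X) = Cod KK"
  "Ide (K A X) = Ide KK" "Comp (K A X) = Comp KK" "Add (K A X) = Add KK" "Zero (K A X) = Zero KK"
  "ShiftO (K A X) = shift_complex A" "ShiftM (K A X) = K_shift A" "Triangles (K A X) = K_triangles A X"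
  by (simp_all add: K_def K_preadd_def preadd_category.defs triang_category.defs)

lemma K_preadd_sel:
  "Dom (K_preadd A X) = Dom KK" "Cod (K_preadd A X) = Cod KK"
  "Ide (K_preadd A X) = Ide KK" "Comp (K_preadd A X) = Comp KK" 
  by (simp_all add: K_preadd_def)

lemma K_Hom_full: "F \<in> Hom (K_preadd A X) C D \<longleftrightarrow> C \<in> dw A X \<and> D \<in> dw A X \<and> F \<in> Hom KK C D"
  by (auto simp: K_Hom_iff dwD)

lemma K_Hom [simp]: "Hom (K A X) C D = Hom (K_preadd A X) C D"
  by (simp add: Hom_def K_preadd_sel[of X])

lemma is_iso_K: "is_iso (K A X) F \<longleftrightarrow> is_iso (K_preadd A X) F"
  by (simp add: is_iso_def K_preadd_sel[of X])

lemma is_iso_KI: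
  assumes "F \<in> Hom KK C D" "G \<in> Hom KK D C" "C \<in> dw A X" "D \<in> dw A X"
    "G \<cdot>\<^bsub>KK\<^esub> F = Ide KK C" "F \<cdot>\<^bsub>KK\<^esub> G = Ide KK D"
  shows "is_iso (K_preadd A X) F"
proof -
  have "F \<in> Hom (K_preadd A X) C D" "G \<in> Hom (K_preadd A X) D C" using assms by (simp_all add: K_Hom_full[of _ X])
  moreover have "Dom KK F = C" "Cod KK F = D" using assms(1) by (simp_all add: Hom_def)
  moreover have "F \<in> Arr (K_preadd A X)" using calculation(1) by (simp add: Hom_def)
  ultimately show ?thesis
    unfolding is_iso_def K_preadd_sel[of X] using assms(5,6) by (intro conjI bexI[of _ G]) simp_all
qed

lemma is_iso_KE:
  assumes "is_iso (K_preadd A X) F" "F \<in> Hom KK C D"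
  obtains G where "G \<in> Hom KK D C" "G \<cdot>\<^bsub>KK\<^esub> F = Ide KK C" "F \<cdot>\<^bsub>KK\<^esub> G = Ide KK D" "C \<in> dw A X" "D \<in> dw A X"
proof -
  have DC: "Dom KK F = C" "Cod KK F = D" using assms(2) by (simp_all add: Hom_def)
  obtain G where "G \<in> Hom (K_preadd A X) D C" "G \<cdot>\<^bsub>KK\<^esub> F = Ide KK C" "F \<cdot>\<^bsub>KK\<^esub> G = Ide KK D"
    using assms(1) unfolding is_iso_def K_preadd_sel[of X] DC by (elim conjE bexE)
  then show thesis by (intro that[of G]) (simp_all add: K_Hom_full[of _ X])
qed

lemma KK_assoc:
  "\<lbrakk>f \<in> Hom KK a b; g \<in> Hom KK b c; h \<in> Hom KK c d\<rbrakk> \<Longrightarrow> (h \<cdot>\<^bsub>KK\<^esub> g) \<cdot>\<^bsub>KK\<^esub> f = h \<cdot>\<^bsub>KK\<^esub> (g \<cdot>\<^bsub>KK\<^esub> f)"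
  by (rule category.Comp_assoc[OF K_category])

lemma KK_Ide_left: "f \<in> Hom KK a b \<Longrightarrow> Ide KK b \<cdot>\<^bsub>KK\<^esub> f = f"
  and KK_Ide_right: "f \<in> Hom KK a b \<Longrightarrow> f \<cdot>\<^bsub>KK\<^esub> Ide KK a = f"
  by (rule category.Ide_left[OF K_category] category.Ide_right[OF K_category], assumption)+

lemma KK_Ide_Hom: "is_complex A C \<Longrightarrow> Ide KK C \<in> Hom KK C C"
  by (rule category.Ide_in_Hom[OF K_category]) simp

lemma K_Hom_dwI: "\<lbrakk>F \<in> Hom KK C D; C \<in> dw A X; D \<in> dw A X\<rbrakk> \<Longrightarrow> F \<in> Hom (K_preadd A X) C D"
  by (simp add: K_Hom_full[of _ X])

lemma pre_isoD:
  assumes "pre_iso Ys C D u" "J \<in> Ys"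
  shows "\<And>b. b \<in> Hom KK C J \<Longrightarrow> \<exists>a \<in> Hom KK D J. a \<cdot>\<^bsub>KK\<^esub> u = b"
    "\<And>a a'. \<lbrakk>a \<in> Hom KK D J; a' \<in> Hom KK D J; a \<cdot>\<^bsub>KK\<^esub> u = a' \<cdot>\<^bsub>KK\<^esub> u\<rbrakk> \<Longrightarrow> a = a'"
proof -
  have *: "(\<forall>b \<in> Hom KK C J. \<exists>a \<in> Hom KK D J. a \<cdot>\<^bsub>KK\<^esub> u = b) \<and>
     (\<forall>a \<in> Hom KK D J. \<forall>a' \<in> Hom KK D J. a \<cdot>\<^bsub>KK\<^esub> u = a' \<cdot>\<^bsub>KK\<^esub> u \<longrightarrow> a = a')"
    using assms unfolding pre_iso_def by (elim conjE) (erule bspec)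
  show "\<And>b. b \<in> Hom KK C J \<Longrightarrow> \<exists>a \<in> Hom KK D J. a \<cdot>\<^bsub>KK\<^esub> u = b"
    by (rule bspec[OF conjunct1[OF *]])
  show "\<And>a a'. \<lbrakk>a \<in> Hom KK D J; a' \<in> Hom KK D J; a \<cdot>\<^bsub>KK\<^esub> u = a' \<cdot>\<^bsub>KK\<^esub> u\<rbrakk> \<Longrightarrow> a = a'"
    by (rule mp[OF bspec[OF bspec[OF conjunct2[OF *]]]])
qed

lemma pre_ex: "\<lbrakk>pre_iso Ys C D u; J \<in> Ys; b \<in> Hom KK C J\<rbrakk> \<Longrightarrow> \<exists>a. a \<in> Hom KK D J \<and> a \<cdot>\<^bsub>KK\<^esub> u = b"
  using pre_isoD(1)[of Ys C D u J b] by (simp add: Bex_def)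

lemmas pre_uniq = pre_isoD(2)

lemma post_isoD:
  assumes "post_iso Xs C D u" "Q \<in> Xs"
  shows "\<And>b. b \<in> Hom KK Q D \<Longrightarrow> \<exists>a \<in> Hom KK Q C. u \<cdot>\<^bsub>KK\<^esub> a = b"
    "\<And>a a'. \<lbrakk>a \<in> Hom KK Q C; a' \<in> Hom KK Q C; u \<cdot>\<^bsub>KK\<^esub> a = u \<cdot>\<^bsub>KK\<^esub> a'\<rbrakk> \<Longrightarrow> a = a'"
proof -
  have *: "(\<forall>b \<in> Hom KK Q D. \<exists>a \<in> Hom KK Q C. u \<cdot>\<^bsub>KK\<^esub> a = b) \<and>
     (\<forall>a \<in> Hom KK Q C. \<forall>a' \<in> Hom KK Q C. u \<cdot>\<^bsub>KK\<^esub> a = u \<cdot>\<^bsub>KK\<^esub> a' \<longrightarrow> a = a')"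
    using assms unfolding post_iso_def by (elim conjE) (erule bspec)
  show "\<And>b. b \<in> Hom KK Q D \<Longrightarrow> \<exists>a \<in> Hom KK Q C. u \<cdot>\<^bsub>KK\<^esub> a = b"
    by (rule bspec[OF conjunct1[OF *]])
  show "\<And>a a'. \<lbrakk>a \<in> Hom KK Q C; a' \<in> Hom KK Q C; u \<cdot>\<^bsub>KK\<^esub> a = u \<cdot>\<^bsub>KK\<^esub> a'\<rbrakk> \<Longrightarrow> a = a'"
    by (rule mp[OF bspec[OF bspec[OF conjunct2[OF *]]]])
qed

lemma post_ex: "\<lbrakk>post_iso Xs C D u; Q \<in> Xs; b \<in> Hom KK Q D\<rbrakk> \<Longrightarrow> \<exists>a. a \<in> Hom KK Q C \<and> u \<cdot>\<^bsub>KK\<^esub> a = b"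
  using post_isoD(1)[of Xs C D u Q b] by (simp add: Bex_def)

lemmas post_uniq = post_isoD(2)

context
  fixes X Y :: "'o set" and FO :: "('o, 'm) chain_complex \<Rightarrow> ('o, 'm) chain_complex" and \<eta>
    and GO :: "('o, 'm) chain_complex \<Rightarrow> ('o, 'm) chain_complex" and \<theta>
  assumes FO: "\<And>P. P \<in> dw A X \<Longrightarrow> FO P \<in> dw A Y"
    and eta_pre: "\<And>P. P \<in> dw A X \<Longrightarrow> pre_iso (dw A Y) P (FO P) (\<eta> P)"
    and eta_post: "\<And>P. P \<in> dw A X \<Longrightarrow> post_iso (dw A X) P (FO P) (\<eta> P)"
    and GO: "\<And>J. J \<in> dw A Y \<Longrightarrow> GO J \<in> dw A X"
    and th_pre: "\<And>J. J \<in> dw A Y \<Longrightarrow> pre_iso (dw A Y) (GO J) J (\<theta> J)"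
    and th_post: "\<And>J. J \<in> dw A Y \<Longrightarrow> post_iso (dw A X) (GO J) J (\<theta> J)"
begin

lemma eta: "P \<in> dw A X \<Longrightarrow> \<eta> P \<in> Hom KK P (FO P)"
  by (rule conjunct1[OF eta_pre[unfolded pre_iso_def]])

lemma th: "J \<in> dw A Y \<Longrightarrow> \<theta> J \<in> Hom KK (GO J) J"
  by (rule conjunct1[OF th_pre[unfolded pre_iso_def]])

definition FM where
  "FM f = (SOME g. g \<in> Hom KK (FO (Dom KK f)) (FO (Cod KK f)) \<and> g \<cdot>\<^bsub>KK\<^esub> \<eta> (Dom KK f) = \<eta> (Cod KK f) \<cdot>\<^bsub>KK\<^esub> f)"

definition GM where
  "GM g = (SOME f. f \<in> Hom KK (GO (Dom KK g)) (GO (Cod KK g)) \<and> \<theta> (Cod KK g) \<cdot>\<^bsub>KK\<^esub> f = g \<cdot>\<^bsub>KK\<^esub> \<theta> (Dom KK g))"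

lemma FM:
  assumes "f \<in> Hom KK P Q" "P \<in> dw A X" "Q \<in> dw A X"
  shows "FM f \<in> Hom KK (FO P) (FO Q)" "FM f \<cdot>\<^bsub>KK\<^esub> \<eta> P = \<eta> Q \<cdot>\<^bsub>KK\<^esub> f"
proof -
  have "Dom KK f = P" "Cod KK f = Q" using assms(1) by (simp_all add: Hom_def)
  then have "FM f = (SOME g. g \<in> Hom KK (FO P) (FO Q) \<and> g \<cdot>\<^bsub>KK\<^esub> \<eta> P = \<eta> Q \<cdot>\<^bsub>KK\<^esub> f)" by (simp add: FM_def)
  moreover have "\<exists>g. g \<in> Hom KK (FO P) (FO Q) \<and> g \<cdot>\<^bsub>KK\<^esub> \<eta> P = \<eta> Q \<cdot>\<^bsub>KK\<^esub> f"
    by (rule pre_ex[OF eta_pre FO KK_HomI[OF assms(1) eta]]) (use assms in simp_all)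
  ultimately show "FM f \<in> Hom KK (FO P) (FO Q)" "FM f \<cdot>\<^bsub>KK\<^esub> \<eta> P = \<eta> Q \<cdot>\<^bsub>KK\<^esub> f"
    using someI_ex[of "\<lambda>g. g \<in> Hom KK (FO P) (FO Q) \<and> g \<cdot>\<^bsub>KK\<^esub> \<eta> P = \<eta> Q \<cdot>\<^bsub>KK\<^esub> f"] by simp_all
qed

lemma FM_eqI:
  assumes "f \<in> Hom KK P Q" "P \<in> dw A X" "Q \<in> dw A X" "g \<in> Hom KK (FO P) (FO Q)" "g \<cdot>\<^bsub>KK\<^esub> \<eta> P = \<eta> Q \<cdot>\<^bsub>KK\<^esub> f"
  shows "FM f = g"
  by (rule pre_uniq[OF eta_pre[OF assms(2)] FO[OF assms(3)]]) (use FM[OF assms(1-3)] assms in simp_all)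

lemma GM:
  assumes "g \<in> Hom KK I J" "I \<in> dw A Y" "J \<in> dw A Y"
  shows "GM g \<in> Hom KK (GO I) (GO J)" "\<theta> J \<cdot>\<^bsub>KK\<^esub> GM g = g \<cdot>\<^bsub>KK\<^esub> \<theta> I"
proof -
  have "Dom KK g = I" "Cod KK g = J" using assms(1) by (simp_all add: Hom_def)
  then have "GM g = (SOME f. f \<in> Hom KK (GO I) (GO J) \<and> \<theta> J \<cdot>\<^bsub>KK\<^esub> f = g \<cdot>\<^bsub>KK\<^esub> \<theta> I)" by (simp add: GM_def)
  moreover have "\<exists>f. f \<in> Hom KK (GO I) (GO J) \<and> \<theta> J \<cdot>\<^bsub>KK\<^esub> f = g \<cdot>\<^bsub>KK\<^esub> \<theta> I"
    by (rule post_ex[OF th_post GO KK_HomI[OF th assms(1)]]) (use assms in simp_all)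
  ultimately show "GM g \<in> Hom KK (GO I) (GO J)" "\<theta> J \<cdot>\<^bsub>KK\<^esub> GM g = g \<cdot>\<^bsub>KK\<^esub> \<theta> I"
    using someI_ex[of "\<lambda>f. f \<in> Hom KK (GO I) (GO J) \<and> \<theta> J \<cdot>\<^bsub>KK\<^esub> f = g \<cdot>\<^bsub>KK\<^esub> \<theta> I"] by simp_all
qed

lemma GM_eqI:
  assumes "g \<in> Hom KK I J" "I \<in> dw A Y" "J \<in> dw A Y" "f \<in> Hom KK (GO I) (GO J)" "\<theta> J \<cdot>\<^bsub>KK\<^esub> f = g \<cdot>\<^bsub>KK\<^esub> \<theta> I"
  shows "GM g = f"
  by (rule post_uniq[OF th_post[OF assms(3)] GO[OF assms(2)]]) (use GM[OF assms(1-3)] assms in simp_all)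

lemma FM_Comp:
  assumes f: "f \<in> Hom KK P Q" and g: "g \<in> Hom KK Q R" and dw: "P \<in> dw A X" "Q \<in> dw A X" "R \<in> dw A X"
  shows "FM (g \<cdot>\<^bsub>KK\<^esub> f) = FM g \<cdot>\<^bsub>KK\<^esub> FM f"
proof (rule FM_eqI[OF KK_HomI[OF f g] dw(1,3)])
  note F = FM[OF f dw(1,2)] and G = FM[OF g dw(2,3)]
  show "FM g \<cdot>\<^bsub>KK\<^esub> FM f \<in> Hom KK (FO P) (FO R)" by (rule KK_HomI[OF F(1) G(1)])
  have "(FM g \<cdot>\<^bsub>KK\<^esub> FM f) \<cdot>\<^bsub>KK\<^esub> \<eta> P = FM g \<cdot>\<^bsub>KK\<^esub> (\<eta> Q \<cdot>\<^bsub>KK\<^esub> f)"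
    using KK_assoc[OF eta[OF dw(1)] F(1) G(1)] F(2) by simp
  also have "\<dots> = (\<eta> R \<cdot>\<^bsub>KK\<^esub> g) \<cdot>\<^bsub>KK\<^esub> f"
    using KK_assoc[OF f eta[OF dw(2)] G(1)] G(2) by simp
  also have "\<dots> = \<eta> R \<cdot>\<^bsub>KK\<^esub> (g \<cdot>\<^bsub>KK\<^esub> f)" by (rule KK_assoc[OF f g eta[OF dw(3)]])
  finally show "(FM g \<cdot>\<^bsub>KK\<^esub> FM f) \<cdot>\<^bsub>KK\<^esub> \<eta> P = \<eta> R \<cdot>\<^bsub>KK\<^esub> (g \<cdot>\<^bsub>KK\<^esub> f)" .
qed

lemma FM_Ide: "P \<in> dw A X \<Longrightarrow> FM (Ide KK P) = Ide KK (FO P)"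
  by (rule FM_eqI, rule KK_Ide_Hom, erule dwD, assumption+, rule KK_Ide_Hom, rule dwD, erule FO,
      rule trans[OF KK_Ide_left KK_Ide_right[symmetric]]; erule eta)

lemma FM_Add:
  assumes f: "f \<in> Hom KK P Q" and g: "g \<in> Hom KK P Q" and dw: "P \<in> dw A X" "Q \<in> dw A X"
  shows "FM (f \<uplus>\<^bsub>KK\<^esub> g) = FM f \<uplus>\<^bsub>KK\<^esub> FM g"
proof -
  interpret K: preadditive_category KK by (rule K_preadditive)
  note F = FM[OF f dw] and G = FM[OF g dw]
  note [simp] = f[unfolded Hom_def, simplified] g[unfolded Hom_def, simplified] F(1)[unfolded Hom_def, simplified]
    G(1)[unfolded Hom_def, simplified] eta[OF dw(1), unfolded Hom_def, simplified] eta[OF dw(2), unfolded Hom_def, simplified]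
  show ?thesis by (rule FM_eqI[OF _ dw]) (simp_all add: Hom_def F(2) G(2))
qed

lemma GM_Comp:
  assumes f: "f \<in> Hom KK I J" and g: "g \<in> Hom KK J L" and dw: "I \<in> dw A Y" "J \<in> dw A Y" "L \<in> dw A Y"
  shows "GM (g \<cdot>\<^bsub>KK\<^esub> f) = GM g \<cdot>\<^bsub>KK\<^esub> GM f"
proof (rule GM_eqI[OF KK_HomI[OF f g] dw(1,3)])
  note F = GM[OF f dw(1,2)] and G = GM[OF g dw(2,3)]
  show "GM g \<cdot>\<^bsub>KK\<^esub> GM f \<in> Hom KK (GO I) (GO L)" by (rule KK_HomI[OF F(1) G(1)])
  have "\<theta> L \<cdot>\<^bsub>KK\<^esub> (GM g \<cdot>\<^bsub>KK\<^esub> GM f) = (g \<cdot>\<^bsub>KK\<^esub> \<theta> J) \<cdot>\<^bsub>KK\<^esub> GM f"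
    using KK_assoc[OF F(1) G(1) th[OF dw(3)]] G(2) by simp
  also have "\<dots> = g \<cdot>\<^bsub>KK\<^esub> (f \<cdot>\<^bsub>KK\<^esub> \<theta> I)"
    using KK_assoc[OF F(1) th[OF dw(2)] g] F(2) by simp
  also have "\<dots> = (g \<cdot>\<^bsub>KK\<^esub> f) \<cdot>\<^bsub>KK\<^esub> \<theta> I" by (rule KK_assoc[OF th[OF dw(1)] f g, symmetric])
  finally show "\<theta> L \<cdot>\<^bsub>KK\<^esub> (GM g \<cdot>\<^bsub>KK\<^esub> GM f) = (g \<cdot>\<^bsub>KK\<^esub> f) \<cdot>\<^bsub>KK\<^esub> \<theta> I" .
qed

lemma GM_Ide: "I \<in> dw A Y \<Longrightarrow> GM (Ide KK I) = Ide KK (GO I)"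
  by (rule GM_eqI, rule KK_Ide_Hom, erule dwD, assumption+, rule KK_Ide_Hom, rule dwD, erule GO,
      rule trans[OF KK_Ide_right KK_Ide_left[symmetric]]; erule th)

lemma functor_F: "is_functor (K A X) (K A Y) FO FM"
  unfolding is_functor_def K_sel K_Hom
  by (intro conjI allI ballI; ((drule iffD1[OF K_Hom_full])+)?; (elim conjE)?; (rule K_Hom_dwI)?; (rule FO FM(1) FM_Ide FM_Comp; assumption)?)

lemma functor_G: "is_functor (K A Y) (K A X) GO GM"
  unfolding is_functor_def K_sel K_Hom
  by (intro conjI allI ballI; ((drule iffD1[OF K_Hom_full])+)?; (elim conjE)?; (rule K_Hom_dwI)?; (rule GO GM(1) GM_Ide GM_Comp; assumption)?)

lemma equivalence_F: "is_equivalence (K A X) (K A Y) FO FM"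
proof -
  have "\<exists>n. n \<in> Hom KK P (GO (FO P)) \<and> \<theta> (FO P) \<cdot>\<^bsub>KK\<^esub> n = \<eta> P" if "P \<in> dw A X" for P
    by (rule post_ex[OF th_post[OF FO[OF that]] that eta[OF that]])
  then have "\<forall>P \<in> dw A X. \<exists>n. n \<in> Hom KK P (GO (FO P)) \<and> \<theta> (FO P) \<cdot>\<^bsub>KK\<^esub> n = \<eta> P" by (intro ballI)
  from bchoice[OF this] obtain \<nu> where
    \<nu>: "\<forall>P \<in> dw A X. \<nu> P \<in> Hom KK P (GO (FO P)) \<and> \<theta> (FO P) \<cdot>\<^bsub>KK\<^esub> \<nu> P = \<eta> P" by (rule exE)
  have nu: "\<nu> P \<in> Hom KK P (GO (FO P))" "\<theta> (FO P) \<cdot>\<^bsub>KK\<^esub> \<nu> P = \<eta> P" if "P \<in> dw A X" for P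
    using bspec[OF \<nu> that] by simp_all
  have nu_iso: "is_iso (K_preadd A X) (\<nu> P)" if P: "P \<in> dw A X" for P
  proof -
    obtain m where m: "m \<in> Hom KK (GO (FO P)) P" "\<eta> P \<cdot>\<^bsub>KK\<^esub> m = \<theta> (FO P)"
      using post_ex[OF eta_post[OF P] GO[OF FO[OF P]] th[OF FO[OF P]]] by (elim exE conjE) (rule that)
    note n = nu[OF P] and t = th[OF FO[OF P]] and e = eta[OF P]
    have c: "is_complex A P" "is_complex A (GO (FO P))" by (rule dwD[OF P] dwD[OF GO[OF FO[OF P]]])+
    have "\<theta> (FO P) \<cdot>\<^bsub>KK\<^esub> (\<nu> P \<cdot>\<^bsub>KK\<^esub> m) = \<theta> (FO P) \<cdot>\<^bsub>KK\<^esub> Ide KK (GO (FO P))"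
      using KK_assoc[OF m(1) n(1) t] n(2) m(2) KK_Ide_right[OF t] by simp
    note e1 = this
    have 1: "\<nu> P \<cdot>\<^bsub>KK\<^esub> m = Ide KK (GO (FO P))"
      by (rule post_uniq[OF th_post[OF FO[OF P]] GO[OF FO[OF P]] KK_HomI[OF m(1) n(1)] KK_Ide_Hom[OF c(2)] e1])
    have "\<eta> P \<cdot>\<^bsub>KK\<^esub> (m \<cdot>\<^bsub>KK\<^esub> \<nu> P) = \<eta> P \<cdot>\<^bsub>KK\<^esub> Ide KK P"
      using KK_assoc[OF n(1) m(1) e] n(2) m(2) KK_Ide_right[OF e] by simp
    note e1 = this
    have 2: "m \<cdot>\<^bsub>KK\<^esub> \<nu> P = Ide KK P"
      by (rule post_uniq[OF eta_post[OF P] P KK_HomI[OF n(1) m(1)] KK_Ide_Hom[OF c(1)] e1])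
    show ?thesis by (rule is_iso_KI[OF n(1) m(1) P GO[OF FO[OF P]] 2 1])
  qed
  have nu_nat: "\<nu> Q \<cdot>\<^bsub>KK\<^esub> f = GM (FM f) \<cdot>\<^bsub>KK\<^esub> \<nu> P" if f: "f \<in> Hom KK P Q" and P: "P \<in> dw A X" and Q: "Q \<in> dw A X" for f P Q
  proof -
    note F = FM[OF f P Q] and G = GM[OF FM(1)[OF f P Q] FO[OF P] FO[OF Q]]
    note n = nu[OF P] nu[OF Q] and t = th[OF FO[OF P]] th[OF FO[OF Q]]
    have "\<theta> (FO Q) \<cdot>\<^bsub>KK\<^esub> (\<nu> Q \<cdot>\<^bsub>KK\<^esub> f) = FM f \<cdot>\<^bsub>KK\<^esub> \<eta> P"
      using KK_assoc[OF f n(3) t(2)] n(4) F(2) by simp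
    also have "\<dots> = (FM f \<cdot>\<^bsub>KK\<^esub> \<theta> (FO P)) \<cdot>\<^bsub>KK\<^esub> \<nu> P"
      using KK_assoc[OF n(1) t(1) F(1)] n(2) by simp
    also have "\<dots> = \<theta> (FO Q) \<cdot>\<^bsub>KK\<^esub> (GM (FM f) \<cdot>\<^bsub>KK\<^esub> \<nu> P)"
      using KK_assoc[OF n(1) G(1) t(2)] G(2) by simp
    finally show ?thesis
      by (rule post_uniq[OF th_post[OF FO[OF Q]] P KK_HomI[OF f n(3)] KK_HomI[OF n(1) G(1)]])
  qed
  have "\<exists>n. n \<in> Hom KK (FO (GO J)) J \<and> n \<cdot>\<^bsub>KK\<^esub> \<eta> (GO J) = \<theta> J" if "J \<in> dw A Y" for J
    by (rule pre_ex[OF eta_pre[OF GO[OF that]] that th[OF that]])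
  then have "\<forall>J \<in> dw A Y. \<exists>n. n \<in> Hom KK (FO (GO J)) J \<and> n \<cdot>\<^bsub>KK\<^esub> \<eta> (GO J) = \<theta> J" by (intro ballI)
  from bchoice[OF this] obtain \<epsilon> where
    \<epsilon>: "\<forall>J \<in> dw A Y. \<epsilon> J \<in> Hom KK (FO (GO J)) J \<and> \<epsilon> J \<cdot>\<^bsub>KK\<^esub> \<eta> (GO J) = \<theta> J" by (rule exE)
  have ep: "\<epsilon> J \<in> Hom KK (FO (GO J)) J" "\<epsilon> J \<cdot>\<^bsub>KK\<^esub> \<eta> (GO J) = \<theta> J" if "J \<in> dw A Y" for J
    using bspec[OF \<epsilon> that] by simp_all
  have ep_iso: "is_iso (K_preadd A Y) (\<epsilon> J)" if J: "J \<in> dw A Y" for J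
  proof -
    obtain m where m: "m \<in> Hom KK J (FO (GO J))" "m \<cdot>\<^bsub>KK\<^esub> \<theta> J = \<eta> (GO J)"
      using pre_ex[OF th_pre[OF J] FO[OF GO[OF J]] eta[OF GO[OF J]]] by (elim exE conjE) (rule that)
    note n = ep[OF J] and t = eta[OF GO[OF J]] and e = th[OF J]
    have c: "is_complex A J" "is_complex A (FO (GO J))" by (rule dwD[OF J] dwD[OF FO[OF GO[OF J]]])+
    have "(m \<cdot>\<^bsub>KK\<^esub> \<epsilon> J) \<cdot>\<^bsub>KK\<^esub> \<eta> (GO J) = Ide KK (FO (GO J)) \<cdot>\<^bsub>KK\<^esub> \<eta> (GO J)"
      using KK_assoc[OF t n(1) m(1)] n(2) m(2) KK_Ide_left[OF t] by simp
    note e1 = this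
    have 1: "m \<cdot>\<^bsub>KK\<^esub> \<epsilon> J = Ide KK (FO (GO J))"
      by (rule pre_uniq[OF eta_pre[OF GO[OF J]] FO[OF GO[OF J]] KK_HomI[OF n(1) m(1)] KK_Ide_Hom[OF c(2)] e1])
    have "(\<epsilon> J \<cdot>\<^bsub>KK\<^esub> m) \<cdot>\<^bsub>KK\<^esub> \<theta> J = Ide KK J \<cdot>\<^bsub>KK\<^esub> \<theta> J"
      using KK_assoc[OF e m(1) n(1)] n(2) m(2) KK_Ide_left[OF e] by simp
    note e1 = this
    have 2: "\<epsilon> J \<cdot>\<^bsub>KK\<^esub> m = Ide KK J"
      by (rule pre_uniq[OF th_pre[OF J] J KK_HomI[OF m(1) n(1)] KK_Ide_Hom[OF c(1)] e1])
    show ?thesis by (rule is_iso_KI[OF n(1) m(1) FO[OF GO[OF J]] J 1 2])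
  qed
  have ep_nat: "\<epsilon> J \<cdot>\<^bsub>KK\<^esub> FM (GM g) = g \<cdot>\<^bsub>KK\<^esub> \<epsilon> I" if g: "g \<in> Hom KK I J" and I: "I \<in> dw A Y" and J: "J \<in> dw A Y" for g I J
  proof -
    note G = GM[OF g I J] and F = FM[OF GM(1)[OF g I J] GO[OF I] GO[OF J]]
    note n = ep[OF I] ep[OF J] and t = eta[OF GO[OF I]] eta[OF GO[OF J]]
    have "(\<epsilon> J \<cdot>\<^bsub>KK\<^esub> FM (GM g)) \<cdot>\<^bsub>KK\<^esub> \<eta> (GO I) = \<epsilon> J \<cdot>\<^bsub>KK\<^esub> (\<eta> (GO J) \<cdot>\<^bsub>KK\<^esub> GM g)"
      using KK_assoc[OF t(1) F(1) n(3)] F(2) by simp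
    also have "\<dots> = g \<cdot>\<^bsub>KK\<^esub> \<theta> I"
      using KK_assoc[OF G(1) t(2) n(3)] n(4) G(2) by simp
    also have "\<dots> = (g \<cdot>\<^bsub>KK\<^esub> \<epsilon> I) \<cdot>\<^bsub>KK\<^esub> \<eta> (GO I)"
      using KK_assoc[OF t(1) n(1) g] n(2) by simp
    finally show ?thesis
      by (rule pre_uniq[OF eta_pre[OF GO[OF I]] J KK_HomI[OF F(1) n(3)] KK_HomI[OF n(1) g]])
  qed
  have "is_natural_iso (K A X) (K A X) (\<lambda>a. a) (\<lambda>f. f) (GO \<circ> FO) (GM \<circ> FM) \<nu>"
    unfolding is_natural_iso_def K_sel K_Hom is_iso_K comp_apply
    by (intro conjI allI ballI; ((drule iffD1[OF K_Hom_full])+)?; (elim conjE)?; (rule K_Hom_dwI)?; (rule nu(1) nu_iso nu_nat GO FO; (intro FO)?; assumption)?)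
  moreover have "is_natural_iso (K A Y) (K A Y) (FO \<circ> GO) (FM \<circ> GM) (\<lambda>b. b) (\<lambda>g. g) \<epsilon>"
    unfolding is_natural_iso_def K_sel K_Hom is_iso_K comp_apply
    by (intro conjI allI ballI; ((drule iffD1[OF K_Hom_full])+)?; (elim conjE)?; (rule K_Hom_dwI)?; (rule ep(1) ep_iso ep_nat GO FO; (intro GO)?; assumption)?)
  ultimately show ?thesis
    unfolding is_equivalence_def using functor_F functor_G by (intro conjI exI)
qed

definition \<phi> where
  "\<phi> P = (SOME s. s \<in> Hom KK (FO (shift_complex A P)) (shift_complex A (FO P)) \<and>
     s \<cdot>\<^bsub>KK\<^esub> \<eta> (shift_complex A P) = K_shift A (\<eta> P))"

lemma phi:
  assumes "P \<in> dw A X"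
  shows "\<phi> P \<in> Hom KK (FO (shift_complex A P)) (shift_complex A (FO P))"
    "\<phi> P \<cdot>\<^bsub>KK\<^esub> \<eta> (shift_complex A P) = K_shift A (\<eta> P)"
proof -
  have "\<exists>s. s \<in> Hom KK (FO (shift_complex A P)) (shift_complex A (FO P)) \<and>
     s \<cdot>\<^bsub>KK\<^esub> \<eta> (shift_complex A P) = K_shift A (\<eta> P)"
    by (rule pre_ex[OF eta_pre[OF shift_dw[OF assms]] shift_dw[OF FO[OF assms]] K_shift_Hom[OF eta[OF assms]]])
  from someI_ex[OF this]
  show "\<phi> P \<in> Hom KK (FO (shift_complex A P)) (shift_complex A (FO P))"
    "\<phi> P \<cdot>\<^bsub>KK\<^esub> \<eta> (shift_complex A P) = K_shift A (\<eta> P)" unfolding \<phi>_def by simp_all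
qed

lemma eta_shift_pre: "P \<in> dw A X \<Longrightarrow> pre_iso (dw A Y) (shift_complex A P) (shift_complex A (FO P)) (K_shift A (\<eta> P))"
  by (rule pre_iso_shift[OF eta_pre unshift_dw])

lemma phi_iso:
  assumes P: "P \<in> dw A X"
  shows "is_iso (K_preadd A Y) (\<phi> P)"
proof -
  let ?S = "shift_complex A"
  note SP = shift_dw[OF P] and SF = shift_dw[OF FO[OF P]] and FS = FO[OF shift_dw[OF P]]
  note n = phi[OF P] and t = eta[OF SP] and e = K_shift_Hom[OF eta[OF P]]
  obtain m where m: "m \<in> Hom KK (?S (FO P)) (FO (?S P))" "m \<cdot>\<^bsub>KK\<^esub> K_shift A (\<eta> P) = \<eta> (?S P)"
    using pre_ex[OF eta_shift_pre[OF P] FS t] by (elim exE conjE) (rule that)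
  have e1: "(m \<cdot>\<^bsub>KK\<^esub> \<phi> P) \<cdot>\<^bsub>KK\<^esub> \<eta> (?S P) = Ide KK (FO (?S P)) \<cdot>\<^bsub>KK\<^esub> \<eta> (?S P)"
    using KK_assoc[OF t n(1) m(1)] n(2) m(2) KK_Ide_left[OF t] by simp
  have 1: "m \<cdot>\<^bsub>KK\<^esub> \<phi> P = Ide KK (FO (?S P))"
    by (rule pre_uniq[OF eta_pre[OF SP] FS KK_HomI[OF n(1) m(1)] KK_Ide_Hom[OF dwD[OF FS]] e1])
  have e2: "(\<phi> P \<cdot>\<^bsub>KK\<^esub> m) \<cdot>\<^bsub>KK\<^esub> K_shift A (\<eta> P) = Ide KK (?S (FO P)) \<cdot>\<^bsub>KK\<^esub> K_shift A (\<eta> P)"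
    using KK_assoc[OF e m(1) n(1)] n(2) m(2) KK_Ide_left[OF e] by simp
  have 2: "\<phi> P \<cdot>\<^bsub>KK\<^esub> m = Ide KK (?S (FO P))"
    by (rule pre_uniq[OF eta_shift_pre[OF P] SF KK_HomI[OF m(1) n(1)] KK_Ide_Hom[OF dwD[OF SF]] e2])
  show ?thesis by (rule is_iso_KI[OF n(1) m(1) FS SF 1 2])
qed

lemma phi_natural:
  assumes f: "f \<in> Hom KK P Q" and P: "P \<in> dw A X" and Q: "Q \<in> dw A X"
  shows "\<phi> Q \<cdot>\<^bsub>KK\<^esub> FM (K_shift A f) = K_shift A (FM f) \<cdot>\<^bsub>KK\<^esub> \<phi> P"
proof -
  let ?S = "shift_complex A"
  note sf = K_shift_Hom[OF f] and F = FM[OF f P Q]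
  note G = FM[OF sf shift_dw[OF P] shift_dw[OF Q]] and sF = K_shift_Hom[OF F(1)]
  note t = eta[OF shift_dw[OF P]] eta[OF shift_dw[OF Q]] and n = phi[OF P] phi[OF Q]
  have "(\<phi> Q \<cdot>\<^bsub>KK\<^esub> FM (K_shift A f)) \<cdot>\<^bsub>KK\<^esub> \<eta> (?S P) = \<phi> Q \<cdot>\<^bsub>KK\<^esub> (\<eta> (?S Q) \<cdot>\<^bsub>KK\<^esub> K_shift A f)"
    using KK_assoc[OF t(1) G(1) n(3)] G(2) by simp
  also have "\<dots> = K_shift A (\<eta> Q) \<cdot>\<^bsub>KK\<^esub> K_shift A f"
    using KK_assoc[OF sf t(2) n(3)] n(4) by simp
  also have "\<dots> = K_shift A (FM f) \<cdot>\<^bsub>KK\<^esub> K_shift A (\<eta> P)"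
    using K_shift_Comp[OF f eta[OF Q]] K_shift_Comp[OF eta[OF P] F(1)] F(2) by simp
  also have "\<dots> = (K_shift A (FM f) \<cdot>\<^bsub>KK\<^esub> \<phi> P) \<cdot>\<^bsub>KK\<^esub> \<eta> (?S P)"
    using KK_assoc[OF t(1) n(1) sF] n(2) by simp
  finally show ?thesis
    by (rule pre_uniq[OF eta_pre[OF shift_dw[OF P]] shift_dw[OF FO[OF Q]] KK_HomI[OF G(1) n(3)] KK_HomI[OF n(1) sF]])
qed

lemma shift_F:
  "is_natural_iso (K A X) (K A Y) (FO \<circ> ShiftO (K A X)) (FM \<circ> ShiftM (K A X))
     (ShiftO (K A Y) \<circ> FO) (ShiftM (K A Y) \<circ> FM) \<phi>"
  unfolding is_natural_iso_def K_sel K_Hom is_iso_K comp_apply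
  by (intro conjI allI ballI; ((drule iffD1[OF K_Hom_full])+)?; (elim conjE)?; (rule K_Hom_dwI)?;
      (rule phi(1) phi_iso phi_natural FO shift_dw; (rule FO shift_dw)?; assumption)?)

lemma FM_iso:
  assumes "is_iso (K_preadd A X) a" "a \<in> Hom KK P Q" "P \<in> dw A X" "Q \<in> dw A X"
  shows "is_iso (K_preadd A Y) (FM a)"
proof -
  obtain b where b: "b \<in> Hom KK Q P" "b \<cdot>\<^bsub>KK\<^esub> a = Ide KK P" "a \<cdot>\<^bsub>KK\<^esub> b = Ide KK Q"
    using assms(1,2) by (rule is_iso_KE) (rule that)
  have "FM b \<cdot>\<^bsub>KK\<^esub> FM a = Ide KK (FO P)" "FM a \<cdot>\<^bsub>KK\<^esub> FM b = Ide KK (FO Q)"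
    using FM_Comp[OF assms(2) b(1) assms(3,4,3)] FM_Comp[OF b(1) assms(2) assms(4,3,4)] b(2,3)
      FM_Ide[OF assms(3)] FM_Ide[OF assms(4)] by simp_all
  then show ?thesis
    by (rule is_iso_KI[OF FM(1)[OF assms(2-4)] FM(1)[OF b(1) assms(4,3)] FO[OF assms(3)] FO[OF assms(4)]])
qed

lemma is_iso_K_comp:
  assumes "is_iso (K_preadd A Y) a" "a \<in> Hom KK P Q" "is_iso (K_preadd A Y) b" "b \<in> Hom KK Q R"
  shows "is_iso (K_preadd A Y) (b \<cdot>\<^bsub>KK\<^esub> a)"
proof -
  obtain a' where a: "a' \<in> Hom KK Q P" "a' \<cdot>\<^bsub>KK\<^esub> a = Ide KK P" "a \<cdot>\<^bsub>KK\<^esub> a' = Ide KK Q" "P \<in> dw A Y"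
    using assms(1,2) by (rule is_iso_KE) (rule that)
  obtain b' where b: "b' \<in> Hom KK R Q" "b' \<cdot>\<^bsub>KK\<^esub> b = Ide KK Q" "b \<cdot>\<^bsub>KK\<^esub> b' = Ide KK R" "R \<in> dw A Y"
    using assms(3,4) by (rule is_iso_KE) (rule that)
  note h = assms(2,4) a(1) b(1)
  have "(a' \<cdot>\<^bsub>KK\<^esub> b') \<cdot>\<^bsub>KK\<^esub> (b \<cdot>\<^bsub>KK\<^esub> a) = a' \<cdot>\<^bsub>KK\<^esub> ((b' \<cdot>\<^bsub>KK\<^esub> b) \<cdot>\<^bsub>KK\<^esub> a)"
    using KK_assoc[OF KK_HomI[OF h(1,2)] h(4,3)] KK_assoc[OF h(1,2,4)] by simp
  then have 1: "(a' \<cdot>\<^bsub>KK\<^esub> b') \<cdot>\<^bsub>KK\<^esub> (b \<cdot>\<^bsub>KK\<^esub> a) = Ide KK P"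
    using b(2) a(2) KK_Ide_left[OF h(1)] by simp
  have "(b \<cdot>\<^bsub>KK\<^esub> a) \<cdot>\<^bsub>KK\<^esub> (a' \<cdot>\<^bsub>KK\<^esub> b') = b \<cdot>\<^bsub>KK\<^esub> ((a \<cdot>\<^bsub>KK\<^esub> a') \<cdot>\<^bsub>KK\<^esub> b')"
    using KK_assoc[OF KK_HomI[OF h(4,3)] h(1,2)] KK_assoc[OF h(4,3,1)] by simp
  then have 2: "(b \<cdot>\<^bsub>KK\<^esub> a) \<cdot>\<^bsub>KK\<^esub> (a' \<cdot>\<^bsub>KK\<^esub> b') = Ide KK R"
    using b(3) a(3) KK_Ide_left[OF h(4)] by simp
  show ?thesis
    by (rule is_iso_KI[OF KK_HomI[OF h(1,2)] KK_HomI[OF h(4,3)] a(4) b(4) 1 2])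
qed

lemma cone_F:
  assumes ds: "\<And>a b. \<lbrakk>a \<in> Obj A; b \<in> Obj A\<rbrakk> \<Longrightarrow> \<exists>s. is_direct_sum A a b s"
    and Yds: "\<And>a b s. \<lbrakk>a \<in> Y; b \<in> Y; is_direct_sum A a b s\<rbrakk> \<Longrightarrow> s \<in> Y"
    and c: "cone C D f E i p \<sigma> \<rho>" and dw: "C \<in> dw A X" "D \<in> dw A X" "E \<in> dw A X"
  obtains g E' i' p' \<sigma>' \<rho>' h where "cone (FO C) (FO D) g E' i' p' \<sigma>' \<rho>'" "E' \<in> dw A Y"
    "h \<in> Hom KK (FO E) E'" "is_iso (K_preadd A Y) h" "FM (cls C D f) = cls (FO C) (FO D) g"
    "h \<cdot>\<^bsub>KK\<^esub> FM (cls D E i) = cls (FO D) E' i'"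
    "\<phi> C \<cdot>\<^bsub>KK\<^esub> FM (cls E (shift_complex A C) p) = cls E' (shift_complex A (FO C)) p' \<cdot>\<^bsub>KK\<^esub> h"
proof -
  let ?S = "shift_complex A"
  define u v w where "u = cls C D f" and "v = cls D E i" and "w = cls E (?S C) p"
  note uvw = cone_arrows[OF c, folded u_def v_def w_def]
  note FC = FO[OF dw(1)] and FD = FO[OF dw(2)] and FE = FO[OF dw(3)]
  note SC = shift_dw[OF dw(1)]
  note Fu = FM[OF uvw(1) dw(1,2)] and Fv = FM[OF uvw(2) dw(2,3)] and Fw = FM[OF uvw(3) dw(3) SC]
  note e = eta[OF dw(1)] eta[OF dw(2)] eta[OF dw(3)]
  obtain g where g: "cm (FO C) (FO D) g" "FM u = cls (FO C) (FO D) g" using Fu(1) unfolding KK_Hom_iff by (elim conjE exE) (rule that)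
  obtain a where a: "cm C (FO C) a" "\<eta> C = cls C (FO C) a" using e(1) unfolding KK_Hom_iff by (elim conjE exE) (rule that)
  obtain b where b: "cm D (FO D) b" "\<eta> D = cls D (FO D) b" using e(2) unfolding KK_Hom_iff by (elim conjE exE) (rule that)
  note cx = dwD[OF dw(1)] dwD[OF dw(2)] dwD[OF dw(3)] dwD[OF FC] dwD[OF FD] dwD[OF FE]
  obtain E' i' p' \<sigma>' \<rho>' where c': "cone (FO C) (FO D) g E' i' p' \<sigma>' \<rho>'"
  proof -
    have "\<exists>E i p \<sigma> \<rho>. cone (FO C) (FO D) g E i p \<sigma> \<rho>"
      by (rule cone_exists[OF _ g(1) cx(4,5)]) (rule ds; assumption)
    then show thesis by (elim exE) (rule that)
  qed
  have E': "E' \<in> dw A Y"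
  proof -
    have "Term E' n \<in> Y" for n
    proof (rule Yds)
      show "Term (FO C) (n - 1) \<in> Y" "Term (FO D) n \<in> Y" using FC FD by (simp_all add: dw_def)
      show "is_direct_sum A (Term (FO C) (n - 1)) (Term (FO D) n) (Term E' n)"
        using coneD(9)[OF c', of n] unfolding is_direct_sum_def by (intro exI)
    qed
    then show ?thesis using coneD(3)[OF c'] by (simp add: dw_def)
  qed
  have "cls C (FO D) (\<lambda>n. b n \<cdot> f n) = cls C (FO D) (\<lambda>n. g n \<cdot> a n)"
    using Fu(2) K_Comp[OF coneD(6)[OF c] b(1) cx(1,2,5), of "Obj A"] K_Comp[OF a(1) g(1) cx(1,4,5), of "Obj A"]
    by (simp add: u_def g(2)[unfolded u_def] a(2) b(2))
  then have H: "htp C (FO D) (\<lambda>n. b n \<cdot> f n) (\<lambda>n. g n \<cdot> a n)"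
    using cls_eq_iff[OF cm_comp[OF coneD(6)[OF c] b(1) cx(1,2,5)] cm_comp[OF a(1) g(1) cx(1,4,5)] cx(1,5)] by simp
  obtain k where k: "cm E E' k" "\<And>n. k n \<cdot> i n = i' n \<cdot> b n" "\<And>n. p' n \<cdot> k n = a (n - 1) \<cdot> p n"
    using cone_map[OF c c' a(1) b(1) H] by (elim exE conjE) (simp add: that)
  define u' v' w' where "u' = cls (FO C) (FO D) g" and "v' = cls (FO D) E' i'" and "w' = cls E' (?S (FO C)) p'"
  note uvw' = cone_arrows[OF c', folded u'_def v'_def w'_def]
  define \<kappa> where "\<kappa> = cls E E' k"
  have cE': "is_complex A E'" by (rule coneD(3)[OF c'])
  have \<kappa>: "\<kappa> \<in> Hom KK E E'" unfolding \<kappa>_def by (rule K_HomI) (simp_all add: k(1) cx cE')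
  have sa: "cm (?S C) (?S (FO C)) (\<lambda>n. a (n - 1))" using cm_shift_iff[OF cx(1,4)] a(1) by simp
  have k1: "\<kappa> \<cdot>\<^bsub>KK\<^esub> v = v' \<cdot>\<^bsub>KK\<^esub> \<eta> D"
    unfolding \<kappa>_def v_def v'_def b(2)
    using K_Comp[OF coneD(7)[OF c] k(1) cx(2,3) cE', of "Obj A"] K_Comp[OF b(1) coneD(7)[OF c'] cx(2,5) cE', of "Obj A"] k(2)
    by simp
  have k2: "w' \<cdot>\<^bsub>KK\<^esub> \<kappa> = K_shift A (\<eta> C) \<cdot>\<^bsub>KK\<^esub> w"
    unfolding \<kappa>_def w_def w'_def a(2) K_shift_cls[OF a(1) cx(1,4)]
    using K_Comp[OF k(1) coneD(8)[OF c'] cx(3) cE' coneD(4)[OF c'], of "Obj A"]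
      K_Comp[OF coneD(8)[OF c] sa cx(3) coneD(4)[OF c] coneD(4)[OF c'], of "Obj A"] k(3) by simp
  have pre: "pre_iso (dw A Y) E E' \<kappa>"
    by (rule five_pre_iso[OF c c' eta_pre[OF dw(1)] eta_pre[OF dw(2)] \<kappa>
        Fu(2)[symmetric, unfolded u_def g(2)[unfolded u_def]] k1[unfolded v_def v'_def] k2[unfolded w_def w'_def] unshift_dw])
  obtain h where h: "h \<in> Hom KK (FO E) E'" "h \<cdot>\<^bsub>KK\<^esub> \<eta> E = \<kappa>"
    using pre_ex[OF eta_pre[OF dw(3)] E' \<kappa>] by (elim exE conjE) (rule that)
  obtain h' where h': "h' \<in> Hom KK E' (FO E)" "h' \<cdot>\<^bsub>KK\<^esub> \<kappa> = \<eta> E"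
    using pre_ex[OF pre FE e(3)] by (elim exE conjE) (rule that)
  have 1: "(h' \<cdot>\<^bsub>KK\<^esub> h) \<cdot>\<^bsub>KK\<^esub> \<eta> E = Ide KK (FO E) \<cdot>\<^bsub>KK\<^esub> \<eta> E"
    using KK_assoc[OF e(3) h(1) h'(1)] h(2) h'(2) KK_Ide_left[OF e(3)] by simp
  have 2: "(h \<cdot>\<^bsub>KK\<^esub> h') \<cdot>\<^bsub>KK\<^esub> \<kappa> = Ide KK E' \<cdot>\<^bsub>KK\<^esub> \<kappa>"
    using KK_assoc[OF \<kappa> h'(1) h(1)] h(2) h'(2) KK_Ide_left[OF \<kappa>] by simp
  have iso: "is_iso (K_preadd A Y) h"
    by (rule is_iso_KI[OF h(1) h'(1) FE E'
        pre_uniq[OF eta_pre[OF dw(3)] FE KK_HomI[OF h(1) h'(1)] KK_Ide_Hom[OF cx(6)] 1]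
        pre_uniq[OF pre E' KK_HomI[OF h'(1) h(1)] KK_Ide_Hom[OF cE'] 2]])
  have "(h \<cdot>\<^bsub>KK\<^esub> FM v) \<cdot>\<^bsub>KK\<^esub> \<eta> D = h \<cdot>\<^bsub>KK\<^esub> (\<eta> E \<cdot>\<^bsub>KK\<^esub> v)"
    using KK_assoc[OF e(2) Fv(1) h(1)] Fv(2) by simp
  also have "\<dots> = v' \<cdot>\<^bsub>KK\<^esub> \<eta> D" using KK_assoc[OF uvw(2) e(3) h(1)] h(2) k1 by simp
  finally have 3: "h \<cdot>\<^bsub>KK\<^esub> FM v = v'"
    by (rule pre_uniq[OF eta_pre[OF dw(2)] E' KK_HomI[OF Fv(1) h(1)] uvw'(2)])
  note ph = phi[OF dw(1)] and eS = eta[OF SC]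
  have "(\<phi> C \<cdot>\<^bsub>KK\<^esub> FM w) \<cdot>\<^bsub>KK\<^esub> \<eta> E = \<phi> C \<cdot>\<^bsub>KK\<^esub> (\<eta> (?S C) \<cdot>\<^bsub>KK\<^esub> w)"
    using KK_assoc[OF e(3) Fw(1) ph(1)] Fw(2) by simp
  also have "\<dots> = w' \<cdot>\<^bsub>KK\<^esub> \<kappa>" using KK_assoc[OF uvw(3) eS ph(1)] ph(2) k2 by simp
  also have "\<dots> = (w' \<cdot>\<^bsub>KK\<^esub> h) \<cdot>\<^bsub>KK\<^esub> \<eta> E" using KK_assoc[OF e(3) h(1) uvw'(3)] h(2) by simp
  finally have 4: "\<phi> C \<cdot>\<^bsub>KK\<^esub> FM w = w' \<cdot>\<^bsub>KK\<^esub> h"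
    by (rule pre_uniq[OF eta_pre[OF dw(3)] shift_dw[OF FC] KK_HomI[OF Fw(1) ph(1)] KK_HomI[OF h(1) uvw'(3)]])
  show thesis
    by (rule that[OF c' E' h(1) iso g(2)[unfolded u_def] 3[unfolded v_def v'_def] 4[unfolded w_def w'_def]])
qed

lemma triangle_F:
  assumes ds: "\<And>a b. \<lbrakk>a \<in> Obj A; b \<in> Obj A\<rbrakk> \<Longrightarrow> \<exists>s. is_direct_sum A a b s"
    and Yds: "\<And>a b s. \<lbrakk>a \<in> Y; b \<in> Y; is_direct_sum A a b s\<rbrakk> \<Longrightarrow> s \<in> Y"
    and t: "(u, v, w) \<in> K_triangles A X"
  shows "(FM u, FM v, \<phi> (Dom KK u) \<cdot>\<^bsub>KK\<^esub> FM w) \<in> K_triangles A Y"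
proof -
  let ?S = "shift_complex A"
  obtain P Q R F I G a b c where
    dw: "P \<in> dw A X" "Q \<in> dw A X" "R \<in> dw A X" and
    uvw: "u \<in> Hom KK P Q" "v \<in> Hom KK Q R" "w \<in> Hom KK R (?S P)" and
    tri: "is_cone_triangle A F I G" and
    dw': "Source F \<in> dw A X" "Target F \<in> dw A X" "Target I \<in> dw A X" and
    abc: "a \<in> Hom KK P (Source F)" "is_iso (K_preadd A X) a" "b \<in> Hom KK Q (Target F)" "is_iso (K_preadd A X) b"
      "c \<in> Hom KK R (Target I)" "is_iso (K_preadd A X) c" and
    eqs: "b \<cdot>\<^bsub>KK\<^esub> u = htpy_class A F \<cdot>\<^bsub>KK\<^esub> a" "c \<cdot>\<^bsub>KK\<^esub> v = htpy_class A I \<cdot>\<^bsub>KK\<^esub> b"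
      "K_shift A a \<cdot>\<^bsub>KK\<^esub> w = htpy_class A G \<cdot>\<^bsub>KK\<^esub> c"
    using t unfolding K_triangles_def Let_def K_preadd_sel[of X] mem_Collect_eq prod.case
    by (elim bexE exE conjE) (simp add: K_Hom_full[of _ X])
  obtain C D E f i p \<sigma> \<rho> where FIG: "F = mk C D f" "I = mk D E i" "G = mk E (?S C) p" and
    co: "cone C D f E i p \<sigma> \<rho>" using tri by (rule cone_triangleE) (rule that)
  note abc = abc[unfolded FIG, simplified] and eqs = eqs[unfolded FIG, folded cls_def] and dw' = dw'[unfolded FIG, simplified]
  obtain g E' i' p' \<sigma>' \<rho>' h where c': "cone (FO C) (FO D) g E' i' p' \<sigma>' \<rho>'" "E' \<in> dw A Y"
    and h: "h \<in> Hom KK (FO E) E'" "is_iso (K_preadd A Y) h" and g: "FM (cls C D f) = cls (FO C) (FO D) g"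
    and hv: "h \<cdot>\<^bsub>KK\<^esub> FM (cls D E i) = cls (FO D) E' i'"
    and hw: "\<phi> C \<cdot>\<^bsub>KK\<^esub> FM (cls E (shift_complex A C) p) = cls E' (shift_complex A (FO C)) p' \<cdot>\<^bsub>KK\<^esub> h"
    by (rule cone_F[OF _ _ co dw']) (erule (1) ds | erule (2) Yds | (rule that; assumption))+
  have tri': "is_cone_triangle A (mk (FO C) (FO D) g) (mk (FO D) E' i') (mk E' (?S (FO C)) p')"
    unfolding cone_triangle_mk using c'(1) by (intro conjI refl exI)
  note cone = cone_arrows[OF co]
  note F = FM(1)[OF uvw(1) dw(1,2)] FM(1)[OF uvw(2) dw(2,3)] FM(1)[OF uvw(3) dw(3) shift_dw[OF dw(1)]]
    FM(1)[OF abc(1) dw(1) dw'(1)] FM(1)[OF abc(3) dw(2) dw'(2)] FM(1)[OF abc(5) dw(3) dw'(3)]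
    FM(1)[OF cone(1) dw'(1,2)] FM(1)[OF cone(2) dw'(2,3)] FM(1)[OF cone(3) dw'(3) shift_dw[OF dw'(1)]]
  note ph = phi(1)[OF dw(1)] phi(1)[OF dw'(1)]
  note cone' = cone_arrows[OF c'(1)]
  have 1: "FM b \<cdot>\<^bsub>KK\<^esub> FM u = cls (FO C) (FO D) g \<cdot>\<^bsub>KK\<^esub> FM a"
    using FM_Comp[OF uvw(1) abc(3) dw(1,2) dw'(2)] FM_Comp[OF abc(1) cone(1) dw(1) dw'(1,2)] eqs(1) g by simp
  have "(h \<cdot>\<^bsub>KK\<^esub> FM c) \<cdot>\<^bsub>KK\<^esub> FM v = h \<cdot>\<^bsub>KK\<^esub> (FM (cls D E i) \<cdot>\<^bsub>KK\<^esub> FM b)"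
    using KK_assoc[OF F(2,6) h(1)] FM_Comp[OF uvw(2) abc(5) dw(2,3) dw'(3)]
      FM_Comp[OF abc(3) cone(2) dw(2) dw'(2,3)] eqs(2) by simp
  also have "\<dots> = cls (FO D) E' i' \<cdot>\<^bsub>KK\<^esub> FM b" using KK_assoc[OF F(5,8) h(1)] hv by simp
  finally have 2: "(h \<cdot>\<^bsub>KK\<^esub> FM c) \<cdot>\<^bsub>KK\<^esub> FM v = cls (FO D) E' i' \<cdot>\<^bsub>KK\<^esub> FM b" .
  note sF = K_shift_Hom[OF F(4)] and sa = K_shift_Hom[OF abc(1)]
  have "K_shift A (FM a) \<cdot>\<^bsub>KK\<^esub> (\<phi> P \<cdot>\<^bsub>KK\<^esub> FM w) = \<phi> C \<cdot>\<^bsub>KK\<^esub> (FM (K_shift A a) \<cdot>\<^bsub>KK\<^esub> FM w)"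
    using KK_assoc[OF F(3) ph(1) sF] phi_natural[OF abc(1) dw(1) dw'(1)]
      KK_assoc[OF F(3) FM(1)[OF sa shift_dw[OF dw(1)] shift_dw[OF dw'(1)]] ph(2)] by simp
  also have "\<dots> = \<phi> C \<cdot>\<^bsub>KK\<^esub> (FM (cls E (?S C) p) \<cdot>\<^bsub>KK\<^esub> FM c)"
    using FM_Comp[OF uvw(3) sa dw(3) shift_dw[OF dw(1)] shift_dw[OF dw'(1)]]
      FM_Comp[OF abc(5) cone(3) dw(3) dw'(3) shift_dw[OF dw'(1)]] eqs(3) by simp
  also have "\<dots> = cls E' (?S (FO C)) p' \<cdot>\<^bsub>KK\<^esub> (h \<cdot>\<^bsub>KK\<^esub> FM c)"
    using KK_assoc[OF F(6,9) ph(2)] KK_assoc[OF F(6) h(1) cone'(3)] hw by simp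
  finally have 3: "K_shift A (FM a) \<cdot>\<^bsub>KK\<^esub> (\<phi> P \<cdot>\<^bsub>KK\<^esub> FM w) = cls E' (?S (FO C)) p' \<cdot>\<^bsub>KK\<^esub> (h \<cdot>\<^bsub>KK\<^esub> FM c)" .
  have DP: "Dom KK u = P" using uvw(1) by (simp add: Hom_def)
  note FO' = FO[OF dw(1)] FO[OF dw(2)] FO[OF dw(3)] FO[OF dw'(1)] FO[OF dw'(2)] FO[OF dw'(3)]
  show ?thesis
    unfolding K_triangles_def Let_def K_preadd_sel[of Y] mem_Collect_eq prod.case DP
  proof (rule bexI[of _ "FO P"], rule bexI[of _ "FO Q"], rule bexI[of _ "FO R"], intro conjI)
    show "FM u \<in> Hom (K_preadd A Y) (FO P) (FO Q)" by (rule K_Hom_dwI[OF F(1) FO'(1,2)])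
    show "FM v \<in> Hom (K_preadd A Y) (FO Q) (FO R)" by (rule K_Hom_dwI[OF F(2) FO'(2,3)])
    show "\<phi> P \<cdot>\<^bsub>KK\<^esub> FM w \<in> Hom (K_preadd A Y) (FO R) (?S (FO P))"
      by (rule K_Hom_dwI[OF KK_HomI[OF F(3) ph(1)] FO'(3) shift_dw[OF FO'(1)]])
    show "\<exists>f i p a b c. is_cone_triangle A f i p \<and>
           Source f \<in> dw A Y \<and> Target f \<in> dw A Y \<and> Target i \<in> dw A Y \<and>
           a \<in> Hom (K_preadd A Y) (FO P) (Source f) \<and> is_iso (K_preadd A Y) a \<and>
           b \<in> Hom (K_preadd A Y) (FO Q) (Target f) \<and> is_iso (K_preadd A Y) b \<and>
           c \<in> Hom (K_preadd A Y) (FO R) (Target i) \<and> is_iso (K_preadd A Y) c \<and>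
           b \<cdot>\<^bsub>KK\<^esub> FM u = htpy_class A f \<cdot>\<^bsub>KK\<^esub> a \<and>
           c \<cdot>\<^bsub>KK\<^esub> FM v = htpy_class A i \<cdot>\<^bsub>KK\<^esub> b \<and>
           K_shift A a \<cdot>\<^bsub>KK\<^esub> (\<phi> P \<cdot>\<^bsub>KK\<^esub> FM w) = htpy_class A p \<cdot>\<^bsub>KK\<^esub> c"
      apply (rule exI[of _ "mk (FO C) (FO D) g"], rule exI[of _ "mk (FO D) E' i'"], rule exI[of _ "mk E' (?S (FO C)) p'"],
          rule exI[of _ "FM a"], rule exI[of _ "FM b"], rule exI[of _ "h \<cdot>\<^bsub>KK\<^esub> FM c"])
      unfolding chain_map.select_convs
      apply (intro conjI)
                  apply (rule tri')
                 apply (rule FO'(4))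
                apply (rule FO'(5))
               apply (rule c'(2))
              apply (rule K_Hom_dwI[OF F(4) FO'(1,4)])
             apply (rule FM_iso[OF abc(2,1) dw(1) dw'(1)])
            apply (rule K_Hom_dwI[OF F(5) FO'(2,5)])
           apply (rule FM_iso[OF abc(4,3) dw(2) dw'(2)])
          apply (rule K_Hom_dwI[OF KK_HomI[OF F(6) h(1)] FO'(3) c'(2)])
         apply (rule is_iso_K_comp[OF FM_iso[OF abc(6,5) dw(3) dw'(3)] F(6) h(2,1)])
        apply (rule 1[unfolded cls_def])
       apply (rule 2[unfolded cls_def])
      apply (rule 3[unfolded cls_def])
      done
  qed (rule FO')+
qed

lemma triangle_equivalent_K:
  assumes ds: "\<And>a b. \<lbrakk>a \<in> Obj A; b \<in> Obj A\<rbrakk> \<Longrightarrow> \<exists>s. is_direct_sum A a b s"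
    and Yds: "\<And>a b s. \<lbrakk>a \<in> Y; b \<in> Y; is_direct_sum A a b s\<rbrakk> \<Longrightarrow> s \<in> Y"
  shows "triangle_equivalent (K A X) (K A Y)"
proof -
  have "is_triangle_functor (K A X) (K A Y) FO FM \<phi>"
    unfolding is_triangle_functor_def
  proof (intro conjI functor_F shift_F allI ballI)
    fix P Q f g assume "f \<in> Hom (K A X) P Q" "g \<in> Hom (K A X) P Q"
    then have "f \<in> Hom KK P Q" "g \<in> Hom KK P Q" "P \<in> dw A X" "Q \<in> dw A X"
      by (simp_all add: K_Hom_full[of _ X])
    then show "FM (f \<uplus>\<^bsub>K A X\<^esub> g) = FM f \<uplus>\<^bsub>K A Y\<^esub> FM g" unfolding K_sel by (rule FM_Add)
  next
    fix t assume t: "t \<in> Triangles (K A X)"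
    obtain u v w where [simp]: "t = (u, v, w)" by (rule prod_cases3)
    have "(FM u, FM v, \<phi> (Dom KK u) \<cdot>\<^bsub>KK\<^esub> FM w) \<in> K_triangles A Y"
      by (rule triangle_F[OF ds Yds]) (use t in simp_all)
    then show "case t of (u, v, w) \<Rightarrow> (FM u, FM v, \<phi> (Dom (K A X) u) \<cdot>\<^bsub>K A Y\<^esub> FM w) \<in> Triangles (K A Y)" by simp
  qed
  then show ?thesis unfolding triangle_equivalent_def using equivalence_F by (intro exI conjI)
qed

end


lemma monic_cancel: "\<lbrakk>is_monic A f; f \<cdot> g = f \<cdot> h; g \<in> Arr A; h \<in> Arr A; Cod A g = Dom A f; Cod A h = Dom A f; Dom A g = Dom A h\<rbrakk> \<Longrightarrow> g = h"
  unfolding is_monic_def by (auto simp: Hom_def)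

lemma epic_cancel: "\<lbrakk>is_epic A f; g \<cdot> f = h \<cdot> f; g \<in> Arr A; h \<in> Arr A; Dom A g = Cod A f; Dom A h = Cod A f; Cod A g = Cod A h\<rbrakk> \<Longrightarrow> g = h"
  unfolding is_epic_def by (auto simp: Hom_def)

lemma kernelD:
  assumes "is_kernel A k f"
  shows "k \<in> Arr A" "f \<in> Arr A" "Cod A k = Dom A f" "f \<cdot> k = Zero A (Dom A k) (Cod A f)"
  using assms by (simp_all add: is_kernel_def)

lemma kernel_factor:
  assumes "is_kernel A k f" "g \<in> Arr A" "Cod A g = Dom A f" "f \<cdot> g = Zero A (Dom A g) (Cod A f)"
  shows "\<exists>u. u \<in> Arr A \<and> Dom A u = Dom A g \<and> Cod A u = Dom A k \<and> k \<cdot> u = g"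
proof -
  have "g \<in> Hom A (Dom A g) (Dom A f)" using assms by (simp add: Hom_def)
  then have "\<exists>!u. u \<in> Hom A (Dom A g) (Dom A k) \<and> k \<cdot> u = g" using assms unfolding is_kernel_def by blast
  then show ?thesis by (auto simp: Hom_def)
qed

lemma kernel_monic: "is_kernel A k f \<Longrightarrow> is_monic A k"
  unfolding is_monic_def
proof (intro conjI allI ballI impI)
  assume k: "is_kernel A k f"
  show "k \<in> Arr A" using kernelD[OF k] by simp
  fix t g h assume g: "g \<in> Hom A t (Dom A k)" and h: "h \<in> Hom A t (Dom A k)" and e: "k \<cdot> g = k \<cdot> h"
  note [simp] = kernelD[OF k] g[unfolded Hom_def, simplified] h[unfolded Hom_def, simplified]
  have "t = Dom A g" by simp
  then have [simp]: "t \<in> Obj A" by (metis Dom_Obj \<open>g \<in> Arr A \<and> Dom A g = t \<and> Cod A g = Dom A k\<close>)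
  have "f \<cdot> (k \<cdot> g) = Zero A t (Cod A f)"
    using Comp_reassoc[OF kernelD(4)[OF k], of g] by simp
  moreover have "k \<cdot> g \<in> Hom A t (Dom A f)" by (simp add: Hom_def)
  ultimately have "\<exists>!u. u \<in> Hom A t (Dom A k) \<and> k \<cdot> u = k \<cdot> g" using k unfolding is_kernel_def by blast
  then show "g = h" using g h e by metis
qed

lemma cokernelD:
  assumes "is_cokernel A c f"
  shows "c \<in> Arr A" "f \<in> Arr A" "Dom A c = Cod A f" "c \<cdot> f = Zero A (Dom A f) (Cod A c)"
  using assms by (simp_all add: is_cokernel_def)

lemma cokernel_factor:
  assumes "is_cokernel A c f" "g \<in> Arr A" "Dom A g = Cod A f" "g \<cdot> f = Zero A (Dom A f) (Cod A g)"
  shows "\<exists>u. u \<in> Arr A \<and> Dom A u = Cod A c \<and> Cod A u = Cod A g \<and> u \<cdot> c = g"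
proof -
  have "g \<in> Hom A (Cod A f) (Cod A g)" using assms by (simp add: Hom_def)
  then have "\<exists>!u. u \<in> Hom A (Cod A c) (Cod A g) \<and> u \<cdot> c = g" using assms unfolding is_cokernel_def by blast
  then show ?thesis by (auto simp: Hom_def)
qed

lemma cokernel_epic: "is_cokernel A c f \<Longrightarrow> is_epic A c"
  unfolding is_epic_def
proof (intro conjI allI ballI impI)
  assume c: "is_cokernel A c f"
  show "c \<in> Arr A" using cokernelD[OF c] by simp
  fix t g h assume g: "g \<in> Hom A (Cod A c) t" and h: "h \<in> Hom A (Cod A c) t" and e: "g \<cdot> c = h \<cdot> c"
  note [simp] = cokernelD[OF c] g[unfolded Hom_def, simplified] h[unfolded Hom_def, simplified]
  have "t = Cod A g" by simp
  then have [simp]: "t \<in> Obj A" by (metis Cod_Obj \<open>g \<in> Arr A \<and> Dom A g = Cod A c \<and> Cod A g = t\<close>)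
  have "(g \<cdot> c) \<cdot> f = Zero A (Dom A f) t" by simp
  moreover have "g \<cdot> c \<in> Hom A (Cod A f) t" by (simp add: Hom_def)
  ultimately have "\<exists>!u. u \<in> Hom A (Cod A c) t \<and> u \<cdot> c = g \<cdot> c" using c unfolding is_cokernel_def by blast
  then show "g = h" using g h e by metis
qed

lemma short_exact_section:
  assumes "short_exact A i p" "s \<in> Arr A" "Dom A s = Cod A p" "Cod A s = Dom A p" "p \<cdot> s = Ide A (Cod A p)"
  shows "\<exists>r. is_biproduct A (Dom A i) (Cod A p) (Cod A i) i s r p"
proof -
  have k: "is_kernel A i p" using assms(1) by (simp add: short_exact_def)
  note [simp] = kernelD[OF k] assms(2-5)
  have ps: "p \<cdot> (s \<cdot> x) = x" if "x \<in> Arr A" "Cod A x = Cod A p" for x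
    using Comp_reassoc[OF assms(5), of x] that by simp
  let ?g = "Ide A (Cod A i) \<uplus> Neg A (s \<cdot> p)"
  have "p \<cdot> ?g = Zero A (Dom A ?g) (Cod A p)" by (simp add: ps)
  then obtain r where r: "r \<in> Arr A" "Dom A r = Cod A i" "Cod A r = Dom A i" "i \<cdot> r = ?g"
    using kernel_factor[OF k, of ?g] by auto
  note [simp] = r(1-3)
  have ir: "i \<cdot> (r \<cdot> x) = x \<uplus> Neg A (s \<cdot> (p \<cdot> x))" if "x \<in> Arr A" "Cod A x = Cod A i" for x
    using Comp_reassoc[OF r(4), of x] that by simp
  have 1: "r \<cdot> i = Ide A (Dom A i)"
    by (rule monic_cancel[OF kernel_monic[OF k]]) (simp_all add: ir)
  have 2: "r \<cdot> s = Zero A (Cod A p) (Dom A i)"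
    by (rule monic_cancel[OF kernel_monic[OF k]]) (simp_all add: ir)
  have 3: "(i \<cdot> r) \<uplus> (s \<cdot> p) = Ide A (Cod A i)"
    unfolding r(4) by (rule lin_eqI, (rule lin_intros | simp)+)
  show ?thesis by (rule exI[of _ r]) (use 1 2 3 in \<open>simp add: is_biproduct_def Hom_def\<close>)
qed

lemma short_exact_retraction:
  assumes "short_exact A i p" "r \<in> Arr A" "Dom A r = Cod A i" "Cod A r = Dom A i" "r \<cdot> i = Ide A (Dom A i)"
  shows "\<exists>s. is_biproduct A (Dom A i) (Cod A p) (Cod A i) i s r p"
proof -
  have k: "is_kernel A i p" and c: "is_cokernel A p i" using assms(1) by (simp_all add: short_exact_def)
  note [simp] = kernelD[OF k] assms(2-5)
  let ?g = "Ide A (Cod A i) \<uplus> Neg A (i \<cdot> r)"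
  have "?g \<cdot> i = Zero A (Dom A i) (Cod A ?g)" by simp
  then obtain s where s: "s \<in> Arr A" "Dom A s = Cod A p" "Cod A s = Cod A i" "s \<cdot> p = ?g"
    using cokernel_factor[OF c, of ?g] by auto
  note [simp] = s(1-3)
  have pi: "p \<cdot> (i \<cdot> x) = Zero A (Dom A x) (Cod A p)" if "x \<in> Arr A" "Cod A x = Dom A i" for x
    using Comp_reassoc[OF kernelD(4)[OF k], of x] that by simp
  have ri: "r \<cdot> (i \<cdot> x) = x" if "x \<in> Arr A" "Cod A x = Dom A i" for x
    using Comp_reassoc[OF assms(5), of x] that by simp
  have 1: "p \<cdot> s = Ide A (Cod A p)"
    by (rule epic_cancel[OF cokernel_epic[OF c]]) (simp_all add: s(4) pi)
  have 2: "r \<cdot> s = Zero A (Cod A p) (Dom A i)"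
    by (rule epic_cancel[OF cokernel_epic[OF c]]) (simp_all add: s(4) ri)
  have 3: "(i \<cdot> r) \<uplus> (s \<cdot> p) = Ide A (Cod A i)"
    unfolding s(4) by (rule lin_eqI, (rule lin_intros | simp)+)
  show ?thesis by (rule exI[of _ s]) (use 1 2 3 in \<open>simp add: is_biproduct_def Hom_def\<close>)
qed

lemma biproduct_short_exact:
  assumes b: "is_biproduct A a b s i j p q"
  shows "short_exact A i q"
proof -
  note [simp] = biD[OF b] bi_reassoc[OF b]
  have "is_kernel A i q" unfolding is_kernel_def
  proof (intro conjI allI ballI impI)
    fix t g assume g: "g \<in> Hom A t (Dom A q)" "q \<cdot> g = Zero A t (Cod A q)"
    have [simp]: "t \<in> Obj A" using g(1) Dom_Obj[of g] by (auto simp: Hom_def)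
    note [simp] = g(1)[unfolded Hom_def, simplified]
    show "\<exists>!u. u \<in> Hom A t (Dom A i) \<and> i \<cdot> u = g"
    proof
      show "p \<cdot> g \<in> Hom A t (Dom A i) \<and> i \<cdot> (p \<cdot> g) = g"
        by (simp add: Hom_def, rule sym, rule trans[OF bi_into[OF b, of g]]) (simp_all add: g(2))
      fix u assume u: "u \<in> Hom A t (Dom A i) \<and> i \<cdot> u = g"
      then have [simp]: "u \<in> Arr A" "Dom A u = t" "Cod A u = a" and iu: "i \<cdot> u = g" by (simp_all add: Hom_def)
      have "p \<cdot> (i \<cdot> u) = p \<cdot> g" by (rule arg_cong[OF iu])
      then show "u = p \<cdot> g" by simp
    qed
  qed simp_all
  moreover have "is_cokernel A q i" unfolding is_cokernel_def
  proof (intro conjI allI ballI impI)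
    fix t g assume g: "g \<in> Hom A (Cod A i) t" "g \<cdot> i = Zero A (Dom A i) t"
    have [simp]: "t \<in> Obj A" using g(1) Cod_Obj[of g] by (auto simp: Hom_def)
    note [simp] = g(1)[unfolded Hom_def, simplified]
    show "\<exists>!u. u \<in> Hom A (Cod A q) t \<and> u \<cdot> q = g"
    proof
      show "g \<cdot> j \<in> Hom A (Cod A q) t \<and> (g \<cdot> j) \<cdot> q = g"
        by (simp add: Hom_def, rule sym, rule trans[OF bi_from[OF b, of g]]) (simp_all add: g(2))
      fix u assume u: "u \<in> Hom A (Cod A q) t \<and> u \<cdot> q = g"
      then have [simp]: "u \<in> Arr A" "Dom A u = b" "Cod A u = t" by (simp_all add: Hom_def)
      have "u \<cdot> (q \<cdot> j) = g \<cdot> j" using u assoc[of j q u] by simp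
      then show "u = g \<cdot> j" by simp
    qed
  qed simp_all
  ultimately show ?thesis by (simp add: short_exact_def)
qed

text \<open>A unipotent map between two split extensions of the same ends is invertible.\<close>

lemma unipotent_iso:
  assumes b: "is_biproduct A c s e i \<sigma> \<rho> p" and b': "is_biproduct A c s e' i' \<sigma>' \<rho>' p'"
    and k: "k \<in> Arr A" "Dom A k = e" "Cod A k = e'" "k \<cdot> i = i'" "p' \<cdot> k = p"
  shows "\<exists>l. l \<in> Arr A \<and> Dom A l = e' \<and> Cod A l = e \<and> l \<cdot> k = Ide A e \<and> k \<cdot> l = Ide A e'"
proof -
  note [simp] = biD[OF b] bi_reassoc[OF b] biD[OF b'] bi_reassoc[OF b'] k
  have ki: "k \<cdot> (i \<cdot> x) = i' \<cdot> x" if "x \<in> Arr A" "Cod A x = c" for x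
    using Comp_reassoc[OF k(4), of x] that by simp
  have pk: "p' \<cdot> (k \<cdot> x) = p \<cdot> x" if "x \<in> Arr A" "Cod A x = e" for x
    using Comp_reassoc[OF k(5), of x] that by simp
  note [simp] = ki pk
  define l where "l = (i \<cdot> \<rho>') \<uplus> ((\<sigma> \<cdot> p') \<uplus> Neg A (i \<cdot> (\<rho>' \<cdot> (k \<cdot> (\<sigma> \<cdot> p')))))"
  have [simp]: "l \<in> Arr A" "Dom A l = e'" "Cod A l = e" by (simp_all add: l_def)
  have li: "l \<cdot> i' = i" by (simp add: l_def)
  have ls: "l \<cdot> \<sigma>' = \<sigma> \<uplus> Neg A (i \<cdot> (\<rho>' \<cdot> (k \<cdot> \<sigma>)))" by (simp add: l_def)
  have ks: "k \<cdot> \<sigma> = (i' \<cdot> (\<rho>' \<cdot> (k \<cdot> \<sigma>))) \<uplus> \<sigma>'"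
    by (rule trans[OF bi_into[OF b', of "k \<cdot> \<sigma>"]]) simp_all
  have "l \<cdot> (k \<cdot> \<sigma>) = \<sigma>"
  proof -
    have "l \<cdot> (k \<cdot> \<sigma>) = l \<cdot> ((i' \<cdot> (\<rho>' \<cdot> (k \<cdot> \<sigma>))) \<uplus> \<sigma>')" by (rule arg_cong[OF ks])
    also have "\<dots> = (i \<cdot> (\<rho>' \<cdot> (k \<cdot> \<sigma>))) \<uplus> (\<sigma> \<uplus> Neg A (i \<cdot> (\<rho>' \<cdot> (k \<cdot> \<sigma>))))"
      using Comp_reassoc[OF li] ls by simp
    also have "\<dots> = \<sigma>" by (rule lin_eqI, (rule lin_intros | simp)+)
    finally show ?thesis .
  qed
  then have 1: "l \<cdot> k = Ide A e"
    by - (rule bi_eq_from[OF b], simp_all add: li)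
  have "k \<cdot> (\<sigma> \<uplus> Neg A (i \<cdot> (\<rho>' \<cdot> (k \<cdot> \<sigma>)))) = \<sigma>'"
  proof -
    have "k \<cdot> (\<sigma> \<uplus> Neg A (i \<cdot> (\<rho>' \<cdot> (k \<cdot> \<sigma>)))) = (k \<cdot> \<sigma>) \<uplus> Neg A (i' \<cdot> (\<rho>' \<cdot> (k \<cdot> \<sigma>)))" by simp
    also have "\<dots> = ((i' \<cdot> (\<rho>' \<cdot> (k \<cdot> \<sigma>))) \<uplus> \<sigma>') \<uplus> Neg A (i' \<cdot> (\<rho>' \<cdot> (k \<cdot> \<sigma>)))"
      by (rule arg_cong[OF ks])
    also have "\<dots> = \<sigma>'" by (rule lin_eqI, (rule lin_intros | simp)+)
    finally show ?thesis .
  qed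
  then have 2: "k \<cdot> l = Ide A e'"
    by - (rule bi_eq_from[OF b'], simp_all add: li ls del: Comp_distrib)
  show ?thesis using 1 2 by (intro exI[of _ l]) simp
qed


lemma nullmaps_shift_iff:
  assumes "is_complex A C" "is_complex A D"
  shows "nullmaps (shift_complex A C) (shift_complex A D) \<longleftrightarrow> nullmaps C D"
proof
  assume n: "nullmaps (shift_complex A C) (shift_complex A D)"
  show "nullmaps C D" unfolding nullmaps_def
  proof (intro allI impI)
    fix f assume f: "cm C D f"
    then have "cm (shift_complex A C) (shift_complex A D) (\<lambda>n. f (n - 1))" using assms by (simp add: cm_shift_iff)
    then have "nul (shift_complex A C) (shift_complex A D) (\<lambda>n. f (n - 1))" using n by (simp add: nullmaps_def)
    then show "nul C D f" using htp_shift_iff[OF assms f cm_zero[OF assms]] by simp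
  qed
next
  assume n: "nullmaps C D"
  show "nullmaps (shift_complex A C) (shift_complex A D)" unfolding nullmaps_def
  proof (intro allI impI)
    fix f assume "cm (shift_complex A C) (shift_complex A D) f"
    then have f: "cm C D (\<lambda>n. f (n + 1))" using cm_shift_iff[OF assms, of "\<lambda>n. f (n + 1)"] by simp
    then have "nul C D (\<lambda>n. f (n + 1))" using n by (simp add: nullmaps_def)
    then show "nul (shift_complex A C) (shift_complex A D) f" using htp_shift_iff[OF assms f cm_zero[OF assms]] by simp
  qed
qed

lemma extensions_iff:
  "(I, P) \<in> extensions (Ch A) (Ch_exact A E) s c \<longleftrightarrow> (\<exists>e i p. I = mk c e i \<and> P = mk e s p \<and>
     is_complex A c \<and> is_complex A e \<and> is_complex A s \<and> cm c e i \<and> cm e s p \<and> (\<forall>n. (i n, p n) \<in> E))" (is "?L \<longleftrightarrow> ?R")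
proof
  assume ?L
  then show ?R
    by (cases I, cases P) (auto simp: extensions_def Ch_exact_def Ch_def chain_map_iff)
next
  assume ?R
  then show ?L by (auto simp: extensions_def Ch_exact_def Ch_def chain_map_iff)
qed

lemma Ch_iso_iff:
  assumes "is_complex A C" "is_complex A D" "cm C D f"
  shows "is_iso (Ch A) (mk C D f) \<longleftrightarrow> (\<exists>g. cm D C g \<and> (\<forall>n. g n \<cdot> f n = Ide A (Term C n)) \<and> (\<forall>n. f n \<cdot> g n = Ide A (Term D n)))" (is "?L \<longleftrightarrow> ?R")
proof
  assume ?L
  then obtain G where "G \<in> Hom (Ch A) D C" "G \<cdot>\<^bsub>Ch A\<^esub> mk C D f = Ide (Ch A) C" "mk C D f \<cdot>\<^bsub>Ch A\<^esub> G = Ide (Ch A) D"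
    by (auto simp: is_iso_def Ch_def)
  moreover have "cm D C (At G)" using calculation(1) Hom_Ch_iff by blast
  ultimately show ?R by (intro exI[of _ "At G"]) (auto simp: Ch_def fun_eq_iff)
next
  assume ?R
  then obtain g where g: "cm D C g" "\<And>n. g n \<cdot> f n = Ide A (Term C n)" "\<And>n. f n \<cdot> g n = Ide A (Term D n)" by blast
  have "mk D C g \<in> Hom (Ch A) D C" using g(1) assms by (simp add: Hom_Ch_iff)
  moreover have "mk C D f \<in> Arr (Ch A)" using assms by (simp add: Ch_def chain_map_iff)
  moreover have "mk D C g \<cdot>\<^bsub>Ch A\<^esub> mk C D f = Ide (Ch A) C" "mk C D f \<cdot>\<^bsub>Ch A\<^esub> mk D C g = Ide (Ch A) D"
    using g by (auto simp: Ch_def fun_eq_iff)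
  moreover have "Dom (Ch A) (mk C D f) = C" "Cod (Ch A) (mk C D f) = D" by (simp_all add: Ch_def)
  ultimately show ?L unfolding is_iso_def by (intro conjI bexI[of _ "mk D C g"]) simp_all
qed

lemma biproduct_swap:
  assumes b: "is_biproduct A a b s i j p q"
  shows "is_biproduct A b a s j i q p"
proof -
  note [simp] = biD[OF b]
  have "(j \<cdot> q) \<uplus> (i \<cdot> p) = (i \<cdot> p) \<uplus> (j \<cdot> q)" by (rule lin_eqI, (rule lin_intros | simp)+)
  then show ?thesis using bi_sum[OF b] by (simp add: is_biproduct_def Hom_def)
qed

text \<open>Degreewise split extensions are the mapping cones of maps from the desuspended quotient.\<close>

lemma extension_cone:
  assumes c: "is_complex A c" and e: "is_complex A e" and s: "is_complex A s"
    and i: "cm c e i" and p: "cm e s p"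
    and b: "\<And>n. is_biproduct A (Term c n) (Term s n) (Term e n) (i n) (\<sigma> n) (\<rho> n) (p n)"
  shows "cone (unshift s) c (\<lambda>n. \<rho> n \<cdot> (Diff e (n + 1) \<cdot> \<sigma> (n + 1))) e i p \<sigma> \<rho>"
proof -
  note [simp] = cplxD[OF c] cplxD[OF e] cplxD[OF s] biD(4-)[OF b] bi_reassoc[OF b]
  let ?f = "\<lambda>n. \<rho> n \<cdot> (Diff e (n + 1) \<cdot> \<sigma> (n + 1))"
  have dn: "Diff e n = (\<sigma> (n - 1) \<cdot> (Diff s n \<cdot> p n)) \<uplus> ((i (n - 1) \<cdot> (?f (n - 1) \<cdot> p n)) \<uplus> (i (n - 1) \<cdot> (Diff c n \<cdot> \<rho> n)))" for n
  proof -
    have 1: "Diff e n \<cdot> i n = i (n - 1) \<cdot> Diff c n" using cmD(4)[OF i, of "n - 1" n] by simp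
    have "p (n - 1) \<cdot> (Diff e n \<cdot> \<sigma> n) = Diff s n \<cdot> (p n \<cdot> \<sigma> n)"
      using Comp_reassoc[OF cmD(4)[OF p, of "n - 1" n], of "\<sigma> n"] by simp
    then have 2: "p (n - 1) \<cdot> (Diff e n \<cdot> \<sigma> n) = Diff s n" by simp
    have ds: "Diff e n \<cdot> \<sigma> n = (i (n - 1) \<cdot> (\<rho> (n - 1) \<cdot> (Diff e n \<cdot> \<sigma> n))) \<uplus> (\<sigma> (n - 1) \<cdot> Diff s n)"
      by (rule trans[OF bi_into[OF b[of "n - 1"], of "Diff e n \<cdot> \<sigma> n"]]) (simp_all add: 2)
    have "Diff e n = ((Diff e n \<cdot> i n) \<cdot> \<rho> n) \<uplus> ((Diff e n \<cdot> \<sigma> n) \<cdot> p n)"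
      by (rule bi_from[OF b]) simp_all
    also have "\<dots> = ((i (n - 1) \<cdot> Diff c n) \<cdot> \<rho> n) \<uplus> (((i (n - 1) \<cdot> (\<rho> (n - 1) \<cdot> (Diff e n \<cdot> \<sigma> n))) \<uplus> (\<sigma> (n - 1) \<cdot> Diff s n)) \<cdot> p n)"
      using 1 arg_cong[OF ds, of "\<lambda>x. x \<cdot> p n"] by (simp only:)
    also have "\<dots> = (\<sigma> (n - 1) \<cdot> (Diff s n \<cdot> p n)) \<uplus> ((i (n - 1) \<cdot> (?f (n - 1) \<cdot> p n)) \<uplus> (i (n - 1) \<cdot> (Diff c n \<cdot> \<rho> n)))"
      by (simp, rule lin_eqI, (rule lin_intros | simp)+)
    finally show ?thesis .
  qed
  define f where "f = ?f"
  have [simp]: "f n \<in> Arr A" "Dom A (f n) = Term s (n + 1)" "Cod A (f n) = Term c n" for n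
    by (simp_all add: f_def)
  have dn: "Diff e n = (\<sigma> (n - 1) \<cdot> (Diff s n \<cdot> p n)) \<uplus> ((i (n - 1) \<cdot> (f (n - 1) \<cdot> p n)) \<uplus> (i (n - 1) \<cdot> (Diff c n \<cdot> \<rho> n)))" for n
    unfolding f_def by (rule dn)
  have "f (n - 1) \<cdot> Diff (unshift s) n = Diff c n \<cdot> f n" for n
  proof -
    have 1: "Diff e (n + 1) \<cdot> \<sigma> (n + 1) = (\<sigma> n \<cdot> Diff s (n + 1)) \<uplus> (i n \<cdot> f n)"
      by (subst dn) simp
    have 2: "\<rho> (n - 1) \<cdot> (Diff e n \<cdot> x) = (f (n - 1) \<cdot> (p n \<cdot> x)) \<uplus> (Diff c n \<cdot> (\<rho> n \<cdot> x))" if "x \<in> Arr A" "Cod A x = Term e n" for x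
      using that by (subst dn) simp
    have "\<rho> (n - 1) \<cdot> (Diff e n \<cdot> (Diff e (n + 1) \<cdot> \<sigma> (n + 1))) = Zero A (Term s (n + 1)) (Term c (n - 1))" by simp
    moreover have "\<rho> (n - 1) \<cdot> (Diff e n \<cdot> (Diff e (n + 1) \<cdot> \<sigma> (n + 1))) = (f (n - 1) \<cdot> Diff s (n + 1)) \<uplus> (Diff c n \<cdot> f n)"
      unfolding 1 by (rule trans[OF 2]) simp_all
    ultimately have z: "(f (n - 1) \<cdot> Diff s (n + 1)) \<uplus> (Diff c n \<cdot> f n) = Zero A (Term s (n + 1)) (Term c (n - 1))" by simp
    have "Neg A (f (n - 1) \<cdot> Diff s (n + 1)) = Diff c n \<cdot> f n"
      by (rule Add_cross[OF z[symmetric]]) (simp_all, rule lin_eqI, (rule lin_intros | simp)+)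
    then show ?thesis by simp
  qed
  then have f: "cm (unshift s) c f" by (intro cmI) simp_all
  have "cone (unshift s) c f e i p \<sigma> \<rho>"
    unfolding cone_def
  proof (intro conjI allI unshift_complex c e s f i)
    show "cm e (shift_complex A (unshift s)) p" using p s by (simp add: shift_unshift)
    fix n
    show "is_biproduct A (Term (unshift s) (n - 1)) (Term c n) (Term e n) (\<sigma> n) (i n) (p n) (\<rho> n)"
      using biproduct_swap[OF b[of n]] by simp
    show "Diff e n = (\<sigma> (n - 1) \<cdot> Neg A (Diff (unshift s) (n - 1)) \<cdot> p n) \<uplus>
             ((i (n - 1) \<cdot> f (n - 1) \<cdot> p n) \<uplus> (i (n - 1) \<cdot> Diff c n \<cdot> \<rho> n))"
      by (subst dn) simp
  qed
  then show ?thesis by (simp add: f_def)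
qed

lemma Ext1_zero_iff:
  assumes ds: "\<And>a b. \<lbrakk>a \<in> Obj A; b \<in> Obj A\<rbrakk> \<Longrightarrow> \<exists>s. is_direct_sum A a b s"
    and s: "is_complex A s" and c: "is_complex A c"
    and E1: "\<And>n e i \<sigma> \<rho> p. is_biproduct A (Term c n) (Term s n) e i \<sigma> \<rho> p \<Longrightarrow> (i, p) \<in> E"
    and E2: "\<And>n i p. \<lbrakk>(i, p) \<in> E; Dom A i = Term c n; Cod A p = Term s n\<rbrakk>
               \<Longrightarrow> \<exists>\<sigma> \<rho>. is_biproduct A (Dom A i) (Cod A p) (Cod A i) i \<sigma> \<rho> p"
  shows "Ext1_zero (Ch A) (Ch_exact A E) s c \<longleftrightarrow> nullmaps (unshift s) c"
proof -
  let ?X = "extensions (Ch A) (Ch_exact A E) s c" and ?r = "extension_equiv (Ch A) (Ch_exact A E) s c"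
  have us: "is_complex A (unshift s)" "shift_complex A (unshift s) = s" using s by (simp_all add: unshift_complex shift_unshift)
  have cone_ext: "(mk c e i, mk e s p) \<in> ?X" if "cone (unshift s) c f e i p \<sigma> \<rho>" for f e i p \<sigma> \<rho>
  proof -
    have b: "is_biproduct A (Term c n) (Term s n) (Term e n) (i n) (\<sigma> n) (\<rho> n) (p n)" for n
      using biproduct_swap[OF coneD(9)[OF that, of n]] by simp
    show ?thesis unfolding extensions_iff using coneD(1-8)[OF that] s E1[OF b] us by auto
  qed
  show ?thesis
  proof
    assume n: "nullmaps (unshift s) c"
    obtain e0 i0 p0 \<sigma>0 \<rho>0 where "cone (unshift s) c (\<lambda>n. Zero A (Term (unshift s) n) (Term c n)) e0 i0 p0 \<sigma>0 \<rho>0"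
      using cone_exists[OF ds cm_zero[OF us(1) c] us(1) c] by blast
    then have ne: "?X \<noteq> {}" using cone_ext by blast
    have rel: "(x, y) \<in> ?r" if x: "x \<in> ?X" and y: "y \<in> ?X" for x y
    proof -
      have get: "\<exists>e i p \<sigma> \<rho> f. x = (mk c e i, mk e s p) \<and> cone (unshift s) c f e i p \<sigma> \<rho>" if x: "x \<in> ?X" for x
      proof -
        obtain I P where IP: "x = (I, P)" by (cases x)
        then obtain e i p where *: "I = mk c e i" "P = mk e s p" "is_complex A e" "cm c e i" "cm e s p" "\<And>n. (i n, p n) \<in> E"
          using x unfolding IP extensions_iff by blast
        have "\<exists>\<sigma> \<rho>. is_biproduct A (Term c n) (Term s n) (Term e n) (i n) \<sigma> \<rho> (p n)" for n
          using E2[OF *(6), of n] cmD[OF *(4), of n] cmD[OF *(5), of n] by simp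
        then obtain \<sigma> \<rho> where "\<And>n. is_biproduct A (Term c n) (Term s n) (Term e n) (i n) (\<sigma> n) (\<rho> n) (p n)" by metis
        from extension_cone[OF c *(3) s *(4,5) this] show ?thesis using IP * by blast
      qed
      obtain e i p \<sigma> \<rho> f where x': "x = (mk c e i, mk e s p)" and co: "cone (unshift s) c f e i p \<sigma> \<rho>"
        using get[OF x] by blast
      obtain e' i' p' \<sigma>' \<rho>' f' where y': "y = (mk c e' i', mk e' s p')" and co': "cone (unshift s) c f' e' i' p' \<sigma>' \<rho>'"
        using get[OF y] by blast
      note [simp] = cplxD[OF us(1)] cplxD[OF c] cplxD[OF s] cplxD[OF coneD(3)[OF co]] cplxD[OF coneD(3)[OF co']]
        cmD(1-3)[OF coneD(6)[OF co]] cmD(1-3)[OF coneD(6)[OF co']] 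
      have F: "nul (unshift s) c f" "nul (unshift s) c f'"
        using n coneD(6)[OF co] coneD(6)[OF co'] by (simp_all add: nullmaps_def)
      have "htp (unshift s) c f f'"
        by (rule htp_trans[OF F(1) htp_sym[OF F(2)]]) (simp_all add: coneD(6)[OF co] coneD(6)[OF co'] cm_zero[OF us(1) c, simplified] us c)
      then have H: "htp (unshift s) c (\<lambda>n. Ide A (Term c n) \<cdot> f n) (\<lambda>n. f' n \<cdot> Ide A (Term (unshift s) n))"
        by simp
      obtain k where k: "cm e e' k" "\<And>n. k n \<cdot> i n = i' n \<cdot> Ide A (Term c n)" "\<And>n. p' n \<cdot> k n = Ide A (Term (unshift s) (n - 1)) \<cdot> p n"
        using cone_map[OF co co' cm_ide[OF us(1)] cm_ide[OF c] H] by blast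
      note [simp] = cmD(1-3)[OF k(1)] biD(4-)[OF coneD(9)[OF co], simplified] biD(4-)[OF coneD(9)[OF co'], simplified]
      have k': "k n \<cdot> i n = i' n" "p' n \<cdot> k n = p n" for n using k(2,3)[of n] by simp_all
      have b: "is_biproduct A (Term c n) (Term s n) (Term e n) (i n) (\<sigma> n) (\<rho> n) (p n)"
        "is_biproduct A (Term c n) (Term s n) (Term e' n) (i' n) (\<sigma>' n) (\<rho>' n) (p' n)" for n
        using biproduct_swap[OF coneD(9)[OF co, of n]] biproduct_swap[OF coneD(9)[OF co', of n]] by simp_all
      have "\<exists>l. l \<in> Arr A \<and> Dom A l = Term e' n \<and> Cod A l = Term e n \<and> l \<cdot> k n = Ide A (Term e n) \<and> k n \<cdot> l = Ide A (Term e' n)" for n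
        by (rule unipotent_iso[OF b(1) b(2)]) (simp_all add: k')
      then obtain l where l: "\<And>n. l n \<in> Arr A" "\<And>n. Dom A (l n) = Term e' n" "\<And>n. Cod A (l n) = Term e n"
        "\<And>n. l n \<cdot> k n = Ide A (Term e n)" "\<And>n. k n \<cdot> l n = Ide A (Term e' n)" by metis
      note [simp] = l
      have "l (n - 1) \<cdot> Diff e' n = Diff e n \<cdot> l n" for n
      proof -
        have "l (n - 1) \<cdot> Diff e' n = l (n - 1) \<cdot> ((Diff e' n \<cdot> k n) \<cdot> l n)" by simp
        also have "\<dots> = l (n - 1) \<cdot> ((k (n - 1) \<cdot> Diff e n) \<cdot> l n)" using cmD(4)[OF k(1), of "n - 1" n] by simp
        also have "\<dots> = (l (n - 1) \<cdot> k (n - 1)) \<cdot> (Diff e n \<cdot> l n)" by (simp del: l(4))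
        finally show ?thesis by simp
      qed
      then have "cm e' e l" by (intro cmI) simp_all
      then have "is_iso (Ch A) (mk e e' k)"
        using Ch_iso_iff[OF coneD(3)[OF co] coneD(3)[OF co'] k(1)] by auto
      moreover have "mk e e' k \<in> Hom (Ch A) e e'" using k(1) coneD(3)[OF co] coneD(3)[OF co'] by (simp add: Hom_Ch_iff)
      moreover have "mk e e' k \<cdot>\<^bsub>Ch A\<^esub> mk c e i = mk c e' i'" "mk e' s p' \<cdot>\<^bsub>Ch A\<^esub> mk e e' k = mk e s p"
        using k' by (simp_all add: Ch_def)
      ultimately show ?thesis using x y unfolding x' y' extension_equiv_def by (auto simp: Ch_def)
    qed
    have "?r `` {x} = ?X" if "x \<in> ?X" for x
      using rel[OF that] by (auto simp: extension_equiv_def)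
    then have "Ext1 (Ch A) (Ch_exact A E) s c = {?X}" using ne by (auto simp: Ext1_def quotient_def)
    then show "Ext1_zero (Ch A) (Ch_exact A E) s c" by (simp add: Ext1_zero_def)
  next
    assume z: "Ext1_zero (Ch A) (Ch_exact A E) s c"
    show "nullmaps (unshift s) c" unfolding nullmaps_def
    proof (intro allI impI)
      fix f assume f: "cm (unshift s) c f"
      obtain e i p \<sigma> \<rho> where co: "cone (unshift s) c f e i p \<sigma> \<rho>"
        using cone_exists[OF ds f us(1) c] by blast
      obtain e0 i0 p0 \<sigma>0 \<rho>0 where co0: "cone (unshift s) c (\<lambda>n. Zero A (Term (unshift s) n) (Term c n)) e0 i0 p0 \<sigma>0 \<rho>0"
        using cone_exists[OF ds cm_zero[OF us(1) c] us(1) c] by blast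
      note ce = coneD(3)[OF co] and ce0 = coneD(3)[OF co0]
      let ?x = "(mk c e i, mk e s p)" and ?y = "(mk c e0 i0, mk e0 s p0)"
      have X: "?x \<in> ?X" "?y \<in> ?X" using cone_ext[OF co] cone_ext[OF co0] by auto
      have "?r `` {?x} \<in> Ext1 (Ch A) (Ch_exact A E) s c" "?r `` {?y} \<in> Ext1 (Ch A) (Ch_exact A E) s c"
        using X by (auto simp: Ext1_def quotient_def)
      then have eq: "?r `` {?x} = ?r `` {?y}" using z unfolding Ext1_zero_def is_singleton_def by auto
      note [simp] = cplxD[OF us(1)] cplxD[OF c] cplxD[OF s] cplxD[OF ce] cplxD[OF ce0] 
        cmD(1-3)[OF f] biD(4-)[OF coneD(9)[OF co], simplified] biD(4-)[OF coneD(9)[OF co0], simplified]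
      have "is_iso (Ch A) (Ide (Ch A) e0)" using Ch_iso_iff[OF ce0 ce0 cm_ide[OF ce0]] cm_ide[OF ce0] by (auto simp: Ch_def)
      moreover have "Ide (Ch A) e0 \<in> Hom (Ch A) e0 e0" using cm_ide[OF ce0] ce0 by (simp add: Hom_Ch_iff) (simp add: Ch_def)
      moreover have "Ide (Ch A) e0 \<cdot>\<^bsub>Ch A\<^esub> mk c e0 i0 = mk c e0 i0" "mk e0 s p0 \<cdot>\<^bsub>Ch A\<^esub> Ide (Ch A) e0 = mk e0 s p0"
        by (simp_all add: Ch_def)
      ultimately have "(?y, ?y) \<in> ?r" using X(2) unfolding extension_equiv_def by (auto simp: Ch_def)
      then have "(?x, ?y) \<in> ?r" using eq by blast
      then obtain H where H: "H \<in> Hom (Ch A) e e0" "H \<cdot>\<^bsub>Ch A\<^esub> mk c e i = mk c e0 i0"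
        unfolding extension_equiv_def by (auto simp: Ch_def)
      define h where "h = At H"
      have h: "cm e e0 h" "\<And>n. h n \<cdot> i n = i0 n"
        using H(1) unfolding Hom_Ch_iff h_def apply blast
        using H(2) by (auto simp: Ch_def h_def fun_eq_iff)
      note [simp] = cmD(1-3)[OF h(1)]
      have r: "cm e0 c \<rho>0"
      proof (rule cmI)
        show "\<rho>0 (n - 1) \<cdot> Diff e0 n = Diff c n \<cdot> \<rho>0 n" for n
          using cone_diff(2)[OF co0, of "n - 1" n] by simp
      qed simp_all
      have rh: "cm e c (\<lambda>n. \<rho>0 n \<cdot> h n)" by (rule cm_comp[OF h(1) r ce ce0 c])
      have "cm (unshift s) e (\<lambda>n. i n \<cdot> f n)" by (rule cm_comp[OF f coneD(7)[OF co] us(1) c ce])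
      then have "htp (unshift s) c (\<lambda>n. (\<rho>0 n \<cdot> h n) \<cdot> (i n \<cdot> f n)) (\<lambda>n. (\<rho>0 n \<cdot> h n) \<cdot> Zero A (Term (unshift s) n) (Term e n))"
        by (rule htp_comp_left[OF cone_null_left[OF co] _ cm_zero[OF us(1) ce] rh us(1) ce c])
      moreover have "(\<rho>0 n \<cdot> h n) \<cdot> (i n \<cdot> f n) = f n" for n
        using Comp_reassoc[OF h(2)[of n], of "f n"] bi_reassoc(2)[OF coneD(9)[OF co0, of n], of "f n"] by simp
      ultimately show "nul (unshift s) c f" by simp
    qed
  qed
qed


lemma to_zero_object:
  assumes "is_zero_object A z" "f \<in> Arr A" "g \<in> Arr A" "Dom A f = Dom A g" "Cod A f = z" "Cod A g = z"
  shows "f = g"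
proof -
  have "\<exists>!f. f \<in> Hom A (Dom A g) z" using assms unfolding is_zero_object_def by simp
  moreover have "f \<in> Hom A (Dom A g) z" "g \<in> Hom A (Dom A g) z" using assms by (simp_all add: Hom_def)
  ultimately show ?thesis by blast
qed

lemma from_zero_object:
  assumes "is_zero_object A z" "f \<in> Arr A" "g \<in> Arr A" "Cod A f = Cod A g" "Dom A f = z" "Dom A g = z"
  shows "f = g"
proof -
  have "\<exists>!f. f \<in> Hom A z (Cod A g)" using assms unfolding is_zero_object_def by simp
  moreover have "f \<in> Hom A z (Cod A g)" "g \<in> Hom A z (Cod A g)" using assms by (simp_all add: Hom_def)
  ultimately show ?thesis by blast
qed

lemma right_acyclicD:
  assumes "right_acyclic A X C" "is_complex A C" "f \<in> Arr A" "Dom A f \<in> X" "Cod A f = Term C n"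
    "Diff C n \<cdot> f = Zero A (Dom A f) (Term C (n - 1))"
  shows "\<exists>g. g \<in> Arr A \<and> Dom A g = Dom A f \<and> Cod A g = Term C (n + 1) \<and> Diff C (n + 1) \<cdot> g = f"
proof -
  have "{f' \<in> Hom A (Dom A f) (Term C n). Diff C n \<cdot> f' = Zero A (Dom A f) (Term C (n - 1))} =
     (\<lambda>g. Diff C (n + 1) \<cdot> g) ` Hom A (Dom A f) (Term C (n + 1))"
    using assms(1,4) unfolding right_acyclic_def by blast
  moreover have "f \<in> {f' \<in> Hom A (Dom A f) (Term C n). Diff C n \<cdot> f' = Zero A (Dom A f) (Term C (n - 1))}"
    using assms by (simp add: Hom_def)
  ultimately have "f \<in> (\<lambda>g. Diff C (n + 1) \<cdot> g) ` Hom A (Dom A f) (Term C (n + 1))" by simp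
  then show ?thesis by (auto simp: Hom_def)
qed

lemma left_acyclicD:
  assumes "left_acyclic A Y C" "is_complex A C" "f \<in> Arr A" "Cod A f \<in> Y" "Dom A f = Term C n"
    "f \<cdot> Diff C (n + 1) = Zero A (Term C (n + 1)) (Cod A f)"
  shows "\<exists>g. g \<in> Arr A \<and> Dom A g = Term C (n - 1) \<and> Cod A g = Cod A f \<and> g \<cdot> Diff C n = f"
proof -
  have "{f' \<in> Hom A (Term C n) (Cod A f). f' \<cdot> Diff C (n + 1) = Zero A (Term C (n + 1)) (Cod A f)} =
     (\<lambda>g. g \<cdot> Diff C n) ` Hom A (Term C (n - 1)) (Cod A f)"
    using assms(1,4) unfolding left_acyclic_def by blast
  moreover have "f \<in> {f' \<in> Hom A (Term C n) (Cod A f). f' \<cdot> Diff C (n + 1) = Zero A (Term C (n + 1)) (Cod A f)}"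
    using assms by (simp add: Hom_def)
  ultimately have "f \<in> (\<lambda>g. g \<cdot> Diff C n) ` Hom A (Term C (n - 1)) (Cod A f)" by simp
  then show ?thesis by (auto simp: Hom_def)
qed

lemma nullmaps_bounded_below:
  assumes P: "P \<in> dw A X" and B: "is_complex A B" "right_acyclic A X B" and z: "\<And>n. n < m \<Longrightarrow> is_zero_object A (Term B n)"
  shows "nullmaps P B"
  unfolding nullmaps_def
proof (intro allI impI)
  fix f assume f: "cm P B f"
  have cP: "is_complex A P" by (rule dwD[OF P])
  note [simp] = cplxD[OF cP] cplxD[OF B(1)] cmD[OF f] cm_reassoc[OF f cP B(1)] cP B(1)
  have PX: "Term P n \<in> X" for n using P by (simp add: dw_def)
  define D where "D j = m - 1 + int j" for j
  have DS: "D (Suc j) = D j + 1" for j by (simp add: D_def)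
  define good where "good j h \<longleftrightarrow> h \<in> Arr A \<and> Dom A h = Term P (D j) \<and> Cod A h = Term B (D j + 1) \<and>
     (Diff B (D j + 1) \<cdot> h) \<cdot> Diff P (D j + 1) = f (D j) \<cdot> Diff P (D j + 1) \<and>
     (j = 0 \<longrightarrow> h = Zero A (Term P (D 0)) (Term B (D 0 + 1)))" for j h
  have "\<exists>H. \<forall>j. good j (H j) \<and> f (D j + 1) = (Diff B (D j + 2) \<cdot> H (Suc j)) \<uplus> (H j \<cdot> Diff P (D j + 1))"
  proof (rule dependent_nat_choice)
    have "f (D 0) \<cdot> Diff P (D 0 + 1) = Zero A (Term P (D 0 + 1)) (Term B (D 0))"
      by (rule to_zero_object[OF z[of "D 0"]]) (simp_all add: D_def)
    then show "\<exists>h. good 0 h" unfolding good_def by (intro exI[of _ "Zero A (Term P (D 0)) (Term B (D 0 + 1))"]) simp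
  next
    fix h j assume g: "good j h"
    note [simp] = g[unfolded good_def, THEN conjunct1] g[unfolded good_def, THEN conjunct2, THEN conjunct1]
      g[unfolded good_def, THEN conjunct2, THEN conjunct2, THEN conjunct1]
    have e: "Diff B (D j + 1) \<cdot> (h \<cdot> Diff P (D j + 1)) = Diff B (D j + 1) \<cdot> f (D j + 1)"
      using g unfolding good_def by simp
    let ?k = "f (D j + 1) \<uplus> Neg A (h \<cdot> Diff P (D j + 1))"
    have "Diff B (D j + 1) \<cdot> ?k = Zero A (Dom A ?k) (Term B (D j + 1 - 1))"
      by (simp add: e)
    then obtain h' where h': "h' \<in> Arr A" "Dom A h' = Term P (D j + 1)" "Cod A h' = Term B (D j + 1 + 1)" "Diff B (D j + 1 + 1) \<cdot> h' = ?k"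
      using right_acyclicD[OF B(2,1), of ?k "D j + 1"] PX by auto
    note [simp] = h'(1-3)
    have 1: "f (D j + 1) = ?k \<uplus> (h \<cdot> Diff P (D j + 1))"
      by (rule lin_eqI, (rule lin_intros | simp)+)
    have 2: "Diff B (D j + 2) \<cdot> h' = ?k"
      using h'(4) unfolding add.assoc[of "D j" 1 1] one_add_one .
    have [simp]: "Term P (1 + D j) = Term P (D j + 1)" "Term B (1 + D j) = Term B (D j + 1)"
      "Term B (2 + D j) = Term B (D j + 2)"
      by (simp_all add: add.commute)
    have "?k \<cdot> Diff P (D j + 2) = f (D j + 1) \<cdot> Diff P (D j + 2)" by simp
    then have "good (Suc j) h'"
      unfolding good_def DS add.assoc[of "D j" 1 1] one_add_one using 2 by simp
    then show "\<exists>h'. good (Suc j) h' \<and> f (D j + 1) = (Diff B (D j + 2) \<cdot> h') \<uplus> (h \<cdot> Diff P (D j + 1))"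
      using 1 2 by (intro exI[of _ h']) simp
  qed
  then obtain H where H: "\<And>j. good j (H j)" "\<And>j. f (D j + 1) = (Diff B (D j + 2) \<cdot> H (Suc j)) \<uplus> (H j \<cdot> Diff P (D j + 1))"
    by blast
  define h where "h n = (if m - 1 \<le> n then H (nat (n - m + 1)) else Zero A (Term P n) (Term B (n + 1)))" for n
  have hD: "h (D j) = H j" for j by (simp add: h_def D_def)
  have [simp]: "h n \<in> Arr A" "Dom A (h n) = Term P n" "Cod A (h n) = Term B (n + 1)" for n
  proof -
    have "h n \<in> Arr A \<and> Dom A (h n) = Term P n \<and> Cod A (h n) = Term B (n + 1)"
    proof (cases "m - 1 \<le> n")
      case True
      then have n: "n = D (nat (n - m + 1))" by (simp add: D_def)
      show ?thesis using H(1)[of "nat (n - m + 1)"] n hD[of "nat (n - m + 1)"] by (simp add: good_def)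
    qed (simp add: h_def)
    then show "h n \<in> Arr A" "Dom A (h n) = Term P n" "Cod A (h n) = Term B (n + 1)" by auto
  qed
  show "nul P B f"
  proof (rule nulI[where h = h])
    fix n
    show "f n = (Diff B (n + 1) \<cdot> h n) \<uplus> (h (n - 1) \<cdot> Diff P n)"
    proof (cases "m \<le> n")
      case True
      define j where "j = nat (n - m)"
      have n: "n = D j + 1" "n + 1 = D j + 2" "n - 1 = D j" using True by (simp_all add: D_def j_def)
      have "h n = H (Suc j)" using hD[of "Suc j"] unfolding DS n(1)[symmetric] .
      moreover have "h (n - 1) = H j" using hD[of j] unfolding n(3) .
      moreover have "f n = (Diff B (n + 1) \<cdot> H (Suc j)) \<uplus> (H j \<cdot> Diff P n)"
        using H(2)[of j] unfolding n(2)[symmetric] n(1)[symmetric] .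
      ultimately show ?thesis by simp
    next
      case False
      then show ?thesis by (intro to_zero_object[OF z[of n]]) simp_all
    qed
  qed simp_all
qed

end

context abelian_category
begin

lemma resolution_approximation:
  assumes r: "is_resolution A X N C"
  shows "is_right_approximation A X (Diff C 0)" "Cod A (Diff C 0) = N"
proof -
  have C: "is_complex A C" and t: "Term C (-1) = N" "Term C 0 \<in> X" "is_zero_object A (Term C (-2))" and a: "right_acyclic A X C"
    using r by (simp_all add: is_resolution_def)
  note [simp] = cplxD(1-4)[OF C]
  show "Cod A (Diff C 0) = N" by (simp add: t)
  show "is_right_approximation A X (Diff C 0)" unfolding is_right_approximation_def
  proof (intro conjI ballI)
    fix x g assume x: "x \<in> X" and g: "g \<in> Hom A x (Cod A (Diff C 0))"
    have "x \<in> Obj A" using g Dom_Obj[of g] by (auto simp: Hom_def)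
    then have "Diff C (-1) \<cdot> g = Zero A (Dom A g) (Term C (-2))"
      by - (rule to_zero_object[OF t(3)], use g in \<open>simp_all add: Hom_def\<close>)
    then show "\<exists>h \<in> Hom A x (Dom A (Diff C 0)). Diff C 0 \<cdot> h = g"
      using right_acyclicD[OF a C, of g "-1"] g x by (auto simp: Hom_def)
  qed (simp_all add: t)
qed

text \<open>Right \<open>X\<close>-acyclic short exact sequences are left \<open>Y\<close>-acyclic.\<close>

lemma right_acyclic_extend:
  assumes bp: "admissible_balanced_pair A X Y" and e: "(i, p) \<in> right_acyclic_sequences A X"
    and y: "y \<in> Y" and g: "g \<in> Arr A" "Dom A g = Dom A i" "Cod A g = y"
  shows "\<exists>m. m \<in> Arr A \<and> Dom A m = Cod A i \<and> Cod A m = y \<and> m \<cdot> i = g"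
proof -
  have se: "is_kernel A i p" "is_cokernel A p i" using e by (simp_all add: right_acyclic_sequences_def short_exact_def)
  have lift: "(\<lambda>f. p \<cdot> f) ` Hom A x (Dom A p) = Hom A x (Cod A p)" if "x \<in> X" for x
    using e that unfolding right_acyclic_sequences_def by auto
  note [simp] = kernelD[OF se(1)] g
  have ra: "is_epic A f" if "is_right_approximation A X f" for f using bp that by (simp add: admissible_balanced_pair_def)
  have cf: "\<exists>f. is_right_approximation A X f \<and> Cod A f = M" if "M \<in> Obj A" for M
    using bp that by (simp add: admissible_balanced_pair_def balanced_pair_def contravariantly_finite_def)
  obtain C where C: "is_resolution A X (Cod A p) C" "left_acyclic A Y C"
    using bp unfolding admissible_balanced_pair_def balanced_pair_def by (meson Cod_Obj kernelD(2) se(1))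
  have cC: "is_complex A C" and tX: "\<And>n. 0 \<le> n \<Longrightarrow> Term C n \<in> X" and rC: "right_acyclic A X C" and tN: "Term C (-1) = Cod A p"
    using C(1) by (simp_all add: is_resolution_def)
  note [simp] = cplxD(1-4)[OF cC] tN
  have dd: "Diff C 0 \<cdot> Diff C 1 = Zero A (Term C 1) (Cod A p)" "Diff C 1 \<cdot> Diff C 2 = Zero A (Term C 2) (Term C 0)"
    using cplxD(5)[OF cC, of 0 1] cplxD(5)[OF cC, of 1 2] by simp_all
  have y': "y \<in> Obj A" using Cod_Obj[OF g(1)] by simp
  note [simp] = y'
  obtain s where s: "s \<in> Arr A" "Dom A s = Term C 0" "Cod A s = Dom A p" "p \<cdot> s = Diff C 0"
  proof -
    have "Diff C 0 \<in> (\<lambda>f. p \<cdot> f) ` Hom A (Term C 0) (Dom A p)"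
      unfolding lift[OF tX[of 0, simplified]] by (simp add: Hom_def)
    then show thesis using that by (auto simp: Hom_def)
  qed
  note [simp] = s(1-3)
  have ps: "p \<cdot> (s \<cdot> x) = Diff C 0 \<cdot> x" if "x \<in> Arr A" "Cod A x = Term C 0" for x
    using Comp_reassoc[OF s(4), of x] that by simp
  obtain t where t: "t \<in> Arr A" "Dom A t = Term C 1" "Cod A t = Dom A i" "i \<cdot> t = s \<cdot> Diff C 1"
    using kernel_factor[OF se(1), of "s \<cdot> Diff C 1"] by (auto simp: ps dd)
  note [simp] = t(1-3)
  have it: "i \<cdot> (t \<cdot> x) = s \<cdot> (Diff C 1 \<cdot> x)" if "x \<in> Arr A" "Cod A x = Term C 1" for x
    using Comp_reassoc[OF t(4), of x] that by simp
  have "t \<cdot> Diff C 2 = Zero A (Term C 2) (Dom A i)"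
    by (rule monic_cancel[OF kernel_monic[OF se(1)]]) (simp_all add: it dd)
  then have "(g \<cdot> t) \<cdot> Diff C (1 + 1) = Zero A (Term C (1 + 1)) (Cod A (g \<cdot> t))" by simp
  then obtain g' where g': "g' \<in> Arr A" "Dom A g' = Term C 0" "Cod A g' = y" "g' \<cdot> Diff C 1 = g \<cdot> t"
    using left_acyclicD[OF C(2) cC, of "g \<cdot> t" 1] y by auto
  note [simp] = g'(1-3)
  have gd: "g' \<cdot> (Diff C 1 \<cdot> x) = g \<cdot> (t \<cdot> x)" if "x \<in> Arr A" "Cod A x = Term C 1" for x
    using Comp_reassoc[OF g'(4), of x] that by simp
  obtain S i1 i2 p1 p2 where b: "is_biproduct A (Dom A i) (Term C 0) S i1 i2 p1 p2"
    using ex_direct_sum[of "Dom A i" "Term C 0"] by (auto simp: is_direct_sum_def)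
  note [simp] = biD[OF b] bi_reassoc[OF b]
  let ?e = "(i \<cdot> p1) \<uplus> (s \<cdot> p2)" and ?w = "(g \<cdot> p1) \<uplus> (g' \<cdot> p2)"
  have epi: "is_epic A ?e" unfolding is_epic_def
  proof (intro conjI allI ballI impI)
    fix c u v assume u: "u \<in> Hom A (Cod A ?e) c" and v: "v \<in> Hom A (Cod A ?e) c" and uv: "u \<cdot> ?e = v \<cdot> ?e"
    have c: "c \<in> Obj A" using u Cod_Obj[of u] by (auto simp: Hom_def)
    have [simp]: "u \<in> Arr A" "Dom A u = Dom A p" "Cod A u = c" "v \<in> Arr A" "Dom A v = Dom A p" "Cod A v = c"
      using u v by (simp_all add: Hom_def)
    note [simp] = c
    have "(u \<cdot> ?e) \<cdot> i1 = (v \<cdot> ?e) \<cdot> i1" "(u \<cdot> ?e) \<cdot> i2 = (v \<cdot> ?e) \<cdot> i2" using uv by simp_all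
    then have ui: "u \<cdot> i = v \<cdot> i" and us: "u \<cdot> s = v \<cdot> s" by simp_all
    obtain d where d: "d \<in> Arr A" "Dom A d = Cod A p" "Cod A d = c" "d \<cdot> p = u \<uplus> Neg A v"
      using cokernel_factor[OF se(2), of "u \<uplus> Neg A v"] ui by auto
    note [simp] = d(1-3)
    have "(d \<cdot> p) \<cdot> s = Zero A (Term C 0) c" unfolding d(4) using us by simp
    then have "d \<cdot> Diff C 0 = Zero A (Cod A p) c \<cdot> Diff C 0" using s(4) by simp
    then have "d = Zero A (Cod A p) c"
      by - (rule epic_cancel[OF ra[OF resolution_approximation(1)[OF C(1)]]], simp_all)
    then have z: "u \<uplus> Neg A v = Zero A (Dom A p) c" using d(4)[symmetric] by simp
    show "u = v"
      by (rule Add_cross[OF z]) (simp_all, rule lin_eqI, (rule lin_intros | simp)+)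
  qed simp
  from epic_normal[OF this] obtain k where k: "is_cokernel A ?e k" by (rule exE)
  note ck = cokernelD[OF k]
  obtain q where q: "is_right_approximation A X q" "Cod A q = Dom A k" using cf[of "Dom A k"] ck by auto
  have qX: "Dom A q \<in> X" and [simp]: "q \<in> Arr A" using q by (simp_all add: is_right_approximation_def)
  have [simp]: "k \<in> Arr A" "Cod A k = S" using ck by simp_all
  note [simp] = q(2)
  have ke: "(i \<cdot> (p1 \<cdot> k)) \<uplus> (s \<cdot> (p2 \<cdot> k)) = Zero A (Dom A k) (Dom A p)" using ck(4) by simp
  have "p \<cdot> ((i \<cdot> (p1 \<cdot> k)) \<uplus> (s \<cdot> (p2 \<cdot> k))) = Zero A (Dom A k) (Cod A p)" unfolding ke by simp
  moreover have pi: "p \<cdot> (i \<cdot> x) = Zero A (Dom A x) (Cod A p)" if "x \<in> Arr A" "Cod A x = Dom A i" for x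
    using Comp_reassoc[OF kernelD(4)[OF se(1)], of x] that by simp
  ultimately have d0: "Diff C 0 \<cdot> (p2 \<cdot> k) = Zero A (Dom A k) (Cod A p)" by (simp add: ps)
  have "Diff C 0 \<cdot> ((p2 \<cdot> k) \<cdot> q) = Zero A (Dom A q) (Term C (0 - 1))"
    using Comp_reassoc[OF d0, of q] by simp
  then obtain w where w: "w \<in> Arr A" "Dom A w = Dom A q" "Cod A w = Term C 1" "Diff C 1 \<cdot> w = p2 \<cdot> (k \<cdot> q)"
    using right_acyclicD[OF rC cC, of "p2 \<cdot> (k \<cdot> q)" 0] qX by auto
  note [simp] = w(1-3)
  have "((i \<cdot> (p1 \<cdot> k)) \<uplus> (s \<cdot> (p2 \<cdot> k))) \<cdot> q = Zero A (Dom A q) (Dom A p)" unfolding ke by simp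
  then have "(i \<cdot> (p1 \<cdot> (k \<cdot> q))) \<uplus> (i \<cdot> (t \<cdot> w)) = Zero A (Dom A q) (Dom A p)" by (simp add: it w(4))
  then have "i \<cdot> ((p1 \<cdot> (k \<cdot> q)) \<uplus> (t \<cdot> w)) = i \<cdot> Zero A (Dom A q) (Dom A i)" by simp
  then have z: "(p1 \<cdot> (k \<cdot> q)) \<uplus> (t \<cdot> w) = Zero A (Dom A q) (Dom A i)"
    by (rule monic_cancel[OF kernel_monic[OF se(1)]]) simp_all
  have "(?w \<cdot> k) \<cdot> q = (g \<cdot> (p1 \<cdot> (k \<cdot> q))) \<uplus> (g' \<cdot> (Diff C 1 \<cdot> w))" by (simp add: w(4))
  also have "\<dots> = g \<cdot> ((p1 \<cdot> (k \<cdot> q)) \<uplus> (t \<cdot> w))" by (simp add: gd)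
  also have "\<dots> = Zero A (Dom A k) y \<cdot> q" unfolding z by simp
  finally have "?w \<cdot> k = Zero A (Dom A k) y"
    by (rule epic_cancel[OF ra[OF q(1)]]) simp_all
  then obtain m where m: "m \<in> Arr A" "Dom A m = Dom A p" "Cod A m = y" "m \<cdot> ?e = ?w"
    using cokernel_factor[OF k, of ?w] by auto
  note [simp] = m(1-3)
  have "(m \<cdot> ?e) \<cdot> i1 = ?w \<cdot> i1" unfolding m(4) ..
  then show ?thesis by (intro exI[of _ m]) simp
qed

lemma orthogonal_iff:
  assumes bp: "admissible_balanced_pair A X Y"
    and h: "right_orth (Ch A) (Ch_exact A (right_acyclic_sequences A X)) (dw A X) =
      left_orth (Ch A) (Ch_exact A (right_acyclic_sequences A X)) (dw A Y)"
    and C: "is_complex A C"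
  shows "(\<forall>P \<in> dw A X. nullmaps P C) \<longleftrightarrow> (\<forall>I \<in> dw A Y. nullmaps C I)"
proof -
  let ?E = "right_acyclic_sequences A X"
  have XO: "X \<subseteq> Obj A" using bp by (simp add: admissible_balanced_pair_def balanced_pair_def is_subcategory_def)
  have E1: "(i, p) \<in> ?E" if b: "is_biproduct A c s e i \<sigma> \<rho> p" for c s e i \<sigma> \<rho> p
  proof -
    note [simp] = biD[OF b] bi_reassoc[OF b]
    have se: "is_kernel A i p" using biproduct_short_exact[OF b] by (simp add: short_exact_def)
    have "inj_on (\<lambda>f. i \<cdot> f) (Hom A x (Dom A i)) \<and>
     {f \<in> Hom A x (Cod A i). p \<cdot> f = Zero A x (Cod A p)} = (\<lambda>f. i \<cdot> f) ` Hom A x (Dom A i) \<and>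
     (\<lambda>f. p \<cdot> f) ` Hom A x (Dom A p) = Hom A x (Cod A p)" if "x \<in> X" for x
    proof (intro conjI)
      have [simp]: "x \<in> Obj A" using XO that by blast
      show "inj_on (\<lambda>f. i \<cdot> f) (Hom A x (Dom A i))"
      proof (rule inj_onI)
        fix f g assume f: "f \<in> Hom A x (Dom A i)" "g \<in> Hom A x (Dom A i)" "i \<cdot> f = i \<cdot> g"
        show "f = g" by (rule monic_cancel[OF kernel_monic[OF se] f(3)]) (use f(1,2) in \<open>simp_all add: Hom_def\<close>)
      qed
      show "{f \<in> Hom A x (Cod A i). p \<cdot> f = Zero A x (Cod A p)} = (\<lambda>f. i \<cdot> f) ` Hom A x (Dom A i)"
      proof (intro equalityI subsetI)
        fix f assume "f \<in> {f \<in> Hom A x (Cod A i). p \<cdot> f = Zero A x (Cod A p)}"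
        then obtain u where "u \<in> Arr A" "Dom A u = x" "Cod A u = Dom A i" "i \<cdot> u = f"
          using kernel_factor[OF se, of f] by (auto simp: Hom_def)
        then show "f \<in> (\<lambda>f. i \<cdot> f) ` Hom A x (Dom A i)" by (auto simp: Hom_def)
      qed (auto simp: Hom_def)
      show "(\<lambda>f. p \<cdot> f) ` Hom A x (Dom A p) = Hom A x (Cod A p)"
      proof (intro equalityI subsetI)
        fix f assume "f \<in> Hom A x (Cod A p)"
        then show "f \<in> (\<lambda>f. p \<cdot> f) ` Hom A x (Dom A p)"
          by (intro image_eqI[of _ _ "\<sigma> \<cdot> f"]) (simp_all add: Hom_def)
      qed (auto simp: Hom_def)
    qed
    then show ?thesis using biproduct_short_exact[OF b] by (simp add: right_acyclic_sequences_def)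
  qed
  have E2X: "\<exists>\<sigma> \<rho>. is_biproduct A (Dom A i) (Cod A p) (Cod A i) i \<sigma> \<rho> p" if e: "(i, p) \<in> ?E" and x: "Cod A p \<in> X" for i p
  proof -
    have se: "short_exact A i p" and l: "(\<lambda>f. p \<cdot> f) ` Hom A (Cod A p) (Dom A p) = Hom A (Cod A p) (Cod A p)"
      using e x by (auto simp: right_acyclic_sequences_def)
    have "p \<in> Arr A" using se by (simp add: short_exact_def is_kernel_def)
    then have "Ide A (Cod A p) \<in> (\<lambda>f. p \<cdot> f) ` Hom A (Cod A p) (Dom A p)" unfolding l by (simp add: Hom_def)
    then obtain s where "s \<in> Arr A" "Dom A s = Cod A p" "Cod A s = Dom A p" "p \<cdot> s = Ide A (Cod A p)"
      by (auto simp: Hom_def)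
    then show ?thesis using short_exact_section[OF se] by blast
  qed
  have E2Y: "\<exists>\<sigma> \<rho>. is_biproduct A (Dom A i) (Cod A p) (Cod A i) i \<sigma> \<rho> p" if e: "(i, p) \<in> ?E" and y: "Dom A i \<in> Y" for i p
  proof -
    have se: "short_exact A i p" using e by (simp add: right_acyclic_sequences_def)
    have i: "i \<in> Arr A" using se by (simp add: short_exact_def is_kernel_def)
    obtain r where "r \<in> Arr A" "Dom A r = Cod A i" "Cod A r = Dom A i" "r \<cdot> i = Ide A (Dom A i)"
      using right_acyclic_extend[OF bp e y, of "Ide A (Dom A i)"] i by auto
    then show ?thesis using short_exact_retraction[OF se] by blast
  qed
  have 1: "Ext1_zero (Ch A) (Ch_exact A ?E) P C \<longleftrightarrow> nullmaps (unshift P) C" if P: "P \<in> dw A X" for P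
  proof (rule Ext1_zero_iff[OF ex_direct_sum dwD[OF P] C E1])
    fix n i p assume "(i, p) \<in> ?E" "Cod A p = Term P n"
    then show "\<exists>\<sigma> \<rho>. is_biproduct A (Dom A i) (Cod A p) (Cod A i) i \<sigma> \<rho> p"
      by (intro E2X) (use P in \<open>simp_all add: dw_def\<close>)
  qed
  have 2: "Ext1_zero (Ch A) (Ch_exact A ?E) C I \<longleftrightarrow> nullmaps (unshift C) I" if I: "I \<in> dw A Y" for I
  proof (rule Ext1_zero_iff[OF ex_direct_sum C dwD[OF I] E1])
    fix n i p assume "(i, p) \<in> ?E" "Dom A i = Term I n"
    then show "\<exists>\<sigma> \<rho>. is_biproduct A (Dom A i) (Cod A p) (Cod A i) i \<sigma> \<rho> p"
      by (intro E2Y) (use I in \<open>simp_all add: dw_def\<close>)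
  qed
  have sh: "unshift (shift_complex A P) = P" if "is_complex A P" for P
    using that by (simp add: unshift_def shift_complex_def cplxD)
  have "(\<forall>P \<in> dw A X. nullmaps P C) \<longleftrightarrow> (\<forall>P \<in> dw A X. nullmaps (unshift P) C)"
    using unshift_dw shift_dw sh dwD by metis
  also have "\<dots> \<longleftrightarrow> C \<in> right_orth (Ch A) (Ch_exact A ?E) (dw A X)"
    using 1 C by (simp add: right_orth_def Ch_def)
  also have "\<dots> \<longleftrightarrow> (\<forall>I \<in> dw A Y. nullmaps (unshift C) I)"
    unfolding h using 2 C by (simp add: left_orth_def Ch_def)
  also have "\<dots> \<longleftrightarrow> (\<forall>I \<in> dw A Y. nullmaps C I)"
  proof -
    have "nullmaps (unshift C) I \<longleftrightarrow> nullmaps C (shift_complex A I)" if "I \<in> dw A Y" for I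
      using nullmaps_shift_iff[OF unshift_complex[OF C] dwD[OF that]] C by (simp add: shift_unshift)
    then show ?thesis using unshift_dw shift_dw shift_unshift dwD by metis
  qed
  finally show ?thesis .
qed

end

context preadditive_category
begin

lemma HomD: "f \<in> Hom A a b \<Longrightarrow> f \<in> Arr A" "f \<in> Hom A a b \<Longrightarrow> Dom A f = a" "f \<in> Hom A a b \<Longrightarrow> Cod A f = b"
  by (simp_all add: Hom_def)

definition exact_at where
  "exact_at X T m \<longleftrightarrow> (\<forall>f. f \<in> Arr A \<and> Dom A f \<in> X \<and> Cod A f = Term T m \<and>
     Diff T m \<cdot> f = Zero A (Dom A f) (Term T (m - 1)) \<longrightarrow>
     (\<exists>g. g \<in> Arr A \<and> Dom A g = Dom A f \<and> Cod A g = Term T (m + 1) \<and> Diff T (m + 1) \<cdot> g = f))"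

lemma exact_atD:
  assumes "exact_at X T m" "f \<in> Arr A" "Dom A f \<in> X" "Cod A f = Term T m"
    "Diff T m \<cdot> f = Zero A (Dom A f) (Term T (m - 1))"
  shows "\<exists>g. g \<in> Arr A \<and> Dom A g = Dom A f \<and> Cod A g = Term T (m + 1) \<and> Diff T (m + 1) \<cdot> g = f"
  using assms unfolding exact_at_def by simp

definition is_coproduct :: "(nat \<Rightarrow> 'o) \<Rightarrow> 'o \<Rightarrow> (nat \<Rightarrow> 'm) \<Rightarrow> bool" where
  "is_coproduct x S j \<longleftrightarrow> S \<in> Obj A \<and> (\<forall>k. j k \<in> Hom A (x k) S) \<and>
     (\<forall>c g. c \<in> Obj A \<and> (\<forall>k. g k \<in> Hom A (x k) c) \<longrightarrow> (\<exists>!u. u \<in> Hom A S c \<and> (\<forall>k. u \<cdot> j k = g k)))"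

lemma coproductD:
  assumes "is_coproduct x S j"
  shows "S \<in> Obj A" "j k \<in> Arr A" "Dom A (j k) = x k" "Cod A (j k) = S"
  using assms by (simp_all add: is_coproduct_def Hom_def)

lemma coproduct_ex:
  assumes "is_coproduct x S j" "c \<in> Obj A" "\<And>k. g k \<in> Hom A (x k) c"
  shows "\<exists>u. u \<in> Hom A S c \<and> (\<forall>k. u \<cdot> j k = g k)"
proof -
  have "\<exists>!u. u \<in> Hom A S c \<and> (\<forall>k. u \<cdot> j k = g k)"
    using assms unfolding is_coproduct_def by simp
  then show ?thesis by (rule ex1_implies_ex)
qed

lemma ex1_same: "\<exists>!x. Q x \<Longrightarrow> Q u \<Longrightarrow> Q v \<Longrightarrow> u = v"
  by blast

lemma coproduct_eq:
  assumes "is_coproduct x S j" "u \<in> Arr A" "v \<in> Arr A" "Dom A u = S" "Dom A v = S" "Cod A u = Cod A v" "\<And>k. u \<cdot> j k = v \<cdot> j k"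
  shows "u = v"
proof -
  note [simp] = coproductD[OF assms(1)] assms(2-6)
  have "\<exists>!w. w \<in> Hom A S (Cod A v) \<and> (\<forall>k. w \<cdot> j k = v \<cdot> j k)"
  proof -
    have "Cod A v \<in> Obj A \<and> (\<forall>k. v \<cdot> j k \<in> Hom A (x k) (Cod A v))" by (simp add: Hom_def)
    then show ?thesis using assms(1) unfolding is_coproduct_def by simp
  qed
  then show ?thesis by (rule ex1_same) (use assms(7) in \<open>simp_all add: Hom_def\<close>)
qed

lemma biproduct_zero:
  assumes "a \<in> Obj A" "is_zero_object A z"
  shows "is_biproduct A a z a (Ide A a) (Zero A z a) (Ide A a) (Zero A a z)"
proof -
  have [simp]: "z \<in> Obj A" using assms by (simp add: is_zero_object_def)
  have "Zero A z z = Ide A z" by (rule to_zero_object[OF assms(2)]) simp_all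
  then show ?thesis using assms(1) by (simp add: is_biproduct_def Hom_def)
qed

context
  fixes X :: "'o set"
  assumes zero_X: "\<exists>z \<in> X. is_zero_object A z"
    and kernels: "\<And>f. f \<in> Arr A \<Longrightarrow> \<exists>k. is_kernel A k f"
    and sums: "\<And>a b. \<lbrakk>a \<in> Obj A; b \<in> Obj A\<rbrakk> \<Longrightarrow> \<exists>s. is_direct_sum A a b s"
    and appr: "\<And>M. M \<in> Obj A \<Longrightarrow> \<exists>f. is_right_approximation A X f \<and> Cod A f = M"
begin

text \<open>Attaching \<open>X\<close>-objects in degrees above \<open>n\<close> so as to kill all cycles in degrees at least \<open>n\<close>.\<close>

lemma attach_step:
  assumes d: "d \<in> Arr A" and a: "a \<in> Arr A" "Cod A a = Dom A d" "d \<cdot> a = Zero A (Dom A a) (Cod A d)"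
  shows "\<exists>d' i j r q x. is_biproduct A (Dom A a) x (Dom A d') i j r q \<and> x \<in> X \<and> d' \<in> Arr A \<and> Cod A d' = Dom A d \<and>
     d' \<cdot> i = a \<and> d \<cdot> d' = Zero A (Dom A d') (Cod A d) \<and>
     (\<forall>f. f \<in> Arr A \<and> Dom A f \<in> X \<and> Cod A f = Dom A d \<and> d \<cdot> f = Zero A (Dom A f) (Cod A d) \<longrightarrow>
       (\<exists>g. g \<in> Arr A \<and> Dom A g = Dom A f \<and> Cod A g = Dom A d' \<and> d' \<cdot> g = f))"
proof -
  obtain z where z: "is_kernel A z d" using kernels[OF d] by blast
  note [simp] = kernelD(1-3)[OF z] d a
  obtain e where e: "is_right_approximation A X e" "Cod A e = Dom A z" using appr[of "Dom A z"] by auto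
  have e': "e \<in> Arr A" "Dom A e \<in> X" using e by (simp_all add: is_right_approximation_def)
  note [simp] = e'(1) e(2)
  obtain s i j r q where b: "is_biproduct A (Dom A a) (Dom A e) s i j r q"
    using sums[of "Dom A a" "Dom A e"] by (auto simp: is_direct_sum_def)
  note [simp] = biD[OF b] bi_reassoc[OF b]
  let ?d = "(a \<cdot> r) \<uplus> (z \<cdot> (e \<cdot> q))"
  have da: "d \<cdot> (a \<cdot> y) = Zero A (Dom A y) (Cod A d)" if "y \<in> Arr A" "Cod A y = Dom A a" for y
    using Comp_reassoc[OF a(3), of y] that by simp
  have dz: "d \<cdot> (z \<cdot> y) = Zero A (Dom A y) (Cod A d)" if "y \<in> Arr A" "Cod A y = Dom A z" for y
    using Comp_reassoc[OF kernelD(4)[OF z], of y] that by simp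
  have ex: "\<exists>g. g \<in> Arr A \<and> Dom A g = Dom A f \<and> Cod A g = Dom A ?d \<and> ?d \<cdot> g = f"
    if f: "f \<in> Arr A" "Dom A f \<in> X" "Cod A f = Dom A d" "d \<cdot> f = Zero A (Dom A f) (Cod A d)" for f
  proof -
    obtain u where u: "u \<in> Arr A" "Dom A u = Dom A f" "Cod A u = Dom A z" "z \<cdot> u = f"
      using kernel_factor[OF z f(1,3,4)] by blast
    have "u \<in> Hom A (Dom A f) (Cod A e)" using u by (simp add: Hom_def)
    then obtain h where "h \<in> Hom A (Dom A f) (Dom A e)" "e \<cdot> h = u"
      using e(1) f(2) unfolding is_right_approximation_def by blast
    then have h: "h \<in> Arr A" "Dom A h = Dom A f" "Cod A h = Dom A e" "e \<cdot> h = u" by (simp_all add: Hom_def)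
    note [simp] = h(1-3) f(1,3)
    show ?thesis by (rule exI[of _ "j \<cdot> h"]) (simp add: h(4) u(4))
  qed
  have 1: "?d \<cdot> i = a" "d \<cdot> ?d = Zero A (Dom A ?d) (Cod A d)" by (simp_all add: da dz)
  have 2: "?d \<in> Arr A" "Dom A ?d = s" "Cod A ?d = Dom A d" by simp_all
  have 3: "is_biproduct A (Dom A a) (Dom A e) (Dom A ?d) i j r q" unfolding 2(2) by (rule b)
  show ?thesis
    by (rule exI[of _ ?d], rule exI[of _ i], rule exI[of _ j], rule exI[of _ r], rule exI[of _ q], rule exI[of _ "Dom A e"],
        intro conjI allI impI, rule 3, rule e'(2), rule 2, rule 2, rule 1, rule 1, elim conjE, rule ex; assumption)
qed

lemma attach:
  assumes T: "is_complex A T"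
  shows "\<exists>T' i. is_complex A T' \<and> cm T T' i \<and> (\<forall>m. m \<ge> n \<longrightarrow> exact_at X T' m) \<and>
    (\<forall>m. \<exists>x j r q. x \<in> X \<and> is_biproduct A (Term T m) x (Term T' m) (i m) j r q)"
proof -
  note [simp] = cplxD[OF T]
  define D where "D k = n + int k" for k
  have D [simp]: "D (Suc k) - 1 = D k" "D (Suc k) - 2 = D k - 1" for k by (simp_all add: D_def)
  obtain z where z: "z \<in> X" "is_zero_object A z" using zero_X by blast
  define good where "good k s \<longleftrightarrow> (case s of (d, i) \<Rightarrow> d \<in> Arr A \<and>
      (\<exists>x j r q. x \<in> X \<and> is_biproduct A (Term T (D k)) x (Dom A d) i j r q) \<and>
      d \<cdot> (i \<cdot> Diff T (D (Suc k))) = Zero A (Term T (D (Suc k))) (Cod A d) \<and>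
      (k = 0 \<longrightarrow> d = Diff T (D 0) \<and> i = Ide A (Term T (D 0))))" for k s
  define step where "step k s s' \<longleftrightarrow> (case s of (d, i) \<Rightarrow> case s' of (d', i') \<Rightarrow> Cod A d' = Dom A d \<and>
      d' \<cdot> i' = i \<cdot> Diff T (D (Suc k)) \<and> d \<cdot> d' = Zero A (Dom A d') (Cod A d) \<and>
      (\<forall>f. f \<in> Arr A \<and> Dom A f \<in> X \<and> Cod A f = Dom A d \<and> d \<cdot> f = Zero A (Dom A f) (Cod A d) \<longrightarrow>
       (\<exists>g. g \<in> Arr A \<and> Dom A g = Dom A f \<and> Cod A g = Dom A d' \<and> d' \<cdot> g = f)))" for k s s'
  have "\<exists>s. \<forall>k. good k (s k) \<and> step k (s k) (s (Suc k))"
  proof (rule dependent_nat_choice)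
    show "\<exists>s. good 0 s"
      using z(1) biproduct_zero[OF _ z(2), of "Term T (D 0)"] unfolding good_def
      by (intro exI[of _ "(Diff T (D 0), Ide A (Term T (D 0)))"]) auto
  next
    fix s k assume g: "good k s"
    obtain d i where s: "s = (d, i)" by (cases s)
    have d: "d \<in> Arr A" and di: "d \<cdot> (i \<cdot> Diff T (D (Suc k))) = Zero A (Term T (D (Suc k))) (Cod A d)"
      using g by (simp_all add: good_def s)
    obtain x j r q where b: "is_biproduct A (Term T (D k)) x (Dom A d) i j r q" using g by (auto simp: good_def s)
    note [simp] = biD[OF b] d
    obtain d' i' j' r' q' x' where n: "is_biproduct A (Term T (D (Suc k))) x' (Dom A d') i' j' r' q'" "x' \<in> X" "d' \<in> Arr A"
      "Cod A d' = Dom A d" "d' \<cdot> i' = i \<cdot> Diff T (D (Suc k))" "d \<cdot> d' = Zero A (Dom A d') (Cod A d)"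
      "\<forall>f. f \<in> Arr A \<and> Dom A f \<in> X \<and> Cod A f = Dom A d \<and> d \<cdot> f = Zero A (Dom A f) (Cod A d) \<longrightarrow>
       (\<exists>g. g \<in> Arr A \<and> Dom A g = Dom A f \<and> Cod A g = Dom A d' \<and> d' \<cdot> g = f)"
      using attach_step[OF d, of "i \<cdot> Diff T (D (Suc k))"] di by auto
    note [simp] = biD[OF n(1)] n(3,4)
    have "d' \<cdot> (i' \<cdot> Diff T (D (Suc (Suc k)))) = (i \<cdot> Diff T (D (Suc k))) \<cdot> Diff T (D (Suc (Suc k)))"
      by (rule Comp_reassoc[OF n(5)]) simp_all
    then have "d' \<cdot> (i' \<cdot> Diff T (D (Suc (Suc k)))) = Zero A (Term T (D (Suc (Suc k)))) (Cod A d')" by simp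
    then have "good (Suc k) (d', i')" using n(1-3) by (auto simp: good_def)
    moreover have "step k s (d', i')" unfolding step_def s using n(5-7) by simp
    ultimately show "\<exists>s'. good (Suc k) s' \<and> step k s s'" by blast
  qed
  then obtain s where s: "\<And>k. good k (s k)" "\<And>k. step k (s k) (s (Suc k))" by blast
  define d i where "d k = fst (s k)" and "i k = snd (s k)" for k
  have g: "d k \<in> Arr A" "\<exists>x j r q. x \<in> X \<and> is_biproduct A (Term T (D k)) x (Dom A (d k)) (i k) j r q" for k
    using s(1)[of k] by (auto simp: good_def d_def i_def split: prod.splits)
  have g0: "d 0 = Diff T (D 0)" "i 0 = Ide A (Term T (D 0))"
    using s(1)[of 0] by (auto simp: good_def d_def i_def split: prod.splits)
  have st: "Cod A (d (Suc k)) = Dom A (d k)" "d (Suc k) \<cdot> i (Suc k) = i k \<cdot> Diff T (D (Suc k))"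
      "d k \<cdot> d (Suc k) = Zero A (Dom A (d (Suc k))) (Cod A (d k))" for k
    using s(2)[of k] by (auto simp: step_def d_def i_def split: prod.splits)
  have ex: "\<exists>g. g \<in> Arr A \<and> Dom A g = Dom A f \<and> Cod A g = Dom A (d (Suc k)) \<and> d (Suc k) \<cdot> g = f"
    if "f \<in> Arr A" "Dom A f \<in> X" "Cod A f = Dom A (d k)" "d k \<cdot> f = Zero A (Dom A f) (Cod A (d k))" for f k
    using s(2)[of k] that by (auto simp: step_def d_def i_def split: prod.splits)
  have iA: "i k \<in> Arr A" "Dom A (i k) = Term T (D k)" "Cod A (i k) = Dom A (d k)" for k
    using g(2)[of k] by (auto dest: biD)
  define dT where "dT m = (if n \<le> m then d (nat (m - n)) else Diff T m)" for m
  define iT where "iT m = (if n \<le> m then i (nat (m - n)) else Ide A (Term T m))" for m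
  define T' where "T' = \<lparr>Term = (\<lambda>m. Dom A (dT m)), Diff = dT\<rparr>"
  have [simp]: "Term T' m = Dom A (dT m)" "Diff T' = dT" for m by (simp_all add: T'_def)
  have up: "dT (D k) = d k" "iT (D k) = i k" for k by (simp_all add: dT_def iT_def D_def)
  have low: "m < n \<Longrightarrow> dT m = Diff T m" "m < n \<Longrightarrow> iT m = Ide A (Term T m)" for m by (simp_all add: dT_def iT_def)
  have cases: "(m < n \<Longrightarrow> Q m) \<Longrightarrow> Q (D 0) \<Longrightarrow> (\<And>k. Q (D (Suc k))) \<Longrightarrow> Q m" for Q m
  proof -
    assume *: "m < n \<Longrightarrow> Q m" "Q (D 0)" "\<And>k. Q (D (Suc k))"
    show "Q m"
    proof (cases "m < n")
      case False
      then have m: "m = D (nat (m - n))" by (simp add: D_def)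
      show ?thesis using *(2,3) by (subst m) (cases "nat (m - n)", auto)
    qed (rule *)
  qed
  have D0: "D 0 - 1 < n" by (simp add: D_def)
  have A1: "dT m \<in> Arr A" for m by (cases "m < n") (simp_all add: low dT_def g)
  have A2: "Cod A (dT m) = Dom A (dT (m - 1))" for m
    by (rule cases[of m]) (simp_all add: low up g0 st low[OF D0])
  have A3: "iT m \<in> Arr A \<and> Dom A (iT m) = Term T m \<and> Cod A (iT m) = Dom A (dT m)" for m
    by (rule cases[of m]) (simp_all add: low up iA)
  have A4: "dT (m - 1) \<cdot> dT m = Zero A (Dom A (dT m)) (Cod A (dT (m - 1)))" for m
  proof (rule cases[of m])
    show "dT (D 0 - 1) \<cdot> dT (D 0) = Zero A (Dom A (dT (D 0))) (Cod A (dT (D 0 - 1)))"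
      unfolding low(1)[OF D0] up g0 by simp
  qed (simp_all add: low up st)
  have A5: "iT (m - 1) \<cdot> Diff T m = dT m \<cdot> iT m" for m
  proof (rule cases[of m])
    show "iT (D 0 - 1) \<cdot> Diff T (D 0) = dT (D 0) \<cdot> iT (D 0)"
      unfolding low(2)[OF D0] up g0 by simp
  qed (simp_all add: low up st)
  note [simp] = A1 A3[THEN conjunct1] A3[THEN conjunct2, THEN conjunct1] A3[THEN conjunct2, THEN conjunct2]
  have cT: "is_complex A T'"
    unfolding is_complex_def
  proof (intro conjI allI)
    fix m show "Term T' m \<in> Obj A" by simp
    show "Diff T' m \<in> Hom A (Term T' m) (Term T' (m - 1))" using A2 by (simp add: Hom_def)
    show "Diff T' m \<cdot> Diff T' (m + 1) = Zero A (Term T' (m + 1)) (Term T' (m - 1))"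
      using A4[of "m + 1"] A2[of m] by simp
  qed
  moreover have "cm T T' iT" by (rule cmI) (simp_all add: A5)
  moreover have "exact_at X T' m" if "n \<le> m" for m
  proof -
    define k where "k = nat (m - n)"
    have m: "m = D k" "m + 1 = D (Suc k)" using that by (simp_all add: k_def D_def)
    have "Dom A (dT (m - 1)) = Cod A (d k)" using A2[of m] up m by simp
    then show ?thesis unfolding exact_at_def using ex[of _ k] by (simp add: m(2)) (simp add: m(1) up)
  qed
  moreover have "\<exists>x j r q. x \<in> X \<and> is_biproduct A (Term T m) x (Term T' m) (iT m) j r q" for m
  proof (rule cases[of m])
    assume "m < n"
    then show ?thesis using biproduct_zero[OF _ z(2), of "Term T m"] z(1) by (auto simp: low)
  next
    show "\<exists>x j r q. x \<in> X \<and> is_biproduct A (Term T (D 0)) x (Term T' (D 0)) (iT (D 0)) j r q" using g(2)[of 0] by (simp add: up)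
    show "\<exists>x j r q. x \<in> X \<and> is_biproduct A (Term T (D (Suc k))) x (Term T' (D (Suc k))) (iT (D (Suc k))) j r q" for k
      using g(2)[of "Suc k"] by (simp add: up)
  qed
  ultimately show ?thesis by blast
qed

end


text \<open>
  The colimit of a sequence of split monomorphisms \<open>t 0 \<rightarrow> t 1 \<rightarrow> \<dots>\<close>: it is the biproduct of \<open>t 0\<close> and the
  coproduct of the complements \<open>x k\<close>.
\<close>

lemma split_colimit:
  assumes sums: "\<And>a b. \<lbrakk>a \<in> Obj A; b \<in> Obj A\<rbrakk> \<Longrightarrow> \<exists>s. is_direct_sum A a b s"
    and copr: "\<exists>S \<in> X. \<exists>j. is_coproduct x S j"
    and b: "\<And>k. is_biproduct A (t k) (x k) (t (Suc k)) (i k) (j k) (r k) (q k)"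
  shows "\<exists>L J. (\<exists>S s p p'. S \<in> X \<and> is_biproduct A (t 0) S L (J 0) s p p') \<and>
    (\<forall>k. J k \<in> Hom A (t k) L) \<and> (\<forall>k. J (Suc k) \<cdot> i k = J k) \<and>
    (\<forall>c g. c \<in> Obj A \<and> (\<forall>k. g k \<in> Hom A (t k) c) \<and> (\<forall>k. g (Suc k) \<cdot> i k = g k) \<longrightarrow>
      (\<exists>u. u \<in> Hom A L c \<and> (\<forall>k. u \<cdot> J k = g k))) \<and>
    (\<forall>u v. u \<in> Arr A \<and> v \<in> Arr A \<and> Dom A u = L \<and> Dom A v = L \<and> Cod A u = Cod A v \<and> (\<forall>k. u \<cdot> J k = v \<cdot> J k) \<longrightarrow> u = v)"
proof -
  obtain S jj where S: "S \<in> X" "is_coproduct x S jj" using copr by blast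
  note [simp] = biD[OF b] bi_reassoc[OF b] coproductD[OF S(2)]
  obtain L i1 i2 p1 p2 where B: "is_biproduct A (t 0) S L i1 i2 p1 p2"
    using sums[of "t 0" S] by (auto simp: is_direct_sum_def)
  note [simp] = biD[OF B] bi_reassoc[OF B]
  define J where "J = rec_nat i1 (\<lambda>k y. (y \<cdot> r k) \<uplus> (i2 \<cdot> (jj k \<cdot> q k)))"
  have J0: "J 0 = i1" and JS: "\<And>k. J (Suc k) = (J k \<cdot> r k) \<uplus> (i2 \<cdot> (jj k \<cdot> q k))" by (simp_all add: J_def)
  have "J k \<in> Arr A \<and> Dom A (J k) = t k \<and> Cod A (J k) = L" for k
    by (induction k) (simp_all add: J0 JS)
  then have Ja [simp]: "J k \<in> Arr A" "Dom A (J k) = t k" "Cod A (J k) = L" for k by auto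
  have Ji: "J (Suc k) \<cdot> i k = J k" "J (Suc k) \<cdot> j k = i2 \<cdot> jj k" for k by (simp_all add: JS)
  have "\<exists>u. u \<in> Hom A L c \<and> (\<forall>k. u \<cdot> J k = g k)"
    if c: "c \<in> Obj A" and g: "\<And>k. g k \<in> Hom A (t k) c" "\<And>k. g (Suc k) \<cdot> i k = g k" for c g
  proof -
    have [simp]: "g k \<in> Arr A" "Dom A (g k) = t k" "Cod A (g k) = c" for k
      using g(1)[of k] by (simp_all add: Hom_def)
    note [simp] = c
    have "g (Suc k) \<cdot> j k \<in> Hom A (x k) c" for k by (simp add: Hom_def)
    from coproduct_ex[OF S(2) c this] obtain w where w: "w \<in> Hom A S c" "\<forall>k. w \<cdot> jj k = g (Suc k) \<cdot> j k" by (elim exE conjE)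
    have [simp]: "w \<in> Arr A" "Dom A w = S" "Cod A w = c" using w(1) by (simp_all add: Hom_def)
    let ?u = "(g 0 \<cdot> p1) \<uplus> (w \<cdot> p2)"
    have "?u \<cdot> J k = g k" for k
    proof (induction k)
      case 0
      show ?case by (simp add: J0)
    next
      case (Suc k)
      have "?u \<cdot> J (Suc k) = ((?u \<cdot> J k) \<cdot> r k) \<uplus> ((w \<cdot> jj k) \<cdot> q k)" unfolding JS by simp
      also have "\<dots> = ((g (Suc k) \<cdot> i k) \<cdot> r k) \<uplus> ((g (Suc k) \<cdot> j k) \<cdot> q k)" unfolding Suc.IH g(2) using w(2) by simp
      also have "\<dots> = g (Suc k)" by (rule bi_from[OF b, symmetric]) simp_all
      finally show ?case .
    qed
    then show ?thesis by (intro exI[of _ ?u] conjI allI) (simp_all add: Hom_def)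
  qed
  moreover have "u = v" if uv: "u \<in> Arr A" "v \<in> Arr A" "Dom A u = L" "Dom A v = L" "Cod A u = Cod A v"
    and e: "\<And>k. u \<cdot> J k = v \<cdot> J k" for u v
  proof -
    note [simp] = uv
    have e2: "(u \<cdot> i2) \<cdot> jj k = (v \<cdot> i2) \<cdot> jj k" for k
    proof -
      have "u \<cdot> (J (Suc k) \<cdot> j k) = v \<cdot> (J (Suc k) \<cdot> j k)"
        using arg_cong[OF e[of "Suc k"], of "\<lambda>y. y \<cdot> j k"] by simp
      then show ?thesis unfolding Ji by simp
    qed
    have "u \<cdot> i2 = v \<cdot> i2" by (rule coproduct_eq[OF S(2) _ _ _ _ _ e2]) simp_all
    moreover have "u \<cdot> i1 = v \<cdot> i1" using e[of 0] unfolding J0 .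
    ultimately show ?thesis by - (rule bi_eq_from[OF B], simp_all)
  qed
  moreover have "S \<in> X \<and> is_biproduct A (t 0) S L (J 0) i2 p1 p2" using S(1) B by (simp add: J0)
  moreover have "J k \<in> Hom A (t k) L" for k by (simp add: Hom_def)
  ultimately show ?thesis
    using Ji(1)
    apply -
    apply (rule exI[of _ L], rule exI[of _ J])
    apply (intro conjI)
        apply (rule exI[of _ S], rule exI[of _ i2], rule exI[of _ p1], rule exI[of _ p2], assumption)
       apply (intro allI, assumption)+
     apply (intro allI impI, elim conjE)
     apply (metis)
    apply (intro allI impI, elim conjE)
    apply (metis)
    done
qed

text \<open>
  Truncation: where \<open>T\<close> is right \<open>X\<close>-exact in degrees at least \<open>m\<close>, its good truncation is a bounded below
  right \<open>X\<close>-acyclic complex, so a family that commutes with the differentials in degrees at least \<open>m\<close> is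
  null homotopic in high degrees.
\<close>

lemma truncated_null:
  assumes T: "is_complex A T" and I: "is_complex A I"
    and ker: "\<And>f. f \<in> Arr A \<Longrightarrow> \<exists>k. is_kernel A k f" and zero: "is_zero_object A zo" and X: "X \<subseteq> Obj A"
    and null: "\<And>B n. \<lbrakk>is_complex A B; right_acyclic A X B; \<And>k. k < n \<Longrightarrow> is_zero_object A (Term B k)\<rbrakk> \<Longrightarrow> nullmaps B I"
    and ex: "\<And>k. m \<le> k \<Longrightarrow> exact_at X T k"
    and f: "\<And>k. f k \<in> Hom A (Term T k) (Term I k)"
    and fd: "\<And>k. m \<le> k \<Longrightarrow> f (k - 1) \<cdot> Diff T k = Diff I k \<cdot> f k"
  shows "\<exists>h. (\<forall>k. h k \<in> Hom A (Term T k) (Term I (k + 1))) \<and>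
     (\<forall>k. m + 2 \<le> k \<longrightarrow> f k = (Diff I (k + 1) \<cdot> h k) \<uplus> (h (k - 1) \<cdot> Diff T k))"
proof -
  note [simp] = cplxD[OF T] cplxD[OF I] HomD[OF f]
  have zo [simp]: "zo \<in> Obj A" using zero by (simp add: is_zero_object_def)
  obtain z where z: "is_kernel A z (Diff T m)" using ker[of "Diff T m"] by auto
  note zD = kernelD[OF z]
  have [simp]: "z \<in> Arr A" "Cod A z = Term T m" using zD by simp_all
  have dz: "Diff T m \<cdot> (z \<cdot> x) = Zero A (Dom A x) (Term T (m - 1))" if "x \<in> Arr A" "Cod A x = Dom A z" for x
    using Comp_reassoc[OF zD(4), of x] that by simp
  obtain e where e: "e \<in> Arr A" "Dom A e = Term T (m + 1)" "Cod A e = Dom A z" "z \<cdot> e = Diff T (m + 1)"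
    using kernel_factor[OF z, of "Diff T (m + 1)"] by auto
  have [simp]: "Term T (1 + m) = Term T (m + 1)" "Term T (2 + m) = Term T (m + 2)" "Diff T (2 + m) = Diff T (m + 2)"
    by (simp_all add: add.commute)
  note [simp] = e(1-3)
  have ze: "z \<cdot> (e \<cdot> x) = Diff T (m + 1) \<cdot> x" if "x \<in> Arr A" "Cod A x = Term T (m + 1)" for x
    using Comp_reassoc[OF e(4), of x] that by simp
  define Tm where "Tm k = (if m < k then Term T k else if k = m then Dom A z else zo)" for k
  define Df where "Df k = (if m + 1 < k then Diff T k else if k = m + 1 then e else Zero A (Tm k) (Tm (k - 1)))" for k
  define B where "B = \<lparr>Term = Tm, Diff = Df\<rparr>"
  have [simp]: "Term B = Tm" "Diff B = Df" by (simp_all add: B_def)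
  have Tm: "m < k \<Longrightarrow> Tm k = Term T k" "Tm m = Dom A z" "k < m \<Longrightarrow> Tm k = zo" for k by (simp_all add: Tm_def)
  have Df: "m + 1 < k \<Longrightarrow> Df k = Diff T k" "Df (m + 1) = e" "k \<le> m \<Longrightarrow> Df k = Zero A (Tm k) (Tm (k - 1))" for k by (simp_all add: Df_def)
  have TmO [simp]: "Tm k \<in> Obj A" for k by (simp add: Tm_def)
  have DfH: "Df k \<in> Arr A \<and> Dom A (Df k) = Tm k \<and> Cod A (Df k) = Tm (k - 1)" for k
  proof -
    consider "m + 1 < k" | "k = m + 1" | "k \<le> m" by linarith
    then show ?thesis by cases (simp_all add: Df Tm)
  qed
  note [simp] = DfH[THEN conjunct1] DfH[THEN conjunct2, THEN conjunct1] DfH[THEN conjunct2, THEN conjunct2]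
  have "z \<cdot> (e \<cdot> Diff T (m + 2)) = z \<cdot> Zero A (Term T (m + 2)) (Dom A z)"
    by (subst ze) simp_all
  then have ed: "e \<cdot> Diff T (m + 2) = Zero A (Term T (m + 2)) (Dom A z)"
    by (rule monic_cancel[OF kernel_monic[OF z]]) simp_all
  have DD: "Df k \<cdot> Df (k + 1) = Zero A (Tm (k + 1)) (Tm (k - 1))" for k
  proof -
    consider "m + 1 < k" | "k = m + 1" | "k \<le> m" by linarith
    then show ?thesis
    proof cases
      case 1
      then show ?thesis using cplxD(5)[OF T, of k "k + 1"] by (simp add: Df Tm)
    next
      case 2
      then show ?thesis using ed by (simp add: Df Tm)
    next
      case 3
      then show ?thesis by (simp add: Df)
    qed
  qed
  have cB: "is_complex A B" unfolding is_complex_def using DD by (simp add: Hom_def)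
  have "\<exists>g. g \<in> Arr A \<and> Dom A g = Dom A u \<and> Cod A g = Tm (k + 1) \<and> Df (k + 1) \<cdot> g = u"
    if u: "u \<in> Arr A" "Dom A u \<in> X" "Cod A u = Tm k" "Df k \<cdot> u = Zero A (Dom A u) (Tm (k - 1))" for u k
  proof -
    note [simp] = u(1)
    consider "m + 1 < k" | "k = m + 1" | "k = m" | "k < m" by linarith
    then show ?thesis
    proof cases
      case 1
      have "\<exists>g. g \<in> Arr A \<and> Dom A g = Dom A u \<and> Cod A g = Term T (k + 1) \<and> Diff T (k + 1) \<cdot> g = u"
        by (rule exact_atD[OF ex]) (use u 1 in \<open>simp_all add: Df Tm\<close>)
      then show ?thesis using 1 by (simp add: Df Tm)
    next
      case 2
      have "e \<cdot> u = Zero A (Dom A u) (Dom A z)" using u(4) 2 by (simp add: Df Tm)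
      moreover have cu: "Cod A u = Term T (m + 1)" using u(3) 2 by (simp add: Tm)
      ultimately have "Diff T (m + 1) \<cdot> u = Zero A (Dom A u) (Term T m)" using ze[of u] by simp
      then have "\<exists>g. g \<in> Arr A \<and> Dom A g = Dom A u \<and> Cod A g = Term T (k + 1) \<and> Diff T (k + 1) \<cdot> g = u"
        using 2 cu u(1,2) by - (rule exact_atD[OF ex], simp_all)
      then show ?thesis using 2 by (simp add: Df Tm)
    next
      case 3
      have c: "Cod A u = Dom A z" using u(3) 3 by (simp add: Tm)
      note [simp] = c
      have "Diff T m \<cdot> (z \<cdot> u) = Zero A (Dom A (z \<cdot> u)) (Term T (m - 1))" by (simp add: dz)
      then have "\<exists>g. g \<in> Arr A \<and> Dom A g = Dom A (z \<cdot> u) \<and> Cod A g = Term T (m + 1) \<and> Diff T (m + 1) \<cdot> g = z \<cdot> u"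
        using u(2) by - (rule exact_atD[OF ex], simp_all)
      then obtain g where g: "g \<in> Arr A" "Dom A g = Dom A (z \<cdot> u)" "Cod A g = Term T (m + 1)" "Diff T (m + 1) \<cdot> g = z \<cdot> u"
        by (elim exE conjE) (rule that)
      have gu: "Dom A g = Dom A u" using g(2) by simp
      note [simp] = g(1,3) gu
      have "e \<cdot> g = u" by (rule monic_cancel[OF kernel_monic[OF z]]) (simp_all add: ze g(4))
      then show ?thesis using 3 by (intro exI[of _ g]) (simp add: Df Tm)
    next
      case 4
      have "Df (k + 1) \<cdot> Zero A (Dom A u) (Tm (k + 1)) = u"
        by (rule to_zero_object[OF zero]) (use 4 u(3) in \<open>simp_all add: Tm\<close>)
      then show ?thesis by (intro exI[of _ "Zero A (Dom A u) (Tm (k + 1))"]) simp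
    qed
  qed
  note ex1 = this
  have "right_acyclic A X B" unfolding right_acyclic_def
  proof (intro ballI allI equalityI subsetI)
    fix x k u assume x: "x \<in> X" and u: "u \<in> {f \<in> Hom A x (Term B k). Diff B k \<cdot> f = Zero A x (Term B (k - 1))}"
    then have "\<exists>g. g \<in> Arr A \<and> Dom A g = Dom A u \<and> Cod A g = Tm (k + 1) \<and> Df (k + 1) \<cdot> g = u"
      by (intro ex1) (auto simp: Hom_def)
    then show "u \<in> (\<lambda>g. Diff B (k + 1) \<cdot> g) ` Hom A x (Term B (k + 1))" using u by (auto simp: Hom_def)
  next
    fix x k u assume x: "x \<in> X" and u: "u \<in> (\<lambda>g. Diff B (k + 1) \<cdot> g) ` Hom A x (Term B (k + 1))"
    then obtain g where g: "g \<in> Arr A" "Dom A g = x" "Cod A g = Tm (k + 1)" "u = Df (k + 1) \<cdot> g" by (auto simp: Hom_def)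
    note [simp] = g(1-3)
    have "x \<in> Obj A" using X x by blast
    have "Df k \<cdot> (Df (k + 1) \<cdot> g) = Zero A x (Tm (k - 1))"
      using Comp_reassoc[OF DD[of k], of g] \<open>x \<in> Obj A\<close> by simp
    then show "u \<in> {f \<in> Hom A x (Term B k). Diff B k \<cdot> f = Zero A x (Term B (k - 1))}"
      by (simp add: g(4) Hom_def)
  qed
  then have nB: "nullmaps B I" by (rule null[OF cB, of m]) (simp add: Tm zero)
  define fB where "fB k = (if m < k then f k else if k = m then f m \<cdot> z else Zero A zo (Term I k))" for k
  have fB: "m < k \<Longrightarrow> fB k = f k" "fB m = f m \<cdot> z" "k < m \<Longrightarrow> fB k = Zero A zo (Term I k)" for k by (simp_all add: fB_def)
  have "cm B I fB"
  proof (rule cmI)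
    fix k
    have *: "fB k \<in> Arr A \<and> Dom A (fB k) = Tm k \<and> Cod A (fB k) = Term I k" for k
      by (simp add: fB_def Tm)
    then show "fB k \<in> Arr A" "Dom A (fB k) = Term B k" "Cod A (fB k) = Term I k" by simp_all
    consider "m + 1 < k" | "k = m + 1" | "k = m" | "k < m" by linarith
    then show "fB (k - 1) \<cdot> Diff B k = Diff I k \<cdot> fB k"
    proof cases
      case 1
      then show ?thesis using fd[of k] by (simp add: fB Df)
    next
      case 2
      then show ?thesis using fd[of k] by (simp add: fB Df e(4))
    next
      case 3
      have "Diff I m \<cdot> (f m \<cdot> z) = (f (m - 1) \<cdot> Diff T m) \<cdot> z" using fd[of m] by simp
      also have "\<dots> = Zero A (Dom A z) (Term I (m - 1))" using zD(4) by simp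
      finally show ?thesis using 3 by (simp add: fB Df Tm)
    next
      case 4
      then show ?thesis by (simp add: fB Df Tm)
    qed
  qed
  then have "nul B I fB" using nB by (simp add: nullmaps_def)
  from nulE[OF this cB I] obtain h where h: "\<And>k. h k \<in> Arr A" "\<And>k. Dom A (h k) = Term B k" "\<And>k. Cod A (h k) = Term I (k + 1)"
    and hh: "\<And>k. fB k = (Diff I (k + 1) \<cdot> h k) \<uplus> (h (k - 1) \<cdot> Diff B k)"
    by blast
  define h' where "h' k = (if m < k then h k else Zero A (Term T k) (Term I (k + 1)))" for k
  have "h' k \<in> Hom A (Term T k) (Term I (k + 1))" for k
    using h[of k] by (simp add: h'_def Hom_def Tm)
  moreover have "f k = (Diff I (k + 1) \<cdot> h' k) \<uplus> (h' (k - 1) \<cdot> Diff T k)" if "m + 2 \<le> k" for k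
    using hh[of k] that by (simp add: fB Df h'_def)
  ultimately show ?thesis by (intro exI[of _ h']) simp
qed


text \<open>
  One step of gluing null homotopies: a null homotopy \<open>h\<close> of \<open>\<phi>\<close> on the subcomplex \<open>U\<close> and one of \<open>\<phi>\<close> on
  \<open>V\<close> differ by a cycle of degree one; if such cycles bound in high degrees, the homotopy on \<open>V\<close> can be
  changed so as to extend \<open>h\<close> in high degrees.
\<close>

lemma extend_homotopy:
  assumes U: "is_complex A U" and V: "is_complex A V" and I: "is_complex A I" and i: "cm U V i"
    and r: "\<And>m. r m \<in> Hom A (Term V m) (Term U m)" "\<And>m. r m \<cdot> i m = Ide A (Term U m)"
    and f: "\<And>m. f m \<in> Hom A (Term V m) (Term I m)"
    and h: "\<And>m. h m \<in> Hom A (Term U m) (Term I (m + 1))"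
      "\<And>m. a \<le> m \<Longrightarrow> f m \<cdot> i m = (Diff I (m + 1) \<cdot> h m) \<uplus> (h (m - 1) \<cdot> Diff U m)"
    and g: "\<And>m. g m \<in> Hom A (Term V m) (Term I (m + 1))"
      "\<And>m. b \<le> m \<Longrightarrow> f m = (Diff I (m + 1) \<cdot> g m) \<uplus> (g (m - 1) \<cdot> Diff V m)"
    and ba: "b \<le> a"
    and tn: "\<And>e. \<lbrakk>\<And>m. e m \<in> Hom A (Term U m) (Term (unshift I) m);
        \<And>m. a \<le> m \<Longrightarrow> e (m - 1) \<cdot> Diff U m = Diff (unshift I) m \<cdot> e m\<rbrakk> \<Longrightarrow>
      \<exists>k. (\<forall>m. k m \<in> Hom A (Term U m) (Term (unshift I) (m + 1))) \<and>
        (\<forall>m. a + 2 \<le> m \<longrightarrow> e m = (Diff (unshift I) (m + 1) \<cdot> k m) \<uplus> (k (m - 1) \<cdot> Diff U m))"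
  shows "\<exists>h'. (\<forall>m. h' m \<in> Hom A (Term V m) (Term I (m + 1))) \<and>
      (\<forall>m. b \<le> m \<longrightarrow> f m = (Diff I (m + 1) \<cdot> h' m) \<uplus> (h' (m - 1) \<cdot> Diff V m)) \<and>
      (\<forall>m. a + 2 \<le> m \<longrightarrow> h' m \<cdot> i m = h m)"
proof -
  note [simp] = cplxD[OF U] cplxD[OF V] cplxD[OF I] cmD(1-3)[OF i] HomD[OF r(1)] r(2) HomD[OF f] HomD[OF h(1)] HomD[OF g(1)]
  have [simp]: "Term I (1 + m) = Term I (m + 1)" "Term I (2 + m) = Term I (m + 2)" "Diff I (1 + m) = Diff I (m + 1)"
    "Diff I (2 + m) = Diff I (m + 2)" for m
    by (simp_all add: add.commute)
  have ri: "r m \<cdot> (i m \<cdot> x) = x" if "x \<in> Arr A" "Cod A x = Term U m" for m x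
    using Comp_reassoc[OF r(2)[of m], of x] that by simp
  have di: "Diff V m \<cdot> i m = i (m - 1) \<cdot> Diff U m" for m using cmD(4)[OF i, of "m - 1" m] by simp
  define e where "e m = (g m \<cdot> i m) \<uplus> Neg A (h m)" for m
  have [simp]: "e m \<in> Arr A" "Dom A (e m) = Term U m" "Cod A (e m) = Term I (m + 1)" for m by (simp_all add: e_def)
  have ed: "e (m - 1) \<cdot> Diff U m = Neg A (Diff I (m + 1) \<cdot> e m)" if m: "a \<le> m" for m
  proof -
    have bm: "b \<le> m" using m ba by simp
    have "f m \<cdot> i m = ((Diff I (m + 1) \<cdot> g m) \<uplus> (g (m - 1) \<cdot> Diff V m)) \<cdot> i m"
      by (rule arg_cong[OF g(2)[OF bm]])
    also have "\<dots> = (Diff I (m + 1) \<cdot> (g m \<cdot> i m)) \<uplus> (g (m - 1) \<cdot> (i (m - 1) \<cdot> Diff U m))"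
      by (simp add: di)
    finally have q: "(Diff I (m + 1) \<cdot> (g m \<cdot> i m)) \<uplus> (g (m - 1) \<cdot> (i (m - 1) \<cdot> Diff U m))
        = (Diff I (m + 1) \<cdot> h m) \<uplus> (h (m - 1) \<cdot> Diff U m)" using h(2)[OF m] by simp
    show ?thesis
      by (rule Add_cross[OF q]) (simp_all add: e_def, rule lin_eqI, (rule lin_intros | simp)+)
  qed
  have "\<exists>k. (\<forall>m. k m \<in> Hom A (Term U m) (Term (unshift I) (m + 1))) \<and>
        (\<forall>m. a + 2 \<le> m \<longrightarrow> e m = (Diff (unshift I) (m + 1) \<cdot> k m) \<uplus> (k (m - 1) \<cdot> Diff U m))"
    by (rule tn) (simp_all add: Hom_def ed)
  then obtain k where k: "\<And>m. k m \<in> Hom A (Term U m) (Term I (m + 2))"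
    and ek: "\<And>m. a + 2 \<le> m \<Longrightarrow> e m = (Neg A (Diff I (m + 2)) \<cdot> k m) \<uplus> (k (m - 1) \<cdot> Diff U m)"
    by auto
  note [simp] = HomD[OF k]
  have [simp]: "Cod A (k (m - 1)) = Term I (m + 1)" "Cod A (Diff I (m + 2)) = Term I (m + 1)" for m
    using HomD(3)[OF k, of "m - 1"] cplxD(4)[OF I, of "m + 2"] by simp_all
  have dd: "Diff I (m + 1) \<cdot> (Diff I (m + 2) \<cdot> x) = Zero A (Dom A x) (Term I m)" if "x \<in> Arr A" "Cod A x = Term I (m + 2)" for m x
    using cplxD(6)[OF I, of "m + 1" "m + 2" x] that by simp
  define c where "c m = (Diff I (m + 2) \<cdot> (k m \<cdot> r m)) \<uplus> Neg A (k (m - 1) \<cdot> (r (m - 1) \<cdot> Diff V m))" for m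
  have c [simp]: "c m \<in> Arr A" "Dom A (c m) = Term V m" "Cod A (c m) = Term I (m + 1)" for m by (simp_all add: c_def)
  have cc: "(Diff I (m + 1) \<cdot> c m) \<uplus> (c (m - 1) \<cdot> Diff V m) = Zero A (Term V m) (Term I m)" for m
  proof -
    have 1: "Diff I (m + 1) \<cdot> c m = Neg A (Diff I (m + 1) \<cdot> (k (m - 1) \<cdot> (r (m - 1) \<cdot> Diff V m)))"
      by (simp add: c_def dd)
    have c': "c (m - 1) = (Diff I (m + 1) \<cdot> (k (m - 1) \<cdot> r (m - 1))) \<uplus> Neg A (k (m - 2) \<cdot> (r (m - 2) \<cdot> Diff V (m - 1)))"
      by (simp add: c_def)
    have [simp]: "Cod A (k (m - 2)) = Term I m" using HomD(3)[OF k, of "m - 2"] by simp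
    have 2: "c (m - 1) \<cdot> Diff V m = Diff I (m + 1) \<cdot> (k (m - 1) \<cdot> (r (m - 1) \<cdot> Diff V m))"
      unfolding c' by simp
    show ?thesis unfolding 1 2 by (rule lin_eqI, (rule lin_intros | simp)+)
  qed
  have ci: "c m \<cdot> i m = (Diff I (m + 2) \<cdot> k m) \<uplus> Neg A (k (m - 1) \<cdot> Diff U m)" for m
    by (simp add: c_def di ri)
  show ?thesis
  proof (rule exI[of _ "\<lambda>m. g m \<uplus> c m"], intro conjI allI impI)
    show "g m \<uplus> c m \<in> Hom A (Term V m) (Term I (m + 1))" for m by (simp add: Hom_def)
    show "f m = (Diff I (m + 1) \<cdot> (g m \<uplus> c m)) \<uplus> ((g (m - 1) \<uplus> c (m - 1)) \<cdot> Diff V m)" if m: "b \<le> m" for m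
    proof -
      have "(Diff I (m + 1) \<cdot> (g m \<uplus> c m)) \<uplus> ((g (m - 1) \<uplus> c (m - 1)) \<cdot> Diff V m)
        = ((Diff I (m + 1) \<cdot> g m) \<uplus> (g (m - 1) \<cdot> Diff V m)) \<uplus> ((Diff I (m + 1) \<cdot> c m) \<uplus> (c (m - 1) \<cdot> Diff V m))"
        by (simp, rule lin_eqI, (rule lin_intros | simp)+)
      also have "\<dots> = (Diff I (m + 1) \<cdot> g m) \<uplus> (g (m - 1) \<cdot> Diff V m)" unfolding cc by simp
      finally show ?thesis using g(2)[OF m] by simp
    qed
    show "(g m \<uplus> c m) \<cdot> i m = h m" if m: "a + 2 \<le> m" for m
    proof -
      have z: "(g m \<cdot> i m) \<uplus> Neg A (h m) = (Neg A (Diff I (m + 2)) \<cdot> k m) \<uplus> (k (m - 1) \<cdot> Diff U m)"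
        using ek[OF m] by (simp only: e_def)
      have "(g m \<cdot> i m) \<uplus> (c m \<cdot> i m) = h m"
        unfolding ci by (rule Add_cross[OF z]) (simp_all, rule lin_eqI, (rule lin_intros | simp)+)
      then show ?thesis by simp
    qed
  qed
qed


lemma acyclic_extension:
  fixes X :: "'o set" and \<J> :: "('o, 'm) chain_complex set"
  assumes X: "X \<subseteq> Obj A"
    and zero_X: "\<exists>z \<in> X. is_zero_object A z"
    and kernels: "\<And>f. f \<in> Arr A \<Longrightarrow> \<exists>k. is_kernel A k f"
    and sums: "\<And>a b. \<lbrakk>a \<in> Obj A; b \<in> Obj A\<rbrakk> \<Longrightarrow> \<exists>s. is_direct_sum A a b s"
    and appr: "\<And>M. M \<in> Obj A \<Longrightarrow> \<exists>f. is_right_approximation A X f \<and> Cod A f = M"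
    and copr: "\<And>x. (\<And>k::nat. x k \<in> X) \<Longrightarrow> \<exists>S \<in> X. \<exists>j. is_coproduct x S j"
    and J: "\<And>I. I \<in> \<J> \<Longrightarrow> is_complex A I" "\<And>I. I \<in> \<J> \<Longrightarrow> unshift I \<in> \<J>"
    and null: "\<And>B n I. \<lbrakk>I \<in> \<J>; is_complex A B; right_acyclic A X B; \<And>k. k < n \<Longrightarrow> is_zero_object A (Term B k)\<rbrakk> \<Longrightarrow> nullmaps B I"
    and C: "is_complex A C"
  shows "\<exists>T i. is_complex A T \<and> cm C T i \<and> (\<forall>I \<in> \<J>. nullmaps T I) \<and>
    (\<forall>m. \<exists>S s p p'. S \<in> X \<and> is_biproduct A (Term C m) S (Term T m) (i m) s p p')"
proof -
  obtain zo where zo: "is_zero_object A zo" using zero_X by blast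
  \<comment> \<open>The tower of attachments.\<close>
  define att where "att k T T' i \<longleftrightarrow> is_complex A T' \<and> cm T T' i \<and> (\<forall>m. m \<ge> - int k \<longrightarrow> exact_at X T' m) \<and>
    (\<forall>m. \<exists>x j r q. x \<in> X \<and> is_biproduct A (Term T m) x (Term T' m) (i m) j r q)" for k T T' i
  have "\<exists>F. \<forall>k. (is_complex A (F k) \<and> (k = 0 \<longrightarrow> F k = C)) \<and> (\<exists>i. att k (F k) (F (Suc k)) i)"
  proof (rule dependent_nat_choice)
    show "\<exists>T. is_complex A T \<and> (0 = (0::nat) \<longrightarrow> T = C)" using C by auto
    fix T :: "('o, 'm) chain_complex" and k :: nat assume "is_complex A T \<and> (k = 0 \<longrightarrow> T = C)"
    then have "is_complex A T" by simp
    from attach[OF zero_X kernels sums appr this, where n = "- int k"]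
    show "\<exists>T'. (is_complex A T' \<and> (Suc k = 0 \<longrightarrow> T' = C)) \<and> (\<exists>i. att k T T' i)"
      unfolding att_def by auto
  qed
  then obtain F where F: "\<And>k. is_complex A (F k)" "F 0 = C" and "\<forall>k. \<exists>i. att k (F k) (F (Suc k)) i" by blast
  from choice[OF this(3)] obtain i where i0: "\<forall>k. att k (F k) (F (Suc k)) (i k)" by (rule exE)
  note i = i0[rule_format]
  have ic: "cm (F k) (F (Suc k)) (i k)" and ex: "\<And>m. - int k \<le> m \<Longrightarrow> exact_at X (F (Suc k)) m"
    and bi: "\<exists>x j r q. x \<in> X \<and> is_biproduct A (Term (F k) m) x (Term (F (Suc k)) m) (i k m) j r q" for k m
    using i[of k] by (simp_all add: att_def)
  define W where "W k m y \<longleftrightarrow> (case y of (x, j, r, q) \<Rightarrow> x \<in> X \<and> is_biproduct A (Term (F k) m) x (Term (F (Suc k)) m) (i k m) j r q)" for k m y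
  have "\<forall>k. \<exists>g. \<forall>m. W k m (g m)"
  proof
    fix k
    have "\<forall>m. \<exists>y. W k m y" using bi[of k] unfolding W_def by auto
    then show "\<exists>g. \<forall>m. W k m (g m)" by (rule choice)
  qed
  from choice[OF this] obtain Y where Y0: "\<forall>k m. W k m (Y k m)" by (rule exE)
  note Y = Y0[rule_format]
  define x j r q where "x k m = fst (Y k m)" and "j k m = fst (snd (Y k m))" and "r k m = fst (snd (snd (Y k m)))"
    and "q k m = snd (snd (snd (Y k m)))" for k m
  have xX: "x k m \<in> X" and b: "is_biproduct A (Term (F k) m) (x k m) (Term (F (Suc k)) m) (i k m) (j k m) (r k m) (q k m)" for k m
    using Y[of k m] by (simp_all add: W_def x_def j_def r_def q_def split: prod.splits)
  \<comment> \<open>Its colimit, degree by degree.\<close>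
  define V where "V m L Q \<longleftrightarrow> (\<exists>S s p p'. S \<in> X \<and> is_biproduct A (Term (F 0) m) S L (Q 0) s p p') \<and>
    (\<forall>k. Q k \<in> Hom A (Term (F k) m) L) \<and> (\<forall>k. Q (Suc k) \<cdot> i k m = Q k) \<and>
    (\<forall>c g. c \<in> Obj A \<and> (\<forall>k. g k \<in> Hom A (Term (F k) m) c) \<and> (\<forall>k. g (Suc k) \<cdot> i k m = g k) \<longrightarrow>
      (\<exists>u. u \<in> Hom A L c \<and> (\<forall>k. u \<cdot> Q k = g k))) \<and>
    (\<forall>u v. u \<in> Arr A \<and> v \<in> Arr A \<and> Dom A u = L \<and> Dom A v = L \<and> Cod A u = Cod A v \<and> (\<forall>k. u \<cdot> Q k = v \<cdot> Q k) \<longrightarrow> u = v)" for m L Q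
  have "\<exists>L Q. V m L Q" for m
    unfolding V_def
  proof (rule split_colimit)
    show "\<exists>S \<in> X. \<exists>jj. is_coproduct (\<lambda>k. x k m) S jj" by (rule copr) (rule xX)
    show "is_biproduct A (Term (F k) m) (x k m) (Term (F (Suc k)) m) (i k m) (j k m) (r k m) (q k m)" for k by (rule b)
  qed (rule sums)
  then have "\<forall>m. \<exists>y. V m (fst y) (snd y)" by auto
  from choice[OF this] obtain LQ where LQ0: "\<forall>m. V m (fst (LQ m)) (snd (LQ m))" by (rule exE)
  note LQ = LQ0[rule_format]
  define L Q where "L m = fst (LQ m)" and "Q m = snd (LQ m)" for m
  have VL: "V m (L m) (Q m)" for m unfolding L_def Q_def by (rule LQ)
  have bL: "\<exists>S s p p'. S \<in> X \<and> is_biproduct A (Term C m) S (L m) (Q m 0) s p p'" for m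
    using VL[of m] unfolding V_def F(2) by (elim conjE)
  have QH: "Q m k \<in> Hom A (Term (F k) m) (L m)" and Qi: "Q m (Suc k) \<cdot> i k m = Q m k" for m k
    using VL[of m] unfolding V_def by simp_all
  have ext: "\<exists>u. u \<in> Hom A (L m) c \<and> (\<forall>k. u \<cdot> Q m k = g k)"
    if "c \<in> Obj A" "\<And>k. g k \<in> Hom A (Term (F k) m) c" "\<And>k. g (Suc k) \<cdot> i k m = g k" for m c g
    using VL[of m] that unfolding V_def by (elim conjE) simp
  have uniq: "u = v" if "u \<in> Arr A" "v \<in> Arr A" "Dom A u = L m" "Dom A v = L m" "Cod A u = Cod A v"
      "\<And>k. u \<cdot> Q m k = v \<cdot> Q m k" for m u v
  proof -
    have "\<forall>u v. u \<in> Arr A \<and> v \<in> Arr A \<and> Dom A u = L m \<and> Dom A v = L m \<and> Cod A u = Cod A v \<and> (\<forall>k. u \<cdot> Q m k = v \<cdot> Q m k) \<longrightarrow> u = v"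
      using VL[of m] unfolding V_def by (elim conjE)
    then show ?thesis using that by simp
  qed
  have LO: "L m \<in> Obj A" for m using QH[of m 0] Cod_Obj[of "Q m 0"] by (simp add: Hom_def)
  note [simp] = HomD[OF QH] LO cplxD[OF F(1)] cmD(1-3)[OF ic]
  have id: "i k (m - 1) \<cdot> Diff (F k) m = Diff (F (Suc k)) m \<cdot> i k m" for k m
    using cmD(4)[OF ic, of "m - 1" m k] by simp
  have "\<exists>u. u \<in> Hom A (L m) (L (m - 1)) \<and> (\<forall>k. u \<cdot> Q m k = Q (m - 1) k \<cdot> Diff (F k) m)" for m
  proof (rule ext)
    show "(Q (m - 1) (Suc k) \<cdot> Diff (F (Suc k)) m) \<cdot> i k m = Q (m - 1) k \<cdot> Diff (F k) m" for k
      using Comp_reassoc[OF Qi[of "m - 1" k], of "Diff (F k) m"] by (simp add: id)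
  qed (simp_all add: Hom_def)
  then have "\<forall>m. \<exists>u. u \<in> Hom A (L m) (L (m - 1)) \<and> (\<forall>k. u \<cdot> Q m k = Q (m - 1) k \<cdot> Diff (F k) m)" by simp
  from choice[OF this] obtain d where
    d0: "\<forall>m. d m \<in> Hom A (L m) (L (m - 1)) \<and> (\<forall>k. d m \<cdot> Q m k = Q (m - 1) k \<cdot> Diff (F k) m)" by (rule exE)
  note dH = d0[rule_format, THEN conjunct1] and dQ = d0[rule_format, THEN conjunct2, rule_format]
  note [simp] = HomD[OF dH]
  define T where "T = \<lparr>Term = L, Diff = d\<rparr>"
  have [simp]: "Term T = L" "Diff T = d" by (simp_all add: T_def)
  have dd: "d m \<cdot> d (m + 1) = Zero A (L (m + 1)) (L (m - 1))" for m
  proof (rule uniq[of _ _ "m + 1"])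
    fix k
    have "d m \<cdot> (d (m + 1) \<cdot> Q (m + 1) k) = d m \<cdot> (Q m k \<cdot> Diff (F k) (m + 1))"
      using dQ[of "m + 1" k] by simp
    also have "\<dots> = (Q (m - 1) k \<cdot> Diff (F k) m) \<cdot> Diff (F k) (m + 1)"
      by (rule Comp_reassoc[OF dQ]) simp_all
    also have "\<dots> = Zero A (Term (F k) (m + 1)) (L (m - 1))" by simp
    finally show "(d m \<cdot> d (m + 1)) \<cdot> Q (m + 1) k = Zero A (L (m + 1)) (L (m - 1)) \<cdot> Q (m + 1) k" by simp
  qed simp_all
  have cT: "is_complex A T" unfolding is_complex_def using dd by (simp add: Hom_def)
  have cQ: "cm (F k) T (\<lambda>m. Q m k)" for k by (rule cmI) (simp_all add: dQ)
  \<comment> \<open>Tails of compatible families.\<close>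
  have tail: "\<exists>g'. (\<forall>k. g' k \<in> Hom A (Term (F k) m) c) \<and> (\<forall>k. g' (Suc k) \<cdot> i k m = g' k) \<and> (\<forall>k \<ge> K. g' k = g k)"
    if "\<And>k. K \<le> k \<Longrightarrow> g k \<in> Hom A (Term (F k) m) c" "\<And>k. K \<le> k \<Longrightarrow> g (Suc k) \<cdot> i k m = g k" for K g m c
    using that
  proof (induction K arbitrary: g)
    case 0
    then show ?case by (intro exI[of _ g]) simp
  next
    case (Suc K)
    define g1 where "g1 k = (if k = K then g (Suc K) \<cdot> i K m else g k)" for k
    have gS: "g (Suc K) \<in> Hom A (Term (F (Suc K)) m) c" by (rule Suc.prems) simp
    note [simp] = HomD[OF gS]
    have 1: "g1 k \<in> Hom A (Term (F k) m) c" if "K \<le> k" for k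
      using Suc.prems(1)[of k] that by (cases "k = K") (simp_all add: g1_def Hom_def)
    have 2: "g1 (Suc k) \<cdot> i k m = g1 k" if "K \<le> k" for k
      using Suc.prems(2)[of k] that by (cases "k = K") (simp_all add: g1_def)
    have "\<exists>g'. (\<forall>k. g' k \<in> Hom A (Term (F k) m) c) \<and> (\<forall>k. g' (Suc k) \<cdot> i k m = g' k) \<and> (\<forall>k \<ge> K. g' k = g1 k)"
      by (rule Suc.IH) (rule 1 2; assumption)+
    then obtain g' where g': "\<forall>k. g' k \<in> Hom A (Term (F k) m) c" "\<forall>k. g' (Suc k) \<cdot> i k m = g' k" "\<forall>k \<ge> K. g' k = g1 k"
      by (elim exE conjE) (rule that)
    have "\<forall>k \<ge> Suc K. g' k = g k" using g'(3) by (auto simp: g1_def)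
    then show ?case using g'(1,2) by (intro exI[of _ g'] conjI)
  qed
  have tail_eq: "u = v" if uv: "u \<in> Arr A" "v \<in> Arr A" "Dom A u = L m" "Dom A v = L m" "Cod A u = Cod A v"
    and e: "\<And>k. K \<le> k \<Longrightarrow> u \<cdot> Q m k = v \<cdot> Q m k" for u v m K
  proof (rule uniq[OF uv])
    note [simp] = uv
    have "\<forall>k. K \<le> k + n \<longrightarrow> u \<cdot> Q m k = v \<cdot> Q m k" for n
    proof (induction n)
      case 0
      then show ?case using e by simp
    next
      case (Suc n)
      show ?case
      proof (intro allI impI)
        fix k assume "K \<le> k + Suc n"
        then have "u \<cdot> Q m (Suc k) = v \<cdot> Q m (Suc k)" using Suc.IH by simp
        then have "(u \<cdot> Q m (Suc k)) \<cdot> i k m = (v \<cdot> Q m (Suc k)) \<cdot> i k m" by simp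
        then show "u \<cdot> Q m k = v \<cdot> Q m k" using Qi[of m k] by simp
      qed
    qed
    then show "u \<cdot> Q m k = v \<cdot> Q m k" for k by (metis le_add2)
  qed
  \<comment> \<open>Every map from the colimit to a complex in \<open>\<J>\<close> is null homotopic.\<close>
  have "nullmaps T I" if I: "I \<in> \<J>" for I
    unfolding nullmaps_def
  proof (intro allI impI)
    fix f assume f: "cm T I f"
    note cI = J(1)[OF I] and cuI = J(1)[OF J(2)[OF I]]
    note [simp] = cplxD(1-4)[OF cI] cmD(1-3)[OF f, simplified]
    have trunc: "\<exists>h. (\<forall>m. h m \<in> Hom A (Term (F (Suc k)) m) (Term I' (m + 1))) \<and>
       (\<forall>m. n + 2 \<le> m \<longrightarrow> e m = (Diff I' (m + 1) \<cdot> h m) \<uplus> (h (m - 1) \<cdot> Diff (F (Suc k)) m))"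
      if "I' \<in> \<J>" "- int k \<le> n" "\<And>m. e m \<in> Hom A (Term (F (Suc k)) m) (Term I' m)"
        "\<And>m. n \<le> m \<Longrightarrow> e (m - 1) \<cdot> Diff (F (Suc k)) m = Diff I' m \<cdot> e m" for I' n e k
    proof (rule truncated_null[OF F(1) J(1)[OF that(1)] kernels zo X null[OF that(1)]])
      show "n \<le> m \<Longrightarrow> exact_at X (F (Suc k)) m" for m using ex[of k m] that(2) by simp
    qed (simp_all add: that(3,4))
    define fk where "fk k m = f m \<cdot> Q m (Suc k)" for k m
    have fkH: "fk k m \<in> Hom A (Term (F (Suc k)) m) (Term I m)" for k m by (simp add: fk_def Hom_def)
    have fkd: "fk k (m - 1) \<cdot> Diff (F (Suc k)) m = Diff I m \<cdot> fk k m" for k m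
    proof -
      have "f (m - 1) \<cdot> (d m \<cdot> Q m (Suc k)) = (Diff I m \<cdot> f m) \<cdot> Q m (Suc k)"
        using Comp_reassoc[OF cmD(4)[OF f, of "m - 1" m], of "Q m (Suc k)"] by simp
      then show ?thesis using dQ[of m "Suc k"] by (simp add: fk_def)
    qed
    have fki: "fk (Suc k) m \<cdot> i (Suc k) m = fk k m" for k m using Qi[of m "Suc k"] by (simp add: fk_def)
    define good where "good k h \<longleftrightarrow> (\<forall>m. h m \<in> Hom A (Term (F (Suc k)) m) (Term I (m + 1))) \<and>
      (\<forall>m. 2 - int k \<le> m \<longrightarrow> fk k m = (Diff I (m + 1) \<cdot> h m) \<uplus> (h (m - 1) \<cdot> Diff (F (Suc k)) m))" for k h
    have ge: "\<exists>h. good k h" for k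
      using trunc[OF I order_refl fkH fkd, of k] unfolding good_def by (simp add: algebra_simps)
    have "\<exists>H. \<forall>k. good k (H k) \<and> (\<forall>m. 4 - int k \<le> m \<longrightarrow> H (Suc k) m \<cdot> i (Suc k) m = H k m)"
    proof (rule dependent_nat_choice)
      show "\<exists>h. good 0 h" by (rule ge)
      fix h k assume h: "good k h"
      obtain g where g: "good (Suc k) g" using ge by blast
      have "\<exists>h'. (\<forall>m. h' m \<in> Hom A (Term (F (Suc (Suc k))) m) (Term I (m + 1))) \<and>
        (\<forall>m. 1 - int k \<le> m \<longrightarrow> fk (Suc k) m = (Diff I (m + 1) \<cdot> h' m) \<uplus> (h' (m - 1) \<cdot> Diff (F (Suc (Suc k))) m)) \<and>
        (\<forall>m. (2 - int k) + 2 \<le> m \<longrightarrow> h' m \<cdot> i (Suc k) m = h m)"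
      proof (rule extend_homotopy[OF F(1) F(1) cI ic])
        show "r (Suc k) m \<in> Hom A (Term (F (Suc (Suc k))) m) (Term (F (Suc k)) m)"
          "r (Suc k) m \<cdot> i (Suc k) m = Ide A (Term (F (Suc k)) m)" for m
          using biD[OF b[of "Suc k" m]] by (simp_all add: Hom_def)
        show "fk (Suc k) m \<in> Hom A (Term (F (Suc (Suc k))) m) (Term I m)" for m by (rule fkH)
        show "h m \<in> Hom A (Term (F (Suc k)) m) (Term I (m + 1))" for m using h by (simp add: good_def)
        show "fk (Suc k) m \<cdot> i (Suc k) m = (Diff I (m + 1) \<cdot> h m) \<uplus> (h (m - 1) \<cdot> Diff (F (Suc k)) m)" if "2 - int k \<le> m" for m
          unfolding fki using h that by (simp add: good_def)
        show "g m \<in> Hom A (Term (F (Suc (Suc k))) m) (Term I (m + 1))" for m using g by (simp add: good_def)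
        show "fk (Suc k) m = (Diff I (m + 1) \<cdot> g m) \<uplus> (g (m - 1) \<cdot> Diff (F (Suc (Suc k))) m)" if "1 - int k \<le> m" for m
          using g that by (simp add: good_def)
        show "1 - int k \<le> 2 - int k" by simp
        fix e assume e: "\<And>m. e m \<in> Hom A (Term (F (Suc k)) m) (Term (unshift I) m)"
          "\<And>m. 2 - int k \<le> m \<Longrightarrow> e (m - 1) \<cdot> Diff (F (Suc k)) m = Diff (unshift I) m \<cdot> e m"
        show "\<exists>ka. (\<forall>m. ka m \<in> Hom A (Term (F (Suc k)) m) (Term (unshift I) (m + 1))) \<and>
          (\<forall>m. 2 - int k + 2 \<le> m \<longrightarrow> e m = (Diff (unshift I) (m + 1) \<cdot> ka m) \<uplus> (ka (m - 1) \<cdot> Diff (F (Suc k)) m))"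
          by (rule trunc[OF J(2)[OF I] _ e]) simp_all
      qed
      then show "\<exists>h'. good (Suc k) h' \<and> (\<forall>m. 4 - int k \<le> m \<longrightarrow> h' m \<cdot> i (Suc k) m = h m)"
        unfolding good_def by (simp add: algebra_simps)
    qed
    then obtain H where H: "\<And>k. good k (H k)" "\<And>k m. 4 - int k \<le> m \<Longrightarrow> H (Suc k) m \<cdot> i (Suc k) m = H k m" by blast
    have HH: "H k m \<in> Hom A (Term (F (Suc k)) m) (Term I (m + 1))" for k m using H(1)[of k] by (simp add: good_def)
    have Hd: "fk k m = (Diff I (m + 1) \<cdot> H k m) \<uplus> (H k (m - 1) \<cdot> Diff (F (Suc k)) m)" if "2 - int k \<le> m" for k m
      using H(1)[of k] that by (simp add: good_def)
    define N where "N m = nat (4 - m)" for m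
    have "\<exists>u. u \<in> Hom A (L m) (Term I (m + 1)) \<and> (\<forall>k \<ge> Suc (N m). u \<cdot> Q m k = H (k - 1) m)" for m
    proof -
      have "\<exists>g'. (\<forall>k. g' k \<in> Hom A (Term (F k) m) (Term I (m + 1))) \<and> (\<forall>k. g' (Suc k) \<cdot> i k m = g' k) \<and>
          (\<forall>k \<ge> Suc (N m). g' k = H (k - 1) m)"
      proof (rule tail)
        fix k assume k: "Suc (N m) \<le> k"
        then obtain k' where k': "k = Suc k'" by (cases k) auto
        have "4 - int k' \<le> m" using k unfolding k' N_def by linarith
        then show "H (k - 1) m \<in> Hom A (Term (F k) m) (Term I (m + 1))" "H (Suc k - 1) m \<cdot> i k m = H (k - 1) m"
          using HH[of k' m] H(2)[of k' m] by (simp_all add: k')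
      qed
      then obtain g' where g': "\<And>k. g' k \<in> Hom A (Term (F k) m) (Term I (m + 1))" "\<And>k. g' (Suc k) \<cdot> i k m = g' k"
          "\<And>k. Suc (N m) \<le> k \<Longrightarrow> g' k = H (k - 1) m" by blast
      obtain u where "u \<in> Hom A (L m) (Term I (m + 1))" "\<forall>k. u \<cdot> Q m k = g' k"
        using ext[OF cplxD(1)[OF cI, of "m + 1"] g'(1,2)] by (elim exE conjE) (rule that)
      then show ?thesis using g'(3) by (intro exI[of _ u]) simp
    qed
    then have "\<forall>m. \<exists>u. u \<in> Hom A (L m) (Term I (m + 1)) \<and> (\<forall>k \<ge> Suc (N m). u \<cdot> Q m k = H (k - 1) m)" by simp
    from choice[OF this] obtain h where
      h0: "\<forall>m. h m \<in> Hom A (L m) (Term I (m + 1)) \<and> (\<forall>k \<ge> Suc (N m). h m \<cdot> Q m k = H (k - 1) m)" by (rule exE)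
    note hH = spec[OF h0, THEN conjunct1] and hQ = spec[OF h0, THEN conjunct2, rule_format]
    note [simp] = HomD[OF hH] HomD[OF HH]
    show "nul T I f"
    proof (rule nulI[where h = h])
      fix m
      show "f m = (Diff I (m + 1) \<cdot> h m) \<uplus> (h (m - 1) \<cdot> Diff T m)"
      proof (rule tail_eq[of _ _ m "Suc (N (m - 1))"])
        fix k assume k: "Suc (N (m - 1)) \<le> k"
        then obtain k' where k': "k = Suc k'" by (cases k) auto
        have k2: "2 - int k' \<le> m" "Suc (N m) \<le> k" using k unfolding k' N_def by linarith+
        have 1: "h m \<cdot> Q m k = H k' m" "h (m - 1) \<cdot> Q (m - 1) k = H k' (m - 1)" using hQ[OF k] hQ[OF k2(2)] by (simp_all add: k')
        have "((Diff I (m + 1) \<cdot> h m) \<uplus> (h (m - 1) \<cdot> d m)) \<cdot> Q m k = (Diff I (m + 1) \<cdot> (h m \<cdot> Q m k)) \<uplus> (h (m - 1) \<cdot> (d m \<cdot> Q m k))"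
          by simp
        also have "h (m - 1) \<cdot> (d m \<cdot> Q m k) = (h (m - 1) \<cdot> Q (m - 1) k) \<cdot> Diff (F k) m"
          unfolding dQ by simp
        also have "(Diff I (m + 1) \<cdot> (h m \<cdot> Q m k)) \<uplus> \<dots> = f m \<cdot> Q m k"
          unfolding 1 using Hd[OF k2(1)] by (simp add: fk_def k')
        finally show "f m \<cdot> Q m k = ((Diff I (m + 1) \<cdot> h m) \<uplus> (h (m - 1) \<cdot> Diff T m)) \<cdot> Q m k" by simp
      qed simp_all
    qed (simp_all add: cT cI)
  qed
  moreover have "cm C T (\<lambda>m. Q m 0)" using cQ[of 0] F(2) by simp
  ultimately show ?thesis using cT bL by (intro exI[of _ T] exI[of _ "\<lambda>m. Q m 0"] conjI allI ballI) simp_all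
qed

end

definition opp :: "('o, 'm, 'z) preadd_category_scheme \<Rightarrow> ('o, 'm) preadd_category" where
  "opp A = \<lparr>Obj = Obj A, Arr = Arr A, Dom = Cod A, Cod = Dom A, Ide = Ide A,
     Comp = (\<lambda>g f. f \<cdot>\<^bsub>A\<^esub> g), Add = Add A, Zero = (\<lambda>a b. Zero A b a)\<rparr>"

lemma opp_sel [simp]:
  "Obj (opp A) = Obj A" "Arr (opp A) = Arr A" "Dom (opp A) = Cod A" "Cod (opp A) = Dom A" "Ide (opp A) = Ide A"
  "g \<cdot>\<^bsub>opp A\<^esub> f = f \<cdot>\<^bsub>A\<^esub> g" "Add (opp A) = Add A" "Zero (opp A) a b = Zero A b a"
  by (simp_all add: opp_def)

lemma opp_Hom [simp]: "Hom (opp A) a b = Hom A b a"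
  by (auto simp: Hom_def)

definition rev_complex :: "('o, 'm) chain_complex \<Rightarrow> ('o, 'm) chain_complex" where
  "rev_complex C = \<lparr>Term = (\<lambda>n. Term C (- n)), Diff = (\<lambda>n. Diff C (1 - n))\<rparr>"

lemma rev_sel [simp]: "Term (rev_complex C) n = Term C (- n)" "Diff (rev_complex C) n = Diff C (1 - n)"
  by (simp_all add: rev_complex_def)

lemma rev_rev [simp]: "rev_complex (rev_complex C) = C"
  by (simp add: rev_complex_def)

lemma category_opposite: "category C \<Longrightarrow> category (opposite C)"
proof -
  assume "category C"
  then interpret category C .
  show ?thesis
    by unfold_locales (auto simp: opposite_def Hom_def)
qed

definition discrete_category :: "'u set \<Rightarrow> ('u, 'u) category" where
  "discrete_category I = \<lparr>Obj = I, Arr = I, Dom = (\<lambda>a. a), Cod = (\<lambda>a. a), Ide = (\<lambda>a. a), Comp = (\<lambda>g f. f)\<rparr>"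

lemma discrete_category: "category (discrete_category I)"
  by unfold_locales (auto simp: discrete_category_def Hom_def)

lemma complete_nat_product:
  fixes D :: "('o, 'm, 'z) category_scheme"
  assumes inf: "infinite (UNIV :: 'u set)" and cD: "category D" and comp: "complete_category TYPE('u) D"
    and x: "\<And>k::nat. x k \<in> Obj D"
  shows "\<exists>v p. v \<in> Obj D \<and> (\<forall>k. p k \<in> Hom D v (x k)) \<and>
    (\<forall>w q. w \<in> Obj D \<and> (\<forall>k. q k \<in> Hom D w (x k)) \<longrightarrow> (\<exists>!u. u \<in> Hom D w v \<and> (\<forall>k. p k \<cdot>\<^bsub>D\<^esub> u = q k)))"
proof -
  obtain e :: "nat \<Rightarrow> 'u" where e: "inj e" using infinite_countable_subset[OF inf] by blast
  let ?J = "discrete_category (range e)"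
  have J: "Hom ?J a b = {f. f \<in> range e \<and> f = a \<and> f = b}" "Obj ?J = range e" "Ide ?J a = a" "Comp ?J g f = f" for a b f g
    by (auto simp: discrete_category_def Hom_def)
  have "is_functor ?J D (\<lambda>a. x (the_inv e a)) (\<lambda>a. Ide D (x (the_inv e a)))"
    unfolding is_functor_def using category.Ide_in_Hom[OF cD] category.Ide_left[OF cD category.Ide_in_Hom[OF cD x]] by (auto simp: J x)
  with discrete_category obtain v p where l: "is_limit ?J D (\<lambda>a. x (the_inv e a)) (\<lambda>a. Ide D (x (the_inv e a))) v p"
    using comp unfolding complete_category_def by blast
  have ie: "the_inv e (e k) = k" for k using e by (rule the_inv_f_f)
  have v: "v \<in> Obj D" and p: "p (e k) \<in> Hom D v (x k)" for k
    using l unfolding is_limit_def is_cone_def by (auto simp: J ie)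
  have "\<exists>!u. u \<in> Hom D w v \<and> (\<forall>k. p (e k) \<cdot>\<^bsub>D\<^esub> u = q k)" if w: "w \<in> Obj D" "\<And>k. q k \<in> Hom D w (x k)" for w q
  proof -
    have "is_cone ?J D (\<lambda>a. x (the_inv e a)) (\<lambda>a. Ide D (x (the_inv e a))) w (\<lambda>a. q (the_inv e a))"
      unfolding is_cone_def using w category.Ide_left[OF cD] by (auto simp: J)
    then have "\<exists>!u. u \<in> Hom D w v \<and> (\<forall>i \<in> Obj ?J. p i \<cdot>\<^bsub>D\<^esub> u = q (the_inv e i))"
      using l unfolding is_limit_def by blast
    then show ?thesis by (simp add: J ie)
  qed
  then show ?thesis using v p by (intro exI[of _ v] exI[of _ "\<lambda>k. p (e k)"]) simp
qed

context preadditive_category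
begin

lemma opp_category: "category (opp A)"
  by unfold_locales (auto simp: Hom_def)

lemma opp_hom_group: "hom_group (opp A) a b = hom_group A b a"
  by (simp add: hom_group_def)

lemma opp_preadditive: "preadditive_category (opp A)"
proof (intro preadditive_category.intro preadditive_category_axioms.intro opp_category)
  show "a \<in> Obj (opp A) \<Longrightarrow> b \<in> Obj (opp A) \<Longrightarrow> comm_group (hom_group (opp A) a b)" for a b
    by (simp add: opp_hom_group comm_group_hom)
qed (simp_all add: Hom_def)

lemma opp_Neg: "f \<in> Arr A \<Longrightarrow> Neg (opp A) f = Neg A f"
  by (simp add: Neg_def opp_hom_group)

lemma opp_complex: "is_complex (opp A) (rev_complex C) \<longleftrightarrow> is_complex A C"
proof -
  have 1: "(\<forall>n. Term C (- n) \<in> Obj A) \<longleftrightarrow> (\<forall>n. Term C n \<in> Obj A)" by (metis minus_minus)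
  have 2: "(\<forall>n. Diff C (1 - n) \<in> Hom A (Term C (- (n - 1))) (Term C (- n))) \<longleftrightarrow> (\<forall>n. Diff C n \<in> Hom A (Term C n) (Term C (n - 1)))" (is "?a \<longleftrightarrow> ?b")
  proof
    assume ?a
    show ?b
    proof
      fix n show "Diff C n \<in> Hom A (Term C n) (Term C (n - 1))" using \<open>?a\<close>[rule_format, of "1 - n"] by simp
    qed
  next
    assume ?b
    show ?a
    proof
      fix n show "Diff C (1 - n) \<in> Hom A (Term C (- (n - 1))) (Term C (- n))" using \<open>?b\<close>[rule_format, of "1 - n"] by simp
    qed
  qed
  have ix: "1 - (- n + 1) = n" "1 - - n = n + 1" "- (- n - 1) = n + 1" "- (- n + 1) = n - 1"
    and ix': "- n + 1 = 1 - n" "- n - 1 = - (n + 1)" "1 - (n + 1) = - n" "- (n - 1) = 1 - n" for n :: int by simp_all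
  have 3: "(\<forall>n. Diff C (1 - (n + 1)) \<cdot> Diff C (1 - n) = Zero A (Term C (- (n - 1))) (Term C (- (n + 1)))) \<longleftrightarrow>
    (\<forall>n. Diff C n \<cdot> Diff C (n + 1) = Zero A (Term C (n + 1)) (Term C (n - 1)))" (is "?a \<longleftrightarrow> ?b")
  proof
    assume ?a
    show ?b
    proof
      fix n show "Diff C n \<cdot> Diff C (n + 1) = Zero A (Term C (n + 1)) (Term C (n - 1))"
        using \<open>?a\<close>[rule_format, of "- n"] unfolding ix[of n] .
    qed
  next
    assume ?b
    show ?a
    proof
      fix n show "Diff C (1 - (n + 1)) \<cdot> Diff C (1 - n) = Zero A (Term C (- (n - 1))) (Term C (- (n + 1)))"
        using \<open>?b\<close>[rule_format, of "- n"] unfolding ix'[of n] .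
    qed
  qed
  show ?thesis unfolding is_complex_def opp_sel opp_Hom rev_sel using 1 2 3 by simp
qed

lemma opp_dw: "rev_complex C \<in> dw (opp A) Y \<longleftrightarrow> C \<in> dw A Y"
proof -
  have "(\<forall>n. Term C (- n) \<in> Y) \<longleftrightarrow> (\<forall>n. Term C n \<in> Y)" by (metis minus_minus)
  then show ?thesis by (simp add: dw_def opp_complex)
qed

lemma opp_cm:
  assumes C: "is_complex A C" and D: "is_complex A D"
  shows "preadditive_category.cm (opp A) (rev_complex D) (rev_complex C) (\<lambda>n. f (- n)) \<longleftrightarrow> cm C D f" (is "?a \<longleftrightarrow> ?b")
proof -
  interpret B: preadditive_category "opp A" by (rule opp_preadditive)
  note [simp] = cplxD[OF C] cplxD[OF D]
  show ?thesis
  proof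
    assume a: ?a
    have "f n \<in> Hom A (Term C n) (Term D n)" for n using a unfolding B.cm_def by (simp, metis minus_minus)
    moreover have "f (n - 1) \<cdot> Diff C n = Diff D n \<cdot> f n" for n
      using B.cmD(4)[OF a, of "- n" "1 - n"] by (simp add: algebra_simps)
    ultimately show ?b by (simp add: cm_def)
  next
    assume b: ?b
    show ?a unfolding B.cm_def
    proof (intro conjI allI)
      show "f (- n) \<in> Hom (opp A) (Term (rev_complex D) n) (Term (rev_complex C) n)" for n using b by (simp add: cm_def)
      show "f (- (n - 1)) \<cdot>\<^bsub>opp A\<^esub> Diff (rev_complex D) n = Diff (rev_complex C) n \<cdot>\<^bsub>opp A\<^esub> f (- n)" for n
        using cmD(4)[OF b, of "- n" "1 - n"] by simp
    qed
  qed
qed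

lemma opp_nullmaps:
  assumes C: "is_complex A C" and D: "is_complex A D"
  shows "preadditive_category.nullmaps (opp A) (rev_complex D) (rev_complex C) \<longleftrightarrow> nullmaps C D" (is "?a \<longleftrightarrow> ?b")
proof -
  interpret B: preadditive_category "opp A" by (rule opp_preadditive)
  note [simp] = cplxD[OF C] cplxD[OF D]
  have C': "is_complex (opp A) (rev_complex C)" and D': "is_complex (opp A) (rev_complex D)"
    using C D by (simp_all add: opp_complex)
  show ?thesis
  proof
    assume a: ?a
    show ?b unfolding nullmaps_def
    proof (intro allI impI)
      fix f assume f: "cm C D f"
      then have "B.nul (rev_complex D) (rev_complex C) (\<lambda>n. f (- n))"
        using a opp_cm[OF C D] unfolding B.nullmaps_def by simp
      from B.nulE[OF this D' C'] obtain h where h: "\<And>n. h n \<in> Arr A" "\<And>n. Cod A (h n) = Term D (- n)" "\<And>n. Dom A (h n) = Term C (- (n + 1))"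
        and e: "\<And>n. f (- n) = (h n \<cdot> Diff C (1 - (n + 1))) \<uplus> (Diff D (1 - n) \<cdot> h (n - 1))"
        unfolding opp_sel rev_sel by blast
      define k where "k n = h (- (n + 1))" for n
      have k [simp]: "k n \<in> Arr A" "Dom A (k n) = Term C n" "Cod A (k n) = Term D (n + 1)" for n
        using h(1)[of "- (n + 1)"] h(2)[of "- (n + 1)"] h(3)[of "- (n + 1)"] by (simp_all add: k_def add.commute)
      show "nul C D f"
      proof (rule nulI[where h = k])
        fix n
        have "- (n - 1 + 1) = - n" "- (n + 1) = - n - 1" for n :: int by simp_all
        then have i: "h (- n) = k (n - 1)" "h (- n - 1) = k n" unfolding k_def by simp_all
        have "f n = (h (- n) \<cdot> Diff C n) \<uplus> (Diff D (1 + n) \<cdot> h (- n - 1))"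
          using e[of "- n"] by simp
        then have "f n = (k (n - 1) \<cdot> Diff C n) \<uplus> (Diff D (n + 1) \<cdot> k n)" unfolding i by (simp add: add.commute)
        also have "\<dots> = (Diff D (n + 1) \<cdot> k n) \<uplus> (k (n - 1) \<cdot> Diff C n)"
          by (rule lin_eqI, (rule lin_intros | simp)+)
        finally show "f n = (Diff D (n + 1) \<cdot> k n) \<uplus> (k (n - 1) \<cdot> Diff C n)" .
      qed (simp_all add: C D)
    qed
  next
    assume b: ?b
    show ?a unfolding B.nullmaps_def
    proof (intro allI impI)
      fix f assume f: "B.cm (rev_complex D) (rev_complex C) f"
      define g where "g n = f (- n)" for n
      have fg: "f = (\<lambda>n. g (- n))" by (simp add: g_def)
      have g: "cm C D g" using f unfolding fg using opp_cm[OF C D] by simp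
      have "nul C D g" using b g unfolding nullmaps_def by simp
      from nulE[OF this C D] obtain h where h: "\<And>n. h n \<in> Arr A" "\<And>n. Dom A (h n) = Term C n" "\<And>n. Cod A (h n) = Term D (n + 1)"
        and e: "\<And>n. g n = (Diff D (n + 1) \<cdot> h n) \<uplus> (h (n - 1) \<cdot> Diff C n)" by blast
      note [simp] = h
      show "B.nul (rev_complex D) (rev_complex C) f"
      proof (rule B.nulI[where h = "\<lambda>n. h (- n - 1)"])
        fix n
        have i: "- (n - 1) - 1 = - n" "1 - (n + 1) = - n" "1 - n = - n + 1" for n :: int by simp_all
        have "f n = (Diff D (- n + 1) \<cdot> h (- n)) \<uplus> (h (- n - 1) \<cdot> Diff C (- n))" unfolding fg by (rule e)
        also have "\<dots> = (h (- n - 1) \<cdot> Diff C (- n)) \<uplus> (Diff D (- n + 1) \<cdot> h (- n))"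
          by (rule lin_eqI, (rule lin_intros | simp)+)
        finally show "f n = (Diff (rev_complex C) (n + 1) \<cdot>\<^bsub>opp A\<^esub> h (- n - 1)) \<uplus>\<^bsub>opp A\<^esub> (h (- (n - 1) - 1) \<cdot>\<^bsub>opp A\<^esub> Diff (rev_complex D) n)"
          unfolding opp_sel rev_sel i(1,2) unfolding i(3) .
      qed (simp_all add: C' D')
    qed
  qed
qed

lemma opp_unshift: "is_complex A I \<Longrightarrow> preadditive_category.unshift (opp A) (rev_complex I) = rev_complex (shift_complex A I)"
proof -
  assume I: "is_complex A I"
  interpret B: preadditive_category "opp A" by (rule opp_preadditive)
  show ?thesis
    by (simp add: B.unshift_def rev_complex_def shift_complex_def opp_Neg cplxD[OF I])
qed

lemma opp_right_acyclic: "right_acyclic (opp A) Y (rev_complex C) \<longleftrightarrow> left_acyclic A Y C"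
proof -
  have "(\<forall>n. {f \<in> Hom A (Term C (- n)) y. f \<cdot> Diff C (1 - n) = Zero A (Term C (- (n - 1))) y} =
      (\<lambda>g. g \<cdot> Diff C (1 - (n + 1))) ` Hom A (Term C (- (n + 1))) y) \<longleftrightarrow>
    (\<forall>n. {f \<in> Hom A (Term C n) y. f \<cdot> Diff C (n + 1) = Zero A (Term C (n + 1)) y} = (\<lambda>g. g \<cdot> Diff C n) ` Hom A (Term C (n - 1)) y)"
    (is "(\<forall>n. ?p n) \<longleftrightarrow> (\<forall>n. ?q n)") for y
  proof -
    have pq: "?p (- n) \<longleftrightarrow> ?q n" for n :: int
    proof -
      have "- (- n) = n" "1 - - n = n + 1" "- (- n - 1) = n + 1" "1 - (- n + 1) = n" "- (- n + 1) = n - 1" by simp_all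
      then show ?thesis by (simp only:)
    qed
    show ?thesis
    proof (intro iffI allI)
      fix n assume "\<forall>n. ?p n"
      then have "?p (- n)" by (rule spec)
      then show "?q n" by (simp only: pq)
    next
      fix n assume "\<forall>n. ?q n"
      then have "?q (- n)" by (rule spec)
      then have "?p (- (- n))" by (simp only: pq)
      then show "?p n" by (simp only: minus_minus)
    qed
  qed
  then show ?thesis unfolding right_acyclic_def left_acyclic_def opp_sel opp_Hom rev_sel by (simp only:)
qed

lemma opp_biproduct: "is_biproduct (opp A) a b s i j p q \<longleftrightarrow> is_biproduct A a b s p q i j"
  by (auto simp: is_biproduct_def)

lemma opp_direct_sum: "is_direct_sum (opp A) a b s \<longleftrightarrow> is_direct_sum A a b s"
  unfolding is_direct_sum_def opp_biproduct by blast

lemma opp_zero_object: "is_zero_object (opp A) z \<longleftrightarrow> is_zero_object A z"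
  by (auto simp: is_zero_object_def)

lemma opp_kernel: "is_kernel (opp A) k f \<longleftrightarrow> is_cokernel A k f"
  by (auto simp: is_kernel_def is_cokernel_def)

lemma opp_approximation: "is_right_approximation (opp A) Y f \<longleftrightarrow> is_left_approximation A Y f"
  by (simp add: is_right_approximation_def is_left_approximation_def)

text \<open>\<open>X\<close> is closed under coproducts: these are retracts of their approximations, hence direct summands.\<close>

lemma coproduct_closed:
  assumes summand: "\<And>a b s. \<lbrakk>is_direct_sum A a b s; s \<in> X\<rbrakk> \<Longrightarrow> a \<in> X"
    and kernels: "\<And>f. f \<in> Arr A \<Longrightarrow> \<exists>k. is_kernel A k f"
    and appr: "\<And>M. M \<in> Obj A \<Longrightarrow> \<exists>f. is_right_approximation A X f \<and> Cod A f = M"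
    and S: "is_coproduct x S j" and x: "\<And>k. x k \<in> X"
  shows "S \<in> X"
proof -
  note [simp] = coproductD[OF S]
  obtain f where f: "is_right_approximation A X f" "Cod A f = S" using appr[of S] by auto
  have f' [simp]: "f \<in> Arr A" "Cod A f = S" and fX: "Dom A f \<in> X" using f by (simp_all add: is_right_approximation_def)
  have "\<exists>h. h \<in> Hom A (x k) (Dom A f) \<and> f \<cdot> h = j k" for k
  proof -
    have "j k \<in> Hom A (x k) (Cod A f)" by (simp add: Hom_def)
    then show ?thesis using f(1) x[of k] unfolding is_right_approximation_def by blast
  qed
  then have "\<forall>k. \<exists>h. h \<in> Hom A (x k) (Dom A f) \<and> f \<cdot> h = j k" by simp
  from choice[OF this] obtain h where h: "\<forall>k. h k \<in> Hom A (x k) (Dom A f) \<and> f \<cdot> h k = j k" by (rule exE)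
  have "Dom A f \<in> Obj A" "\<And>k. h k \<in> Hom A (x k) (Dom A f)" using h by simp_all
  from coproduct_ex[OF S this] obtain u where u: "u \<in> Hom A S (Dom A f)" "\<forall>k. u \<cdot> j k = h k" by (elim exE conjE)
  have u' [simp]: "u \<in> Arr A" "Dom A u = S" "Cod A u = Dom A f" using u(1) by (simp_all add: Hom_def)
  have fu: "f \<cdot> u = Ide A S"
    by (rule coproduct_eq[OF S]) (simp_all add: u(2) h)
  obtain k where k: "is_kernel A k f" using kernels[of f] by auto
  note kD = kernelD[OF k]
  have [simp]: "k \<in> Arr A" "Cod A k = Dom A f" using kD by simp_all
  have fu': "f \<cdot> (u \<cdot> y) = y" if "y \<in> Arr A" "Cod A y = S" for y using Comp_reassoc[OF fu, of y] that by simp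
  have fk: "f \<cdot> k = Zero A (Dom A k) S" using kD(4) by simp
  let ?g = "Ide A (Dom A f) \<uplus> Neg A (u \<cdot> f)"
  have "f \<cdot> ?g = Zero A (Dom A ?g) (Cod A f)" by (simp add: fu')
  then have "\<exists>r. r \<in> Arr A \<and> Dom A r = Dom A ?g \<and> Cod A r = Dom A k \<and> k \<cdot> r = ?g"
    by (intro kernel_factor[OF k]) simp_all
  then obtain r where r: "r \<in> Arr A" "Dom A r = Dom A f" "Cod A r = Dom A k" "k \<cdot> r = ?g" by auto
  note [simp] = r(1-3)
  have kr: "k \<cdot> (r \<cdot> y) = y \<uplus> Neg A (u \<cdot> (f \<cdot> y))" if "y \<in> Arr A" "Cod A y = Dom A f" for y
    using Comp_reassoc[OF r(4), of y] that by simp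
  have 1: "r \<cdot> k = Ide A (Dom A k)"
    by (rule monic_cancel[OF kernel_monic[OF k]]) (simp_all add: kr fk)
  have 2: "r \<cdot> u = Zero A S (Dom A k)"
    by (rule monic_cancel[OF kernel_monic[OF k]]) (simp_all add: kr fu)
  have 3: "(u \<cdot> f) \<uplus> (k \<cdot> r) = Ide A (Dom A f)"
    unfolding r(4) by (rule lin_eqI, (rule lin_intros | simp)+)
  have "is_biproduct A S (Dom A k) (Dom A f) u k f r"
    unfolding is_biproduct_def using 1 2 3 fu fk by (simp add: Hom_def)
  then have "is_direct_sum A S (Dom A k) (Dom A f)" unfolding is_direct_sum_def by (intro exI)
  then show ?thesis using fX by (rule summand)
qed


lemma unshift_shift: "is_complex A C \<Longrightarrow> unshift (shift_complex A C) = C"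
  by (simp add: unshift_def shift_complex_def cplxD)

lemma quotient_complex:
  assumes C: "is_complex A C" and T: "is_complex A T" and i: "cm C T i"
    and b: "\<And>n. is_biproduct A (Term C n) (S n) (Term T n) (i n) (\<sigma> n) (\<rho> n) (p n)"
  defines "s \<equiv> \<lparr>Term = S, Diff = (\<lambda>n. p (n - 1) \<cdot> (Diff T n \<cdot> \<sigma> n))\<rparr>"
  shows "is_complex A s" "cm T s p"
proof -
  have bD: "S n \<in> Obj A" "\<sigma> n \<in> Arr A" "Dom A (\<sigma> n) = S n" "Cod A (\<sigma> n) = Term T n"
      "\<rho> n \<in> Arr A" "Dom A (\<rho> n) = Term T n" "Cod A (\<rho> n) = Term C n"
      "p n \<in> Arr A" "Dom A (p n) = Term T n" "Cod A (p n) = S n"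
      "p n \<cdot> i n = Zero A (Term C n) (S n)"
      "(i n \<cdot> \<rho> n) \<uplus> (\<sigma> n \<cdot> p n) = Ide A (Term T n)" for n
    using b[of n] by (simp_all add: is_biproduct_def Hom_def)
  note [simp] = cplxD[OF C] cplxD[OF T] cmD(1-3)[OF i] bD(1-11)
  have s [simp]: "Term s n = S n" "Diff s n = p (n - 1) \<cdot> (Diff T n \<cdot> \<sigma> n)" for n by (simp_all add: s_def)
  have pdi: "p (n - 1) \<cdot> (Diff T n \<cdot> (i n \<cdot> \<rho> n)) = Zero A (Term T n) (S (n - 1))" for n
  proof -
    have "Diff T n \<cdot> (i n \<cdot> \<rho> n) = i (n - 1) \<cdot> (Diff C n \<cdot> \<rho> n)"
      using cm_reassoc[OF i C T, of "n - 1" n "\<rho> n"] by simp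
    moreover have "p (n - 1) \<cdot> (i (n - 1) \<cdot> (Diff C n \<cdot> \<rho> n)) = Zero A (Term T n) (S (n - 1))"
      using Comp_reassoc[OF bD(11)[of "n - 1"], of "Diff C n \<cdot> \<rho> n"] by simp
    ultimately show ?thesis by simp
  qed
  \<comment> \<open>The differential of the quotient is determined by commuting with the projections.\<close>
  have pd: "p (n - 1) \<cdot> Diff T n = (p (n - 1) \<cdot> (Diff T n \<cdot> \<sigma> n)) \<cdot> p n" for n
  proof -
    have "p (n - 1) \<cdot> Diff T n = p (n - 1) \<cdot> (Diff T n \<cdot> ((i n \<cdot> \<rho> n) \<uplus> (\<sigma> n \<cdot> p n)))"
      unfolding bD(12) by simp
    also have "\<dots> = (p (n - 1) \<cdot> (Diff T n \<cdot> (i n \<cdot> \<rho> n))) \<uplus> (p (n - 1) \<cdot> (Diff T n \<cdot> (\<sigma> n \<cdot> p n)))"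
      by simp
    also have "\<dots> = (p (n - 1) \<cdot> (Diff T n \<cdot> \<sigma> n)) \<cdot> p n" unfolding pdi by simp
    finally show ?thesis .
  qed
  show "cm T s p" by (rule cmI) (simp_all add: pd)
  show "is_complex A s" unfolding is_complex_def
  proof (intro conjI allI)
    fix n
    have "Diff s n \<cdot> Diff s (n + 1) = (Diff s n \<cdot> p n) \<cdot> (Diff T (n + 1) \<cdot> \<sigma> (n + 1))" by simp
    also have "Diff s n \<cdot> p n = p (n - 1) \<cdot> Diff T n" using pd[of n] by simp
    also have "(p (n - 1) \<cdot> Diff T n) \<cdot> (Diff T (n + 1) \<cdot> \<sigma> (n + 1)) = p (n - 1) \<cdot> ((Diff T n \<cdot> Diff T (n + 1)) \<cdot> \<sigma> (n + 1))" by simp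
    also have "\<dots> = Zero A (S (n + 1)) (S (n - 1))" by simp
    finally show "Diff s n \<cdot> Diff s (n + 1) = Zero A (Term s (n + 1)) (Term s (n - 1))" by simp
  qed (simp_all add: Hom_def)
qed

lemma acyclic_embedding:
  fixes X :: "'o set" and \<J> :: "('o, 'm) chain_complex set"
  assumes X: "X \<subseteq> Obj A"
    and zero_X: "\<exists>z \<in> X. is_zero_object A z"
    and kernels: "\<And>f. f \<in> Arr A \<Longrightarrow> \<exists>k. is_kernel A k f"
    and sums: "\<And>a b. \<lbrakk>a \<in> Obj A; b \<in> Obj A\<rbrakk> \<Longrightarrow> \<exists>s. is_direct_sum A a b s"
    and appr: "\<And>M. M \<in> Obj A \<Longrightarrow> \<exists>f. is_right_approximation A X f \<and> Cod A f = M"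
    and copr: "\<And>x. (\<And>k::nat. x k \<in> X) \<Longrightarrow> \<exists>S \<in> X. \<exists>j. is_coproduct x S j"
    and J: "\<And>I. I \<in> \<J> \<Longrightarrow> is_complex A I" "\<And>I. I \<in> \<J> \<Longrightarrow> unshift I \<in> \<J>"
    and null: "\<And>B n I. \<lbrakk>I \<in> \<J>; is_complex A B; right_acyclic A X B; \<And>k. k < n \<Longrightarrow> is_zero_object A (Term B k)\<rbrakk> \<Longrightarrow> nullmaps B I"
    and C: "is_complex A C"
  shows "\<exists>T s i p \<sigma> \<rho>. is_complex A T \<and> s \<in> dw A X \<and> cm C T i \<and> cm T s p \<and>
    (\<forall>n. is_biproduct A (Term C n) (Term s n) (Term T n) (i n) (\<sigma> n) (\<rho> n) (p n)) \<and> (\<forall>I \<in> \<J>. nullmaps T I)"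
proof -
  have "\<exists>T i. is_complex A T \<and> cm C T i \<and> (\<forall>I \<in> \<J>. nullmaps T I) \<and>
    (\<forall>m. \<exists>S s p p'. S \<in> X \<and> is_biproduct A (Term C m) S (Term T m) (i m) s p p')"
    by (rule acyclic_extension; fact)
  then obtain T i
    where T: "is_complex A T" and i: "cm C T i" and n: "\<forall>I \<in> \<J>. nullmaps T I"
      and b: "\<forall>m. \<exists>S s p p'. S \<in> X \<and> is_biproduct A (Term C m) S (Term T m) (i m) s p p'"
    by (elim exE conjE) (rule that, assumption+)
  from choice[OF b] obtain S where "\<forall>m. \<exists>s p p'. S m \<in> X \<and> is_biproduct A (Term C m) (S m) (Term T m) (i m) s p p'" by (rule exE)
  from choice[OF this] obtain \<sigma> where "\<forall>m. \<exists>p p'. S m \<in> X \<and> is_biproduct A (Term C m) (S m) (Term T m) (i m) (\<sigma> m) p p'" by (rule exE)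
  from choice[OF this] obtain \<rho> where "\<forall>m. \<exists>p'. S m \<in> X \<and> is_biproduct A (Term C m) (S m) (Term T m) (i m) (\<sigma> m) (\<rho> m) p'" by (rule exE)
  from choice[OF this] obtain p where b: "\<forall>m. S m \<in> X \<and> is_biproduct A (Term C m) (S m) (Term T m) (i m) (\<sigma> m) (\<rho> m) (p m)" by (rule exE)
  let ?s = "\<lparr>Term = S, Diff = (\<lambda>n. p (n - 1) \<cdot> (Diff T n \<cdot> \<sigma> n))\<rparr>"
  have b': "\<And>n. is_biproduct A (Term C n) (S n) (Term T n) (i n) (\<sigma> n) (\<rho> n) (p n)" using b by simp
  note q = quotient_complex[OF C T i b']
  have "?s \<in> dw A X" using q(1) b by (simp add: dw_def)
  then show ?thesis
    by (intro exI[of _ T] exI[of _ ?s] exI[of _ i] exI[of _ p] exI[of _ \<sigma>] exI[of _ \<rho>] conjI)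
      (use T i n q(2) b' in simp_all)
qed

lemma subcategoryD:
  assumes "is_subcategory A X"
  shows "X \<subseteq> Obj A" and "is_zero_object A z \<Longrightarrow> z \<in> X"
    and "\<lbrakk>a \<in> X; b \<in> X; is_direct_sum A a b s\<rbrakk> \<Longrightarrow> s \<in> X"
    and "\<lbrakk>is_direct_sum A a b s; s \<in> X\<rbrakk> \<Longrightarrow> a \<in> X"
proof -
  note * = assms[unfolded is_subcategory_def]
  note 1 = conjunct1[OF *] and * = conjunct2[OF *]
  note 2 = conjunct1[OF *] and * = conjunct2[OF *]
  note 3 = conjunct1[OF *] and 4 = conjunct2[OF conjunct2[OF *]]
  show "X \<subseteq> Obj A" by (rule 1)
  show "is_zero_object A z \<Longrightarrow> z \<in> X" using 2 by (elim allE) (erule mp)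
  show "\<lbrakk>a \<in> X; b \<in> X; is_direct_sum A a b s\<rbrakk> \<Longrightarrow> s \<in> X" using 3 by blast
  show "\<lbrakk>is_direct_sum A a b s; s \<in> X\<rbrakk> \<Longrightarrow> a \<in> X" using 4 by blast
qed

lemma nat_coproduct:
  assumes "infinite (UNIV :: 'u set)" "cocomplete_category TYPE('u) A" and x: "\<And>k. x k \<in> Obj A"
  shows "\<exists>S j. is_coproduct x S j"
proof -
  have c: "category A" by unfold_locales
  have "Obj (opposite A) = Obj A" "\<And>a b. Hom (opposite A) a b = Hom A b a" "\<And>g f. g \<cdot>\<^bsub>opposite A\<^esub> f = f \<cdot> g"
    by (auto simp: opposite_def Hom_def)
  note o = this
  have "\<And>k. x k \<in> Obj (opposite A)" using x by (simp add: o)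
  from complete_nat_product[where x = x, OF assms(1) category_opposite[OF c] assms(2)[unfolded cocomplete_category_def] this]
  show ?thesis unfolding is_coproduct_def o by (elim exE) (rule exI, rule exI, assumption)
qed

lemma opp_nat_coproduct:
  assumes "infinite (UNIV :: 'u set)" "complete_category TYPE('u) A" and x: "\<And>k. x k \<in> Obj A"
  shows "\<exists>S j. preadditive_category.is_coproduct (opp A) x S j"
proof -
  interpret B: preadditive_category "opp A" by (rule opp_preadditive)
  have c: "category A" by unfold_locales
  from complete_nat_product[where x = x, OF assms(1) c assms(2) x]
  show ?thesis unfolding B.is_coproduct_def opp_sel opp_Hom by (elim exE) (rule exI, rule exI, assumption)
qed

end

context abelian_category
begin

context
  fixes X Y :: "'a set"
  assumes bp: "admissible_balanced_pair A X Y"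
    and h: "right_orth (Ch A) (Ch_exact A (right_acyclic_sequences A X)) (dw A X) =
      left_orth (Ch A) (Ch_exact A (right_acyclic_sequences A X)) (dw A Y)"
begin

lemma pair:
  shows "is_subcategory A X" "is_subcategory A Y"
    and "M \<in> Obj A \<Longrightarrow> \<exists>f. is_right_approximation A X f \<and> Cod A f = M"
    and "M \<in> Obj A \<Longrightarrow> \<exists>f. is_left_approximation A Y f \<and> Dom A f = M"
proof -
  note * = conjunct1[OF bp[unfolded admissible_balanced_pair_def], unfolded balanced_pair_def]
  show "is_subcategory A X" by (rule conjunct1[OF *])
  note * = conjunct2[OF *]
  show "is_subcategory A Y" by (rule conjunct1[OF *])
  note * = conjunct2[OF *]
  show "M \<in> Obj A \<Longrightarrow> \<exists>f. is_right_approximation A X f \<and> Cod A f = M"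
    by (rule bspec[OF conjunct1[OF *, unfolded contravariantly_finite_def]])
  note * = conjunct2[OF *]
  show "M \<in> Obj A \<Longrightarrow> \<exists>f. is_left_approximation A Y f \<and> Dom A f = M"
    by (rule bspec[OF conjunct1[OF *, unfolded covariantly_finite_def]])
qed

lemma X_into_Y_replacement:
  assumes copr: "\<And>x. (\<And>k::nat. x k \<in> Obj A) \<Longrightarrow> \<exists>S j. is_coproduct x S j" and J: "J \<in> dw A Y"
  shows "\<exists>P. \<exists>\<theta>. P \<in> dw A X \<and> pre_iso (dw A Y) P J \<theta> \<and> post_iso (dw A X) P J \<theta>"
proof -
  have J': "is_complex A J" using J by (simp add: dw_def)
  note X = subcategoryD(1)[OF pair(1)] and sX = subcategoryD(4)[OF pair(1)] and zX = subcategoryD(2)[OF pair(1)]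
  have "\<exists>T s i p \<sigma> \<rho>. is_complex A T \<and> s \<in> dw A X \<and> cm J T i \<and> cm T s p \<and>
    (\<forall>n. is_biproduct A (Term J n) (Term s n) (Term T n) (i n) (\<sigma> n) (\<rho> n) (p n)) \<and> (\<forall>I \<in> dw A Y. nullmaps T I)"
  proof (rule acyclic_embedding)
    obtain z where z: "is_zero_object A z" using ex_zero_object by (rule exE)
    show "\<exists>z \<in> X. is_zero_object A z" by (rule bexI[of _ z]) (rule z, rule zX[OF z])
    show "\<exists>k. is_kernel A k f" if "f \<in> Arr A" for f using that by (rule ex_kernel)
    show "\<exists>s. is_direct_sum A a b s" if "a \<in> Obj A" "b \<in> Obj A" for a b using that by (rule ex_direct_sum)
    show "\<exists>f. is_right_approximation A X f \<and> Cod A f = M" if "M \<in> Obj A" for M using that by (rule pair(3))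
    show "\<exists>S \<in> X. \<exists>j. is_coproduct x S j" if x: "\<And>k::nat. x k \<in> X" for x
    proof -
      have "\<And>k. x k \<in> Obj A" using x X by (rule subsetD[rotated])
      from copr[of x, OF this] obtain S j where S: "is_coproduct x S j" by (elim exE)
      have "S \<in> X" by (rule coproduct_closed[where X = X and x = x and j = j]) (fact sX ex_kernel pair(3) S x)+
      then show ?thesis by (rule bexI[rotated]) (rule exI, rule S)
    qed
    show "is_complex A I" "unshift I \<in> dw A Y" if "I \<in> dw A Y" for I using that unshift_dw by (simp_all add: dw_def)
    show "nullmaps B I" if I: "I \<in> dw A Y" and B: "is_complex A B" "right_acyclic A X B"
        and z: "\<And>k. k < n \<Longrightarrow> is_zero_object A (Term B k)" for B n I
    proof -
      have "\<forall>P \<in> dw A X. nullmaps P B" by (rule ballI) (rule nullmaps_bounded_below[OF _ B z])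
      then show ?thesis using orthogonal_iff[OF bp h B(1)] I by simp
    qed
  qed (fact X J')+
  then obtain T s i p \<sigma> \<rho> where T: "is_complex A T" and s: "s \<in> dw A X" and i: "cm J T i" and p: "cm T s p"
    and b: "\<forall>n. is_biproduct A (Term J n) (Term s n) (Term T n) (i n) (\<sigma> n) (\<rho> n) (p n)" and n: "\<forall>I \<in> dw A Y. nullmaps T I"
    by (elim exE conjE) (rule that, assumption+)
  have s': "is_complex A s" using s by (simp add: dw_def)
  note c = extension_cone[OF J' T s' i p spec[OF b]]
  have n': "\<forall>Q \<in> dw A X. nullmaps Q T" using orthogonal_iff[OF bp h T] n by simp
  show ?thesis
    by (rule exI, rule exI, rule conjI[OF unshift_dw[OF s]], rule conjI,
        rule cone_pre_iso[OF c bspec[OF n] shift_dw], assumption+,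
        rule cone_post_iso[OF c bspec[OF n'] shift_dw], assumption+)
qed

lemma Y_into_X_replacement:
  assumes copr: "\<And>x. (\<And>k::nat. x k \<in> Obj A) \<Longrightarrow> \<exists>S j. preadditive_category.is_coproduct (opp A) x S j" and P: "P \<in> dw A X"
  shows "\<exists>J. \<exists>\<eta>. J \<in> dw A Y \<and> pre_iso (dw A Y) P J \<eta> \<and> post_iso (dw A X) P J \<eta>"
proof -
  interpret B: preadditive_category "opp A" by (rule opp_preadditive)
  let ?C = "shift_complex A P"
  have P': "is_complex A P" using P by (simp add: dw_def)
  have C: "is_complex A ?C" using P' by (rule shift_complex)
  note Y = subcategoryD(1)[OF pair(2)] and sY = subcategoryD(4)[OF pair(2)] and zY = subcategoryD(2)[OF pair(2)]
  have k: "\<exists>k. is_kernel (opp A) k f" if "f \<in> Arr (opp A)" for f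
    using ex_cokernel[of f] that by (simp add: opp_kernel)
  have a: "\<exists>f. is_right_approximation (opp A) Y f \<and> Cod (opp A) f = M" if "M \<in> Obj (opp A)" for M
    using pair(4)[of M] that by (simp add: opp_approximation)
  have "\<exists>T s i p \<sigma> \<rho>. is_complex (opp A) T \<and> s \<in> dw (opp A) Y \<and> B.cm (rev_complex ?C) T i \<and> B.cm T s p \<and>
    (\<forall>n. is_biproduct (opp A) (Term (rev_complex ?C) n) (Term s n) (Term T n) (i n) (\<sigma> n) (\<rho> n) (p n)) \<and>
    (\<forall>I \<in> rev_complex ` dw A X. B.nullmaps T I)"
  proof (rule B.acyclic_embedding)
    show "Y \<subseteq> Obj (opp A)" using Y by simp
    obtain z where z: "is_zero_object A z" using ex_zero_object by (rule exE)
    show "\<exists>z \<in> Y. is_zero_object (opp A) z" unfolding opp_zero_object by (rule bexI[of _ z]) (rule z, rule zY[OF z])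
    show "\<exists>k. is_kernel (opp A) k f" if "f \<in> Arr (opp A)" for f using that by (rule k)
    show "\<exists>s. is_direct_sum (opp A) a b s" if "a \<in> Obj (opp A)" "b \<in> Obj (opp A)" for a b
      unfolding opp_direct_sum using that ex_direct_sum[of a b] by simp
    show "\<exists>f. is_right_approximation (opp A) Y f \<and> Cod (opp A) f = M" if "M \<in> Obj (opp A)" for M using that by (rule a)
    show "\<exists>S \<in> Y. \<exists>j. B.is_coproduct x S j" if x: "\<And>k::nat. x k \<in> Y" for x
    proof -
      have "\<And>k. x k \<in> Obj A" using x Y by (rule subsetD[rotated])
      from copr[of x, OF this] obtain S j where S: "B.is_coproduct x S j" by (elim exE)
      have "S \<in> Y" by (rule B.coproduct_closed[where X = Y and x = x and j = j]) (fact sY[folded opp_direct_sum] k a S x)+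
      then show ?thesis by (rule bexI[rotated]) (rule exI, rule S)
    qed
    show "is_complex (opp A) I" if "I \<in> rev_complex ` dw A X" for I
      using that by (elim imageE) (simp add: opp_complex dw_def)
    show "B.unshift I \<in> rev_complex ` dw A X" if I: "I \<in> rev_complex ` dw A X" for I
    proof -
      obtain Q where Q: "I = rev_complex Q" "Q \<in> dw A X" using I by (rule imageE)
      then have "is_complex A Q" by (simp add: dw_def)
      from opp_unshift[OF this] show ?thesis unfolding Q(1) by (rule image_eqI) (rule shift_dw[OF Q(2)])
    qed
    show "B.nullmaps D I" if I: "I \<in> rev_complex ` dw A X" and D: "is_complex (opp A) D" "right_acyclic (opp A) Y D"
        and z: "\<And>k. k < n \<Longrightarrow> is_zero_object (opp A) (Term D k)" for D n I
    proof -
      obtain Q where Q: "I = rev_complex Q" "Q \<in> dw A X" using I by (rule imageE)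
      have Q': "is_complex A Q" using Q(2) by (simp add: dw_def)
      define D' where "D' = rev_complex D"
      have DD: "D = rev_complex D'" by (simp add: D'_def)
      have D': "is_complex A D'" using D(1) unfolding DD by (simp only: opp_complex)
      have "nullmaps D' I'" if I': "I' \<in> dw A Y" for I'
      proof -
        have "B.nullmaps (rev_complex I') (rev_complex D')"
          by (rule B.nullmaps_bounded_below[where X = Y, OF _ D z, unfolded DD]) (use I' in \<open>simp_all add: opp_dw\<close>)
        then show ?thesis using opp_nullmaps[OF D', of I'] I' by (simp add: dw_def)
      qed
      then have "nullmaps Q D'" using orthogonal_iff[OF bp h D'] Q(2) by simp
      then show ?thesis unfolding Q(1) DD using opp_nullmaps[OF Q' D'] by simp
    qed
    show "is_complex (opp A) (rev_complex ?C)" unfolding opp_complex by (rule C)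
  qed
  then obtain T\<^sub>0 s\<^sub>0 i p \<sigma> \<rho> where T0: "is_complex (opp A) T\<^sub>0" and s0: "s\<^sub>0 \<in> dw (opp A) Y"
    and i0: "B.cm (rev_complex ?C) T\<^sub>0 i" and p0: "B.cm T\<^sub>0 s\<^sub>0 p"
    and b0: "\<forall>n. is_biproduct (opp A) (Term (rev_complex ?C) n) (Term s\<^sub>0 n) (Term T\<^sub>0 n) (i n) (\<sigma> n) (\<rho> n) (p n)"
    and n0: "\<forall>I \<in> rev_complex ` dw A X. B.nullmaps T\<^sub>0 I"
    by (elim exE conjE) (rule that, assumption+)
  define T s where "T = rev_complex T\<^sub>0" and "s = rev_complex s\<^sub>0"
  have T0s0: "T\<^sub>0 = rev_complex T" "s\<^sub>0 = rev_complex s" by (simp_all add: T_def s_def)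
  have T: "is_complex A T" using T0 unfolding T0s0 opp_complex .
  have s: "s \<in> dw A Y" using s0 unfolding T0s0 opp_dw .
  have s': "is_complex A s" using s by (simp add: dw_def)
  have "B.cm (rev_complex ?C) (rev_complex T) (\<lambda>n. i (- (- n)))" "B.cm (rev_complex T) (rev_complex s) (\<lambda>n. p (- (- n)))"
    using i0 p0 unfolding T0s0 by simp_all
  then have i: "cm T ?C (\<lambda>n. i (- n))" and p: "cm s T (\<lambda>n. p (- n))"
    unfolding opp_cm[OF T C, of "\<lambda>n. i (- n)"] opp_cm[OF s' T, of "\<lambda>n. p (- n)"] .
  have b: "is_biproduct A (Term s n) (Term ?C n) (Term T n) (p (- n)) (\<rho> (- n)) (\<sigma> (- n)) (i (- n))" for n
    by (rule biproduct_swap) (use spec[OF b0, of "- n"] in \<open>simp add: T0s0 opp_biproduct\<close>)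
  have c: "cone P s (\<lambda>n. \<sigma> (- n) \<cdot> (Diff T (n + 1) \<cdot> \<rho> (- (n + 1)))) T (\<lambda>n. p (- n)) (\<lambda>n. i (- n)) (\<lambda>n. \<rho> (- n)) (\<lambda>n. \<sigma> (- n))"
    using extension_cone[OF s' T C p i b] unfolding unshift_shift[OF P'] .
  have n': "\<forall>Q \<in> dw A X. nullmaps Q T"
  proof
    fix Q assume Q: "Q \<in> dw A X"
    then have "B.nullmaps (rev_complex T) (rev_complex Q)" using n0 unfolding T0s0 by simp
    then show "nullmaps Q T" using opp_nullmaps[OF _ T, of Q] Q by (simp add: dw_def)
  qed
  then have n: "\<forall>I \<in> dw A Y. nullmaps T I" using orthogonal_iff[OF bp h T] by simp
  show ?thesis
    by (rule exI, rule exI, rule conjI[OF s], rule conjI,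
        rule cone_pre_iso[OF c bspec[OF n] shift_dw], assumption+,
        rule cone_post_iso[OF c bspec[OF n'] shift_dw], assumption+)
qed

lemma triangle_equivalent_of_replacements:
  assumes copr: "\<And>x. (\<And>k::nat. x k \<in> Obj A) \<Longrightarrow> \<exists>S j. is_coproduct x S j"
    and prd: "\<And>x. (\<And>k::nat. x k \<in> Obj A) \<Longrightarrow> \<exists>S j. preadditive_category.is_coproduct (opp A) x S j"
  shows "triangle_equivalent (K A X) (K A Y)"
proof -
  have "\<forall>J \<in> dw A Y. \<exists>P. \<exists>\<theta>. P \<in> dw A X \<and> pre_iso (dw A Y) P J \<theta> \<and> post_iso (dw A X) P J \<theta>"
    by (rule ballI) (rule X_into_Y_replacement[OF copr])
  from bchoice[OF this] obtain GO where "\<forall>J \<in> dw A Y. \<exists>\<theta>. GO J \<in> dw A X \<and> pre_iso (dw A Y) (GO J) J \<theta> \<and> post_iso (dw A X) (GO J) J \<theta>"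
    by (rule exE)
  from bchoice[OF this] obtain \<theta> where G: "\<forall>J \<in> dw A Y. GO J \<in> dw A X \<and> pre_iso (dw A Y) (GO J) J (\<theta> J) \<and> post_iso (dw A X) (GO J) J (\<theta> J)"
    by (rule exE)
  have "\<forall>P \<in> dw A X. \<exists>J. \<exists>\<eta>. J \<in> dw A Y \<and> pre_iso (dw A Y) P J \<eta> \<and> post_iso (dw A X) P J \<eta>"
    by (rule ballI) (rule Y_into_X_replacement[OF prd])
  from bchoice[OF this] obtain FO where "\<forall>P \<in> dw A X. \<exists>\<eta>. FO P \<in> dw A Y \<and> pre_iso (dw A Y) P (FO P) \<eta> \<and> post_iso (dw A X) P (FO P) \<eta>"
    by (rule exE)
  from bchoice[OF this] obtain \<eta> where F: "\<forall>P \<in> dw A X. FO P \<in> dw A Y \<and> pre_iso (dw A Y) P (FO P) (\<eta> P) \<and> post_iso (dw A X) P (FO P) (\<eta> P)"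
    by (rule exE)
  show ?thesis
    by (rule triangle_equivalent_K[where FO = FO and \<eta> = \<eta> and GO = GO and \<theta> = \<theta>])
      (fact ex_direct_sum subcategoryD(3)[OF pair(2)] | use F G in simp)+
qed

end

end

theorem theorem4p10:
  fixes A :: "('o, 'm) preadd_category" and X Y :: "'o set" and E :: "('m \<times> 'm) set"
  assumes "infinite (UNIV :: 'u set)"
    and "abelian_category A"
    and "complete_category TYPE('u) A"
    and "cocomplete_category TYPE('u) A"
    and "admissible_balanced_pair A X Y"
    and "E = right_acyclic_sequences A X"
    and "right_orth (Ch A) (Ch_exact A E) (dw A X) = left_orth (Ch A) (Ch_exact A E) (dw A Y)"
  shows "triangle_equivalent (K A X) (K A Y)"
proof -
  interpret abelian_category A by (rule assms(2))
  show ?thesis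
    by (rule triangle_equivalent_of_replacements[OF assms(5) assms(7)[unfolded assms(6)]
          nat_coproduct[OF assms(1,4)] opp_nat_coproduct[OF assms(1,3)]])
qed

end
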